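(* Let $G\subseteq \mathrm{SL}_2(\mathbb{R})$ be a group and $H$ a finite index subgroup with $-I\in H$ such that the images $\bar H,\bar G$ in $\mathrm{PSL}_2(\mathbb{R})$ are Fuchsian groups of the first kind. Let $\rho:H\to\mathrm{GL}_m(\mathbb{C})$ be a finite dimensional representation, and suppose that $\psi$ is a representation of $G$ such that $\widetilde\rho=\psi$, where $\widetilde\rho=\mathrm{Ind}_H^G(\rho)$. Then there exists a weakly holomorphic logarithmic vector-valued automorphic form (vvaf) $\widetilde{\mathbb{X}}(\tau)$ associated to $(\psi,G)$ with linearly independent components if and only if there exists a weakly holomorphic logarithmic vvaf $\mathbb{X}(\tau)$ associated to $(\rho,H)$ with linearly independent components.
   Context: $\mathbb{H}$ is the upper half plane; matrices act by Möbius transformations. A Fuchsian group of the first kind is a discrete subgroup of $\mathrm{PSL}_2(\mathbb{R})$ whose quotient of $\mathbb{H}$ is a Riemann surface with finitely many punctures and which has a fundamental domain of finite area. Parabolic means trace $\pm2$; cusps are points of $\mathbb{R}\cup\{\infty\}$ fixed by a nontrivial parabolic element of the group. $A_{\mathfrak{c}}=\begin{pmatrix}\mathfrak{c}&-1\\1&0\end{pmatrix}$ for $\mathfrak{c}\ne\infty$, $A_\infty=I$; the cusp width $h_{\mathfrak{c}}>0$ is such that the stabilizer of $\mathfrak{c}$ in the image of the group in $\mathrm{PSL}_2(\mathbb{R})$ is generated by the image of $t_{\mathfrak{c}}=A_{\mathfrak{c}}\begin{pmatrix}1&h_{\mathfrak{c}}\\0&1\end{pmatrix}A_{\mathfrak{c}}^{-1}$.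 Put $\log\widetilde q_{\mathfrak{c}}=2\pi iA_{\mathfrak{c}}^{-1}\tau/h_{\mathfrak{c}}$, $\widetilde q_{\mathfrak{c}}=e^{\log\widetilde q_{\mathfrak{c}}}$. $\mathbb{X}|_k\gamma(\tau)=(c\tau+d)^{-k}\mathbb{X}(\gamma\tau)$. A representation is logarithmic if at all parabolic elements its values have only eigenvalues of absolute value 1 and at some parabolic element its value is not diagonalizable. A weakly holomorphic logarithmic vvaf of weight $k\in\mathbb{Z}$ associated to a logarithmic $\rho$ (with $\rho(I)=e^{i\pi k}\rho(-I)$) is a holomorphic $\mathbb{X}:\mathbb{H}\to\mathbb{C}^m$ with $\mathbb{X}|_k\gamma=\rho(\gamma)\mathbb{X}$ for all group elements $\gamma$ and at every cusp $\mathfrak{c}$ an expansion $\mathbb{X}(\tau)=\epsilon_{\mathfrak{c}}(\tau)\sum_\lambda\sum_{j=0}^{m(\lambda)-1}(\log\widetilde q_{\mathfrak{c}})^j\widetilde q_{\mathfrak{c}}^{\,\mu(\lambda)}\sum_{n\ge-M_{\mathfrak{c}}}\mathbb{X}^{\mathfrak{c}}[\lambda,j,n]\widetilde q_{\mathfrak{c}}^{\,n}$ with $M_{\mathfrak{c}}$ finite, where $\epsilon_\infty=1$, $\epsilon_{\mathfrak{c}}(\tau)=(\tau-\mathfrak{c})^{-k}$ for $\mathfrak{c}\neq\infty$, $\lambda$ runs over the eigenvalues of $\rho(t_{\mathfrak{c}})$ attached to Jordan blocks, $m(\lambda)$ is the block size, $\lambda=e^{2\pi i\mu(\lambda)}$,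 $0\le\mu(\lambda)<1$. The components of $\mathbb{X}$ are its coordinate functions $\mathbb{H}\to\mathbb{C}$. $\widetilde\rho(\gamma)$ is the block matrix with $(a,b)$ block $\rho(\gamma_a^{-1}\gamma\gamma_b)$ (zero if this element is not in $H$), for representatives $\gamma_1,\dots,\gamma_d$ of the left cosets $G/H$. *)

theory Defs
  imports
    "HOL-Analysis.Analysis"
    "HOL-Algebra.Left_Coset"
    "HOL-Algebra.Generated_Groups"
    "Jordan_Normal_Form.Jordan_Normal_Form_Existence"
begin

text \<open>
  Elements of \<open>SL\<^sub>2(\<real>)\<close> have the HOL-Analysis type \<open>real^2^2\<close> (which carries a topology); complex
  matrices and vectors, in particular the values of representations and of vector-valued forms,
  have the types \<open>complex mat\<close> and \<open>complex vec\<close> of the entry Jordan_Normal_Form. Below, \<open>$\<close>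
  always belongs to HOL-Analysis, and entries of a \<open>complex vec\<close> are written with \<open>vec_index\<close>.
\<close>

no_notation vec_index (infixl \<open>$\<close> 100)
hide_const (open) Matrix.mat Determinant.det Matrix.vec


section \<open>The groups \<open>SL\<^sub>2(\<real>)\<close> and \<open>PSL\<^sub>2(\<real>)\<close> and their actions\<close>

definition mat2 :: "real \<Rightarrow> real \<Rightarrow> real \<Rightarrow> real \<Rightarrow> real^2^2" where
  "mat2 a b c d = vector [vector [a, b], vector [c, d]]"

definition SL2R :: "(real^2^2) monoid" where
  "SL2R = \<lparr>carrier = {g. Determinants.det g = 1}, mult = (**), one = Finite_Cartesian_Product.mat 1\<rparr>"

abbreviation I2 :: "real^2^2" where
  "I2 \<equiv> Finite_Cartesian_Product.mat 1"

definition PSL2R :: "(real^2^2) set monoid" where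
  "PSL2R = SL2R Mod {I2, - I2}"

text \<open>The image in \<open>PSL\<^sub>2(\<real>)\<close> of an element, resp. of a subset, of \<open>SL\<^sub>2(\<real>)\<close>.\<close>

definition psl :: "real^2^2 \<Rightarrow> (real^2^2) set" where
  "psl g = {I2, - I2} #>\<^bsub>SL2R\<^esub> g"

definition psl_image :: "(real^2^2) set \<Rightarrow> (real^2^2) set set" where
  "psl_image G = psl ` G"

text \<open>The quotient topology.\<close>

definition PSL2R_topology :: "(real^2^2) set topology" where
  "PSL2R_topology = topology (\<lambda>U. U \<subseteq> carrier PSL2R \<and> openin (top_of_set (carrier SL2R)) (\<Union>U))"

definition upper_half_plane :: "complex set" (\<open>\<H>\<close>) where
  "\<H> = {z. Im z > 0}"

definition mobius :: "real^2^2 \<Rightarrow> complex \<Rightarrow> complex" where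
  "mobius g = moebius (of_real (g$1$1)) (of_real (g$1$2)) (of_real (g$2$1)) (of_real (g$2$2))"

text \<open>The action on \<open>\<real> \<union> {\<infinity>}\<close>, represented by \<open>real option\<close> with \<open>None\<close> as \<open>\<infinity>\<close>.\<close>

fun boundary_mobius :: "real^2^2 \<Rightarrow> real option \<Rightarrow> real option" where
  "boundary_mobius g None = (if g$2$1 = 0 then None else Some (g$1$1 / g$2$1))"
| "boundary_mobius g (Some x) =
     (if g$2$1 * x + g$2$2 = 0 then None
      else Some (moebius (g$1$1) (g$1$2) (g$2$1) (g$2$2) x))"

lemma group_SL2R: "group SL2R"
proof (rule groupI)
  fix x assume "x \<in> carrier SL2R"
  then have d: "Determinants.det x = 1" by (simp add: SL2R_def)
  then have "invertible x" by (simp add: invertible_det_nz)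
  then obtain y where y: "y ** x = I2" unfolding invertible_def by blast
  then have "Determinants.det (y ** x) = 1" by (simp only: Determinants.det_I)
  with d have "Determinants.det y = 1" by (simp add: Determinants.det_mul)
  with y show "\<exists>y\<in>carrier SL2R. y \<otimes>\<^bsub>SL2R\<^esub> x = \<one>\<^bsub>SL2R\<^esub>"
    by (auto simp: SL2R_def)
qed (auto simp: SL2R_def Determinants.det_mul matrix_mul_assoc)

lemma uminus_mult_mat2:
  fixes A B :: "real^2^2"
  shows "(- A) ** B = - (A ** B)" and "A ** (- B) = - (A ** B)"
  by (simp_all add: matrix_matrix_mult_def Finite_Cartesian_Product.vec_eq_iff sum_negf)

lemma normal_center_SL2R: "{I2, - I2} \<lhd> SL2R"
proof -
  interpret group SL2R by (rule group_SL2R)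
  have sub: "{I2, - I2} \<subseteq> carrier SL2R"
    by (auto simp: SL2R_def det_2 Finite_Cartesian_Product.mat_def)
  have "subgroup {I2, - I2} SL2R"
  proof (rule subgroupI)
    have "inv\<^bsub>SL2R\<^esub> (- I2) = - I2"
      using sub by (intro inv_equality) (auto simp: SL2R_def uminus_mult_mat2)
    moreover have "inv\<^bsub>SL2R\<^esub> I2 = I2"
      using inv_one by (simp add: SL2R_def)
    ultimately show "\<And>a. a \<in> {I2, - I2} \<Longrightarrow> inv\<^bsub>SL2R\<^esub> a \<in> {I2, - I2}"
      by auto
  qed (use sub in \<open>auto simp: SL2R_def uminus_mult_mat2\<close>)
  then show ?thesis
    by (rule normalI) (auto simp: r_coset_def l_coset_def SL2R_def uminus_mult_mat2)
qed

lemma istopology_PSL2R: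
  "istopology (\<lambda>U. U \<subseteq> carrier PSL2R \<and> openin (top_of_set (carrier SL2R)) (\<Union>U))"
proof -
  interpret normal "{I2, - I2}" SL2R by (rule normal_center_SL2R)
  have c: "carrier PSL2R = rcosets\<^bsub>SL2R\<^esub> {I2, - I2}"
    by (simp add: PSL2R_def FactGroup_def)
  have 1: "\<Union>(S \<inter> T) = \<Union>S \<inter> \<Union>T" if "S \<subseteq> carrier PSL2R" "T \<subseteq> carrier PSL2R" for S T
  proof
    show "\<Union>S \<inter> \<Union>T \<subseteq> \<Union>(S \<inter> T)"
    proof
      fix x assume "x \<in> \<Union>S \<inter> \<Union>T"
      then obtain A B where AB: "A \<in> S" "x \<in> A" "B \<in> T" "x \<in> B" by blast
      then have "A \<in> rcosets\<^bsub>SL2R\<^esub> {I2, - I2}" "B \<in> rcosets\<^bsub>SL2R\<^esub> {I2, - I2}"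
        using that c by auto
      then have "A = B"
        using AB rcos_disjoint[OF subgroup_axioms] unfolding pairwise_def disjnt_def by blast
      with AB show "x \<in> \<Union>(S \<inter> T)" by blast
    qed
  qed blast
  have 2: "\<Union>(\<Union>K) = \<Union>(Union ` K)" for K :: "(real^2^2) set set set"
    by blast
  show ?thesis
    unfolding istopology_def
  proof (intro conjI allI impI)
    fix S T
    assume S: "S \<subseteq> carrier PSL2R \<and> openin (top_of_set (carrier SL2R)) (\<Union>S)"
      and T: "T \<subseteq> carrier PSL2R \<and> openin (top_of_set (carrier SL2R)) (\<Union>T)"
    then show "S \<inter> T \<subseteq> carrier PSL2R" by blast
    show "openin (top_of_set (carrier SL2R)) (\<Union>(S \<inter> T))"
      using S T 1[of S T] by (simp only: openin_Int)
  next
    fix K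
    assume K: "\<forall>U\<in>K. U \<subseteq> carrier PSL2R \<and> openin (top_of_set (carrier SL2R)) (\<Union>U)"
    then show "\<Union>K \<subseteq> carrier PSL2R" by blast
    show "openin (top_of_set (carrier SL2R)) (\<Union>(\<Union>K))"
      unfolding 2 using K by (intro openin_Union) blast
  qed
qed


section \<open>Fuchsian groups of the first kind\<close>

text \<open>For \<open>\<Gamma> \<le> PSL\<^sub>2(\<real>)\<close>, the union \<open>\<Union>\<Gamma>\<close> is the preimage of \<open>\<Gamma>\<close> in \<open>SL\<^sub>2(\<real>)\<close>.\<close>

definition orbit_of :: "(real^2^2) set set \<Rightarrow> complex \<Rightarrow> complex set" where
  "orbit_of \<Gamma> z = {mobius g z | g. g \<in> \<Union>\<Gamma>}"

definition complex_atlas :: "'a topology \<Rightarrow> ('a set \<times> ('a \<Rightarrow> complex)) set \<Rightarrow> bool" where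
  "complex_atlas T \<A> \<longleftrightarrow>
     (\<forall>(U, \<phi>) \<in> \<A>. openin T U \<and> open (\<phi> ` U) \<and>
        homeomorphic_map (subtopology T U) (top_of_set (\<phi> ` U)) \<phi>) \<and>
     (\<Union>(U, \<phi>) \<in> \<A>. U) = topspace T \<and>
     (\<forall>(U, \<phi>) \<in> \<A>. \<forall>(V, \<psi>) \<in> \<A>. (\<psi> \<circ> inv_into U \<phi>) holomorphic_on \<phi> ` (U \<inter> V))"

definition riemann_surface :: "'a topology \<Rightarrow> ('a set \<times> ('a \<Rightarrow> complex)) set \<Rightarrow> bool" where
  "riemann_surface T \<A> \<longleftrightarrow> Hausdorff_space T \<and> connected_space T \<and> complex_atlas T \<A>"

definition holomorphic_into ::
  "(complex \<Rightarrow> 'a) \<Rightarrow> complex set \<Rightarrow> 'a topology \<Rightarrow> ('a set \<times> ('a \<Rightarrow> complex)) set \<Rightarrow> bool" where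
  "holomorphic_into f S T \<A> \<longleftrightarrow>
     continuous_map (top_of_set S) T f \<and>
     (\<forall>(U, \<phi>) \<in> \<A>. (\<phi> \<circ> f) holomorphic_on {z \<in> S. f z \<in> U})"

text \<open>
  \<open>\<Gamma>\<close>\<open>\<setminus>\<H>\<close> is a compact Riemann surface with finitely many points \<open>P\<close> (the punctures) removed. The
  complex structure on the orbit space is pinned down by requiring that the projection from \<open>\<H>\<close> be
  a holomorphic quotient map. The punctures are arbitrary points outside the orbit space; the type
  \<open>complex set\<close> has room for them.
\<close>

definition quotient_finitely_punctured :: "(real^2^2) set set \<Rightarrow> bool" where
  "quotient_finitely_punctured \<Gamma> \<longleftrightarrow>
     (\<exists>(T :: complex set topology) \<A> P.
        riemann_surface T \<A> \<and> compact_space T \<and>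
        finite P \<and> P \<subseteq> topspace T \<and> topspace T - P = orbit_of \<Gamma> ` \<H> \<and>
        quotient_map (top_of_set \<H>) (subtopology T (topspace T - P)) (orbit_of \<Gamma>) \<and>
        holomorphic_into (orbit_of \<Gamma>) \<H> T \<A>)"

definition fundamental_domain :: "(real^2^2) set set \<Rightarrow> complex set \<Rightarrow> bool" where
  "fundamental_domain \<Gamma> F \<longleftrightarrow>
     F \<subseteq> \<H> \<and> F = closure (interior F) \<inter> \<H> \<and>
     (\<Union>g \<in> \<Union>\<Gamma>. mobius g ` F) = \<H> \<and>
     (\<forall>g \<in> \<Union>\<Gamma>. g \<notin> {I2, - I2} \<longrightarrow> interior F \<inter> mobius g ` interior F = {})"

definition hyperbolic_area :: "complex set \<Rightarrow> ennreal" where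
  "hyperbolic_area F = (\<integral>\<^sup>+ z \<in> F. ennreal (1 / (Im z)\<^sup>2) \<partial>lborel)"

definition fuchsian_first_kind :: "(real^2^2) set set \<Rightarrow> bool" where
  "fuchsian_first_kind \<Gamma> \<longleftrightarrow>
     subgroup \<Gamma> PSL2R \<and>
     subtopology PSL2R_topology \<Gamma> = discrete_topology \<Gamma> \<and>
     quotient_finitely_punctured \<Gamma> \<and>
     (\<exists>F. fundamental_domain \<Gamma> F \<and> hyperbolic_area F < \<infinity>)"


section \<open>Cusps\<close>

definition parabolic :: "real^2^2 \<Rightarrow> bool" where
  "parabolic g \<longleftrightarrow> trace g = 2 \<or> trace g = - 2"

text \<open>A parabolic element is nontrivial if its image in \<open>PSL\<^sub>2(\<real>)\<close> is.\<close>

definition is_cusp :: "(real^2^2) set \<Rightarrow> real option \<Rightarrow> bool" where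
  "is_cusp G \<cc> \<longleftrightarrow> (\<exists>g\<in>G. parabolic g \<and> g \<notin> {I2, - I2} \<and> boundary_mobius g \<cc> = \<cc>)"

fun cusp_mat :: "real option \<Rightarrow> real^2^2" where
  "cusp_mat None = I2"
| "cusp_mat (Some x) = mat2 x (-1) 1 0"

definition cusp_transl :: "real option \<Rightarrow> real \<Rightarrow> real^2^2" where
  "cusp_transl \<cc> h = cusp_mat \<cc> \<otimes>\<^bsub>SL2R\<^esub> mat2 1 h 0 1 \<otimes>\<^bsub>SL2R\<^esub> inv\<^bsub>SL2R\<^esub> (cusp_mat \<cc>)"

definition cusp_stabilizer :: "(real^2^2) set \<Rightarrow> real option \<Rightarrow> (real^2^2) set set" where
  "cusp_stabilizer G \<cc> = {C \<in> psl_image G. \<forall>g\<in>C. boundary_mobius g \<cc> = \<cc>}"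

definition cusp_width :: "(real^2^2) set \<Rightarrow> real option \<Rightarrow> real" where
  "cusp_width G \<cc> =
     (THE h. h > 0 \<and> cusp_stabilizer G \<cc> = generate PSL2R {psl (cusp_transl \<cc> h)})"

definition cusp_generator :: "(real^2^2) set \<Rightarrow> real option \<Rightarrow> real^2^2" where
  "cusp_generator G \<cc> = cusp_transl \<cc> (cusp_width G \<cc>)"

definition log_q :: "(real^2^2) set \<Rightarrow> real option \<Rightarrow> complex \<Rightarrow> complex" where
  "log_q G \<cc> \<tau> =
     2 * of_real pi * \<i> * mobius (inv\<^bsub>SL2R\<^esub> (cusp_mat \<cc>)) \<tau> / of_real (cusp_width G \<cc>)"


section \<open>Representations\<close>

definition GL :: "nat \<Rightarrow> complex mat monoid" where
  "GL m = units_of (ring_mat TYPE(complex) m ())"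

definition matrix_rep :: "(real^2^2) set \<Rightarrow> nat \<Rightarrow> (real^2^2 \<Rightarrow> complex mat) \<Rightarrow> bool" where
  "matrix_rep G m \<rho> \<longleftrightarrow> \<rho> \<in> hom (SL2R\<lparr>carrier := G\<rparr>) (GL m)"

definition diagonalizable :: "complex mat \<Rightarrow> bool" where
  "diagonalizable A \<longleftrightarrow> (\<exists>D. diagonal_mat D \<and> similar_mat A D)"

definition logarithmic :: "(real^2^2) set \<Rightarrow> (real^2^2 \<Rightarrow> complex mat) \<Rightarrow> bool" where
  "logarithmic G \<rho> \<longleftrightarrow>
     (\<forall>g\<in>G. parabolic g \<longrightarrow> (\<forall>l. eigenvalue (\<rho> g) l \<longrightarrow> cmod l = 1)) \<and>
     (\<exists>g\<in>G. parabolic g \<and> \<not> diagonalizable (\<rho> g))"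

definition left_coset_reps ::
  "(real^2^2) set \<Rightarrow> (real^2^2) set \<Rightarrow> nat \<Rightarrow> (nat \<Rightarrow> real^2^2) \<Rightarrow> bool" where
  "left_coset_reps G H d \<gamma> \<longleftrightarrow>
     \<gamma> ` {..<d} \<subseteq> G \<and>
     bij_betw (\<lambda>a. \<gamma> a <#\<^bsub>SL2R\<^esub> H) {..<d} (lcosets\<^bsub>SL2R\<lparr>carrier := G\<rparr>\<^esub> H)"

text \<open>
  Row \<open>a * m + i\<close> (with \<open>a < d\<close>, \<open>i < m\<close>) is row \<open>i\<close> of block row \<open>a\<close>, and likewise for columns.
\<close>

definition induced_rep ::
  "(real^2^2) set \<Rightarrow> nat \<Rightarrow> (real^2^2 \<Rightarrow> complex mat) \<Rightarrow> nat \<Rightarrow> (nat \<Rightarrow> real^2^2)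
     \<Rightarrow> real^2^2 \<Rightarrow> complex mat" where
  "induced_rep H m \<rho> d \<gamma> g =
     Matrix.mat (d * m) (d * m) (\<lambda>(r, s).
       let u = inv\<^bsub>SL2R\<^esub> (\<gamma> (r div m)) \<otimes>\<^bsub>SL2R\<^esub> g \<otimes>\<^bsub>SL2R\<^esub> \<gamma> (s div m)
       in if u \<in> H then \<rho> u $$ (r mod m, s mod m) else 0)"


section \<open>Vector-valued automorphic forms\<close>

definition slash :: "int \<Rightarrow> real^2^2 \<Rightarrow> (complex \<Rightarrow> complex vec) \<Rightarrow> complex \<Rightarrow> complex vec" where
  "slash k g X \<tau> =
     ((of_real (g$2$1) * \<tau> + of_real (g$2$2)) powi (- k)) \<cdot>\<^sub>v X (mobius g \<tau>)"

fun cusp_factor :: "int \<Rightarrow> real option \<Rightarrow> complex \<Rightarrow> complex" where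
  "cusp_factor k None \<tau> = 1"
| "cusp_factor k (Some x) \<tau> = (\<tau> - of_real x) powi (- k)"

text \<open>For an eigenvalue \<open>l\<close> of absolute value 1 this is the \<open>\<mu>\<close> with \<open>0 \<le> \<mu> < 1\<close> and
  \<open>l = exp (2 * pi * \<i> * \<mu>)\<close>.\<close>

definition exponent_of :: "complex \<Rightarrow> real" where
  "exponent_of l = Arg2pi l / (2 * pi)"

text \<open>
  The list \<open>bs\<close> enumerates the Jordan blocks of the value of \<open>\<rho>\<close> at \<open>cusp_generator G \<cc>\<close> as pairs of
  block size and eigenvalue, and \<open>C b j n\<close> is the coefficient vector belonging to the \<open>b\<close>-th block; the
  expansion is written componentwise.
\<close>

definition log_expansion_at ::
  "int \<Rightarrow> (real^2^2) set \<Rightarrow> nat \<Rightarrow> (real^2^2 \<Rightarrow> complex mat) \<Rightarrow> (complex \<Rightarrow> complex vec)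
     \<Rightarrow> real option \<Rightarrow> bool" where
  "log_expansion_at k G m \<rho> X \<cc> \<longleftrightarrow>
     (\<exists>bs (M :: int) (C :: nat \<Rightarrow> nat \<Rightarrow> int \<Rightarrow> complex vec).
        jordan_nf (\<rho> (cusp_generator G \<cc>)) bs \<and>
        (\<forall>b j n. C b j n \<in> carrier_vec m) \<and>
        (\<forall>\<tau>\<in>\<H>. \<forall>i<m.
           (\<forall>b<length bs. \<forall>j<fst (bs ! b).
              (\<lambda>n. vec_index (C b j n) i * exp (log_q G \<cc> \<tau>) powi n) summable_on {- M..}) \<and>
           vec_index (X \<tau>) i =
             cusp_factor k \<cc> \<tau> *
             (\<Sum>b<length bs. \<Sum>j<fst (bs ! b).
                log_q G \<cc> \<tau> ^ j * exp (of_real (exponent_of (snd (bs ! b))) * log_q G \<cc> \<tau>) *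
                (\<Sum>\<^sub>\<infinity>n\<in>{- M..}. vec_index (C b j n) i * exp (log_q G \<cc> \<tau>) powi n))))"

definition weakly_holomorphic_log_vvaf ::
  "int \<Rightarrow> (real^2^2) set \<Rightarrow> nat \<Rightarrow> (real^2^2 \<Rightarrow> complex mat) \<Rightarrow> (complex \<Rightarrow> complex vec)
     \<Rightarrow> bool" where
  "weakly_holomorphic_log_vvaf k G m \<rho> X \<longleftrightarrow>
     logarithmic G \<rho> \<and>
     \<rho> I2 = exp (\<i> * of_real pi * of_int k) \<cdot>\<^sub>m \<rho> (- I2) \<and>
     (\<forall>\<tau>\<in>\<H>. X \<tau> \<in> carrier_vec m) \<and>
     (\<forall>i<m. (\<lambda>\<tau>. vec_index (X \<tau>) i) holomorphic_on \<H>) \<and>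
     (\<forall>g\<in>G. \<forall>\<tau>\<in>\<H>. slash k g X \<tau> = \<rho> g *\<^sub>v X \<tau>) \<and>
     (\<forall>\<cc>. is_cusp G \<cc> \<longrightarrow> log_expansion_at k G m \<rho> X \<cc>)"

definition independent_components :: "nat \<Rightarrow> (complex \<Rightarrow> complex vec) \<Rightarrow> bool" where
  "independent_components m X \<longleftrightarrow>
     (\<forall>c :: nat \<Rightarrow> complex.
        (\<forall>\<tau>\<in>\<H>. (\<Sum>i<m. c i * vec_index (X \<tau>) i) = 0) \<longrightarrow> (\<forall>i<m. c i = 0))"

end

theory Submission
 imports Defs "HOL-Complex_Analysis.Complex_Analysis"
begin

text \<open>Restricting the components of a form for \<open>(\<psi>, G)\<close> to the block of the trivial coset gives a form for
 \<open>(\<rho>, H)\<close>. Conversely, a form \<open>X\<close> for \<open>(\<rho>, H)\<close> lifts to the vector with blocks \<open>X|\<gamma>\<^sub>a\<^sup>-\<^sup>1\<close>, whose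
 components may be dependent. They become independent after multiplying \<open>X\<close> by a suitable polynomial
 in an \<open>H\<close>-invariant function \<open>f\<close> that is fixed by no element of \<open>G\<close> outside \<open>H\<close> and has poles at the
 cusps only. Such an \<open>f\<close> is a quotient of Poincare series of weight four. Its denominator is a series
 for \<open>G\<close>, which has finitely many zeros modulo \<open>G\<close> because finite hyperbolic area makes the thick part
 of the quotient compact, while the thin part consists of cusp neighbourhoods and neighbourhoods of
 closed geodesics. The logarithmic expansions are handled through the equivalent condition that
 every translate of the form to infinity grows at most exponentially in \<open>Im z\<close>.\<close>

text \<open>The dependence among the lifted blocks is real: if X transforms under all of G by an
  extension of the representation, every block consists of combinations of the same m functions.
  Poincare series need a cusp; one exists because a parabolic element with non-diagonalizable value
  cannot be plus or minus the identity, and conjugation moves it to infinity. Weight four gives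
  absolute convergence since only O(r^2) bottom rows have norm at most r, and an even weight ignores
  the sign of a matrix. The denominator belongs to G, so its zeros form a G-invariant set; each zero
  modulo H puts finitely many linear conditions on a numerator, and seeds with poles of growing
  order supply more numerators than conditions. Growth is required along every matrix that
  conjugates some translation into the group, not along chosen cusps with their widths: powers of a
  translation of G lie in H, so the condition is the same for both groups.\<close>

no_notation fps_nth (infixl \<open>$\<close> 75)
no_notation vec_index (infixl \<open>$\<close> 100)

section \<open>Two by two matrices and Moebius transformations\<close>

lemma mat2_entries [simp]:
 "mat2 a b c d $ 1 $ 1 = a" "mat2 a b c d $ 1 $ 2 = b"
 "mat2 a b c d $ 2 $ 1 = c" "mat2 a b c d $ 2 $ 2 = d"
 by (simp_all add: mat2_def)

lemma mat2_eq_iff: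
 fixes g h :: "real^2^2"
 shows "g = h \<longleftrightarrow> g$1$1 = h$1$1 \<and> g$1$2 = h$1$2 \<and> g$2$1 = h$2$1 \<and> g$2$2 = h$2$2"
 unfolding Finite_Cartesian_Product.vec_eq_iff forall_2 by (simp only: conj_assoc)

lemma mult2_entries [simp]:
 fixes A B :: "real^2^2"
 shows "(A ** B) $ 1 $ 1 = A$1$1 * B$1$1 + A$1$2 * B$2$1"
  "(A ** B) $ 1 $ 2 = A$1$1 * B$1$2 + A$1$2 * B$2$2"
  "(A ** B) $ 2 $ 1 = A$2$1 * B$1$1 + A$2$2 * B$2$1"
  "(A ** B) $ 2 $ 2 = A$2$1 * B$1$2 + A$2$2 * B$2$2"
 by (simp_all add: matrix_matrix_mult_def sum_2)

lemma I2_entries [simp]: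
 "(I2::real^2^2) $ 1 $ 1 = 1" "(I2::real^2^2) $ 1 $ 2 = 0"
 "(I2::real^2^2) $ 2 $ 1 = 0" "(I2::real^2^2) $ 2 $ 2 = 1"
 by (simp_all add: Finite_Cartesian_Product.mat_def)

lemma trace2: "trace (g::real^2^2) = g$1$1 + g$2$2"
 by (simp add: trace_def sum_2)

lemma norm_sq2: "(norm (g::real^2^2))^2 = (g$1$1)^2 + (g$1$2)^2 + (g$2$1)^2 + (g$2$2)^2"
 by (simp add: norm_vec_def L2_set_def sum_2)

lemma abs_entry_le_norm2: "\<bar>(g::real^2^2) $ i $ j\<bar> <= norm g"
 by (meson component_le_norm_cart order_trans Finite_Cartesian_Product.norm_nth_le real_norm_def)

text \<open>\<open>norm\<close> on \<open>real^2^2\<close> is the Frobenius norm, which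
  Cauchy-Schwarz makes submultiplicative; \<open>cs\<close> is Lagrange's identity.\<close>

lemma norm_mult2_le:
 fixes A B :: "real^2^2"
 shows "norm (A ** B) <= norm A * norm B"
proof -
 have cs: "(a * e + b * g)^2 <= (a^2 + b^2) * (e^2 + g^2)" for a b e g :: real
 proof -
  have "(a^2 + b^2) * (e^2 + g^2) - (a * e + b * g)^2 = (a * g - b * e)^2"
   by (simp add: power2_eq_square algebra_simps)
  then show ?thesis by (metis diff_ge_0_iff_ge zero_le_power2)
 qed
 have "(norm (A ** B))^2 <= (norm A * norm B)^2"
  unfolding power_mult_distrib norm_sq2 mult2_entries
  using cs[of "A$1$1" "B$1$1" "A$1$2" "B$2$1"] cs[of "A$1$1" "B$1$2" "A$1$2" "B$2$2"]
   cs[of "A$2$1" "B$1$1" "A$2$2" "B$2$1"] cs[of "A$2$1" "B$1$2" "A$2$2" "B$2$2"]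
  by (simp add: algebra_simps)
 then show ?thesis by (rule power2_le_imp_le) simp
qed

text \<open>The adjugate: the inverse at determinant 1, given by a formula that is linear in the
  entries, preserves \<open>norm\<close> and carries no membership condition.\<close>

definition adj2 :: "real^2^2 => real^2^2" where
 "adj2 g = mat2 (g$2$2) (- (g$1$2)) (- (g$2$1)) (g$1$1)"

lemma adj2_entries [simp]:
 "adj2 g $ 1 $ 1 = g$2$2" "adj2 g $ 1 $ 2 = - (g$1$2)"
 "adj2 g $ 2 $ 1 = - (g$2$1)" "adj2 g $ 2 $ 2 = g$1$1"
 by (simp_all add: adj2_def)

lemma norm_adj2 [simp]: "norm (adj2 g) = norm g"
 by (rule power2_eq_imp_eq) (simp_all add: norm_sq2)

lemma det_adj2 [simp]: "det (adj2 g) = det g"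
 by (simp add: det_2)

lemma det_mat2 [simp]: "det (mat2 a b c d) = a * d - b * c"
 by (simp add: det_2)

lemma adj2_adj2 [simp]: "adj2 (adj2 g) = g"
 by (simp add: mat2_eq_iff)

lemma adj2_uminus [simp]: "adj2 (- g) = - adj2 g"
 by (simp add: mat2_eq_iff)

lemma adj2_mult: "adj2 (A ** B) = adj2 B ** adj2 A"
 by (simp add: mat2_eq_iff algebra_simps)

lemma adj2_I2 [simp]: "adj2 I2 = I2"
 by (simp add: mat2_eq_iff)

lemma adj2_inverse:
 assumes "det g = 1"
 shows "g ** adj2 g = I2" "adj2 g ** g = I2"
 using assms by (simp_all add: mat2_eq_iff det_2 algebra_simps)

lemma adj2_cancel:
 assumes "det g = 1"
 shows "g ** (adj2 g ** x) = x" "adj2 g ** (g ** x) = x" "x ** g ** adj2 g = x" "x ** adj2 g ** g = x"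
 using assms by (simp_all add: matrix_mul_assoc adj2_inverse) (simp_all add: matrix_mul_assoc[symmetric] adj2_inverse)

lemma carrier_SL2R [simp]: "g \<in> carrier SL2R \<longleftrightarrow> det g = 1"
 by (simp add: SL2R_def)

lemma mult_SL2R [simp]: "g \<otimes>\<^bsub>SL2R\<^esub> h = g ** h"
 by (simp add: SL2R_def)

lemma one_SL2R [simp]: "\<one>\<^bsub>SL2R\<^esub> = I2"
 by (simp add: SL2R_def)

lemma inv_SL2R [simp]:
 assumes "det g = 1"
 shows "inv\<^bsub>SL2R\<^esub> g = adj2 g"
 using group.inv_equality[OF group_SL2R, of "adj2 g" g] assms by (simp add: adj2_inverse)

text \<open>The factor of automorphy, of which the slash operators are powers.\<close>

definition jfac :: "real^2^2 => complex => complex" where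
 "jfac g z = of_real (g$2$1) * z + of_real (g$2$2)"

lemma mobius_eq: "mobius g z = (of_real (g$1$1) * z + of_real (g$1$2)) / jfac g z"
 by (simp add: mobius_def moebius_def jfac_def)

lemma mobius_I2 [simp]: "mobius I2 z = z"
 by (simp add: mobius_eq jfac_def)

lemma mobius_uminus [simp]: "mobius (- g) z = mobius g z"
proof -
 have "jfac (- g) z = - jfac g z"
  by (simp add: jfac_def)
 then have "mobius (- g) z = - (of_real (g$1$1) * z + of_real (g$1$2)) / - jfac g z"
  by (simp add: mobius_eq)
 then show ?thesis by (simp only: minus_divide_divide mobius_eq)
qed

lemma jfac_uminus: "jfac (- g) z = - jfac g z"
 by (simp add: jfac_def)

lemma jfac_I2 [simp]: "jfac I2 z = 1"
 by (simp add: jfac_def)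

lemma jfac_nz:
 assumes "det g ~= 0" "Im z > 0"
 shows "jfac g z ~= 0"
proof
 assume j: "jfac g z = 0"
 then have "g$2$1 * Im z = 0" using arg_cong[OF j[unfolded jfac_def], of Im] by (simp del: mult_eq_0_iff)
 with assms have "g$2$1 = 0" by simp
 with j assms show False by (auto simp: jfac_def det_2)
qed

text \<open>The cocycle relation, which makes successive slash operators compose.\<close>

lemma jfac_mult:
 assumes "det h ~= 0" "Im z > 0"
 shows "jfac (g ** h) z = jfac g (mobius h z) * jfac h z"
proof -
 have "jfac g (mobius h z) * jfac h z =
   of_real (g$2$1) * (mobius h z * jfac h z) + of_real (g$2$2) * jfac h z"
  by (simp add: jfac_def[of g] algebra_simps)
 also have "mobius h z * jfac h z = of_real (h$1$1) * z + of_real (h$1$2)"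
  using jfac_nz[OF assms] by (simp add: mobius_eq)
 finally show ?thesis by (simp add: jfac_def algebra_simps)
qed

lemma mobius_mult:
 assumes "det g = 1" "det h = 1" "Im z > 0"
 shows "mobius (g ** h) z = mobius g (mobius h z)"
proof -
 have nz: "jfac h z ~= 0" using assms by (simp add: jfac_nz)
 have "mobius g (mobius h z) =
  ((of_real (g$1$1) * mobius h z + of_real (g$1$2)) * jfac h z) / (jfac g (mobius h z) * jfac h z)"
  using nz by (simp add: mobius_eq[of g])
 also have "(of_real (g$1$1) * mobius h z + of_real (g$1$2)) * jfac h z
  = of_real ((g ** h)$1$1) * z + of_real ((g ** h)$1$2)"
  using nz by (simp add: mobius_eq[of h] field_simps) (simp add: jfac_def algebra_simps)
 finally show ?thesis
  using assms by (simp add: mobius_eq[of "g ** h"] jfac_mult)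
qed

lemma Im_mobius:
 assumes "det g = 1"
 shows "Im (mobius g z) = Im z / (cmod (jfac g z))^2"
proof -
 obtain x y where z: "z = Complex x y" by (cases z)
 have "mobius g z = (of_real (g$1$1) * z + of_real (g$1$2)) * cnj (jfac g z) / of_real ((cmod (jfac g z))^2)"
  unfolding mobius_eq by (metis complex_div_cnj of_real_power)
 then have "Im (mobius g z) = Im ((of_real (g$1$1) * z + of_real (g$1$2)) * cnj (jfac g z)) / (cmod (jfac g z))^2"
  by (metis Im_divide_of_real)
 moreover have "Im ((of_real (g$1$1) * z + of_real (g$1$2)) * cnj (jfac g z)) = (g$1$1 * g$2$2 - g$1$2 * g$2$1) * y"
  by (simp add: z jfac_def algebra_simps)
 ultimately show ?thesis using assms by (simp add: det_2 z)
qed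

lemma Im_mobius_pos [simp]:
 assumes "det g = 1" "Im z > 0"
 shows "Im (mobius g z) > 0"
 using jfac_nz[of g z] assms by (simp add: Im_mobius)

lemma mobius_adj2:
 assumes "det g = 1" "Im z > 0"
 shows "mobius (adj2 g) (mobius g z) = z" "mobius g (mobius (adj2 g) z) = z"
 using mobius_mult[of "adj2 g" g z] mobius_mult[of g "adj2 g" z] assms by (simp_all add: adj2_inverse)

lemma holomorphic_jfac [holomorphic_intros]: "jfac g holomorphic_on S"
 unfolding jfac_def by (intro holomorphic_intros)

lemma mem_H [simp]: "z \<in> \<H> \<longleftrightarrow> Im z > 0"
 by (simp add: upper_half_plane_def)

lemma open_H: "open \<H>" and connected_H: "connected \<H>" and convex_H: "convex \<H>"
 by (auto simp: upper_half_plane_def open_halfspace_Im_gt convex_halfspace_Im_gt intro: convex_connected)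

lemma holomorphic_mobius:
 assumes "det g = 1"
 shows "mobius g holomorphic_on \<H>"
proof -
 have "(\<lambda>z. (of_real (g$1$1) * z + of_real (g$1$2)) / jfac g z) holomorphic_on \<H>"
  using jfac_nz[of g] assms by (intro holomorphic_intros) auto
 then show ?thesis by (simp add: mobius_eq[abs_def])
qed

lemma holomorphic_compose_mobius:
 assumes "det g = 1" "f holomorphic_on \<H>"
 shows "(\<lambda>z. f (mobius g z)) holomorphic_on \<H>"
proof -
 have "mobius g ` \<H> \<subseteq> \<H>" using assms(1) by auto
 then show ?thesis
  using holomorphic_on_compose_gen[OF holomorphic_mobius[OF assms(1)] assms(2)] by (simp add: o_def)
qed

section \<open>Discrete subgroups\<close>

text \<open>A packing argument: a ball of radius \<delta>/2 holds at most one point of a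
  \<delta>-separated set, so the size of one finite net bounds every such set at once.\<close>

lemma separated_card_bound:
 fixes K :: "'a::heine_borel set"
 assumes "bounded K" "\<delta> > 0"
 obtains N :: nat where "!!S. S \<subseteq> K ==> (!!x y. x \<in> S ==> y \<in> S ==> x ~= y ==> \<delta> <= dist x y)
  ==> finite S \<and> card S <= N"
proof -
 have "compact (closure K)" using assms by simp
 then obtain k where k: "finite k" "closure K \<subseteq> (\<Union>x\<in>k. ball x (\<delta>/2))"
  using seq_compact_imp_totally_bounded[OF compact_imp_seq_compact[OF \<open>compact (closure K)\<close>], rule_format, of "\<delta>/2"] assms(2)
  by auto
 show thesis
 proof (rule that[of "card k"])
  fix S assume S: "S \<subseteq> K" "!!x y. x \<in> S ==> y \<in> S ==> x ~= y ==> \<delta> <= dist x y"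
  have "\<forall>x\<in>S. \<exists>c\<in>k. x \<in> ball c (\<delta>/2)" using S(1) k(2) closure_subset[of K] by blast
  then obtain c where c: "!!x. x \<in> S ==> c x \<in> k \<and> x \<in> ball (c x) (\<delta>/2)" by metis
  have "inj_on c S"
  proof (rule inj_onI, rule ccontr)
   fix x y assume xy: "x \<in> S" "y \<in> S" "c x = c y" "x ~= y"
   have "dist x y <= dist (c x) x + dist (c x) y" by (rule dist_triangle3)
   also have "\<dots> < \<delta>" using c[OF xy(1)] c[OF xy(2)] xy(3) by auto
   finally show False using S(2)[of x y] xy by simp
  qed
  moreover have "c ` S \<subseteq> k" using c by auto
  ultimately show "finite S \<and> card S <= card k"
   using k(1) finite_imageD[OF finite_subset[OF _ k(1)], of c S] card_inj_on_le[of c S k] by blast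
 qed
qed

text \<open>For a subgroup, discreteness is the same as finiteness of all norm balls; the second
  form is the one that every counting argument below starts from. Containing \<open>- I2\<close>
  makes the group the full preimage of its image in the projective group.\<close>

locale discrete_SL2 =
 fixes \<Gamma> :: "(real^2^2) set"
 assumes det1 [simp]: "g \<in> \<Gamma> ==> det g = 1"
  and one_mem [simp]: "I2 \<in> \<Gamma>"
  and mult_mem: "g \<in> \<Gamma> ==> h \<in> \<Gamma> ==> g ** h \<in> \<Gamma>"
  and adj_mem: "g \<in> \<Gamma> ==> adj2 g \<in> \<Gamma>"
  and neg_one_mem: "- I2 \<in> \<Gamma>"
  and finite_bounded: "finite {g \<in> \<Gamma>. norm g <= r}"
begin

lemma uminus_mem: "g \<in> \<Gamma> ==> - g \<in> \<Gamma>"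
 using mult_mem[OF neg_one_mem, of g] by (simp add: uminus_mult_mat2)

lemma exists_separation:
 obtains \<delta> where "\<delta> > 0" "!!g. g \<in> \<Gamma> ==> norm (g - I2) < \<delta> ==> g = I2"
proof -
 define S where "S = {g \<in> \<Gamma>. norm g <= norm I2 + 1} - {I2}"
 have fin: "finite ((\<lambda>g. norm (g - I2)) ` S)"
  unfolding S_def by (intro finite_imageI finite_Diff finite_bounded)
 define \<delta> where "\<delta> = Min (insert 1 ((\<lambda>g. norm (g - I2)) ` S))"
 show thesis
 proof (rule that)
  have "x > 0" if "x \<in> insert 1 ((\<lambda>g. norm (g - I2)) ` S)" for x :: real
   using that by (auto simp: S_def)
  then show "\<delta> > 0" unfolding \<delta>_def using fin Min_in[of "insert 1 ((\<lambda>g. norm (g - I2)) ` S)"] by blast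
  fix g assume g: "g \<in> \<Gamma>" "norm (g - I2) < \<delta>"
  have "\<delta> <= 1" unfolding \<delta>_def using fin by (intro Min_le) auto
  then have "norm g <= norm I2 + 1"
   using g(2) norm_triangle_ineq[of I2 "g - I2"] by simp
  moreover have "g \<notin> S"
  proof
   assume "g \<in> S"
   then have "\<delta> <= norm (g - I2)" unfolding \<delta>_def using fin by (intro Min_le) auto
   with g(2) show False by simp
  qed
  ultimately show "g = I2" using g(1) unfolding S_def by blast
 qed
qed

end

lemma psl_eq: "psl g = {g, - g}"
 by (auto simp: psl_def r_coset_def uminus_mult_mat2)

lemma carrier_PSL2R: "carrier PSL2R = psl ` carrier SL2R"
 by (auto simp: PSL2R_def FactGroup_def RCOSETS_def psl_def)

lemma subgroup_SL2R_iff: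
 assumes "subgroup G SL2R"
 shows "!!g. g \<in> G ==> det g = 1" "I2 \<in> G"
  "!!g h. g \<in> G ==> h \<in> G ==> g ** h \<in> G" "!!g. g \<in> G ==> adj2 g \<in> G"
proof -
 interpret subgroup G SL2R by fact
 show d: "!!g. g \<in> G ==> det g = 1" using subset by (auto simp: SL2R_def)
 show "I2 \<in> G" using one_closed by simp
 show "!!g h. g \<in> G ==> h \<in> G ==> g ** h \<in> G" using m_closed by simp
 show "!!g. g \<in> G ==> adj2 g \<in> G" using m_inv_closed d inv_SL2R by metis
qed

text \<open>An isolated identity in the quotient topology gives a ball about \<open>I2\<close> that
  meets G in \<open>I2\<close> only. Translating by an inverse spreads this separation over each
  norm ball, at the price of the norm, and packing then gives finiteness.\<close>

lemma fuchsian_imp_discrete: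
 assumes G: "subgroup G SL2R" "- I2 \<in> G" and fk: "fuchsian_first_kind (psl_image G)"
 shows "discrete_SL2 G"
proof -
 note sg = subgroup_SL2R_iff[OF G(1)]
 have "subtopology PSL2R_topology (psl_image G) = discrete_topology (psl_image G)"
  using fk by (simp add: fuchsian_first_kind_def)
 then have "openin (subtopology PSL2R_topology (psl_image G)) {psl I2}"
  using sg(2) by (simp add: psl_image_def)
 then obtain U where U: "openin PSL2R_topology U" "U \<inter> psl_image G = {psl I2}"
  by (metis openin_subtopology)
 have U': "U \<subseteq> carrier PSL2R" "openin (top_of_set (carrier SL2R)) (\<Union>U)"
  using U(1) unfolding PSL2R_topology_def topology_inverse'[OF istopology_PSL2R] by auto
 obtain W where W: "open W" "\<Union>U = carrier SL2R \<inter> W"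
  using U'(2) by (auto simp: openin_open)
 have "psl I2 \<in> U" using U(2) by blast
 then have "I2 \<in> \<Union>U" by (rule UnionI) (simp add: psl_eq)
 then have "I2 \<in> W" unfolding W(2) by (rule IntD2)
 then obtain e where e: "e > 0" "ball I2 e \<subseteq> W" using W(1) open_contains_ball by meson
 \<comment> \<open>The bound 1 keeps \<open>- I2\<close> out of the ball: its diagonal entries
   differ from those of \<open>I2\<close> by 2.\<close>
 define \<delta> where "\<delta> = min e 1"
 have \<delta>: "\<delta> > 0" "\<delta> <= 1" "\<delta> <= e" using e by (auto simp: \<delta>_def)
 have sep: "g = I2" if g: "g \<in> G" "norm (g - I2) < \<delta>" for g
 proof -
  have "dist I2 g < e" using g \<delta> by (simp add: dist_norm norm_minus_commute)
  then have "g \<in> \<Union>U" using e(2) W(2) sg(1)[OF g(1)] by auto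
  then obtain C where C: "C \<in> U" "g \<in> C" by blast
  then obtain x where "C = {x, - x}" using U'(1) by (auto simp: carrier_PSL2R psl_eq)
  then have "C = psl g" using C(2) by (auto simp: psl_eq)
  then have "psl g \<in> U \<inter> psl_image G" using C g by (auto simp: psl_image_def)
  then have "psl g = psl I2" using U(2) by blast
  then have "g = I2 \<or> g = - I2" by (auto simp: psl_eq doubleton_eq_iff)
  moreover have "g ~= - I2"
  proof
   assume "g = - I2"
   then have "\<bar>(g - I2)$1$1\<bar> = 2" by simp
   then show False using abs_entry_le_norm2[of "g - I2" 1 1] g(2) \<delta> by linarith
  qed
  ultimately show ?thesis by blast
 qed
 have "finite {g \<in> G. norm g <= r}" for r
 proof -
  define R where "R = max r 1"
  have Rpos: "R > 0" by (simp add: R_def)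
  have bd: "bounded {g::real^2^2. norm g <= R}"
   by (auto simp: bounded_iff)
  obtain N where N: "!!S. S \<subseteq> {g::real^2^2. norm g <= R} ==>
    (!!x y. x \<in> S ==> y \<in> S ==> x ~= y ==> \<delta> / R <= dist x y) ==> finite S \<and> card S <= (N::nat)"
   using separated_card_bound[OF bd, of "\<delta> / R"] Rpos \<delta> by (metis divide_pos_pos)
  have "finite {g \<in> G. norm g <= R}"
  proof (rule N[THEN conjunct1])
   fix x y assume x: "x \<in> {g \<in> G. norm g <= R}" and y: "y \<in> {g \<in> G. norm g <= R}" and "x ~= y"
   have xi: "adj2 x ** (y - x) = adj2 x ** y - I2"
    using sg(1)[of x] x by (simp add: mat2_eq_iff algebra_simps det_2)
   have "adj2 x ** y ~= I2"
    using adj2_cancel(1)[of x y] x sg(1)[of x] \<open>x ~= y\<close> by auto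
   then have "\<delta> <= norm (adj2 x ** y - I2)"
    using sep[of "adj2 x ** y"] sg x y by force
   also have "\<dots> <= norm x * norm (y - x)"
    using norm_mult2_le[of "adj2 x" "y - x"] xi by simp
   also have "\<dots> <= R * dist x y"
    using x Rpos by (intro mult_mono) (auto simp: dist_norm norm_minus_commute)
   finally show "\<delta> / R <= dist x y" by (simp add: R_def field_simps)
  qed auto
  then show ?thesis by (rule rev_finite_subset) (auto simp: R_def)
 qed
 with sg G(2) show ?thesis by unfold_locales auto
qed

section \<open>Moderate growth\<close>

text \<open>At most exponential growth as \<open>Im z\<close> increases, uniformly on vertical
  strips of bounded width. In the local parameter q this is a pole of finite order. The strips are
  bounded because powers of z, which come from the logarithms, must qualify too.\<close>

definition moderate :: "(complex => complex) => bool" where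
 "moderate F \<longleftrightarrow> (\<forall>X y0. y0 > 0 -->
   (\<exists>C N. \<forall>x y. \<bar>x\<bar> <= X --> y0 <= y --> cmod (F (Complex x y)) <= C * exp (N * y)))"

section \<open>Poincare series of weight four\<close>

text \<open>Pigeonhole with cells of length s in [-1, 1]. The explicit linear dependence on 1/s is
  what later yields a quadratic bound for the number of bottom rows.\<close>

lemma separated_count:
 fixes f :: "'a => real"
 assumes "s > 0" "!!x. x \<in> S ==> \<bar>f x\<bar> <= 1"
  "!!x y. x \<in> S ==> y \<in> S ==> x ~= y ==> s <= \<bar>f x - f y\<bar>"
 shows "finite S \<and> real (card S) <= 2 / s + 1"
proof -
 define k where "k x = nat \<lfloor>(f x + 1) / s\<rfloor>" for x
 have k: "real (k x) <= (f x + 1) / s" "(f x + 1) / s < real (k x) + 1" if "x \<in> S" for x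
 proof -
  have "(f x + 1) / s \<ge> 0" using assms(1) assms(2)[OF that] by simp
  then show "real (k x) <= (f x + 1) / s" "(f x + 1) / s < real (k x) + 1"
   unfolding k_def by linarith+
 qed
 have inj: "inj_on k S"
 proof (rule inj_onI, rule ccontr)
  fix x y assume xy: "x \<in> S" "y \<in> S" "k x = k y" "x ~= y"
  have "\<bar>(f x + 1) / s - (f y + 1) / s\<bar> < 1" using k[OF xy(1)] k[OF xy(2)] xy(3) by linarith
  then have "\<bar>f x - f y\<bar> < s" using assms(1) by (simp add: diff_divide_distrib[symmetric] abs_divide)
  with assms(3)[OF xy(1,2,4)] show False by simp
 qed
 have sub: "k ` S \<subseteq> {..nat \<lfloor>2 / s\<rfloor>}"
 proof (rule image_subsetI)
  fix x assume x: "x \<in> S"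
  have "real (k x) <= 2 / s"
   using k(1)[OF x] assms(1) abs_le_D1[OF assms(2)[OF x]] divide_right_mono[of "f x + 1" 2 s] by simp
  then show "k x \<in> {..nat \<lfloor>2 / s\<rfloor>}" by (simp add: le_nat_floor)
 qed
 have "card S <= card {..nat \<lfloor>2 / s\<rfloor>}" by (rule card_inj_on_le[OF inj sub]) simp
 moreover have "real (nat \<lfloor>2 / s\<rfloor>) <= 2 / s" using assms(1) by simp
 ultimately show ?thesis
  using finite_imageD[OF finite_subset[OF sub] inj] by (auto intro: order_trans)
qed

lemma norm2_le_sum: "norm (g::real^2^2) <= \<bar>g$1$1\<bar> + \<bar>g$1$2\<bar> + \<bar>g$2$1\<bar> + \<bar>g$2$2\<bar>"
proof (rule power2_le_imp_le)
 have "(\<bar>g$1$1\<bar> + \<bar>g$1$2\<bar> + \<bar>g$2$1\<bar> + \<bar>g$2$2\<bar>)^2 =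
  (g$1$1)^2 + (g$1$2)^2 + (g$2$1)^2 + (g$2$2)^2 +
  2 * (\<bar>g$1$1\<bar> * \<bar>g$1$2\<bar> + \<bar>g$1$1\<bar> * \<bar>g$2$1\<bar> + \<bar>g$1$1\<bar> * \<bar>g$2$2\<bar> + \<bar>g$1$2\<bar> * \<bar>g$2$1\<bar>
   + \<bar>g$1$2\<bar> * \<bar>g$2$2\<bar> + \<bar>g$2$1\<bar> * \<bar>g$2$2\<bar>)"
  by (simp add: power2_eq_square algebra_simps)
 then show "(norm g)^2 <= (\<bar>g$1$1\<bar> + \<bar>g$1$2\<bar> + \<bar>g$2$1\<bar> + \<bar>g$2$2\<bar>)^2"
  unfolding norm_sq2 by simp
qed simp

section \<open>Bottom rows of group elements and how many of them are short\<close>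

definition row_mult :: "real^2 => real^2^2 => real^2" where
 "row_mult v g = vector [v$1 * g$1$1 + v$2 * g$2$1, v$1 * g$1$2 + v$2 * g$2$2]"

lemma row_mult_entries [simp]:
 "row_mult v g $ 1 = v$1 * g$1$1 + v$2 * g$2$1" "row_mult v g $ 2 = v$1 * g$1$2 + v$2 * g$2$2"
 by (simp_all add: row_mult_def)

lemma vec2_eq_iff: "(v::real^2) = w \<longleftrightarrow> v$1 = w$1 \<and> v$2 = w$2"
 unfolding Finite_Cartesian_Product.vec_eq_iff forall_2 by (rule refl)

lemma norm_sq_vec2: "(norm (v::real^2))^2 = (v$1)^2 + (v$2)^2"
 by (simp add: norm_vec_def L2_set_def sum_2)

lemma row_of_mult: "((A::real^2^2) ** B) $ 2 = row_mult (A $ 2) B"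
 by (simp add: vec2_eq_iff)

lemma row_mult_mult: "row_mult v (A ** B) = row_mult (row_mult v A) B"
 by (simp add: vec2_eq_iff algebra_simps)

lemma row_mult_I2 [simp]: "row_mult v I2 = v"
 by (simp add: vec2_eq_iff)

lemma norm_row_mult: "norm (row_mult v g) <= norm v * norm g"
proof (rule power2_le_imp_le)
 have cs: "(a * e + b * g)^2 <= (a^2 + b^2) * (e^2 + g^2)" for a b e g :: real
 proof -
  have "(a^2 + b^2) * (e^2 + g^2) - (a * e + b * g)^2 = (a * g - b * e)^2"
   by (simp add: power2_eq_square algebra_simps)
  then show ?thesis by (metis diff_ge_0_iff_ge zero_le_power2)
 qed
 show "(norm (row_mult v g))^2 <= (norm v * norm g)^2"
  unfolding power_mult_distrib norm_sq2 norm_sq_vec2 row_mult_entries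
  using cs[of "v$1" "g$1$1" "v$2" "g$2$1"] cs[of "v$1" "g$1$2" "v$2" "g$2$2"]
  by (simp add: algebra_simps)
qed simp

definition row_fac :: "real^2 => complex => complex" where
 "row_fac v z = of_real (v$1) * z + of_real (v$2)"

lemma jfac_row_fac: "jfac g z = row_fac (g$2) z"
 by (simp add: jfac_def row_fac_def)

text \<open>On a strip that stays above height \<open>y0\<close>, the square of the automorphy
  factor is bounded below by a multiple of the squared length of the row, with a constant that does
  not deteriorate as y grows.\<close>

lemma row_fac_lower:
 assumes "y0 > 0"
 obtains \<kappa> where "\<kappa> > 0" "!!v x y. \<bar>x\<bar> <= X ==> y0 <= y ==> \<kappa> * (norm v)^2 <= (cmod (row_fac v (Complex x y)))^2"
proof -
 \<comment> \<open>With v = (c, d): d^2 is at most 2 (c x + d)^2 + 2 X^2 c^2, and c^2 is at most c^2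
   y^2 / y0^2.\<close>
 define K where "K = 2 + (1 + 2 * X^2) / y0^2"
 have K: "K > 0" unfolding K_def by (intro add_pos_nonneg divide_nonneg_nonneg) auto
 show thesis
 proof (rule that[of "1 / K"])
  fix v :: "real^2" and x y :: real
  assume x: "\<bar>x\<bar> <= X" and y: "y0 <= y"
  have e: "(cmod (row_fac v (Complex x y)))^2 = (v$1 * x + v$2)^2 + (v$1)^2 * y^2"
   by (simp add: cmod_power2 row_fac_def power_mult_distrib)
  have xX: "x^2 <= X^2" using x by (simp add: abs_le_square_iff[symmetric])
  have yy: "y0^2 <= y^2" using y assms by simp
  have "(v$2)^2 <= 2 * (v$1 * x + v$2)^2 + 2 * x^2 * (v$1)^2"
  proof -
   have "2 * (v$1 * x + v$2)^2 + 2 * x^2 * (v$1)^2 - (v$2)^2 = (2 * v$1 * x + v$2)^2"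
    by (simp add: power2_eq_square algebra_simps)
   then show ?thesis by (metis diff_ge_0_iff_ge zero_le_power2)
  qed
  also have "\<dots> <= 2 * (v$1 * x + v$2)^2 + 2 * X^2 * (v$1)^2"
   using xX by (simp add: mult_right_mono)
  finally have "(norm v)^2 <= 2 * (v$1 * x + v$2)^2 + (1 + 2 * X^2) * (v$1)^2"
   by (simp add: norm_sq_vec2 algebra_simps)
  also have "(1 + 2 * X^2) * (v$1)^2 = (1 + 2 * X^2) / y0^2 * ((v$1)^2 * y0^2)"
   using assms by simp
  also have "\<dots> <= (1 + 2 * X^2) / y0^2 * ((v$1)^2 * y^2)"
   using yy by (intro mult_left_mono) auto
  also have "\<dots> <= K * ((v$1)^2 * y^2)"
   by (intro mult_right_mono) (auto simp: K_def)
  also have "2 * (v$1 * x + v$2)^2 <= K * (v$1 * x + v$2)^2"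
   by (intro mult_right_mono) (auto simp: K_def)
  finally have "(norm v)^2 <= K * (cmod (row_fac v (Complex x y)))^2"
   unfolding e by (simp add: algebra_simps)
  then show "1 / K * (norm v)^2 <= (cmod (row_fac v (Complex x y)))^2"
   using K by (simp add: field_simps)
 qed (use K in simp)
qed

text \<open>Infinity is a cusp of width h. Any other cusp is brought into this position by
  conjugation.\<close>

locale cusp_group = discrete_SL2 +
 fixes h :: real
 assumes h_pos: "h > 0"
  and transl_mem: "mat2 1 h 0 1 \<in> \<Gamma>"
  and stab_infinity: "g \<in> \<Gamma> ==> g$2$1 = 0 ==>
   \<exists>n::int. g = mat2 1 (of_int n * h) 0 1 \<or> g = - mat2 1 (of_int n * h) 0 1"
begin

definition tr :: "int => real^2^2" where "tr n = mat2 1 (of_int n * h) 0 1"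

lemma tr_entries [simp]: "tr n $ 1 $ 1 = 1" "tr n $ 1 $ 2 = of_int n * h" "tr n $ 2 $ 1 = 0" "tr n $ 2 $ 2 = 1"
 by (simp_all add: tr_def)

lemma det_tr [simp]: "det (tr n) = 1"
 by (simp add: tr_def)

lemma tr_mem: "tr n \<in> \<Gamma>"
proof -
 have nat: "tr (int k) \<in> \<Gamma>" for k
 proof (induction k)
  case 0
  have "tr 0 = I2" by (simp add: mat2_eq_iff)
  then show ?case by simp
 next
  case (Suc k)
  have "tr (int (Suc k)) = tr (int k) ** mat2 1 h 0 1" by (simp add: mat2_eq_iff algebra_simps)
  then show ?case using mult_mem[OF Suc transl_mem] by simp
 qed
 have "adj2 (tr n) = tr (- n)" for n by (simp add: mat2_eq_iff)
 then show ?thesis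
  using nat[of "nat n"] adj_mem[OF nat[of "nat (- n)"]] by (cases "n \<ge> 0") simp_all
qed

text \<open>Translations on the left and on the right change a and d by multiples of h c and leave c
  alone. If c is small, a and d can therefore be moved close to 1, the determinant then bounds b,
  and only finitely many matrices remain.\<close>

lemma lower_left_bound:
 obtains c0 where "c0 > 0" "!!g. g \<in> \<Gamma> ==> g$2$1 ~= 0 ==> c0 <= \<bar>g$2$1\<bar>"
proof -
 \<comment> \<open>The four summands bound the entries a, b, c, d of the reduced matrix
   \<open>g'\<close> below.\<close>
 define B where "B = (1 + h) + (h^2 + 2 * h) + 1 + (1 + h)"
 define S where "S = {g \<in> \<Gamma>. norm g <= B} \<inter> {g. g$2$1 ~= 0}"
 have fin: "finite ((\<lambda>g. \<bar>g$2$1\<bar>) ` S)"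
  unfolding S_def by (intro finite_imageI finite_Int disjI1 finite_bounded)
 define c0 where "c0 = Min (insert 1 ((\<lambda>g. \<bar>g$2$1\<bar>) ` S))"
 show thesis
 proof (rule that)
  have "x > 0" if "x \<in> insert 1 ((\<lambda>g. \<bar>g$2$1\<bar>) ` S)" for x :: real
   using that by (auto simp: S_def)
  then show "c0 > 0" unfolding c0_def using fin Min_in[of "insert 1 ((\<lambda>g. \<bar>g$2$1\<bar>) ` S)"] by blast
  fix g assume g: "g \<in> \<Gamma>" "g$2$1 ~= 0"
  show "c0 <= \<bar>g$2$1\<bar>"
  proof (cases "\<bar>g$2$1\<bar> \<ge> 1")
   case True
   have "c0 <= 1" unfolding c0_def using fin by (intro Min_le) auto
   with True show ?thesis by simp
  next
   case False
   define c where "c = g$2$1"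
   have c: "c ~= 0" "\<bar>c\<bar> < 1" using g False by (auto simp: c_def)
   \<comment> \<open>Rounding: a multiple of h c brings any t within h |c| of 1.\<close>
   have red: "\<bar>t + of_int \<lfloor>(1 - t) / (h * c)\<rfloor> * h * c - 1\<bar> <= h * \<bar>c\<bar>" for t
   proof -
    have "\<bar>(1 - t) / (h * c) - of_int \<lfloor>(1 - t) / (h * c)\<rfloor>\<bar> <= 1" by linarith
    then have "\<bar>(1 - t) / (h * c) - of_int \<lfloor>(1 - t) / (h * c)\<rfloor>\<bar> * \<bar>h * c\<bar> <= 1 * \<bar>h * c\<bar>"
     by (rule mult_right_mono) simp
    also have "\<bar>(1 - t) / (h * c) - of_int \<lfloor>(1 - t) / (h * c)\<rfloor>\<bar> * \<bar>h * c\<bar> =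
     \<bar>((1 - t) / (h * c) - of_int \<lfloor>(1 - t) / (h * c)\<rfloor>) * (h * c)\<bar>"
     by (simp add: abs_mult)
    also have "((1 - t) / (h * c) - of_int \<lfloor>(1 - t) / (h * c)\<rfloor>) * (h * c) =
      1 - t - of_int \<lfloor>(1 - t) / (h * c)\<rfloor> * h * c"
    proof -
     have "(1 - t) / (h * c) * (h * c) = 1 - t" using c h_pos by simp
     then show ?thesis by (simp only: left_diff_distrib mult.assoc)
    qed
    finally show ?thesis using h_pos by (simp add: abs_mult)
   qed
   define k where "k = \<lfloor>(1 - g$1$1) / (h * c)\<rfloor>"
   define l where "l = \<lfloor>(1 - g$2$2) / (h * c)\<rfloor>"
   define g' where "g' = tr k ** g ** tr l"
   have g': "g' \<in> \<Gamma>" unfolding g'_def by (intro mult_mem tr_mem g)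
   have c': "g'$2$1 = c" by (simp add: g'_def c_def)
   have a: "\<bar>g'$1$1 - 1\<bar> <= h * \<bar>c\<bar>"
    using red[of "g$1$1"] unfolding k_def[symmetric] by (simp add: g'_def c_def algebra_simps)
   have d: "\<bar>g'$2$2 - 1\<bar> <= h * \<bar>c\<bar>"
    using red[of "g$2$2"] unfolding l_def[symmetric] by (simp add: g'_def c_def algebra_simps)
   have hc: "h * \<bar>c\<bar> <= h" using c h_pos by simp
   \<comment> \<open>This is b c = a d - 1 expanded about a = d = 1. Each term on the right carries
     a factor |c| in its bound, so c cancels and b is bounded.\<close>
   have "g'$1$2 * c = (g'$1$1 - 1) * (g'$2$2 - 1) + (g'$1$1 - 1) + (g'$2$2 - 1)"
    using det1[OF g'] by (simp add: det_2 c' algebra_simps)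
   then have "\<bar>g'$1$2 * c\<bar> <= \<bar>(g'$1$1 - 1) * (g'$2$2 - 1)\<bar> + \<bar>g'$1$1 - 1\<bar> + \<bar>g'$2$2 - 1\<bar>"
    by linarith
   also have "\<bar>(g'$1$1 - 1) * (g'$2$2 - 1)\<bar> <= (h * \<bar>c\<bar>) * h"
    unfolding abs_mult using a d hc by (intro mult_mono) auto
   finally have "\<bar>g'$1$2\<bar> * \<bar>c\<bar> <= (h^2 + 2 * h) * \<bar>c\<bar>"
    using a d by (simp add: abs_mult algebra_simps power2_eq_square)
   then have b: "\<bar>g'$1$2\<bar> <= h^2 + 2 * h" using c by simp
   have "norm g' <= B"
    using norm2_le_sum[of g'] a b c' d c hc unfolding B_def by linarith
   then have "g' \<in> S" using g' c' c by (simp add: S_def)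
   then have "c0 <= \<bar>g'$2$1\<bar>" unfolding c0_def using fin by (intro Min_le) auto
   then show ?thesis by (simp add: c' c_def)
  qed
 qed
qed

definition rows :: "(real^2) set" where "rows = (\<lambda>g. g$2) ` \<Gamma>"

text \<open>The cross product of two bottom rows is the lower left entry of g k^(-1). It vanishes
  only if g and k differ by an element fixing infinity, and then their rows agree up to
  sign.\<close>

lemma rows_cross_bound:
 obtains c0 where "c0 > 0"
  "!!v w. v \<in> rows ==> w \<in> rows ==> v ~= w ==> v ~= - w ==> c0 <= \<bar>v$1 * w$2 - v$2 * w$1\<bar>"
  "!!v. v \<in> rows ==> c0 <= norm v"
proof -
 obtain c0 where c0: "c0 > 0" "!!g. g \<in> \<Gamma> ==> g$2$1 ~= 0 ==> c0 <= \<bar>g$2$1\<bar>"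
  using lower_left_bound by blast
 show thesis
 proof (rule that[of "min c0 1"])
  fix v w assume vw: "v \<in> rows" "w \<in> rows" "v ~= w" "v ~= - w"
  then obtain g k where g: "g \<in> \<Gamma>" "v = g$2" and k: "k \<in> \<Gamma>" "w = k$2" by (auto simp: rows_def)
  have m: "g ** adj2 k \<in> \<Gamma>" by (intro mult_mem adj_mem g k)
  have e: "(g ** adj2 k)$2$1 = v$1 * w$2 - v$2 * w$1" using g k by simp
  have "(g ** adj2 k)$2$1 ~= 0"
  proof
   assume "(g ** adj2 k)$2$1 = 0"
   then obtain n where n: "g ** adj2 k = tr n \<or> g ** adj2 k = - tr n"
    using stab_infinity[OF m] by (auto simp: tr_def)
   have "g = g ** adj2 k ** k" using k(1) by (simp add: adj2_cancel)
   then have "g = tr n ** k \<or> g = - (tr n ** k)" using n by (auto simp: uminus_mult_mat2)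
   then have "g$2 = k$2 \<or> g$2 = - (k$2)" by (auto simp: vec2_eq_iff)
   with vw g k show False by simp
  qed
  then show "min c0 1 <= \<bar>v$1 * w$2 - v$2 * w$1\<bar>" using c0(2)[OF m] e by simp
 next
  fix v assume "v \<in> rows"
  then obtain g where g: "g \<in> \<Gamma>" "v = g$2" by (auto simp: rows_def)
  show "min c0 1 <= norm v"
  proof (cases "g$2$1 = 0")
   case True
   then obtain n where "g = tr n \<or> g = - tr n" using stab_infinity[OF g(1)] by (auto simp: tr_def)
   then have "\<bar>v$2\<bar> = 1" using g by auto
   then show ?thesis using component_le_norm_cart[of v 2] by simp
  next
   case False
   then show ?thesis using c0(2)[OF g(1)] component_le_norm_cart[of v 1] g(2) by simp
  qed
 qed (use c0 in simp)
qed

text \<open>Split the plane into four sectors by which coordinate dominates and by its sign. Inside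
  a sector the slopes lie in [-1, 1], opposite rows cannot both occur, and the cross product bound
  separates the slopes by c0 / r^2.\<close>

lemma rows_count:
 assumes "c0 > 0" "r > 0"
  "!!v w. v \<in> rows ==> w \<in> rows ==> v ~= w ==> v ~= - w ==> c0 <= \<bar>v$1 * w$2 - v$2 * w$1\<bar>"
  "!!v. v \<in> rows ==> c0 <= norm v"
  "S \<subseteq> rows" "!!v. v \<in> S ==> norm v <= r"
 shows "finite S \<and> real (card S) <= 4 * (2 * r^2 / c0 + 1)"
proof -
 have part: "finite (S \<inter> A) \<and> real (card (S \<inter> A)) <= 2 * r^2 / c0 + 1"
  if A: "A = {v. \<bar>v$j\<bar> <= \<bar>v$i\<bar> \<and> sg * v$i > 0}" and ij: "i = 1 \<and> j = 2 \<or> i = 2 \<and> j = 1"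
  for A :: "(real^2) set" and i j :: 2 and sg :: real
 proof -
  have "finite (S \<inter> A) \<and> real (card (S \<inter> A)) <= 2 / (c0 / r^2) + 1"
  proof (rule separated_count)
   show "c0 / r^2 > 0" using assms by simp
   show "\<bar>v$j / v$i\<bar> <= 1" if "v \<in> S \<inter> A" for v
    using that by (auto simp: A abs_divide divide_le_eq)
   fix v w assume v: "v \<in> S \<inter> A" and w: "w \<in> S \<inter> A" and "v ~= w"
   have nz: "v$i ~= 0" "w$i ~= 0" using v w by (auto simp: A)
   have "v ~= - w" using v w by (auto simp: A)
   then have "c0 <= \<bar>v$1 * w$2 - v$2 * w$1\<bar>" using assms(3,5) v w \<open>v ~= w\<close> by blast
   also have "\<dots> = \<bar>v$j * w$i - w$j * v$i\<bar>"
    using ij by (auto simp: abs_minus_commute mult.commute)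
   also have "\<dots> = \<bar>v$j / v$i - w$j / w$i\<bar> * (\<bar>v$i\<bar> * \<bar>w$i\<bar>)"
    using nz by (simp add: abs_mult[symmetric] field_simps)
   also have "\<dots> <= \<bar>v$j / v$i - w$j / w$i\<bar> * (r * r)"
    using assms(6)[of v] assms(6)[of w] v w component_le_norm_cart[of v i] component_le_norm_cart[of w i]
    by (intro mult_left_mono mult_mono) (auto intro: order_trans)
   finally show "c0 / r^2 <= \<bar>v$j / v$i - w$j / w$i\<bar>"
    using assms(2) by (simp add: divide_le_eq power2_eq_square)
  qed
  then show ?thesis by simp
 qed
 define A where "A i j sg = {v::real^2. \<bar>v$j\<bar> <= \<bar>v$i\<bar> \<and> sg * v$i > (0::real)}" for i j :: 2 and sg :: real
 have p: "finite (S \<inter> A 1 2 1) \<and> real (card (S \<inter> A 1 2 1)) <= 2 * r^2 / c0 + 1"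
  "finite (S \<inter> A 1 2 (-1)) \<and> real (card (S \<inter> A 1 2 (-1))) <= 2 * r^2 / c0 + 1"
  "finite (S \<inter> A 2 1 1) \<and> real (card (S \<inter> A 2 1 1)) <= 2 * r^2 / c0 + 1"
  "finite (S \<inter> A 2 1 (-1)) \<and> real (card (S \<inter> A 2 1 (-1))) <= 2 * r^2 / c0 + 1"
  by (rule part[OF A_def]; simp)+
 have S: "S = (S \<inter> A 1 2 1) \<union> (S \<inter> A 1 2 (-1)) \<union> (S \<inter> A 2 1 1) \<union> (S \<inter> A 2 1 (-1))"
 proof -
  have "v \<in> A 1 2 1 \<or> v \<in> A 1 2 (-1) \<or> v \<in> A 2 1 1 \<or> v \<in> A 2 1 (-1)" if "v \<in> S" for v
  proof -
   have "v ~= 0" using assms(1,4,5) that by force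
   then show ?thesis unfolding A_def vec2_eq_iff by (auto simp: abs_if split: if_splits)
  qed
  then show ?thesis by blast
 qed
 have "card S <= card (S \<inter> A 1 2 1) + card (S \<inter> A 1 2 (-1)) + card (S \<inter> A 2 1 1) + card (S \<inter> A 2 1 (-1))"
  by (subst S) (meson add_le_mono1 card_Un_le le_trans)
 moreover have "finite S" by (subst S) (use p in simp)
 ultimately show ?thesis using p by (simp add: of_nat_le_iff[symmetric, where 'a=real] del: of_nat_le_iff)
qed

text \<open>Dyadic shells: the i-th shell holds O(4^i) rows and each contributes O(16^(-i)).\<close>

lemma rows_summable: "(\<lambda>v. 1 / norm v ^ 4) summable_on rows"
proof -
 obtain c0 where c0: "c0 > 0"
  "!!v w. v \<in> rows ==> w \<in> rows ==> v ~= w ==> v ~= - w ==> c0 <= \<bar>v$1 * w$2 - v$2 * w$1\<bar>"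
  "!!v. v \<in> rows ==> c0 <= norm v"
  using rows_cross_bound by blast
 \<comment> \<open>The count for radius 2^(i+1) c0 is at most 4 (8 c0 4^i + 1), hence at most 4 (8
   c0 + 1) 4^i; the factor c0^(-4) comes from the terms. The number 4/3 below is the geometric sum
   with ratio 1/4.\<close>
 define K where "K = 4 * (8 * c0 + 1) / c0 ^ 4"
 have K: "K \<ge> 0" using c0 by (simp add: K_def)
 define k where "k v = nat \<lfloor>log 2 (norm v / c0)\<rfloor>" for v :: "real^2"
 have k: "2 ^ k v * c0 <= norm v" "norm v <= 2 ^ Suc (k v) * c0" if v: "v \<in> rows" for v
 proof -
  have 1: "norm v / c0 \<ge> 1" using c0(1) c0(3)[OF v] by simp
  then have l: "log 2 (norm v / c0) \<ge> 0" by simp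
  have "real (k v) <= log 2 (norm v / c0)" "log 2 (norm v / c0) <= real (Suc (k v))"
   unfolding k_def using l by linarith+
  then have "2 powr real (k v) <= norm v / c0" "norm v / c0 <= 2 powr real (Suc (k v))"
   using 1 by (simp_all add: le_log_iff log_le_iff)
  then show "2 ^ k v * c0 <= norm v" "norm v <= 2 ^ Suc (k v) * c0"
   using c0(1) by (simp_all add: powr_realpow[symmetric] powr_add field_simps)
 qed
 have "sum (\<lambda>v. 1 / norm v ^ 4) F <= K * (4 / 3)" if F: "F \<subseteq> rows" "finite F" for F
 proof -
  have "sum (\<lambda>v. 1 / norm v ^ 4) F = (\<Sum>i\<in>k ` F. \<Sum>v\<in>{v \<in> F. k v = i}. 1 / norm v ^ 4)"
   using F by (intro sum.group[symmetric]) auto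
  also have "\<dots> <= (\<Sum>i\<in>k ` F. K * (1 / 4) ^ i)"
  proof (rule sum_mono)
   fix i
   have "(\<Sum>v\<in>{v \<in> F. k v = i}. 1 / norm v ^ 4) <= (\<Sum>v\<in>{v \<in> F. k v = i}. 1 / (2 ^ i * c0) ^ 4)"
   proof (rule sum_mono)
    fix v assume "v \<in> {v \<in> F. k v = i}"
    then have v: "v \<in> rows" "k v = i" using F by auto
    have "(2 ^ i * c0) ^ 4 <= norm v ^ 4" using k(1)[OF v(1)] v(2) c0(1) by (intro power_mono) auto
    moreover have "0 < (2 ^ i * c0) ^ 4" using c0(1) by simp
    ultimately show "1 / norm v ^ 4 <= 1 / (2 ^ i * c0) ^ 4" by (intro divide_left_mono mult_pos_pos) auto
   qed
   also have "\<dots> = real (card {v \<in> F. k v = i}) * (1 / (2 ^ i * c0) ^ 4)" by simp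
   also have "\<dots> <= 4 * (2 * (2 ^ Suc i * c0)^2 / c0 + 1) * (1 / (2 ^ i * c0) ^ 4)"
   proof (rule mult_right_mono)
    have "{v \<in> F. k v = i} \<subseteq> rows" "!!v. v \<in> {v \<in> F. k v = i} ==> norm v <= 2 ^ Suc i * c0"
     using F k(2) by auto
    then show "real (card {v \<in> F. k v = i}) <= 4 * (2 * (2 ^ Suc i * c0)^2 / c0 + 1)"
     by (intro conjunct2[OF rows_count[OF c0(1) _ c0(2,3)]]) (use c0(1) in auto)
   qed (use c0 in simp)
   also have "\<dots> <= 4 * (8 * c0 * 4 ^ i + 4 ^ i) * (1 / (2 ^ i * c0) ^ 4)"
   proof (intro mult_right_mono mult_left_mono add_mono)
    have "(2 ^ Suc i * c0)^2 = 4 * 4 ^ i * c0^2"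
     by (simp add: power_mult_distrib power2_eq_square power_mult[symmetric])
      (metis power_mult_distrib num_double numeral_times_numeral)
    then show "2 * (2 ^ Suc i * c0)^2 / c0 <= 8 * c0 * 4 ^ i"
     using c0(1) by (simp add: power2_eq_square)
   qed auto
   also have "\<dots> = K * (4 ^ i / 16 ^ i)"
   proof -
    have "(2 ^ i * c0) ^ 4 = 16 ^ i * c0 ^ 4"
     by (simp add: power_mult_distrib power_mult[symmetric] mult.commute[of i]) (simp add: power_mult)
    then show ?thesis using c0(1) by (simp add: K_def field_simps)
   qed
   also have "(4::real) ^ i / 16 ^ i = (1 / 4) ^ i" by (simp add: power_divide[symmetric])
   finally show "(\<Sum>v\<in>{v \<in> F. k v = i}. 1 / norm v ^ 4) <= K * (1 / 4) ^ i" .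
  qed
  also have "\<dots> = K * (\<Sum>i\<in>k ` F. (1 / 4) ^ i)" by (simp add: sum_distrib_left)
  also have "(\<Sum>i\<in>k ` F. (1 / 4::real) ^ i) <= (\<Sum>i. (1 / 4) ^ i)"
   using F by (intro sum_le_suminf summable_geometric) auto
  also have "(\<Sum>i. (1 / 4::real) ^ i) = 4 / 3" by (subst suminf_geometric) auto
  finally show ?thesis using K by (simp add: mult_left_mono)
 qed
 then show ?thesis by (intro nonneg_bdd_above_summable_on bdd_aboveI[of _ "K * (4 / 3)"]) auto
qed

end

section \<open>The Poincare series: convergence, transformation law and growth\<close>

context cusp_group
begin

text \<open>Bottom rows index the cosets of the translations. The choice of representative is
  harmless: two elements with the same bottom row differ by a translation on the left, under which
  \<open>eterm\<close> is periodic.\<close>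

definition pick :: "real^2 => real^2^2" where "pick v = (SOME g. g \<in> \<Gamma> \<and> g$2 = v)"

lemma pick: "v \<in> rows ==> pick v \<in> \<Gamma>" "v \<in> rows ==> pick v $ 2 = v"
proof -
 assume "v \<in> rows"
 then have "\<exists>g. g \<in> \<Gamma> \<and> g$2 = v" by (auto simp: rows_def)
 then show "pick v \<in> \<Gamma>" "pick v $ 2 = v"
  unfolding pick_def by (metis (mono_tags, lifting) someI_ex)+
qed

lemma same_row:
 assumes "a \<in> \<Gamma>" "b \<in> \<Gamma>" "a$2 = b$2"
 obtains k where "a = tr k ** b"
proof -
 have m: "a ** adj2 b \<in> \<Gamma>" by (intro mult_mem adj_mem assms)
 have "(a ** adj2 b)$2$1 = 0" using assms(3) by simp
 then obtain k where k: "a ** adj2 b = tr k \<or> a ** adj2 b = - tr k"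
  using stab_infinity[OF m] by (auto simp: tr_def)
 have a: "a = a ** adj2 b ** b" using assms(2) by (simp add: adj2_cancel)
 show thesis
 proof (cases "a ** adj2 b = tr k")
  case True
  then show thesis using a that by metis
 next
  \<comment> \<open>The sign -1 would make the bottom row of b equal to its own negative, hence
    zero.\<close>
  case False
  then have "a = - (tr k ** b)" using k a by (metis uminus_mult_mat2(1))
  then have "a$2 = - (b$2)" by (simp add: vec2_eq_iff)
  then have eq: "b$2 = - (b$2)" using assms(3) by simp
  have "b$2$1 = 0" "b$2$2 = 0"
   using arg_cong[OF eq, of "\<lambda>v. v$1"] arg_cong[OF eq, of "\<lambda>v. v$2"] by simp_all
  then have "det b = 0" by (simp add: det_2)
  with det1[OF assms(2)] show thesis by simp
 qed
qed

text \<open>The seed q^(-n) in the local parameter q of width h at infinity.\<close>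

definition eterm :: "nat => complex => complex" where
 "eterm n w = exp (- (2 * of_real pi * \<i> * of_nat n / of_real h) * w)"

lemma eterm_shift: "eterm n (w + of_int k * of_real h) = eterm n w"
proof -
 have "- (2 * of_real pi * \<i> * of_nat n / of_real h) * (w + of_int k * of_real h) =
   - (2 * of_real pi * \<i> * of_nat n / of_real h) * w + 2 * of_int (- (int n * k)) * of_real pi * \<i>"
  using h_pos by (simp add: field_simps)
 moreover have "exp (2 * of_int (- (int n * k)) * of_real pi * \<i>) = 1"
  unfolding exp_eq_1 by (auto intro!: exI[of _ "- (int n * k)"])
 ultimately show ?thesis unfolding eterm_def by (simp only: exp_add mult_1_right)
qed

lemma norm_eterm: "cmod (eterm n w) = exp (2 * pi * n / h * Im w)"
 by (simp add: eterm_def norm_exp_eq_Re)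

definition ptm :: "nat => real^2^2 => real^2 => complex => complex" where
 "ptm n g v z = eterm n (mobius (pick v ** g) z) / jfac (pick v ** g) z ^ 4"

text \<open>\<open>poincare n g\<close> is the weight 4 slash by \<open>g\<close> of the Poincare series with seed \<open>q ^ (- n)\<close>.\<close>

definition poincare :: "nat => real^2^2 => complex => complex" where
 "poincare n g z = (\<Sum>\<^sub>\<infinity>v\<in>rows. ptm n g v z)"

lemma norm_ptm:
 assumes "v \<in> rows" "det g = 1"
 shows "cmod (ptm n g v z) =
  exp (2 * pi * n / h * (Im z / (cmod (row_fac (row_mult v g) z))^2)) / (cmod (row_fac (row_mult v g) z)) ^ 4"
proof -
 have "det (pick v ** g) = 1"
  using assms pick(1) by (simp add: Determinants.det_mul)
 then show ?thesis
  using pick(2)[OF assms(1)] by (simp add: ptm_def norm_divide norm_power norm_eterm Im_mobius jfac_row_fac row_of_mult)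
qed

text \<open>The row v is recovered from v g by the inverse matrix, so \<open>norm v\<close> is at
  most \<open>norm (row_mult v g) * norm g\<close>, and the bound for the row v g becomes one for
  v.\<close>

lemma ptm_bound_general:
 assumes g: "det g = 1" and y0: "y0 > 0"
 obtains \<kappa> where "\<kappa> > 0" "!!v x y. v \<in> rows ==> \<bar>x\<bar> <= X ==> y0 <= y ==>
   \<kappa> * (norm v)^2 <= (cmod (row_fac (row_mult v g) (Complex x y)))^2"
proof -
 obtain \<kappa> where k: "\<kappa> > 0" "!!v x y. \<bar>x\<bar> <= X ==> y0 <= y ==> \<kappa> * (norm v)^2 <= (cmod (row_fac v (Complex x y)))^2"
  using row_fac_lower[OF y0] by metis
 have ng: "norm g > 0" using g by (auto simp: det_2)
 show thesis
 proof (rule that[of "\<kappa> / (norm g)^2"])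
  fix v x y assume "v \<in> rows" and xy: "\<bar>x\<bar> <= X" "y0 <= y"
  have "row_mult (row_mult v g) (adj2 g) = v"
   using g by (simp add: row_mult_mult[symmetric] adj2_inverse)
  then have "norm v <= norm (row_mult v g) * norm g"
   using norm_row_mult[of "row_mult v g" "adj2 g"] by simp
  then have "(norm v)^2 <= (norm (row_mult v g))^2 * (norm g)^2"
   by (metis norm_ge_zero power_mono power_mult_distrib)
  then have "\<kappa> / (norm g)^2 * (norm v)^2 <= \<kappa> / (norm g)^2 * ((norm (row_mult v g))^2 * (norm g)^2)"
   using k(1) by (intro mult_left_mono) auto
  also have "\<dots> = \<kappa> * (norm (row_mult v g))^2" using ng by simp
  also have "\<dots> <= (cmod (row_fac (row_mult v g) (Complex x y)))^2" by (rule k(2)[OF xy])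
  finally show "\<kappa> / (norm g)^2 * (norm v)^2 <= (cmod (row_fac (row_mult v g) (Complex x y)))^2" .
 qed (use k ng in simp)
qed

text \<open>The imaginary part of the image point is y / |j|^2, and |j|^2 is bounded below because
  rows have length at least c0. So the seed costs a factor exp (C1 y) that is the same for all rows,
  and |j|^(-4) gives the summable majorant.\<close>

lemma ptm_bound:
 assumes g: "det g = 1" and y0: "y0 > 0"
 obtains C1 C2 where "C2 > 0" "!!v x y. v \<in> rows ==> \<bar>x\<bar> <= X ==> y0 <= y ==>
   cmod (ptm n g v (Complex x y)) <= exp (C1 * y) * C2 * (1 / norm v ^ 4)"
proof -
 obtain \<kappa> where k: "\<kappa> > 0" "!!v x y. v \<in> rows ==> \<bar>x\<bar> <= X ==> y0 <= y ==>
   \<kappa> * (norm v)^2 <= (cmod (row_fac (row_mult v g) (Complex x y)))^2"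
  using ptm_bound_general[OF g y0] by metis
 obtain c0 where c0: "c0 > 0" "!!v. v \<in> rows ==> c0 <= norm v"
  using rows_cross_bound by metis
 show thesis
 proof (rule that[of "1 / \<kappa>^2" "2 * pi * n / h * (1 / (\<kappa> * c0^2))"])
  fix v x y assume v: "v \<in> rows" and xy: "\<bar>x\<bar> <= X" "y0 <= y"
  define j where "j = (cmod (row_fac (row_mult v g) (Complex x y)))^2"
  have nv: "norm v > 0" using c0 v by force
  have j: "\<kappa> * (norm v)^2 <= j" unfolding j_def by (rule k(2)[OF v xy])
  have "\<kappa> * c0^2 <= \<kappa> * (norm v)^2"
   using c0 v k(1) by (intro mult_left_mono power_mono) auto
  with j have j2: "\<kappa> * c0^2 <= j" by simp
  have kc: "\<kappa> * c0^2 > 0" "\<kappa> * (norm v)^2 > 0" using k c0 nv by auto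
  have jpos: "j > 0" using kc j by linarith
  have "y / j <= y / (\<kappa> * c0^2)" using xy y0 kc j2 jpos by (intro divide_left_mono) (simp_all only: mult_pos_pos)
  then have "2 * pi * n / h * (y / j) <= 2 * pi * n / h * (y / (\<kappa> * c0^2))"
   using h_pos by (intro mult_left_mono) auto
  then have e: "exp (2 * pi * n / h * (y / j)) <= exp (2 * pi * n / h * (1 / (\<kappa> * c0^2)) * y)" by simp
  have "(\<kappa> * (norm v)^2)^2 <= j^2" using j kc by (intro power_mono) auto
  then have "1 / j^2 <= 1 / (\<kappa> * (norm v)^2)^2"
   using kc jpos by (intro divide_left_mono) (simp_all only: mult_pos_pos zero_less_power zero_le_one)
  also have "(\<kappa> * (norm v)^2)^2 = \<kappa>^2 * norm v ^ 4" by (simp add: power_mult_distrib power_mult[symmetric])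
  finally have d: "1 / j^2 <= 1 / \<kappa>^2 * (1 / norm v ^ 4)" by simp
  have "cmod (ptm n g v (Complex x y)) = exp (2 * pi * n / h * (y / j)) * (1 / j^2)"
   unfolding norm_ptm[OF v g] j_def by (simp add: power_mult[symmetric])
  also have "\<dots> <= exp (2 * pi * n / h * (1 / (\<kappa> * c0^2)) * y) * (1 / \<kappa>^2 * (1 / norm v ^ 4))"
   by (intro mult_mono e d) auto
  finally show "cmod (ptm n g v (Complex x y)) <=
    exp (2 * pi * n / h * (1 / (\<kappa> * c0^2)) * y) * (1 / \<kappa>^2) * (1 / norm v ^ 4)"
   by (simp add: mult.assoc)
 qed (use k in simp)
qed

lemma ptm_abs_summable:
 assumes g: "det g = 1" and z: "Im z > 0"
 shows "(\<lambda>v. cmod (ptm n g v z)) summable_on rows"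
proof -
 obtain C1 C2 where C: "C2 > 0" "!!v x y. v \<in> rows ==> \<bar>x\<bar> <= \<bar>Re z\<bar> ==> Im z <= y ==>
   cmod (ptm n g v (Complex x y)) <= exp (C1 * y) * C2 * (1 / norm v ^ 4)"
  using ptm_bound[OF g z] by metis
 have "(\<lambda>v. exp (C1 * Im z) * C2 * (1 / norm v ^ 4)) summable_on rows"
  by (intro summable_on_cmult_right rows_summable)
 then show ?thesis
  by (rule summable_on_comparison_test) (use C(2)[of _ "Re z" "Im z"] in auto)
qed

lemma ptm_summable:
 assumes "det g = 1" "Im z > 0"
 shows "(\<lambda>v. ptm n g v z) summable_on rows"
 using abs_summable_summable[OF ptm_abs_summable[OF assms]] .

lemma infsum_ptm_bound:
 assumes "det g = 1" "Im z > 0" "A \<subseteq> rows"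
  "!!v. v \<in> A ==> cmod (ptm n g v z) <= D * (1 / norm v ^ 4)" "D \<ge> 0"
 shows "cmod (\<Sum>\<^sub>\<infinity>v\<in>A. ptm n g v z) <= D * (\<Sum>\<^sub>\<infinity>v\<in>rows. 1 / norm v ^ 4)"
proof -
 have s: "(\<lambda>v. cmod (ptm n g v z)) summable_on A"
  using ptm_abs_summable[OF assms(1,2)] assms(3) by (rule summable_on_subset_banach)
 have sA: "(\<lambda>v. 1 / norm v ^ 4) summable_on A"
  using rows_summable assms(3) by (rule summable_on_subset_banach)
 have "cmod (\<Sum>\<^sub>\<infinity>v\<in>A. ptm n g v z) <= (\<Sum>\<^sub>\<infinity>v\<in>A. cmod (ptm n g v z))"
  by (rule norm_infsum_bound) (use s in simp)
 also have "\<dots> <= (\<Sum>\<^sub>\<infinity>v\<in>A. D * (1 / norm v ^ 4))"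
  using assms(4) by (intro infsum_mono s summable_on_cmult_right sA)
 also have "\<dots> = D * (\<Sum>\<^sub>\<infinity>v\<in>A. 1 / norm v ^ 4)"
  by (rule infsum_cmult_right) (use sA in simp)
 also have "\<dots> <= D * (\<Sum>\<^sub>\<infinity>v\<in>rows. 1 / norm v ^ 4)"
  using assms(3,5) by (intro mult_left_mono infsum_mono2 sA rows_summable) auto
 finally show ?thesis .
qed

lemma poincare_moderate:
 assumes g: "det g = 1"
 shows "moderate (poincare n g)"
 unfolding moderate_def
proof (intro allI impI)
 fix X y0 :: real assume y0: "y0 > 0"
 obtain C1 C2 where C: "C2 > 0" "!!v x y. v \<in> rows ==> \<bar>x\<bar> <= X ==> y0 <= y ==>
   cmod (ptm n g v (Complex x y)) <= exp (C1 * y) * C2 * (1 / norm v ^ 4)"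
  using ptm_bound[OF g y0] by metis
 define S where "S = (\<Sum>\<^sub>\<infinity>v\<in>rows. 1 / norm v ^ 4)"
 have "cmod (poincare n g (Complex x y)) <= (C2 * S) * exp (C1 * y)" if xy: "\<bar>x\<bar> <= X" "y0 <= y" for x y
 proof -
  have "cmod (poincare n g (Complex x y)) <= exp (C1 * y) * C2 * S"
   unfolding poincare_def S_def
   by (rule infsum_ptm_bound[OF g _ order_refl C(2)[OF _ xy]]) (use C(1) xy y0 in auto)
  then show ?thesis by (simp add: mult_ac)
 qed
 then show "\<exists>C N. \<forall>x y. \<bar>x\<bar> <= X --> y0 <= y --> cmod (poincare n g (Complex x y)) <= C * exp (N * y)"
  by blast
qed

lemma holomorphic_ptm:
 assumes g: "det g = 1" and v: "v \<in> rows"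
 shows "ptm n g v holomorphic_on \<H>"
proof -
 have d: "det (pick v ** g) = 1"
  using g pick(1)[OF v] by (simp add: Determinants.det_mul)
 show ?thesis
  unfolding ptm_def[abs_def] eterm_def
  by (intro holomorphic_intros holomorphic_mobius[OF d]) (use jfac_nz[of "pick v ** g"] d in auto)
qed

lemma poincare_holomorphic:
 assumes g: "det g = 1"
 shows "poincare n g holomorphic_on \<H>"
proof -
 have "poincare n g field_differentiable (at z)" if z: "z \<in> \<H>" for z
 proof -
  \<comment> \<open>Half the height keeps the closed disc above height r, where
    \<open>ptm_bound\<close> yields one majorant for the M-test.\<close>
  define r where "r = Im z / 2"
  have r: "r > 0" using z by (simp add: r_def)
  have sub: "\<bar>Re w\<bar> <= \<bar>Re z\<bar> + r" "r <= Im w" "Im w <= Im z + r" if "w \<in> cball z r" for w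
  proof -
   have "cmod (w - z) <= r" using that by (simp add: dist_norm norm_minus_commute)
   then have "\<bar>Re (w - z)\<bar> <= r" "\<bar>Im (w - z)\<bar> <= r"
    using abs_Re_le_cmod[of "w - z"] abs_Im_le_cmod[of "w - z"] by linarith+
   moreover have "Im z = 2 * r" by (simp add: r_def)
   ultimately show "\<bar>Re w\<bar> <= \<bar>Re z\<bar> + r" "r <= Im w" "Im w <= Im z + r"
    unfolding minus_complex.sel by linarith+
  qed
  have subH: "cball z r \<subseteq> \<H>" using sub r by force
  obtain C1 C2 where C: "C2 > 0" "!!v x y. v \<in> rows ==> \<bar>x\<bar> <= \<bar>Re z\<bar> + r ==> r <= y ==>
    cmod (ptm n g v (Complex x y)) <= exp (C1 * y) * C2 * (1 / norm v ^ 4)"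
   using ptm_bound[OF g r] by metis
  have ul: "uniform_limit (cball z r) (\<lambda>F w. \<Sum>v\<in>F. ptm n g v w) (\<lambda>w. \<Sum>\<^sub>\<infinity>v\<in>rows. ptm n g v w)
    (finite_subsets_at_top rows)"
  proof (rule Weierstrass_m_test_general)
   fix v w assume v: "v \<in> rows" and w: "w \<in> cball z r"
   have "cmod (ptm n g v w) <= exp (C1 * Im w) * C2 * (1 / norm v ^ 4)"
    using C(2)[OF v sub(1,2)[OF w]] by simp
   also have "\<dots> <= exp (\<bar>C1\<bar> * (Im z + r)) * C2 * (1 / norm v ^ 4)"
   proof -
    have "C1 * Im w <= \<bar>C1\<bar> * Im w" using sub(2)[OF w] r by (intro mult_right_mono) auto
    also have "\<dots> <= \<bar>C1\<bar> * (Im z + r)" using sub(3)[OF w] by (intro mult_left_mono) auto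
    finally show ?thesis using C(1) by (intro mult_right_mono) auto
   qed
   finally show "norm (ptm n g v w) <= exp (\<bar>C1\<bar> * (Im z + r)) * C2 * (1 / norm v ^ 4)" .
  qed (intro summable_on_cmult_right rows_summable)
  have ev: "\<forall>\<^sub>F F in finite_subsets_at_top rows. continuous_on (cball z r) (\<lambda>w. \<Sum>v\<in>F. ptm n g v w) \<and>
    (\<lambda>w. \<Sum>v\<in>F. ptm n g v w) holomorphic_on ball z r"
  proof (rule eventually_finite_subsets_at_top_weakI)
   fix F assume F: "finite F" "F \<subseteq> rows"
   have "(\<lambda>w. \<Sum>v\<in>F. ptm n g v w) holomorphic_on cball z r"
    using F subH by (intro holomorphic_on_sum holomorphic_on_subset[OF holomorphic_ptm[OF g]]) auto
   then show "continuous_on (cball z r) (\<lambda>w. \<Sum>v\<in>F. ptm n g v w) \<and>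
     (\<lambda>w. \<Sum>v\<in>F. ptm n g v w) holomorphic_on ball z r"
    using holomorphic_on_imp_continuous_on holomorphic_on_subset ball_subset_cball by blast
  qed
  have "(\<lambda>w. \<Sum>\<^sub>\<infinity>v\<in>rows. ptm n g v w) holomorphic_on ball z r"
   by (rule holomorphic_uniform_limit[OF ev ul]) auto
  then show ?thesis
   using holomorphic_on_imp_differentiable_at[of "poincare n g" "ball z r" z] r by (simp add: poincare_def[abs_def])
 qed
 then show ?thesis
  by (auto simp: holomorphic_on_def intro: field_differentiable_at_within)
qed

lemma poincare_slash:
 assumes g: "det g = 1" and z: "Im z > 0"
 shows "poincare n I2 (mobius g z) = jfac g z ^ 4 * poincare n g z"
proof -
 have nz: "jfac g z ~= 0" using g z by (simp add: jfac_nz)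
 have t: "ptm n I2 v (mobius g z) = jfac g z ^ 4 * ptm n g v z" if v: "v \<in> rows" for v
  using nz g z pick(1)[OF v] by (simp add: ptm_def mobius_mult jfac_mult power_mult_distrib)
 have "poincare n I2 (mobius g z) = (\<Sum>\<^sub>\<infinity>v\<in>rows. jfac g z ^ 4 * ptm n g v z)"
  unfolding poincare_def by (rule infsum_cong) (rule t)
 also have "\<dots> = jfac g z ^ 4 * poincare n g z"
  unfolding poincare_def by (rule infsum_cmult_right) (use ptm_summable[OF g z] in simp)
 finally show ?thesis .
qed

text \<open>Right multiplication by \<gamma> permutes the bottom rows. The chosen representatives
  are permuted only up to translations, which neither the seed nor the automorphy factor
  notices.\<close>

lemma poincare_left_mult:
 assumes \<gamma>: "\<gamma> \<in> \<Gamma>" and g: "det g = 1" and z: "Im z > 0"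
 shows "poincare n (\<gamma> ** g) z = poincare n g z"
proof -
 have rm: "row_mult v a \<in> rows" if "v \<in> rows" "a \<in> \<Gamma>" for v a
  using that mult_mem[OF pick(1)[OF that(1)] that(2)] pick(2)[OF that(1)]
  by (metis image_eqI row_of_mult rows_def)
 have bij: "bij_betw (\<lambda>v. row_mult v \<gamma>) rows rows"
 proof (rule bij_betwI[of _ _ _ "\<lambda>v. row_mult v (adj2 \<gamma>)"])
  show "(\<lambda>v. row_mult v \<gamma>) \<in> rows \<rightarrow> rows" "(\<lambda>v. row_mult v (adj2 \<gamma>)) \<in> rows \<rightarrow> rows"
   using rm \<gamma> adj_mem by auto
  show "!!x. row_mult (row_mult x \<gamma>) (adj2 \<gamma>) = x" "!!x. row_mult (row_mult x (adj2 \<gamma>)) \<gamma> = x"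
   using \<gamma> by (simp_all add: row_mult_mult[symmetric] adj2_inverse)
 qed
 have "ptm n (\<gamma> ** g) v z = ptm n g (row_mult v \<gamma>) z" if v: "v \<in> rows" for v
 proof -
  have a: "pick v ** \<gamma> \<in> \<Gamma>" by (intro mult_mem pick v \<gamma>)
  have b: "pick (row_mult v \<gamma>) \<in> \<Gamma>" by (intro pick rm v \<gamma>)
  have "(pick v ** \<gamma>)$2 = pick (row_mult v \<gamma>) $ 2"
   using v \<gamma> by (simp add: row_of_mult pick rm)
  then obtain k where k: "pick v ** \<gamma> = tr k ** pick (row_mult v \<gamma>)"
   using same_row[OF a b] by blast
  have e: "pick v ** (\<gamma> ** g) = tr k ** (pick (row_mult v \<gamma>) ** g)"
   using k by (simp add: matrix_mul_assoc)
  have d: "det (pick (row_mult v \<gamma>) ** g) = 1"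
   using b g by (simp add: Determinants.det_mul)
  have "mobius (pick v ** (\<gamma> ** g)) z = mobius (pick (row_mult v \<gamma>) ** g) z + of_int k * of_real h"
   unfolding e using mobius_mult[OF det_tr d z] by (simp add: mobius_eq[of "tr k"] jfac_def)
  moreover have "jfac (pick v ** (\<gamma> ** g)) z = jfac (pick (row_mult v \<gamma>) ** g) z"
   unfolding e using jfac_mult[of "pick (row_mult v \<gamma>) ** g" z "tr k"] d z by (simp add: jfac_def[of "tr k"])
  ultimately show ?thesis by (simp add: ptm_def eterm_shift)
 qed
 then have "poincare n (\<gamma> ** g) z = (\<Sum>\<^sub>\<infinity>v\<in>rows. ptm n g (row_mult v \<gamma>) z)"
  unfolding poincare_def by (rule infsum_cong)
 also have "\<dots> = poincare n g z"
  unfolding poincare_def by (rule infsum_reindex_bij_betw[OF bij])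
 finally show ?thesis .
qed

text \<open>If the lower left entries stay away from 0, image points have height at most y / (c1
  y)^2, which is at most 1 / c1^2 for y at least 1. The exponential seed is then bounded and these
  terms do not grow.\<close>

lemma ptm_infsum_bounded:
 assumes g: "det g = 1" and A: "A \<subseteq> rows" and c1: "c1 > 0"
  "!!v. v \<in> A ==> c1 <= \<bar>row_mult v g $ 1\<bar>"
 obtains C where "!!x y. \<bar>x\<bar> <= X ==> 1 <= y ==> cmod (\<Sum>\<^sub>\<infinity>v\<in>A. ptm n g v (Complex x y)) <= C"
proof -
 obtain \<kappa> where k: "\<kappa> > 0" "!!v x y. v \<in> rows ==> \<bar>x\<bar> <= X ==> 1 <= y ==>
   \<kappa> * (norm v)^2 <= (cmod (row_fac (row_mult v g) (Complex x y)))^2"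
  by (rule ptm_bound_general[OF g, of 1 X]) auto
 obtain c0 where c0: "c0 > 0" "!!v. v \<in> rows ==> c0 <= norm v"
  using rows_cross_bound by metis
 define D where "D = exp (2 * pi * n / h * (1 / c1^2)) * (1 / \<kappa>^2)"
 show thesis
 proof (rule that[of "D * (\<Sum>\<^sub>\<infinity>v\<in>rows. 1 / norm v ^ 4)"])
  fix x y :: real assume xy: "\<bar>x\<bar> <= X" "1 <= y"
  show "cmod (\<Sum>\<^sub>\<infinity>v\<in>A. ptm n g v (Complex x y)) <= D * (\<Sum>\<^sub>\<infinity>v\<in>rows. 1 / norm v ^ 4)"
  proof (rule infsum_ptm_bound[OF g _ A])
   fix v assume vA: "v \<in> A"
   then have v: "v \<in> rows" using A by blast
   define j where "j = (cmod (row_fac (row_mult v g) (Complex x y)))^2"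
   have nv: "norm v > 0" using c0 v by force
   have j: "\<kappa> * (norm v)^2 <= j" unfolding j_def by (rule k(2)[OF v xy])
   have kc: "\<kappa> * (norm v)^2 > 0" using k nv by auto
   have jpos: "j > 0" using kc j by linarith
   have "c1^2 * y <= (row_mult v g $ 1)^2 * y^2"
   proof (rule mult_mono)
    show "c1^2 <= (row_mult v g $ 1)^2"
     using c1(2)[OF vA] c1(1) by (metis abs_le_square_iff abs_of_pos)
    show "y <= y^2" using xy by (simp add: power2_eq_square)
   qed (use xy in auto)
   also have "\<dots> = (Im (row_fac (row_mult v g) (Complex x y)))^2"
    by (simp add: row_fac_def power_mult_distrib)
   also have "\<dots> <= j" unfolding j_def cmod_power2 by simp
   finally have "y / j <= 1 / c1^2" using jpos c1(1) by (simp add: field_simps)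
   then have "2 * pi * n / h * (y / j) <= 2 * pi * n / h * (1 / c1^2)"
    using h_pos by (intro mult_left_mono) auto
   then have e: "exp (2 * pi * n / h * (y / j)) <= exp (2 * pi * n / h * (1 / c1^2))" by simp
   have "(\<kappa> * (norm v)^2)^2 <= j^2" using j kc by (intro power_mono) auto
   then have "1 / j^2 <= 1 / (\<kappa> * (norm v)^2)^2"
    using kc jpos by (intro divide_left_mono) (simp_all only: mult_pos_pos zero_less_power zero_le_one)
   also have "(\<kappa> * (norm v)^2)^2 = \<kappa>^2 * norm v ^ 4" by (simp add: power_mult_distrib power_mult[symmetric])
   finally have d: "1 / j^2 <= 1 / \<kappa>^2 * (1 / norm v ^ 4)" by simp
   have "cmod (ptm n g v (Complex x y)) = exp (2 * pi * n / h * (y / j)) * (1 / j^2)"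
    unfolding norm_ptm[OF v g] j_def by (simp add: power_mult[symmetric])
   also have "\<dots> <= exp (2 * pi * n / h * (1 / c1^2)) * (1 / \<kappa>^2 * (1 / norm v ^ 4))"
    by (intro mult_mono e d) auto
   finally show "cmod (ptm n g v (Complex x y)) <= D * (1 / norm v ^ 4)"
    by (simp add: D_def mult.assoc)
  qed (use xy k in \<open>auto simp: D_def\<close>)
 qed
qed

text \<open>Exactly the rows (0, 1) and (0, -1) belong to elements fixing infinity. Both contribute
  the seed itself, hence the factor 2; all other rows fall under the bounded case.\<close>

lemma poincare_at_infinity:
 obtains C where "!!x y. \<bar>x\<bar> <= X ==> 1 <= y ==>
  cmod (poincare n I2 (Complex x y) - 2 * eterm n (Complex x y)) <= C"
proof -
 obtain c0 where c0: "c0 > 0" "!!g. g \<in> \<Gamma> ==> g$2$1 ~= 0 ==> c0 <= \<bar>g$2$1\<bar>"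
  using lower_left_bound by blast
 define A where "A = {v \<in> rows. v$1 ~= 0}"
 define B where "B = {v \<in> rows. v$1 = 0}"
 define e2 where "e2 = (vector [0, 1] :: real^2)"
 have e2: "e2$1 = 0" "e2$2 = 1" by (simp_all add: e2_def)
 have B: "B = {e2, - e2}"
 proof
  show "B \<subseteq> {e2, - e2}"
  proof
   fix v assume "v \<in> B"
   then obtain g where g: "g \<in> \<Gamma>" "v = g$2" "g$2$1 = 0" by (auto simp: B_def rows_def)
   then obtain k where "g = tr k \<or> g = - tr k" using stab_infinity[OF g(1)] by (auto simp: tr_def)
   then show "v \<in> {e2, - e2}" using g(2) e2 by (auto simp: vec2_eq_iff)
  qed
  have "I2$2 = e2" "(- I2)$2 = - e2" using e2 by (auto simp: vec2_eq_iff)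
  then have "e2 \<in> rows" "- e2 \<in> rows" using one_mem neg_one_mem unfolding rows_def by (metis image_eqI)+
  then show "{e2, - e2} \<subseteq> B" using e2 by (auto simp: B_def)
 qed
 obtain C where C: "!!x y. \<bar>x\<bar> <= X ==> 1 <= y ==> cmod (\<Sum>\<^sub>\<infinity>v\<in>A. ptm n I2 v (Complex x y)) <= C"
 proof (rule ptm_infsum_bounded[of I2 A c0 X n])
  show "c0 <= \<bar>row_mult v I2 $ 1\<bar>" if "v \<in> A" for v
   using that c0(2) by (auto simp: A_def rows_def)
 qed (use c0 in \<open>auto simp: A_def\<close>)
 show thesis
 proof (rule that[of C])
  fix x y :: real assume xy: "\<bar>x\<bar> <= X" "1 <= y"
  let ?z = "Complex x y"
  have s: "(\<lambda>v. ptm n I2 v ?z) summable_on rows" by (rule ptm_summable) (use xy in auto)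
  have AB: "rows = A \<union> B" "A \<inter> B = {}" by (auto simp: A_def B_def)
  have t: "ptm n I2 v ?z = eterm n ?z" if v: "v \<in> B" for v
  proof -
   have vr: "v \<in> rows" "v$1 = 0" using v by (auto simp: B_def)
   have "pick v $ 2 $ 1 = 0" using pick(2)[OF vr(1)] vr(2) by simp
   then obtain k where k: "pick v = tr k \<or> pick v = - tr k"
    using stab_infinity[OF pick(1)[OF vr(1)]] by (auto simp: tr_def)
   have "mobius (pick v) ?z = ?z + of_int k * of_real h"
    using k by (auto simp: mobius_eq[of "tr k"] jfac_def)
   moreover have "jfac (pick v) ?z ^ 4 = 1" using k by (auto simp: jfac_def)
   ultimately show ?thesis by (simp add: ptm_def eterm_shift)
  qed
  have "poincare n I2 ?z = (\<Sum>\<^sub>\<infinity>v\<in>A. ptm n I2 v ?z) + (\<Sum>\<^sub>\<infinity>v\<in>B. ptm n I2 v ?z)"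
   unfolding poincare_def AB(1) using s AB
   by (intro infsum_Un_disjoint) (auto intro: summable_on_subset_banach)
  also have "(\<Sum>\<^sub>\<infinity>v\<in>B. ptm n I2 v ?z) = (\<Sum>v\<in>B. ptm n I2 v ?z)" using B by simp
  also have "\<dots> = (\<Sum>v\<in>B. eterm n ?z)" using t by (intro sum.cong) auto
  also have "\<dots> = 2 * eterm n ?z"
  proof -
   have "e2 ~= - e2" using e2 by (auto simp: vec2_eq_iff)
   then show ?thesis by (simp add: B)
  qed
  finally show "cmod (poincare n I2 ?z - 2 * eterm n ?z) <= C" using C[OF xy] by simp
 qed
qed

end

section \<open>Closure properties of moderate growth\<close>

lemma moderateI:
 assumes "!!X y0. y0 > 0 ==> \<exists>C N. \<forall>x y. \<bar>x\<bar> <= X --> y0 <= y --> cmod (F (Complex x y)) <= C * exp (N * y)"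
 shows "moderate F"
 using assms unfolding moderate_def by blast

lemma moderateE:
 assumes "moderate F" "y0 > 0"
 obtains C N where "C \<ge> 0" "N \<ge> 0"
  "!!x y. \<bar>x\<bar> <= X ==> y0 <= y ==> cmod (F (Complex x y)) <= C * exp (N * y)"
proof -
 obtain C N where CN: "!!x y. \<bar>x\<bar> <= X ==> y0 <= y ==> cmod (F (Complex x y)) <= C * exp (N * y)"
  using assms unfolding moderate_def by blast
 show thesis
 proof (rule that[of "\<bar>C\<bar>" "\<bar>N\<bar>"])
  fix x y assume xy: "\<bar>x\<bar> <= X" "y0 <= y"
  have "C * exp (N * y) <= \<bar>C\<bar> * exp (\<bar>N\<bar> * y)"
   using xy assms(2) by (intro mult_mono) (auto intro: mult_right_mono)
  with CN[OF xy] show "cmod (F (Complex x y)) <= \<bar>C\<bar> * exp (\<bar>N\<bar> * y)" by simp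
 qed auto
qed

lemma moderate_cong:
 assumes "moderate F" "!!z. Im z > 0 ==> G z = F z"
 shows "moderate G"
proof (rule moderateI)
 fix X y0 :: real assume y0: "y0 > 0"
 obtain C N where "!!x y. \<bar>x\<bar> <= X ==> y0 <= y ==> cmod (F (Complex x y)) <= C * exp (N * y)"
  using moderateE[OF assms(1) y0] by metis
 then show "\<exists>C N. \<forall>x y. \<bar>x\<bar> <= X --> y0 <= y --> cmod (G (Complex x y)) <= C * exp (N * y)"
  using assms(2) y0 by (intro exI[of _ C] exI[of _ N]) auto
qed

lemma moderate_mult:
 assumes "moderate F" "moderate G"
 shows "moderate (\<lambda>z. F z * G z)"
proof (rule moderateI)
 fix X y0 :: real assume y0: "y0 > 0"
 obtain C N where F: "C \<ge> 0" "!!x y. \<bar>x\<bar> <= X ==> y0 <= y ==> cmod (F (Complex x y)) <= C * exp (N * y)"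
  using moderateE[OF assms(1) y0] by metis
 obtain C' N' where G: "C' \<ge> 0" "!!x y. \<bar>x\<bar> <= X ==> y0 <= y ==> cmod (G (Complex x y)) <= C' * exp (N' * y)"
  using moderateE[OF assms(2) y0] by metis
 have "cmod (F (Complex x y) * G (Complex x y)) <= (C * C') * exp ((N + N') * y)" if "\<bar>x\<bar> <= X" "y0 <= y" for x y
 proof -
  have "cmod (F (Complex x y) * G (Complex x y)) <= (C * exp (N * y)) * (C' * exp (N' * y))"
   unfolding norm_mult using F G that by (intro mult_mono) auto
  then show ?thesis by (simp add: algebra_simps exp_add)
 qed
 then show "\<exists>C N. \<forall>x y. \<bar>x\<bar> <= X --> y0 <= y --> cmod (F (Complex x y) * G (Complex x y)) <= C * exp (N * y)"
  by blast
qed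

lemma moderate_add:
 assumes "moderate F" "moderate G"
 shows "moderate (\<lambda>z. F z + G z)"
proof (rule moderateI)
 fix X y0 :: real assume y0: "y0 > 0"
 obtain C N where F: "C \<ge> 0" "N \<ge> 0" "!!x y. \<bar>x\<bar> <= X ==> y0 <= y ==> cmod (F (Complex x y)) <= C * exp (N * y)"
  using moderateE[OF assms(1) y0] by metis
 obtain C' N' where G: "C' \<ge> 0" "N' \<ge> 0" "!!x y. \<bar>x\<bar> <= X ==> y0 <= y ==> cmod (G (Complex x y)) <= C' * exp (N' * y)"
  using moderateE[OF assms(2) y0] by metis
 have "cmod (F (Complex x y) + G (Complex x y)) <= (C + C') * exp ((N + N') * y)" if xy: "\<bar>x\<bar> <= X" "y0 <= y" for x y
 proof -
  have "N * y <= (N + N') * y" "N' * y <= (N + N') * y"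
   using F G xy y0 by (auto intro!: mult_right_mono)
  then have "C * exp (N * y) + C' * exp (N' * y) <= C * exp ((N + N') * y) + C' * exp ((N + N') * y)"
   using F G by (intro add_mono mult_left_mono) auto
  moreover have "cmod (F (Complex x y) + G (Complex x y)) <= C * exp (N * y) + C' * exp (N' * y)"
   using norm_triangle_ineq[of "F (Complex x y)" "G (Complex x y)"] F(3)[OF xy] G(3)[OF xy] by linarith
  ultimately show ?thesis by (simp add: algebra_simps)
 qed
 then show "\<exists>C N. \<forall>x y. \<bar>x\<bar> <= X --> y0 <= y --> cmod (F (Complex x y) + G (Complex x y)) <= C * exp (N * y)"
  by blast
qed

lemma moderate_const: "moderate (\<lambda>z. c)"
 by (intro moderateI exI[of _ "cmod c"] exI[of _ 0]) auto

lemma moderate_sum: "(!!i. i \<in> I ==> moderate (F i)) ==> moderate (\<lambda>z. \<Sum>i\<in>I. F i z)"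
 by (induction I rule: infinite_finite_induct) (auto intro: moderate_const moderate_add)

lemma moderate_prod: "(!!i. i \<in> I ==> moderate (F i)) ==> moderate (\<lambda>z. \<Prod>i\<in>I. F i z)"
 by (induction I rule: infinite_finite_induct) (auto intro: moderate_const moderate_mult)

lemma moderate_uminus: "moderate F ==> moderate (\<lambda>z. - F z)"
 using moderate_mult[OF moderate_const[of "-1"], of F] by simp

lemma moderate_diff: "moderate F ==> moderate G ==> moderate (\<lambda>z. F z - G z)"
 using moderate_add[OF _ moderate_uminus, of F G] by simp

lemma moderate_power: "moderate F ==> moderate (\<lambda>z. F z ^ n)"
 by (induction n) (auto intro: moderate_const moderate_mult)

lemma moderate_ident: "moderate (\<lambda>z. z)"
proof (rule moderateI)
 fix X y0 :: real assume y0: "y0 > 0"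
 have "cmod (Complex x y) <= (\<bar>X\<bar> + 1) * exp (1 * y)" if xy: "\<bar>x\<bar> <= X" "y0 <= y" for x y
 proof -
  have y: "y <= exp y" "1 <= exp y" using exp_ge_add_one_self[of y] xy y0 by linarith+
  have "cmod (Complex x y) <= \<bar>x\<bar> + \<bar>y\<bar>" using cmod_le[of "Complex x y"] by simp
  also have "\<dots> <= \<bar>X\<bar> * exp y + 1 * exp y"
  proof (rule add_mono)
   have "\<bar>x\<bar> <= \<bar>X\<bar> * 1" using xy by simp
   also have "\<dots> <= \<bar>X\<bar> * exp y" using y by (intro mult_left_mono) auto
   finally show "\<bar>x\<bar> <= \<bar>X\<bar> * exp y" .
  qed (use xy y y0 in auto)
  finally show ?thesis by (simp add: algebra_simps)
 qed
 then show "\<exists>C N. \<forall>x y. \<bar>x\<bar> <= X --> y0 <= y --> cmod (Complex x y) <= C * exp (N * y)" by blast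
qed

lemma moderate_inverse_ident: "moderate (\<lambda>z. inverse z)"
proof (rule moderateI)
 fix X y0 :: real assume y0: "y0 > 0"
 have "cmod (inverse (Complex x y)) <= (1 / y0) * exp (0 * y)" if xy: "\<bar>x\<bar> <= X" "y0 <= y" for x y
 proof -
  have "y0 <= cmod (Complex x y)" using abs_Im_le_cmod[of "Complex x y"] xy by simp
  then show ?thesis using y0 by (simp add: norm_inverse divide_inverse le_imp_inverse_le)
 qed
 then show "\<exists>C N. \<forall>x y. \<bar>x\<bar> <= X --> y0 <= y --> cmod (inverse (Complex x y)) <= C * exp (N * y)" by blast
qed

lemma moderate_exp_bounded: "moderate (\<lambda>z. exp (c * z))"
proof (rule moderateI)
 fix X y0 :: real assume y0: "y0 > 0"
 have "cmod (exp (c * Complex x y)) <= exp (\<bar>Re c\<bar> * \<bar>X\<bar>) * exp (\<bar>Im c\<bar> * y)" if xy: "\<bar>x\<bar> <= X" "y0 <= y" for x y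
 proof -
  have "Re c * x <= \<bar>Re c * x\<bar>" "- Im c * y <= \<bar>Im c * y\<bar>" by auto
  then have "Re (c * Complex x y) <= \<bar>Re c\<bar> * \<bar>x\<bar> + \<bar>Im c\<bar> * \<bar>y\<bar>" by (simp add: abs_mult)
  also have "\<dots> <= \<bar>Re c\<bar> * \<bar>X\<bar> + \<bar>Im c\<bar> * y"
   using xy y0 by (intro add_mono mult_left_mono) auto
  finally show ?thesis by (simp add: norm_exp_eq_Re exp_add[symmetric])
 qed
 then show "\<exists>C N. \<forall>x y. \<bar>x\<bar> <= X --> y0 <= y --> cmod (exp (c * Complex x y)) <= C * exp (N * y)" by blast
qed

lemma moderate_affine:
 assumes "moderate F" "a > 0"
 shows "moderate (\<lambda>z. F (of_real a * z + of_real b))"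
proof (rule moderateI)
 fix X y0 :: real assume y0: "y0 > 0"
 have ay: "a * y0 > 0" using assms(2) y0 by simp
 obtain C N where F: "!!x y. \<bar>x\<bar> <= a * X + \<bar>b\<bar> ==> a * y0 <= y ==> cmod (F (Complex x y)) <= C * exp (N * y)"
  using moderateE[OF assms(1) ay, of "a * X + \<bar>b\<bar>"] by metis
 have "cmod (F (of_real a * Complex x y + of_real b)) <= C * exp ((N * a) * y)" if xy: "\<bar>x\<bar> <= X" "y0 <= y" for x y
 proof -
  have e: "of_real a * Complex x y + of_real b = Complex (a * x + b) (a * y)" by (simp add: complex_eq_iff)
  have "\<bar>a * x + b\<bar> <= a * \<bar>x\<bar> + \<bar>b\<bar>" using assms(2) abs_triangle_ineq[of "a * x" b] by (simp add: abs_mult)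
  also have "\<dots> <= a * X + \<bar>b\<bar>" using xy assms(2) by simp
  finally show ?thesis unfolding e using F[of "a * x + b" "a * y"] xy assms(2) by (simp add: mult.assoc)
 qed
 then show "\<exists>C N. \<forall>x y. \<bar>x\<bar> <= X --> y0 <= y -->
   cmod (F (of_real a * Complex x y + of_real b)) <= C * exp (N * y)" by blast
qed

text \<open>Between the heights \<open>y0\<close> and Y the strip is a compact rectangle, where
  continuity suffices.\<close>

lemma moderate_if_eventually:
 assumes F: "continuous_on \<H> F" and ev: "!!X. \<exists>Y C N. \<forall>x y. \<bar>x\<bar> <= X --> Y <= y --> cmod (F (Complex x y)) <= C * exp (N * y)"
 shows "moderate F"
proof (rule moderateI)
 fix X y0 :: real assume y0: "y0 > 0"
 obtain Y C N where ev: "!!x y. \<bar>x\<bar> <= X ==> Y <= y ==> cmod (F (Complex x y)) <= C * exp (N * y)"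
  using ev[of X] by blast
 have "cbox (Complex (-X) y0) (Complex X Y) \<subseteq> \<H>" using y0 by (auto simp: in_cbox_complex_iff)
 then have "compact (F ` cbox (Complex (-X) y0) (Complex X Y))"
  by (intro compact_continuous_image continuous_on_subset[OF F] compact_cbox)
 then obtain B where B: "!!z. z \<in> cbox (Complex (-X) y0) (Complex X Y) ==> cmod (F z) <= B"
  by (meson bounded_iff compact_imp_bounded imageI)
 have "cmod (F (Complex x y)) <= (\<bar>C\<bar> + \<bar>B\<bar>) * exp (\<bar>N\<bar> * y)" if xy: "\<bar>x\<bar> <= X" "y0 <= y" for x y
 proof -
  have e: "1 <= exp (\<bar>N\<bar> * y)" using xy y0 by simp
  show ?thesis
  proof (cases "Y <= y")
   case True
   have "C * exp (N * y) <= \<bar>C\<bar> * exp (\<bar>N\<bar> * y)"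
    using xy y0 by (intro mult_mono) (auto intro: mult_right_mono)
   also have "\<dots> <= (\<bar>C\<bar> + \<bar>B\<bar>) * exp (\<bar>N\<bar> * y)" by (intro mult_right_mono) auto
   finally show ?thesis using ev[OF xy(1) True] by linarith
  next
   case False
   then have "cmod (F (Complex x y)) <= B" using xy by (intro B) (auto simp: in_cbox_complex_iff)
   also have "\<dots> <= (\<bar>C\<bar> + \<bar>B\<bar>) * 1" by simp
   also have "\<dots> <= (\<bar>C\<bar> + \<bar>B\<bar>) * exp (\<bar>N\<bar> * y)" using e by (intro mult_left_mono) auto
   finally show ?thesis .
  qed
 qed
 then show "\<exists>C N. \<forall>x y. \<bar>x\<bar> <= X --> y0 <= y --> cmod (F (Complex x y)) <= C * exp (N * y)" by blast
qed

section \<open>Expansions of periodic functions\<close>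

lemma periodic_int:
 assumes "!!z. Im z > 0 ==> F (z + of_real h) = F z" "Im z > 0"
 shows "F (z + of_int n * of_real h) = F z"
proof -
 have nat: "F (z + of_nat k * of_real h) = F z" if "Im z > 0" for k z
 proof (induction k)
  case (Suc k)
  have "F (z + of_nat (Suc k) * of_real h) = F ((z + of_nat k * of_real h) + of_real h)"
   by (simp add: algebra_simps)
  also have "\<dots> = F (z + of_nat k * of_real h)" using that by (intro assms(1)) simp
  finally show ?case using Suc by simp
 qed simp
 show ?thesis
 proof (cases "n \<ge> 0")
  case True
  then show ?thesis using nat[OF assms(2), of "nat n"] by simp
 next
  case False
  then show ?thesis using nat[of "z + of_int n * of_real h" "nat (- n)"] assms(2) by simp
 qed
qed

text \<open>The local parameter q at a cusp of width h.\<close>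

definition nome :: "real => complex => complex" where
 "nome h z = exp (2 * of_real pi * \<i> * z / of_real h)"

lemma nome_nz [simp]: "nome h z ~= 0"
 by (simp add: nome_def)

lemma norm_nome: "cmod (nome h z) = exp (- (2 * pi / h * Im z))"
 by (simp add: nome_def norm_exp_eq_Re)

lemma norm_nome_less: "h > 0 ==> Im z > 0 ==> cmod (nome h z) < 1"
 by (simp add: norm_nome)

lemma nome_eq_imp:
 assumes "h > 0" "nome h z = nome h w"
 obtains n :: int where "z = w + of_int n * of_real h"
proof -
 obtain n where "2 * of_real pi * \<i> * z / of_real h = 2 * of_real pi * \<i> * w / of_real h + of_real (of_int (2 * n) * pi) * \<i>"
  using assms(2) unfolding nome_def exp_eq by blast
 then have "(2 * of_real pi * \<i>) * z = (2 * of_real pi * \<i>) * (w + of_int n * of_real h)"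
  using assms(1) by (simp add: field_simps)
 then have "z = w + of_int n * of_real h" by (subst (asm) mult_cancel_left) simp
 then show thesis by (rule that)
qed

lemma nome_inverse:
 assumes "h > 0" "q ~= 0"
 shows "nome h (of_real h * Ln q / (2 * of_real pi * \<i>)) = q"
  "Im (of_real h * Ln q / (2 * of_real pi * \<i>)) = - (h * ln (cmod q) / (2 * pi))"
  "Re (of_real h * Ln q / (2 * of_real pi * \<i>)) = h * Arg q / (2 * pi)"
proof -
 show "nome h (of_real h * Ln q / (2 * of_real pi * \<i>)) = q"
  using assms by (simp add: nome_def)
 have e: "of_real h * Ln q / (2 * of_real pi * \<i>) = - \<i> * of_real (h / (2 * pi)) * Ln q"
  by (simp add: field_simps)
 show "Im (of_real h * Ln q / (2 * of_real pi * \<i>)) = - (h * ln (cmod q) / (2 * pi))"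
  "Re (of_real h * Ln q / (2 * of_real pi * \<i>)) = h * Arg q / (2 * pi)"
  unfolding e using assms by (simp_all add: Re_Ln Arg_eq_Im_Ln)
qed

text \<open>F descends to a holomorphic function on the punctured disc. Moderate growth bounds it
  near 0 by a negative power of |q|, and after multiplication by a power of q the singularity is
  removable.\<close>

lemma periodic_factors_nome:
 assumes h: "h > 0" and F: "F holomorphic_on \<H>" and per: "!!z. Im z > 0 ==> F (z + of_real h) = F z"
  and mod: "moderate F"
 obtains M :: nat and \<Phi> where "\<Phi> holomorphic_on ball 0 1"
  "!!z. Im z > 0 ==> nome h z ^ M * F z = \<Phi> (nome h z)"
proof -
 \<comment> \<open>A section of \<open>nome\<close> that jumps along the branch cut of
   \<open>Ln\<close>; periodicity of F hides the jump.\<close>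
 define L where "L q = of_real h * Ln q / (2 * of_real pi * \<i>)" for q
 have L: "nome h (L q) = q" "Im (L q) > 0" if "q \<in> ball 0 1 - {0}" for q
  using nome_inverse[OF h, of q] that h by (auto simp: L_def mult_pos_neg divide_neg_pos)
 have same: "F z = F w" if same_nome: "nome h z = nome h w" "Im z > 0" "Im w > 0" for z w
 proof -
  obtain n where "z = w + of_int n * of_real h" using nome_eq_imp[OF h same_nome(1)] by blast
  then show ?thesis using periodic_int[of F h w n] per same_nome(3) by simp
 qed
 \<comment> \<open>For |q| < 1/2 the point \<open>L q\<close> has height at least h ln 2 / (2 pi)
   and real part of absolute value at most h.\<close>
 obtain C N where CN: "C \<ge> 0" "N \<ge> 0" "!!x y. \<bar>x\<bar> <= h ==> h * ln 2 / (2 * pi) <= y ==> cmod (F (Complex x y)) <= C * exp (N * y)"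
  using moderateE[OF mod, of "h * ln 2 / (2 * pi)" h] h by (metis divide_pos_pos ln_gt_zero mult_pos_pos one_less_numeral_iff pi_gt_zero semiring_norm(76) zero_less_numeral)
 \<comment> \<open>At height y one has exp (N y) = |q|^(- N h / (2 pi)).\<close>
 define M where "M = nat \<lceil>N * h / (2 * pi)\<rceil>"
 define f where "f q = q ^ M * F (L q)" for q
 have hol: "f holomorphic_on ball 0 1 - {0}"
 proof -
  have "f field_differentiable (at q)" if q: "q \<in> ball 0 1 - {0}" for q
  proof -
   \<comment> \<open>Near q the logarithm is recentred: \<open>Ln (w / q)\<close> is holomorphic
     around w = q even when q lies on the cut, and adding \<open>L q\<close> gives a local
     holomorphic section of \<open>nome\<close>.\<close>
   define A where "A = {w. w / q \<notin> \<real>\<^sub>\<le>\<^sub>0} \<inter> (ball 0 1 - {0})"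
   define z where "z w = of_real h * Ln (w / q) / (2 * of_real pi * \<i>) + L q" for w
   have q0: "q ~= 0" using q by auto
   have "open {w. w / q \<notin> \<real>\<^sub>\<le>\<^sub>0}"
   proof -
    have "open ((\<lambda>w. w / q) -` (- \<real>\<^sub>\<le>\<^sub>0))"
     using q0 by (intro open_vimage) (auto intro!: continuous_intros closed_nonpos_Reals_complex simp: open_closed)
    then show ?thesis by (simp add: vimage_def)
   qed
   then have A: "open A" unfolding A_def by (intro open_Int) auto
   have zz: "nome h (z w) = w" if "w \<in> A" for w
   proof -
    have "nome h (z w) = nome h (of_real h * Ln (w / q) / (2 * of_real pi * \<i>)) * nome h (L q)"
     by (simp add: nome_def z_def exp_add[symmetric] add_divide_distrib ring_distribs)
    also have "\<dots> = w" using nome_inverse(1)[OF h, of "w / q"] L(1)[OF q] that q0 by (auto simp: A_def)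
    finally show ?thesis .
   qed
   have zim: "Im (z w) > 0" if "w \<in> A" for w
   proof -
    have "exp (- (2 * pi / h * Im (z w))) < 1"
     using norm_nome[of h "z w"] zz[OF that] that by (auto simp: A_def)
    then have "0 < 2 * pi / h * Im (z w)" by simp
    moreover have "2 * pi / h > 0" using h by simp
    ultimately show ?thesis using zero_less_mult_pos by blast
   qed
   have "f w = w ^ M * F (z w)" if "w \<in> A" for w
    unfolding f_def using same[of "L w" "z w"] zz[OF that] zim[OF that] L[of w] that by (auto simp: A_def)
   moreover have "(\<lambda>w. w ^ M * F (z w)) holomorphic_on A"
   proof (intro holomorphic_intros)
    have "z holomorphic_on A" unfolding z_def using q0 by (intro holomorphic_intros) (auto simp: A_def)
    then show "(\<lambda>w. F (z w)) holomorphic_on A"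
     using holomorphic_on_compose_gen[OF _ F, of z A] zim by (auto simp: o_def image_subset_iff)
   qed
   ultimately have "f holomorphic_on A" using holomorphic_cong[of A A f] by simp
   moreover have "q \<in> A" using q q0 by (auto simp: A_def)
   ultimately show ?thesis using A holomorphic_on_imp_differentiable_at by blast
  qed
  then show ?thesis by (auto simp: holomorphic_on_def intro: field_differentiable_at_within)
 qed
 have bd: "cmod (f q) <= C" if q: "q ~= 0" "cmod q < 1/2" for q
 proof -
  have im: "Im (L q) = - (h * ln (cmod q) / (2 * pi))" "Re (L q) = h * Arg q / (2 * pi)"
   using nome_inverse[OF h q(1)] by (simp_all add: L_def)
  have "\<bar>Arg q\<bar> <= pi" using mpi_less_Arg[of q] Arg_le_pi[of q] by linarith
  then have "h * \<bar>Arg q\<bar> <= h * (2 * pi)" using h by (intro mult_left_mono) auto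
  then have re: "\<bar>Re (L q)\<bar> <= h" unfolding im using h by (simp add: abs_mult divide_le_eq)
  have "ln (cmod q) <= ln (1/2)" using q by (subst ln_le_cancel_iff) auto
  then have "h * ln 2 <= - (h * ln (cmod q))"
   using h mult_left_mono[of "ln 2" "- ln (cmod q)" h] by (simp add: ln_div)
  then have "h * ln 2 / (2 * pi) <= - (h * ln (cmod q)) / (2 * pi)" by (rule divide_right_mono) simp
  then have imge: "h * ln 2 / (2 * pi) <= Im (L q)" unfolding im by simp
  have F1: "cmod (F (L q)) <= C * exp (N * Im (L q))"
   using CN(3)[OF re imge] by simp
  have "exp (N * Im (L q)) = exp (- (N * h / (2 * pi)) * ln (cmod q))" by (simp add: im field_simps)
  also have "\<dots> <= exp (- real M * ln (cmod q))"
  proof -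
   have "N * h / (2 * pi) <= real M" unfolding M_def by linarith
   moreover have "ln (cmod q) <= 0" using q by simp
   ultimately have "real M * ln (cmod q) <= N * h / (2 * pi) * ln (cmod q)" by (rule mult_right_mono_neg)
   then show ?thesis by simp
  qed
  also have "\<dots> = inverse (cmod q ^ M)"
   using q by (simp add: exp_minus exp_of_nat_mult)
  finally have "cmod (F (L q)) <= C * inverse (cmod q ^ M)"
   using F1 CN(1) by (meson mult_left_mono order_trans)
  then have "cmod q ^ M * cmod (F (L q)) <= cmod q ^ M * (C * inverse (cmod q ^ M))"
   by (rule mult_left_mono) simp
  also have "\<dots> = C" using q by (simp add: field_simps)
  finally show ?thesis by (simp add: f_def norm_mult norm_power)
 qed
 have "\<forall>\<^sub>F q in at 0. cmod (f q) <= C"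
  unfolding eventually_at using bd by (intro exI[of _ "1/2"]) auto
 then obtain \<Phi> where \<Phi>: "\<Phi> holomorphic_on ball 0 1" "!!q. q \<in> ball 0 1 - {0} ==> \<Phi> q = f q"
  using holomorphic_on_extend_bounded[OF hol] by auto
 show thesis
 proof (rule that[OF \<Phi>(1)])
  fix z assume z: "Im z > 0"
  have nq: "nome h z \<in> ball 0 1 - {0}" using norm_nome_less[OF h z] by simp
  show "nome h z ^ M * F z = \<Phi> (nome h z)"
   unfolding \<Phi>(2)[OF nq] f_def using same[of "L (nome h z)" z] L[OF nq] z by simp
 qed
qed

lemma periodic_lower_bound:
 assumes h: "h > 0" and F: "F holomorphic_on \<H>" and per: "!!z. Im z > 0 ==> F (z + of_real h) = F z"
  and mod: "moderate F" and nz: "Im z0 > 0" "F z0 ~= 0"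
 obtains c a Y where "c > 0" "Y > 0" "a \<ge> 0" "!!z. Im z \<ge> Y ==> c * exp (- (a * Im z)) <= cmod (F z)"
proof -
 obtain M \<Phi> where \<Phi>: "\<Phi> holomorphic_on ball 0 1" "!!z. Im z > 0 ==> nome h z ^ M * F z = \<Phi> (nome h z)"
 proof (rule periodic_factors_nome[OF h F per mod])
  fix M' \<Phi>' assume "\<Phi>' holomorphic_on ball 0 1" "!!z. Im z > 0 ==> nome h z ^ M' * F z = \<Phi>' (nome h z)"
  then show thesis by (rule that)
 qed
 have nz0: "\<Phi> (nome h z0) ~= 0" using nz(2) by (simp add: \<Phi>(2)[OF nz(1), symmetric])
 have "\<exists>g r n. r > 0 \<and> r <= 1 \<and> g holomorphic_on ball 0 r \<and> (\<forall>w\<in>ball 0 r. \<Phi> w = w ^ n * g w \<and> g w ~= 0)"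
 proof (cases "\<Phi> 0 = 0")
  case True
  have nc: "\<not> \<Phi> constant_on ball 0 1"
  proof
   assume "\<Phi> constant_on ball 0 1"
   then obtain y where "!!x. x \<in> ball 0 1 ==> \<Phi> x = y" unfolding constant_on_def by blast
   from this[of 0] this[of "nome h z0"] show False
    using True nz0 norm_nome_less[OF h nz(1)] by simp
  qed
  show ?thesis
  proof (rule holomorphic_factor_zero_nonconstant[OF \<Phi>(1) open_ball connected_ball _ True nc])
   fix g r n
   assume "0 < r" "ball 0 r \<subseteq> ball (0::complex) 1" "g holomorphic_on ball 0 r"
    "!!w. w \<in> ball 0 r ==> \<Phi> w = (w - 0) ^ n * g w" "!!w. w \<in> ball 0 r ==> g w ~= 0"
   then show ?thesis by (intro exI[of _ g] exI[of _ r] exI[of _ n]) (auto simp: ball_subset_ball_iff)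
  qed simp
 next
  case False
  have "continuous_on (ball 0 1) \<Phi>" using \<Phi>(1) by (rule holomorphic_on_imp_continuous_on)
  then have "isCont \<Phi> 0" by (simp add: continuous_on_eq_continuous_at)
  then obtain r where r: "r > 0" "!!w. dist w 0 < r ==> \<Phi> w ~= 0"
   using continuous_at_avoid[of 0 \<Phi> 0] False by (metis dist_commute)
  show ?thesis
   by (rule exI[of _ \<Phi>], rule exI[of _ "min r 1"], rule exI[of _ 0])
    (use r \<Phi>(1) in \<open>auto intro: holomorphic_on_subset\<close>)
 qed
 then obtain g r n where g: "r > 0" "r <= 1" "g holomorphic_on ball 0 r"
  "!!w. w \<in> ball 0 r ==> \<Phi> w = w ^ n * g w" "!!w. w \<in> ball 0 r ==> g w ~= 0" by blast
 have sub: "cball 0 (r/2) \<subseteq> ball (0::complex) r" using g by auto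
 have "continuous_on (cball 0 (r/2)) (\<lambda>w. cmod (g w))"
  by (intro continuous_on_norm holomorphic_on_imp_continuous_on holomorphic_on_subset[OF g(3) sub])
 then obtain w0 where w0: "w0 \<in> cball 0 (r/2)" "!!w. w \<in> cball 0 (r/2) ==> cmod (g w0) <= cmod (g w)"
  using continuous_attains_inf[OF compact_cball, of 0 "r/2" "\<lambda>w. cmod (g w)"] g(1) by auto
 define c where "c = cmod (g w0)"
 have c: "c > 0" using g(5) w0 sub unfolding c_def by (metis subsetD zero_less_norm_iff)
 \<comment> \<open>At this height |q| is at most r/2, inside the compact disc on which g has
   positive minimum c.\<close>
 define Y where "Y = max 1 (h * ln (2 / r) / (2 * pi))"
 show thesis
 proof (rule that[of c Y "2 * pi / h * n"])
  show "Y > 0" by (simp add: Y_def)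
  fix z assume z: "Im z \<ge> Y"
  have zp: "Im z > 0" using z by (auto simp: Y_def)
  have "ln (2 / r) <= 2 * pi / h * Im z" using z h by (simp add: Y_def field_simps)
  then have "- (2 * pi / h * Im z) <= ln (r / 2)" using g(1) by (simp add: ln_div)
  then have "exp (- (2 * pi / h * Im z)) <= r / 2"
   using g(1) by (metis exp_le_cancel_iff exp_ln half_gt_zero)
  then have q: "nome h z \<in> cball 0 (r/2)" by (simp add: norm_nome)
  have q1: "cmod (nome h z) <= 1" using norm_nome_less[OF h zp] by simp
  have "cmod (nome h z) ^ M * cmod (F z) = cmod (nome h z) ^ n * cmod (g (nome h z))"
   using \<Phi>(2)[OF zp] g(4) q sub by (metis norm_mult norm_power subsetD)
  moreover have "cmod (nome h z) ^ M * cmod (F z) <= 1 * cmod (F z)"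
   using q1 by (intro mult_right_mono power_le_one) auto
  moreover have "cmod (nome h z) ^ n * c <= cmod (nome h z) ^ n * cmod (g (nome h z))"
   using w0(2)[OF q] unfolding c_def by (intro mult_left_mono) auto
  ultimately have "cmod (nome h z) ^ n * c <= cmod (F z)" by linarith
  moreover have "cmod (nome h z) ^ n = exp (- (2 * pi / h * n * Im z))"
   by (simp add: norm_nome exp_of_nat_mult[symmetric] mult_ac)
  ultimately show "c * exp (- (2 * pi / h * n * Im z)) <= cmod (F z)" by (simp only: mult.commute)
 qed (use c h in auto)
qed

section \<open>Commuting elements and the Zassenhaus neighbourhood\<close>

lemma mult_diff_distrib2:
 fixes A B C :: "real^2^2"
 shows "A ** (B - C) = A ** B - A ** C" "(A - B) ** C = A ** C - B ** C"
  "A ** (B + C) = A ** B + A ** C" "(A + B) ** C = A ** C + B ** C"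
 by (simp_all add: mat2_eq_iff algebra_simps)

lemma scaleR_mult2:
 fixes A B :: "real^2^2"
 shows "(r *\<^sub>R A) ** B = r *\<^sub>R (A ** B)" "A ** (r *\<^sub>R B) = r *\<^sub>R (A ** B)"
 by (simp_all add: mat2_eq_iff algebra_simps)

lemma det_scaleR2: "det (r *\<^sub>R (A::real^2^2)) = r^2 * det A"
 by (simp add: det_2 power2_eq_square algebra_simps)

text \<open>A non-scalar 2 by 2 matrix has the algebra it generates as centralizer. The cases ask
  which of b, c and a - d is nonzero and can serve as divisor.\<close>

lemma commute_span2:
 fixes A B :: "real^2^2"
 assumes "!!x. B ~= x *\<^sub>R I2" "A ** B = B ** A"
 obtains x y where "A = x *\<^sub>R I2 + y *\<^sub>R B"
proof -
 define a b c d where "a = B$1$1" and "b = B$1$2" and "c = B$2$1" and "d = B$2$2"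
 define p q r s where "p = A$1$1" and "q = A$1$2" and "r = A$2$1" and "s = A$2$2"
 note defs = a_def b_def c_def d_def p_def q_def r_def s_def
 have eqs: "q * c = b * r" "p * b + q * d = a * q + b * s" "r * a + s * c = c * p + d * r"
  using arg_cong[OF assms(2), of "\<lambda>M. M$1$1"] arg_cong[OF assms(2), of "\<lambda>M. M$1$2"]
   arg_cong[OF assms(2), of "\<lambda>M. M$2$1"]
  unfolding mult2_entries defs by (simp_all add: mult.commute)
 have ns: "b ~= 0 \<or> c ~= 0 \<or> a ~= d"
  using assms(1)[of a] by (auto simp: mat2_eq_iff defs)
 show thesis
 proof (cases "b = 0")
  case False
  show thesis
  proof (rule that[of "p - q / b * a" "q / b"])
   have "b * s = b * p + q * (d - a)" using eqs(2) by (simp add: algebra_simps)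
   then have "s = p - q / b * a + q / b * d" using False by (simp add: field_simps)
   moreover have "r = q / b * c" using False eqs(1) by (simp add: field_simps)
   ultimately show "A = (p - q / b * a) *\<^sub>R I2 + (q / b) *\<^sub>R B"
    using False by (simp add: mat2_eq_iff defs)
  qed
 next
  case b: True
  show thesis
  proof (cases "c = 0")
   case False
   show thesis
   proof (rule that[of "p - r / c * a" "r / c"])
    have "c * s = c * p + r * (d - a)" using eqs(3) by (simp add: algebra_simps)
    then have "s = p - r / c * a + r / c * d" using False by (simp add: field_simps)
    moreover have "q = 0" using False eqs(1) b by simp
    ultimately show "A = (p - r / c * a) *\<^sub>R I2 + (r / c) *\<^sub>R B"
     using False b by (simp add: mat2_eq_iff defs)
   qed
  next
   case True
   then have ad: "a ~= d" using ns b by simp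
   have "q = 0" "r = 0" using eqs(2,3) b True ad by auto
   show thesis
   proof (rule that[of "p - (p - s) / (a - d) * a" "(p - s) / (a - d)"])
    have "(p - s) / (a - d) * (a - d) = p - s" using ad by simp
    then have "s = p - (p - s) / (a - d) * a + (p - s) / (a - d) * d" unfolding right_diff_distrib by linarith
    then show "A = (p - (p - s) / (a - d) * a) *\<^sub>R I2 + ((p - s) / (a - d)) *\<^sub>R B"
     using \<open>q = 0\<close> \<open>r = 0\<close> b True by (simp add: mat2_eq_iff defs)
   qed
  qed
 qed
qed

text \<open>Commutation is transitive through a non-scalar matrix: A lies in the algebra generated
  by B, and C commutes with that algebra.\<close>

lemma commute_trans2:
 fixes A B C :: "real^2^2"
 assumes "!!x. B ~= x *\<^sub>R I2" "A ** B = B ** A" "C ** B = B ** C"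
 shows "A ** C = C ** A"
proof -
 obtain x y where A: "A = x *\<^sub>R I2 + y *\<^sub>R B" using commute_span2[OF assms(1,2)] by blast
 show ?thesis unfolding A using assms(3) by (simp add: mult_diff_distrib2 scaleR_mult2)
qed

lemma norm_I2_le: "norm I2 <= (1415 / 1000 :: real)"
 by (rule power2_le_imp_le, unfold norm_sq2) (simp_all add: power2_eq_square)

context discrete_SL2
begin

lemma scalar_mem:
 assumes "x *\<^sub>R I2 \<in> \<Gamma>"
 shows "x *\<^sub>R I2 = I2 \<or> x *\<^sub>R I2 = - I2"
proof -
 have "x^2 = 1" using det1[OF assms] by (simp add: det_scaleR2)
 then have "x = 1 \<or> x = - 1" by (simp add: power2_eq_1_iff)
 then show ?thesis by auto
qed

lemma near_not_scalar:
 assumes "B \<in> \<Gamma>" "norm (B - I2) <= 1 / 10" "B ~= I2"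
 shows "B ~= x *\<^sub>R I2"
proof
 assume B: "B = x *\<^sub>R I2"
 then have "B = - I2" using scalar_mem[of x] assms by simp
 then have "\<bar>(B - I2)$1$1\<bar> = 2" by simp
 then show False using abs_entry_le_norm2[of "B - I2" 1 1] assms(2) by linarith
qed

text \<open>If the commutator commutes with B, so does the conjugate of B by X. Conjugation by X
  then multiplies the traceless part N of B by a number y, and y = 1 must be shown. If N is
  invertible, determinants give y^2 = 1; if N is nilpotent, discreteness gives |y| = 1. Nearness of
  X to the identity excludes y = -1.\<close>

lemma commutator_commutes_imp:
 assumes X: "X \<in> \<Gamma>" "norm (X - I2) <= 1 / 10" and B: "B \<in> \<Gamma>" "norm (B - I2) <= 1 / 10"
  and comm: "(X ** B ** adj2 X ** adj2 B) ** B = B ** (X ** B ** adj2 X ** adj2 B)"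
 shows "X ** B = B ** X"
proof (cases "B = I2")
 case True
 then show ?thesis by simp
next
 case False
 have ns: "!!x. B ~= x *\<^sub>R I2" by (rule near_not_scalar[OF B False])
 define B' where "B' = X ** B ** adj2 X"
 have "(X ** B ** adj2 X ** adj2 B) ** B = B'"
  using B(1) by (simp add: B'_def adj2_cancel)
 moreover have "B ** (X ** B ** adj2 X ** adj2 B) = B ** B' ** adj2 B"
  by (simp add: B'_def matrix_mul_assoc)
 ultimately have "B' = B ** B' ** adj2 B" using comm by simp
 then have "B' ** B = B ** B' ** adj2 B ** B" by metis
 then have "B' ** B = B ** B'" using B(1) by (simp add: adj2_cancel)
 then obtain x y where xy: "B' = x *\<^sub>R I2 + y *\<^sub>R B" using commute_span2[OF ns] by blast
 define t where "t = trace B"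
 define N where "N = B - (t / 2) *\<^sub>R I2"
 have BN: "B = (t / 2) *\<^sub>R I2 + N" by (simp add: N_def)
 have N0: "N ~= 0" using ns[of "t / 2"] by (auto simp: N_def)
 have trN: "N$2$2 = - (N$1$1)" by (simp add: N_def t_def trace2 field_simps)
 have X1: "adj2 X ** X = I2" "X ** adj2 X = I2" using X(1) by (simp_all add: adj2_inverse)
 have conjN: "X ** N = y *\<^sub>R (N ** X)"
 proof -
  have e: "X ** N ** adj2 X = B' - (t / 2) *\<^sub>R I2"
   using X1 by (simp add: N_def B'_def mult_diff_distrib2 scaleR_mult2)
  have "trace (X ** N ** adj2 X) = trace N"
   by (metis X1(1) matrix_mul_assoc matrix_mul_rid trace_mul_sym)
  moreover have "trace N = 0" by (simp add: trace2 trN)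
  ultimately have "trace (B' - (t / 2) *\<^sub>R I2) = 0" using e by simp
  then have "2 * x + y * t = t" by (simp add: xy trace2 t_def algebra_simps)
  then have "x = t / 2 - y * (t / 2)" by (simp add: field_simps)
  then have "B' - (t / 2) *\<^sub>R I2 = y *\<^sub>R N"
   unfolding xy N_def by (simp add: mat2_eq_iff algebra_simps)
  then have "X ** N ** adj2 X = y *\<^sub>R N" by (simp only: e)
  then have "X ** N ** adj2 X ** X = y *\<^sub>R N ** X" by simp
  then show ?thesis using X1 by (simp add: matrix_mul_assoc[symmetric] scaleR_mult2)
 qed
 \<comment> \<open>If X and N anticommuted, 2 N would equal -((X - I) N + N (X - I)), whose norm is
   at most a fifth of that of N.\<close>
 have ym1: "y ~= - 1"
 proof
  assume "y = - 1"
  then have "X ** N + N ** X = 0" using conjN by simp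
  then have "2 *\<^sub>R N = - ((X - I2) ** N + N ** (X - I2))"
   by (simp add: mult_diff_distrib2 scaleR_2)
  then have "norm (2 *\<^sub>R N) = norm ((X - I2) ** N + N ** (X - I2))" by (metis norm_minus_cancel)
  then have "2 * norm N <= norm ((X - I2) ** N) + norm (N ** (X - I2))"
   using norm_triangle_ineq[of "(X - I2) ** N" "N ** (X - I2)"] by simp
  also have "\<dots> <= 1 / 10 * norm N + norm N * (1 / 10)"
   by (intro add_mono order_trans[OF norm_mult2_le] mult_mono X) auto
  finally show False using N0 by simp
 qed
 have y1: "y = 1"
 proof (cases "det N = 0")
  case False
  have "det (X ** N) = det (y *\<^sub>R (N ** X))" by (simp only: conjN)
  then have "det N = y^2 * det N"
   using X(1) by (simp add: det_scaleR2 Determinants.det_mul)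
  then have "y^2 = 1" using False by simp
  then show ?thesis using ym1 by (simp add: power2_eq_1_iff)
 next
  case True
  have t2: "t = 2"
  proof -
   have "t^2 = 4 * (det B - det N)"
    using trN by (simp add: det_2 N_def t_def trace2 power2_eq_square field_simps)
   then have "t^2 = 2^2" using True B(1) by simp
   then have "t = 2 \<or> t = - 2" using power2_eq_iff by blast
   moreover have "- ((B - I2)$1$1) <= 1/10" "- ((B - I2)$2$2) <= 1/10"
    using abs_le_D2[OF abs_entry_le_norm2[of "B - I2"]] B(2) order_trans by blast+
   ultimately show ?thesis by (auto simp: t_def trace2)
  qed
  have y0: "y ~= 0"
  proof
   assume "y = 0"
   then have "adj2 X ** (X ** N) = 0" by (simp add: conjN mat2_eq_iff)
   then show False using N0 X(1) by (simp add: adj2_cancel)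
  qed
  \<comment> \<open>Here B = I + N with N nilpotent. Repeated conjugation by Z produces the group
    elements I + u^n N, which tend to the identity without reaching it.\<close>
  have limit: False if Z: "Z \<in> \<Gamma>" and ZN: "Z ** N = u *\<^sub>R (N ** Z)" and u: "\<bar>u\<bar> < 1" "u ~= 0" for Z u
  proof -
   obtain \<delta> where \<delta>: "\<delta> > 0" "!!g. g \<in> \<Gamma> ==> norm (g - I2) < \<delta> ==> g = I2"
    using exists_separation by blast
   define Y where "Y n = ((\<lambda>W. Z ** W ** adj2 Z) ^^ n) B" for n
   have Y: "Y n \<in> \<Gamma> \<and> Y n = I2 + (u ^ n) *\<^sub>R N" for n
   proof (induction n)
    case 0
    then show ?case using B(1) BN t2 by (simp add: Y_def)
   next
    case (Suc n)
    have "Y (Suc n) = Z ** Y n ** adj2 Z" by (simp add: Y_def)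
    moreover have "Z ** (I2 + (u ^ n) *\<^sub>R N) ** adj2 Z = I2 + (u ^ Suc n) *\<^sub>R N"
    proof -
     have z1: "Z ** adj2 Z = I2" using Z by (simp add: adj2_inverse)
     have "Z ** N ** adj2 Z = u *\<^sub>R (N ** (Z ** adj2 Z))"
      unfolding ZN by (simp add: scaleR_mult2 matrix_mul_assoc)
     then show ?thesis by (simp add: mult_diff_distrib2 scaleR_mult2 z1 mult.commute)
    qed
    ultimately show ?case using Suc mult_mem adj_mem Z by metis
   qed
   obtain n where n: "\<bar>u\<bar> ^ n < \<delta> / norm N"
    using real_arch_pow_inv[of "\<delta> / norm N" "\<bar>u\<bar>"] \<delta>(1) N0 u by auto
   have "norm (Y n - I2) < \<delta>" using Y[of n] n N0 by (simp add: power_abs pos_less_divide_eq)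
   then have "Y n = I2" using \<delta>(2) Y by blast
   then show False using Y[of n] N0 u by simp
  qed
  have "\<not> \<bar>y\<bar> < 1" using limit[OF X(1) conjN _ y0] by blast
  \<comment> \<open>The inverse of X scales N by 1/y, which reduces this to the contracting
    case.\<close>
  moreover have "\<not> \<bar>y\<bar> > 1"
  proof
   assume y: "\<bar>y\<bar> > 1"
   have "N ** adj2 X = adj2 X ** (X ** N) ** adj2 X" using X(1) by (simp add: adj2_cancel)
   also have "\<dots> = y *\<^sub>R (adj2 X ** N ** (X ** adj2 X))"
    unfolding conjN by (simp add: scaleR_mult2 matrix_mul_assoc)
   finally have "N ** adj2 X = y *\<^sub>R (adj2 X ** N)" using X1 by simp
   then have "adj2 X ** N = (1 / y) *\<^sub>R (N ** adj2 X)" using y0 by simp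
   then show False using limit[OF adj_mem[OF X(1)], of "1 / y"] y y0 by (simp add: abs_divide)
  qed
  ultimately have "\<bar>y\<bar> = 1" by linarith
  then show ?thesis using ym1 by (auto simp: abs_if split: if_splits)
 qed
 have "X ** N = N ** X" using conjN y1 by simp
 then show ?thesis unfolding BN by (simp add: mult_diff_distrib2 scaleR_mult2)
qed

text \<open>Iterated commutators with B contract towards the identity, so discreteness makes one of
  them equal to \<open>I2\<close>. That one commutes with B, and
  \<open>commutator_commutes_imp\<close> carries the property back to A.\<close>

lemma zassenhaus:
 assumes A: "A \<in> \<Gamma>" "norm (A - I2) <= 1 / 10" and B: "B \<in> \<Gamma>" "norm (B - I2) <= 1 / 10"
 shows "A ** B = B ** A"
proof -
 define X where "X n = ((\<lambda>W. W ** B ** adj2 W ** adj2 B) ^^ n) A" for n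
 have X0: "X 0 = A" and XS: "X (Suc n) = X n ** B ** adj2 (X n) ** adj2 B" for n
  by (simp_all add: X_def)
 \<comment> \<open>1.515 is the bound 1.415 for the norm of the identity plus 0.1.\<close>
 have near: "norm W <= 1515 / 1000" if "norm (W - I2) <= 1 / 10" for W
  using norm_triangle_ineq[of I2 "W - I2"] that norm_I2_le by simp
 have X: "X n \<in> \<Gamma> \<and> norm (X n - I2) <= 1 / 10 * (1 / 2) ^ n" for n
 proof (induction n)
  case 0
  then show ?case using A by (simp add: X0)
 next
  case (Suc n)
  then have Xn: "X n \<in> \<Gamma>" "norm (X n - I2) <= 1 / 10 * (1 / 2) ^ n" by auto
  have "1 / 10 * (1 / 2) ^ n <= (1 / 10 :: real)" by (simp add: power_le_one)
  then have Xn': "norm (X n - I2) <= 1 / 10" using Xn(2) by linarith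
  have mem: "X (Suc n) \<in> \<Gamma>" unfolding XS by (intro mult_mem adj_mem Xn B)
  \<comment> \<open>In X B - B X both factors may be replaced by their differences from the
    identity. This makes the commutator quadratically small.\<close>
  have e: "X (Suc n) - I2 = ((X n - I2) ** (B - I2) - (B - I2) ** (X n - I2)) ** (adj2 (X n) ** adj2 B)"
  proof -
   have "((X n - I2) ** (B - I2) - (B - I2) ** (X n - I2)) = X n ** B - B ** X n"
    by (simp add: mult_diff_distrib2)
   moreover have "B ** X n ** (adj2 (X n) ** adj2 B) = I2"
    using Xn(1) B(1) by (simp add: matrix_mul_assoc adj2_cancel adj2_inverse)
   ultimately show ?thesis by (simp add: XS mult_diff_distrib2 matrix_mul_assoc)
  qed
  have "norm (X (Suc n) - I2) <= norm ((X n - I2) ** (B - I2) - (B - I2) ** (X n - I2)) * norm (adj2 (X n) ** adj2 B)"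
   unfolding e by (rule norm_mult2_le)
  also have "\<dots> <= (norm (X n - I2) * (1/10) + (1/10) * norm (X n - I2)) * (1515/1000 * (1515/1000))"
  proof (rule mult_mono)
   have "norm ((X n - I2) ** (B - I2) - (B - I2) ** (X n - I2)) <=
     norm ((X n - I2) ** (B - I2)) + norm ((B - I2) ** (X n - I2))" by (rule norm_triangle_ineq4)
   also have "\<dots> <= norm (X n - I2) * (1/10) + (1/10) * norm (X n - I2)"
    by (intro add_mono order_trans[OF norm_mult2_le] mult_mono B) auto
   finally show "norm ((X n - I2) ** (B - I2) - (B - I2) ** (X n - I2)) <=
     norm (X n - I2) * (1/10) + (1/10) * norm (X n - I2)" .
   show "norm (adj2 (X n) ** adj2 B) <= 1515/1000 * (1515/1000)"
    using near[OF Xn'] near[OF B(2)] by (intro order_trans[OF norm_mult2_le] mult_mono) auto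
  qed auto
  \<comment> \<open>The factor is 2 * 0.1 * 1.515^2, about 0.46.\<close>
  also have "\<dots> <= norm (X n - I2) * (1 / 2)"
   using norm_ge_zero[of "X n - I2"] by (simp add: field_simps)
  finally show ?case using Xn(2) mem by simp
 qed
 obtain \<delta> where \<delta>: "\<delta> > 0" "!!g. g \<in> \<Gamma> ==> norm (g - I2) < \<delta> ==> g = I2"
  using exists_separation by blast
 obtain n where n: "(1/2::real) ^ n < \<delta>" using real_arch_pow_inv[of \<delta> "1/2"] \<delta>(1) by auto
 have "1 / 10 * (1 / 2) ^ n <= (1/2::real) ^ n" by simp
 then have "X n = I2" using \<delta>(2)[of "X n"] X[of n] n by linarith
 then have "X n ** B = B ** X n" by simp
 then have "X 0 ** B = B ** X 0"
 proof (induction n)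
  case (Suc n)
  have "1 / 10 * (1 / 2) ^ n <= (1 / 10 :: real)" by (simp add: power_le_one)
  then have "norm (X n - I2) <= 1 / 10" using X[of n] by linarith
  then have "X n ** B = B ** X n"
   using commutator_commutes_imp[of "X n" B] X[of n] B Suc.prems unfolding XS by blast
  then show ?case by (rule Suc.IH)
 qed
 then show ?thesis by (simp add: X0)
qed

end

lemma discrete_SL2_conj:
 assumes "discrete_SL2 \<Gamma>" and g: "det g = 1"
 shows "discrete_SL2 ((\<lambda>\<gamma>. adj2 g ** \<gamma> ** g) ` \<Gamma>)"
proof -
 interpret discrete_SL2 \<Gamma> by fact
 show ?thesis
 proof
  fix x assume "x \<in> (\<lambda>\<gamma>. adj2 g ** \<gamma> ** g) ` \<Gamma>"
  then show "det x = 1" using g by (auto simp: Determinants.det_mul)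
 next
  show "I2 \<in> (\<lambda>\<gamma>. adj2 g ** \<gamma> ** g) ` \<Gamma>"
   using g by (intro image_eqI[of _ _ I2]) (simp_all add: adj2_inverse)
  show "- I2 \<in> (\<lambda>\<gamma>. adj2 g ** \<gamma> ** g) ` \<Gamma>"
   using g neg_one_mem by (intro image_eqI[of _ _ "- I2"]) (simp_all add: adj2_inverse uminus_mult_mat2)
 next
  fix x y assume "x \<in> (\<lambda>\<gamma>. adj2 g ** \<gamma> ** g) ` \<Gamma>" "y \<in> (\<lambda>\<gamma>. adj2 g ** \<gamma> ** g) ` \<Gamma>"
  then obtain a b where ab: "a \<in> \<Gamma>" "b \<in> \<Gamma>" "x = adj2 g ** a ** g" "y = adj2 g ** b ** g" by blast
  have "x ** y = adj2 g ** (a ** b) ** g"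
   using g by (simp add: ab matrix_mul_assoc adj2_cancel)
  then show "x ** y \<in> (\<lambda>\<gamma>. adj2 g ** \<gamma> ** g) ` \<Gamma>" using mult_mem ab by blast
 next
  fix x assume "x \<in> (\<lambda>\<gamma>. adj2 g ** \<gamma> ** g) ` \<Gamma>"
  then obtain a where a: "a \<in> \<Gamma>" "x = adj2 g ** a ** g" by blast
  then have "adj2 x = adj2 g ** adj2 a ** g" by (simp add: adj2_mult matrix_mul_assoc)
  then show "adj2 x \<in> (\<lambda>\<gamma>. adj2 g ** \<gamma> ** g) ` \<Gamma>" using adj_mem a by blast
 next
  fix r
  have "{x \<in> (\<lambda>\<gamma>. adj2 g ** \<gamma> ** g) ` \<Gamma>. norm x <= r} \<subseteq>
    (\<lambda>\<gamma>. adj2 g ** \<gamma> ** g) ` {\<gamma> \<in> \<Gamma>. norm \<gamma> <= norm g * r * norm g}"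
  proof clarify
   fix a assume a: "a \<in> \<Gamma>" "norm (adj2 g ** a ** g) <= r"
   have "a = g ** (adj2 g ** a ** g) ** adj2 g"
    using g by (simp add: matrix_mul_assoc[symmetric] adj2_cancel adj2_inverse)
   then have "norm a = norm (g ** (adj2 g ** a ** g) ** adj2 g)" by simp
   also have "\<dots> <= norm (g ** (adj2 g ** a ** g)) * norm g"
    using norm_mult2_le[of _ "adj2 g"] by simp
   also have "\<dots> <= (norm g * norm (adj2 g ** a ** g)) * norm g"
    by (intro mult_right_mono norm_mult2_le) auto
   also have "\<dots> <= (norm g * r) * norm g" using a by (intro mult_right_mono mult_left_mono) auto
   finally show "adj2 g ** a ** g \<in> (\<lambda>\<gamma>. adj2 g ** \<gamma> ** g) ` {\<gamma> \<in> \<Gamma>. norm \<gamma> <= norm g * r * norm g}"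
    using a by blast
  qed
  then show "finite {x \<in> (\<lambda>\<gamma>. adj2 g ** \<gamma> ** g) ` \<Gamma>. norm x <= r}"
   by (rule finite_subset) (intro finite_imageI finite_bounded)
 qed
qed

section \<open>Invariance of the hyperbolic area\<close>

text \<open>The half plane is viewed inside \<open>real^2\<close>, where the derivative of a Moebius
  map has a Jacobian determinant.\<close>

definition cplx :: "real^2 => complex" where "cplx v = Complex (v$1) (v$2)"

definition vec_of_cplx :: "complex => real^2" where "vec_of_cplx z = vector [Re z, Im z]"

lemma vec_of_cplx_entries [simp]: "vec_of_cplx z $ 1 = Re z" "vec_of_cplx z $ 2 = Im z"
 by (simp_all add: vec_of_cplx_def)

lemma cplx_inverse [simp]: "cplx (vec_of_cplx z) = z" "vec_of_cplx (cplx v) = v"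
 by (simp_all add: cplx_def vec2_eq_iff)

lemma bounded_linear_cplx: "bounded_linear cplx"
 by (rule linear_conv_bounded_linear[THEN iffD1], rule linearI) (simp_all add: cplx_def complex_eq_iff)

lemma bounded_linear_vec_of_cplx: "bounded_linear vec_of_cplx"
 by (rule linear_conv_bounded_linear[THEN iffD1], rule linearI) (simp_all add: vec2_eq_iff)

lemma measurable_cplx [measurable]: "cplx \<in> borel_measurable borel"
 using bounded_linear_cplx by (intro borel_measurable_continuous_onI linear_continuous_on)

lemma Basis_real2: "(Basis :: (real^2) set) = {axis 1 1, axis 2 1}"
 by (auto simp: Basis_vec_def UNIV_2)

lemma axis_12_neq: "axis 1 (1::real) ~= (axis 2 1 :: real^2)"
 by (simp add: axis_eq_axis)

lemma lborel_cplx: "(lborel :: complex measure) = distr lborel borel cplx"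
proof (rule lborel_eqI)
 fix l u :: complex assume lu: "!!b. b \<in> Basis ==> l \<bullet> b <= u \<bullet> b"
 then have le: "Re l <= Re u" "Im l <= Im u" using lu[of 1] lu[of \<i>] by (simp_all add: Basis_complex_def)
 have v: "cplx -` box l u = box (vec_of_cplx l) (vec_of_cplx u)"
  by (auto simp: mem_box Basis_real2 Basis_complex_def inner_axis cplx_def)
 have "emeasure (distr lborel borel cplx) (box l u) = emeasure lborel (box (vec_of_cplx l) (vec_of_cplx u))"
  by (subst emeasure_distr) (simp_all add: v)
 also have "\<dots> = (\<Prod>b\<in>Basis. (vec_of_cplx u - vec_of_cplx l) \<bullet> b)"
  using le by (intro emeasure_lborel_box) (auto simp: Basis_real2 inner_axis)
 also have "\<dots> = (\<Prod>b\<in>Basis. (u - l) \<bullet> b)"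
  using axis_12_neq by (simp add: Basis_real2 Basis_complex_def inner_axis)
 finally show "emeasure (distr lborel borel cplx) (box l u) = (\<Prod>b\<in>Basis. (u - l) \<bullet> b)" .
qed simp

lemma nn_integral_cplx:
 assumes [measurable]: "f \<in> borel_measurable borel"
 shows "(\<integral>\<^sup>+z. f z \<partial>lborel) = (\<integral>\<^sup>+v. f (cplx v) \<partial>lborel)"
 by (subst lborel_cplx, subst nn_integral_distr) simp_all

lemma has_derivative_mobius_vec:
 assumes g: "det g = 1" and v: "Im (cplx v) > 0"
 shows "((\<lambda>v. vec_of_cplx (mobius g (cplx v))) has_derivative
   (\<lambda>w. vec_of_cplx ((1 / (jfac g (cplx v))^2) * cplx w))) (at v within S)"
proof -
 let ?z = "cplx v"
 have nz: "jfac g ?z ~= 0" using g v by (simp add: jfac_nz)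
 have "((\<lambda>z. (of_real (g$1$1) * z + of_real (g$1$2)) / jfac g z) has_field_derivative
   (of_real (g$1$1) * jfac g ?z - (of_real (g$1$1) * ?z + of_real (g$1$2)) * of_real (g$2$1)) / (jfac g ?z * jfac g ?z)) (at ?z)"
  using nz unfolding jfac_def by (auto intro!: derivative_eq_intros)
 also have "of_real (g$1$1) * jfac g ?z - (of_real (g$1$1) * ?z + of_real (g$1$2)) * of_real (g$2$1) =
   complex_of_real (g$1$1 * g$2$2 - g$1$2 * g$2$1)"
  by (simp add: jfac_def algebra_simps)
 also have "g$1$1 * g$2$2 - g$1$2 * g$2$1 = 1" using g by (simp add: det_2)
 finally have "(mobius g has_field_derivative 1 / (jfac g ?z)^2) (at ?z)"
  by (simp add: mobius_eq[abs_def] power2_eq_square)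
 then have "(mobius g has_derivative (*) (1 / (jfac g ?z)^2)) (at ?z)"
  by (simp add: has_field_derivative_def)
 moreover have "(cplx has_derivative cplx) (at v within S)"
  by (rule bounded_linear.has_derivative[OF bounded_linear_cplx has_derivative_ident])
 ultimately have "((\<lambda>v. mobius g (cplx v)) has_derivative (\<lambda>w. (1 / (jfac g ?z)^2) * cplx w)) (at v within S)"
  by (metis has_derivative_compose)
 then show ?thesis by (rule bounded_linear.has_derivative[OF bounded_linear_vec_of_cplx])
qed

lemma det_matrix_mult_cplx: "det (matrix (\<lambda>w. vec_of_cplx (D * cplx w))) = (cmod D)^2"
proof -
 have "cplx (axis 1 1) = 1" "cplx (axis 2 1) = \<i>" by (simp_all add: cplx_def axis_def complex_eq_iff)
 then show ?thesis unfolding cmod_power2 by (simp add: det_2 matrix_def power2_eq_square)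
qed

text \<open>The Jacobian is |j|^(-4) and heights are multiplied by |j|^(-2), so the density y^(-2)
  is preserved. Finite area makes the density absolutely integrable, which the change of variables
  rule requires.\<close>

lemma hyperbolic_area_mobius:
 assumes E: "E \<in> sets borel" "E \<subseteq> \<H>" and g: "det g = 1" and fin: "hyperbolic_area E < \<infinity>"
  and gE: "mobius g ` E \<in> sets borel"
 shows "hyperbolic_area (mobius g ` E) = hyperbolic_area E"
proof -
 define S where "S = cplx -` E"
 have S: "S \<in> sets borel" unfolding S_def using measurable_sets_borel[OF measurable_cplx E(1)] by simp
 define f where "f v = 1 / (v$2)^2" for v :: "real^2"
 have area: "hyperbolic_area A = (\<integral>\<^sup>+v \<in> cplx -` A. ennreal (f v) \<partial>lborel)" if "A \<in> sets borel" for A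
 proof -
  have [measurable]: "A \<in> sets borel" by fact
  have "(\<lambda>z. ennreal (1 / (Im z)^2) * indicator A z) \<in> borel_measurable borel" by measurable
  from nn_integral_cplx[OF this] show ?thesis
   by (simp add: hyperbolic_area_def f_def cplx_def indicator_def vimage_def)
 qed
 define G where "G v = vec_of_cplx (mobius g (cplx v))" for v
 have GS: "cplx -` (mobius g ` E) = G ` S"
 proof
  show "cplx -` (mobius g ` E) \<subseteq> G ` S"
  proof
   fix v assume "v \<in> cplx -` (mobius g ` E)"
   then obtain z where z: "z \<in> E" "cplx v = mobius g z" by auto
   then have "v = G (vec_of_cplx z)" by (metis G_def cplx_inverse)
   then show "v \<in> G ` S" using z(1) by (auto simp: S_def)
  qed
 qed (auto simp: S_def G_def)
 have pos: "Im (cplx v) > 0" if "v \<in> S" for v using that E(2) by (auto simp: S_def)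
 \<comment> \<open>The change of variables rule is about vector-valued integrands; \<open>f1\<close>
   is f as a vector with a single entry.\<close>
 define f1 where "f1 v = (\<chi> i::1. f v)" for v
 have f_meas: "f \<in> borel_measurable borel"
  unfolding f_def by (intro borel_measurable_divide borel_measurable_power borel_measurable_const borel_measurable_continuous_onI continuous_intros)
 have "integrable lborel (\<lambda>v. indicator S v *\<^sub>R f v)"
 proof (rule integrableI_nonneg)
  show "(\<lambda>v. indicator S v *\<^sub>R f v) \<in> borel_measurable lborel" using f_meas S by simp
  have "(\<integral>\<^sup>+v. ennreal (indicator S v *\<^sub>R f v) \<partial>lborel) = (\<integral>\<^sup>+v \<in> S. ennreal (f v) \<partial>lborel)"
   by (intro nn_integral_cong) (simp add: indicator_def)
  then show "(\<integral>\<^sup>+v. ennreal (indicator S v *\<^sub>R f v) \<partial>lborel) < \<infinity>"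
   using fin area[OF E(1)] by (simp add: S_def)
 qed (auto simp: f_def indicator_def)
 then have "f absolutely_integrable_on S"
  by (simp add: set_integrable_def integrable_completion f_meas S)
 then have abs1: "f1 absolutely_integrable_on S"
  by (subst absolutely_integrable_componentwise_iff) (auto simp: Basis_vec_def inner_axis f1_def)
 have jac: "\<bar>det (matrix (\<lambda>w. vec_of_cplx ((1 / (jfac g (cplx v))^2) * cplx w)))\<bar> *\<^sub>R f1 (G v) = f1 v"
  if v: "v \<in> S" for v
 proof -
  have nz: "cmod (jfac g (cplx v)) ~= 0" using jfac_nz[of g "cplx v"] g pos[OF v] by simp
  have "G v $ 2 = v$2 / (cmod (jfac g (cplx v)))^2" using g by (simp add: G_def Im_mobius cplx_def)
  then show ?thesis using nz
   unfolding det_matrix_mult_cplx f1_def f_def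
   by (simp add: Finite_Cartesian_Product.vec_eq_iff norm_divide norm_power power_divide)
 qed
 have inj: "inj_on G S"
 proof (rule inj_onI)
  fix v w assume vw: "v \<in> S" "w \<in> S" "G v = G w"
  then have "mobius g (cplx v) = mobius g (cplx w)" unfolding G_def by (metis cplx_inverse(1))
  then have "cplx v = cplx w" using mobius_adj2(1)[OF g pos] vw by metis
  then show "v = w" by (metis cplx_inverse(2))
 qed
 have Sl: "S \<in> sets lebesgue" using S by simp
 have D: "(\<lambda>v. \<bar>det (matrix (\<lambda>w. vec_of_cplx ((1 / (jfac g (cplx v))^2) * cplx w)))\<bar> *\<^sub>R f1 (G v)) absolutely_integrable_on S
  \<and> integral S (\<lambda>v. \<bar>det (matrix (\<lambda>w. vec_of_cplx ((1 / (jfac g (cplx v))^2) * cplx w)))\<bar> *\<^sub>R f1 (G v)) = integral S f1"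
 proof
  show "integral S (\<lambda>v. \<bar>det (matrix (\<lambda>w. vec_of_cplx ((1 / (jfac g (cplx v))^2) * cplx w)))\<bar> *\<^sub>R f1 (G v)) = integral S f1"
   by (rule integral_cong) (rule jac)
  show "(\<lambda>v. \<bar>det (matrix (\<lambda>w. vec_of_cplx ((1 / (jfac g (cplx v))^2) * cplx w)))\<bar> *\<^sub>R f1 (G v)) absolutely_integrable_on S"
   by (rule absolutely_integrable_spike[OF abs1 negligible_empty]) (use jac in auto)
 qed
 have "f1 absolutely_integrable_on (G ` S) \<and> integral (G ` S) f1 = integral S f1"
 proof (rule iffD1[OF has_absolute_integral_change_of_variables[OF Sl _ inj] D])
  show "(G has_derivative (\<lambda>w. vec_of_cplx ((1 / (jfac g (cplx v))^2) * cplx w))) (at v within S)" if "v \<in> S" for v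
   unfolding G_def[abs_def] by (rule has_derivative_mobius_vec[OF g pos[OF that]])
 qed
 then have hi: "(f1 has_integral integral S f1) (G ` S)"
  using set_lebesgue_integral_eq_integral(1) by (metis integrable_integral)
 have hi0: "(f1 has_integral integral S f1) S"
  using abs1 set_lebesgue_integral_eq_integral(1) by (metis integrable_integral)
 have comp: "(f has_integral (integral S f1 $ 1)) A" if "(f1 has_integral integral S f1) A" for A
  using has_integral_linear[OF that bounded_linear_vec_nth, of 1] by (simp add: f1_def o_def)
 have "hyperbolic_area (mobius g ` E) = (\<integral>\<^sup>+v \<in> G ` S. ennreal (f v) \<partial>lborel)"
  using area[OF gE] GS by simp
 also have "\<dots> = ennreal (integral S f1 $ 1)"
  by (rule nn_integral_has_integral_lebesgue'[OF _ comp[OF hi]]) (simp add: f_def)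
 also have "\<dots> = (\<integral>\<^sup>+v \<in> S. ennreal (f v) \<partial>lborel)"
  by (rule nn_integral_has_integral_lebesgue'[OF _ comp[OF hi0], symmetric]) (simp add: f_def)
 also have "\<dots> = hyperbolic_area E" using area[OF E(1)] by (simp add: S_def)
 finally show ?thesis .
qed

section \<open>Thick and thin parts\<close>

text \<open>The upper triangular matrix that takes \<i> to z.\<close>

definition to_point :: "complex => real^2^2" where
 "to_point z = mat2 (sqrt (Im z)) (Re z / sqrt (Im z)) 0 (1 / sqrt (Im z))"

text \<open>The element g as seen from z, after z has been moved to \<i>. Its distance from
  \<open>I2\<close> says how close g is to acting trivially near z.\<close>

definition conj_at :: "complex => real^2^2 => real^2^2" where
 "conj_at z g = adj2 (to_point z) ** g ** to_point z"

text \<open>The quadratic form whose roots are the fixed points of g; its value is (z - g z) times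
  the automorphy factor.\<close>

definition quad :: "real^2^2 => complex => complex" where
 "quad g z = of_real (g$2$1) * z^2 + of_real (g$2$2 - g$1$1) * z - of_real (g$1$2)"

lemma det_to_point [simp]: "Im z > 0 ==> det (to_point z) = 1"
 by (simp add: to_point_def)

lemma mobius_to_point:
 assumes "Im z > 0"
 shows "mobius (to_point z) w = of_real (Re z) + of_real (Im z) * w"
proof -
 have s: "complex_of_real (sqrt (Im z)) * of_real (sqrt (Im z)) = of_real (Im z)"
  using assms by (simp add: of_real_mult[symmetric] del: of_real_mult)
 have nz: "complex_of_real (sqrt (Im z)) ~= 0" using assms by simp
 have "mobius (to_point z) w = (of_real (sqrt (Im z)) * of_real (sqrt (Im z))) * w + of_real (Re z)"
  using nz by (simp add: mobius_eq jfac_def to_point_def field_simps)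
 then show ?thesis by (simp add: s)
qed

lemma mobius_adj_to_point:
 assumes "Im z > 0"
 shows "mobius (adj2 (to_point z)) w = (w - of_real (Re z)) / of_real (Im z)"
proof -
 have s: "complex_of_real (sqrt (Im z)) * of_real (sqrt (Im z)) = of_real (Im z)"
  using assms by (simp add: of_real_mult[symmetric] del: of_real_mult)
 have nz: "complex_of_real (sqrt (Im z)) ~= 0" using assms by simp
 have "mobius (adj2 (to_point z)) w = (w - of_real (Re z)) / (of_real (sqrt (Im z)) * of_real (sqrt (Im z)))"
  using nz by (simp add: mobius_eq jfac_def to_point_def diff_divide_distrib)
 then show ?thesis by (simp add: s)
qed

lemma conj_at_entries:
 assumes "Im z > 0"
 shows "conj_at z g $ 1 $ 1 = g$1$1 - g$2$1 * Re z"
  "conj_at z g $ 1 $ 2 = (g$1$1 * Re z + g$1$2 - Re z * (g$2$1 * Re z + g$2$2)) / Im z"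
  "conj_at z g $ 2 $ 1 = g$2$1 * Im z"
  "conj_at z g $ 2 $ 2 = g$2$1 * Re z + g$2$2"
proof -
 define s where "s = sqrt (Im z)"
 have s: "s ~= 0" "s * s = Im z" using assms by (auto simp: s_def)
 have s': "Im z = s * s" "sqrt (s * s) = s" using s by (simp_all add: s_def assms less_imp_le)
 show "conj_at z g $ 1 $ 1 = g$1$1 - g$2$1 * Re z"
  "conj_at z g $ 1 $ 2 = (g$1$1 * Re z + g$1$2 - Re z * (g$2$1 * Re z + g$2$2)) / Im z"
  "conj_at z g $ 2 $ 1 = g$2$1 * Im z"
  "conj_at z g $ 2 $ 2 = g$2$1 * Re z + g$2$2"
  unfolding conj_at_def to_point_def s' using s(1) by (simp_all add: field_simps)
qed

text \<open>Both sides are twice the hyperbolic cosine of the distance from z to its image under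
  g.\<close>

lemma norm_conj_at:
 assumes z: "Im z > 0" and g: "det g = 1"
 shows "(norm (conj_at z g))^2 = (cmod (quad g z) / Im z)^2 + 2"
proof -
 define A B C D where "A = conj_at z g $ 1 $ 1" and "B = conj_at z g $ 1 $ 2"
  and "C = conj_at z g $ 2 $ 1" and "D = conj_at z g $ 2 $ 2"
 note e = A_def B_def C_def D_def
 have d: "A * D - B * C = 1"
 proof -
  have "det (conj_at z g) = 1" using z g by (simp add: conj_at_def Determinants.det_mul)
  then show ?thesis by (simp add: det_2 e)
 qed
 have re: "Re (quad g z) = - (B + C) * Im z + 2 * C * Im z - 2 * g$2$1 * (Im z)^2"
  unfolding e conj_at_entries[OF z] quad_def using z
  by (simp add: power2_eq_square field_simps)
 have C2: "C * Im z = g$2$1 * (Im z)^2" by (simp add: e conj_at_entries[OF z] power2_eq_square)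
 have re': "Re (quad g z) = - (B + C) * Im z" unfolding re using C2 by simp
 have im: "Im (quad g z) = (D - A) * Im z"
  unfolding e conj_at_entries[OF z] quad_def by (simp add: power2_eq_square algebra_simps)
 have "(cmod (quad g z) / Im z)^2 = (B + C)^2 + (D - A)^2"
  unfolding power_divide cmod_power2 re' im power_mult_distrib power2_minus
  using z by (simp add: add_divide_distrib)
 also have "\<dots> = A^2 + B^2 + C^2 + D^2 - 2 * (A * D - B * C)" by (simp add: power2_eq_square algebra_simps)
 finally show ?thesis unfolding norm_sq2 e[symmetric] d by simp
qed

lemma trace_conj_at: "Im z > 0 ==> trace (conj_at z g) = trace g"
 by (simp add: trace2 conj_at_entries)

text \<open>Nearness to the identity at z depends only on the trace and on the ratio
  \<open>cmod (quad g z) / Im z\<close>. For trace 2 it is exactly that ratio.\<close>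

lemma norm_conj_at_diff:
 assumes z: "Im z > 0" and g: "det g = 1"
 shows "(norm (conj_at z g - I2))^2 = (cmod (quad g z) / Im z)^2 + 4 - 2 * trace g"
proof -
 have "(norm (A - I2))^2 = (norm A)^2 - 2 * trace A + 2" for A :: "real^2^2"
  unfolding norm_sq2 trace2 by (simp add: power2_eq_square algebra_simps)
 then show ?thesis using norm_conj_at[OF assms] trace_conj_at[OF z] by simp
qed

text \<open>Moving the point by g amounts to conjugating the matrix, up to the square of the
  automorphy factor; dividing by the height makes the ratio conjugation invariant.\<close>

lemma quad_conj:
 assumes "det g = 1" "Im w > 0"
 shows "quad \<delta> (mobius g w) * (jfac g w)^2 = quad (adj2 g ** \<delta> ** g) w"
proof -
 define n where "n = of_real (g$1$1) * w + complex_of_real (g$1$2)"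
 define j where "j = jfac g w"
 have j: "j ~= 0" using jfac_nz[of g w] assms by (simp add: j_def)
 have nj: "mobius g w * j = n"
  using j by (simp add: mobius_eq n_def j_def)
 have "quad \<delta> (mobius g w) * j^2 = of_real (\<delta>$2$1) * (mobius g w * j)^2 +
   of_real (\<delta>$2$2 - \<delta>$1$1) * (mobius g w * j) * j - of_real (\<delta>$1$2) * j^2"
  by (simp add: quad_def power2_eq_square algebra_simps)
 also have "\<dots> = of_real (\<delta>$2$1) * n^2 + of_real (\<delta>$2$2 - \<delta>$1$1) * n * j - of_real (\<delta>$1$2) * j^2"
  unfolding nj ..
 also have "\<dots> = quad (adj2 g ** \<delta> ** g) w"
  unfolding n_def j_def jfac_def quad_def by (simp add: power2_eq_square algebra_simps)
 finally show ?thesis by (simp add: j_def)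
qed

lemma quad_ratio_conj:
 assumes "det g = 1" "Im w > 0"
 shows "cmod (quad \<delta> (mobius g w)) / Im (mobius g w) = cmod (quad (adj2 g ** \<delta> ** g) w) / Im w"
proof -
 have j: "cmod (jfac g w) ~= 0" using jfac_nz[of g w] assms by simp
 have "cmod (quad (adj2 g ** \<delta> ** g) w) = cmod (quad \<delta> (mobius g w)) * (cmod (jfac g w))^2"
  by (simp add: quad_conj[OF assms, symmetric] norm_mult norm_power)
 then show ?thesis using j by (simp add: Im_mobius[OF assms(1)])
qed

lemma conj_at_mult: "Im z > 0 ==> conj_at z (g ** k) = conj_at z g ** conj_at z k"
 by (simp add: conj_at_def matrix_mul_assoc adj2_cancel)

lemma conj_at_adj2: "adj2 (conj_at z g) = conj_at z (adj2 g)"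
 by (simp add: conj_at_def adj2_mult matrix_mul_assoc)

lemma conj_at_inverse: "Im z > 0 ==> to_point z ** conj_at z g ** adj2 (to_point z) = g"
 by (simp add: conj_at_def matrix_mul_assoc[symmetric] adj2_cancel adj2_inverse)

lemma conj_at_I2 [simp]: "Im z > 0 ==> conj_at z I2 = I2"
 by (simp add: conj_at_def adj2_inverse)

lemma conj_at_inj: "Im z > 0 ==> conj_at z g = conj_at z k ==> g = k"
 using conj_at_inverse by metis

section \<open>Overlaps and areas of discs of comparable hyperbolic size\<close>

lemma norm_le_if_ball_to_ball:
 assumes h: "det h = 1" and w: "w \<in> ball \<i> (1/2)" "mobius h w \<in> ball \<i> (1/2)"
 shows "norm h <= 30"
proof -
 have bd: "1/2 < Im u" "Im u < 3/2" "cmod u < 3/2" if "u \<in> ball \<i> (1/2)" for u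
 proof -
  have d: "cmod (u - \<i>) < 1/2" using that by (simp add: dist_norm norm_minus_commute)
  then have "\<bar>Im (u - \<i>)\<bar> < 1/2" using abs_Im_le_cmod[of "u - \<i>"] by linarith
  then show "1/2 < Im u" "Im u < 3/2" unfolding minus_complex.sel imaginary_unit.sel by linarith+
  show "cmod u < 3/2" using norm_triangle_ineq[of "u - \<i>" \<i>] d by simp
 qed
 have wI: "Im w > 0" using bd(1)[OF w(1)] by simp
 define j where "j = jfac h w"
 have j0: "cmod j > 0" unfolding j_def using jfac_nz[of h w] h wI by simp
 have "Im (mobius h w) * (cmod j)^2 = Im w" using Im_mobius[OF h, of w] j0 by (simp add: j_def)
 \<comment> \<open>Both points have height between 1/2 and 3/2, and |j|^2 is the quotient of the
   heights. From |j| at most 2 the entries c, d, a, b are bounded in turn by 4, 8, 6, 12, which add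
   up to 30.\<close>
 then have "1/2 * (cmod j)^2 <= 3/2"
  using bd(1)[OF w(2)] bd(2)[OF w(1)] mult_right_mono[of "1/2" "Im (mobius h w)" "(cmod j)^2"] by simp
 then have "(cmod j)^2 <= 2^2" by simp
 then have j2: "cmod j <= 2" by (rule power2_le_imp_le) simp
 have "Im j = h$2$1 * Im w" by (simp add: j_def jfac_def)
 then have "\<bar>h$2$1\<bar> * Im w <= 2" using abs_Im_le_cmod[of j] j2 wI by (simp add: abs_mult)
 then have c: "\<bar>h$2$1\<bar> <= 4" using bd(1)[OF w(1)] mult_left_mono[of "1/2" "Im w" "\<bar>h$2$1\<bar>"] by simp
 have "complex_of_real (h$2$2) = j - of_real (h$2$1) * w" by (simp add: j_def jfac_def)
 then have "\<bar>h$2$2\<bar> <= cmod j + \<bar>h$2$1\<bar> * cmod w"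
  by (metis norm_mult norm_of_real norm_triangle_ineq4 real_norm_def)
 also have "\<dots> <= 2 + 4 * (3/2)" using j2 c bd(3)[OF w(1)] by (intro add_mono mult_mono) auto
 finally have d: "\<bar>h$2$2\<bar> <= 8" by simp
 define n where "n = of_real (h$1$1) * w + complex_of_real (h$1$2)"
 have "n = mobius h w * j" using j0 by (simp add: mobius_eq j_def n_def)
 then have n3: "cmod n <= 3"
  using mult_mono[of "cmod (mobius h w)" "3/2" "cmod j" 2] bd(3)[OF w(2)] j2 by (simp add: norm_mult)
 have "Im n = h$1$1 * Im w" by (simp add: n_def)
 then have "\<bar>h$1$1\<bar> * Im w <= 3" using abs_Im_le_cmod[of n] n3 wI by (simp add: abs_mult)
 then have a: "\<bar>h$1$1\<bar> <= 6" using bd(1)[OF w(1)] mult_left_mono[of "1/2" "Im w" "\<bar>h$1$1\<bar>"] by simp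
 have "complex_of_real (h$1$2) = n - of_real (h$1$1) * w" by (simp add: n_def)
 then have "\<bar>h$1$2\<bar> <= cmod n + \<bar>h$1$1\<bar> * cmod w"
  by (metis norm_mult norm_of_real norm_triangle_ineq4 real_norm_def)
 also have "\<dots> <= 3 + 6 * (3/2)" using n3 a bd(3)[OF w(1)] by (intro add_mono mult_mono) auto
 finally have b: "\<bar>h$1$2\<bar> <= 12" by simp
 show ?thesis using norm2_le_sum[of h] a b c d by linarith
qed

lemma ball_Im_pos: "w \<in> ball z (Im z / 2) ==> Im z / 2 < Im w" "w \<in> ball z (Im z / 2) ==> Im w > 0"
proof -
 assume "w \<in> ball z (Im z / 2)"
 then have d: "cmod (w - z) < Im z / 2" by (simp add: dist_norm norm_minus_commute)
 then have "Im z > 0" using norm_ge_zero[of "w - z"] by linarith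
 moreover have "\<bar>Im (w - z)\<bar> < Im z / 2" using abs_Im_le_cmod[of "w - z"] d by linarith
 ultimately show "Im z / 2 < Im w" "Im w > 0" unfolding minus_complex.sel by linarith+
qed

text \<open>The affine map of \<open>to_point z\<close> carries the disc of radius 1/2 about \<i>
  onto the disc of radius \<open>Im z / 2\<close> about z, so everything reduces to the case at
  \<i>.\<close>

lemma norm_le_if_balls_meet:
 assumes g: "det g = 1" and z: "Im z > 0" "Im z' > 0"
  and w: "w \<in> ball z (Im z / 2)" "mobius g w \<in> ball z' (Im z' / 2)"
 shows "norm (adj2 (to_point z') ** g ** to_point z) <= 30"
proof -
 have b: "(w - of_real (Re z)) / of_real (Im z) \<in> ball \<i> (1/2)" if "Im z > 0" "w \<in> ball z (Im z / 2)" for z w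
 proof -
  have "(w - of_real (Re z)) / of_real (Im z) - \<i> = (w - z) / of_real (Im z)"
   using that(1) by (simp add: field_simps complex_eq_iff)
  then have "cmod ((w - of_real (Re z)) / of_real (Im z) - \<i>) = cmod (w - z) / Im z"
   using that(1) by (simp add: norm_divide)
  moreover have "cmod (w - z) < Im z / 2" using that(2) by (simp add: dist_norm norm_minus_commute)
  ultimately have "cmod ((w - of_real (Re z)) / of_real (Im z) - \<i>) < 1/2"
   using that(1) by (simp add: divide_less_eq)
  then show ?thesis by (simp add: dist_norm norm_minus_commute)
 qed
 define u where "u = mobius (adj2 (to_point z)) w"
 have wI: "Im w > 0" using ball_Im_pos(2)[OF w(1)] .
 have u: "u \<in> ball \<i> (1/2)" unfolding u_def mobius_adj_to_point[OF z(1)] by (rule b[OF z(1) w(1)])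
 have uI: "Im u > 0" unfolding u_def using z wI by simp
 have wu: "w = mobius (to_point z) u" unfolding u_def using mobius_adj2(2)[of "to_point z" w] z wI by simp
 have "mobius (adj2 (to_point z') ** g ** to_point z) u = mobius (adj2 (to_point z')) (mobius g w)"
  using z g uI wI by (simp add: mobius_mult Determinants.det_mul wu)
 also have "\<dots> \<in> ball \<i> (1/2)" unfolding mobius_adj_to_point[OF z(2)] by (rule b[OF z(2) w(2)])
 finally show ?thesis
  using norm_le_if_ball_to_ball[of "adj2 (to_point z') ** g ** to_point z" u] u g z by (simp add: Determinants.det_mul)
qed

text \<open>A bound independent of z: the disc contains a square of side y/2 and Euclidean area
  y^2/4, all of it below height 5y/4, and (y^2/4) * 16/(25 y^2) = 4/25.\<close>

lemma area_ball_ge: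
 assumes z: "Im z > 0"
 shows "ennreal (4/25) <= hyperbolic_area (ball z (Im z / 2))"
proof -
 define y where "y = Im z"
 have y: "y > 0" using z by (simp add: y_def)
 define e where "e = Complex (y/4) (y/4)"
 define Q where "Q = box (z - e) (z + e)"
 have Q: "w \<in> ball z (Im z / 2) \<and> Im w <= 5 * y / 4 \<and> 0 < Im w" if "w \<in> Q" for w
 proof -
  have b: "\<bar>Re (w - z)\<bar> < y / 4" "\<bar>Im (w - z)\<bar> < y / 4"
  proof -
   have "Re z - y / 4 < Re w \<and> Re w < Re z + y / 4 \<and> Im z - y / 4 < Im w \<and> Im w < Im z + y / 4"
    using that by (auto simp: Q_def e_def in_box_complex_iff)
   then show "\<bar>Re (w - z)\<bar> < y / 4" "\<bar>Im (w - z)\<bar> < y / 4"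
    unfolding minus_complex.sel abs_less_iff by linarith+
  qed
  then have "cmod (w - z) < y / 2" using cmod_le[of "w - z"] by linarith
  moreover have "Im w <= 5 * y / 4" using b(2) by (simp add: y_def abs_if split: if_splits)
  moreover have "Im w > 0" using b(2) y by (simp add: y_def abs_if split: if_splits)
  ultimately show ?thesis by (simp add: dist_norm norm_minus_commute y_def)
 qed
 have "emeasure lborel Q = (\<Prod>b\<in>Basis. (z + e - (z - e)) \<bullet> b)"
  unfolding Q_def using y by (intro emeasure_lborel_box) (auto simp: Basis_complex_def e_def)
 also have "(\<Prod>b\<in>Basis. (z + e - (z - e)) \<bullet> b) = y^2 / 4"
  by (simp add: Basis_complex_def e_def power2_eq_square)
 finally have mQ: "emeasure lborel Q = ennreal (y^2 / 4)" .
 have "ennreal (4/25) = ennreal (16 / (25 * y^2)) * emeasure lborel Q"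
  unfolding mQ using y by (subst ennreal_mult[symmetric]) (auto simp: power2_eq_square field_simps)
 also have "\<dots> = (\<integral>\<^sup>+w. ennreal (16 / (25 * y^2)) * indicator Q w \<partial>lborel)"
  by (subst nn_integral_cmult_indicator) (auto simp: Q_def)
 also have "\<dots> <= hyperbolic_area (ball z (Im z / 2))"
  unfolding hyperbolic_area_def
 proof (rule nn_integral_mono)
  fix w
  show "ennreal (16 / (25 * y^2)) * indicator Q w <= ennreal (1 / (Im w)^2) * indicator (ball z (Im z / 2)) w"
  proof (cases "w \<in> Q")
   case True
   note q = Q[OF True]
   have "(Im w)^2 <= (5 * y / 4)^2" using q by (intro power_mono) auto
   then have "1 / (5 * y / 4)^2 <= 1 / (Im w)^2" using q y by (intro divide_left_mono) auto
   then have "16 / (25 * y^2) <= 1 / (Im w)^2" by (simp add: power2_eq_square)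
   then show ?thesis using True q by (simp add: ennreal_leI)
  qed simp
 qed
 finally show ?thesis .
qed

lemma measurable_mobius [measurable]: "mobius g \<in> borel_measurable borel"
proof -
 have "(\<lambda>z. (of_real (g$1$1) * z + of_real (g$1$2)) / jfac g z) \<in> borel_measurable borel"
  unfolding jfac_def by measurable
 then show ?thesis by (simp add: mobius_eq[abs_def])
qed

lemma borel_vimage_mobius: "A \<in> sets borel ==> mobius g -` A \<in> sets borel"
 using measurable_sets_borel[OF measurable_mobius, of A g] by simp

locale finite_area_SL2 = discrete_SL2 +
 fixes F :: "complex set"
 assumes F_sub: "F \<subseteq> \<H>" and F_borel: "F \<in> sets borel"
  and F_cover: "!!z. Im z > 0 ==> \<exists>\<gamma>\<in>\<Gamma>. \<exists>w\<in>F. z = mobius \<gamma> w"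
  and F_area: "hyperbolic_area F < \<infinity>"
begin

definition hm :: "complex measure" where "hm = density lborel (\<lambda>z. ennreal (1 / (Im z)^2))"

lemma sets_hm [simp]: "sets hm = sets borel"
 by (simp add: hm_def)

lemma emeasure_hm: "A \<in> sets borel ==> emeasure hm A = hyperbolic_area A"
 unfolding hm_def hyperbolic_area_def by (subst emeasure_density) auto

lemma countable_group: "countable \<Gamma>"
proof -
 have "g \<in> (\<Union>n::nat. {g \<in> \<Gamma>. norm g <= real n})" if "g \<in> \<Gamma>" for g
  using real_arch_simple[of "norm g"] that by auto
 then have "\<Gamma> \<subseteq> (\<Union>n::nat. {g \<in> \<Gamma>. norm g <= real n})" by (rule subsetI)
 moreover have "countable (\<Union>n::nat. {g \<in> \<Gamma>. norm g <= real n})"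
  by (rule countable_UN[OF countableI_type countable_finite[OF finite_bounded]])
 ultimately show ?thesis by (rule countable_subset)
qed

text \<open>The image of B in the quotient, drawn inside F.\<close>

definition part :: "complex set => complex set" where
 "part B = {w \<in> F. \<exists>\<gamma>\<in>\<Gamma>. mobius \<gamma> w \<in> B}"

lemma part_borel:
 assumes "B \<in> sets borel"
 shows "part B \<in> sets borel"
proof -
 have "part B = (\<Union>\<gamma>\<in>\<Gamma>. F \<inter> mobius \<gamma> -` B)" by (auto simp: part_def)
 also have "\<dots> \<in> sets borel"
  using assms F_borel borel_vimage_mobius countable_group by (intro sets.countable_UN') auto
 finally show ?thesis .
qed

text \<open>B is covered by translates of pieces of F. Each translate has the area of its piece by
  invariance, and a point of F lies in at most N pieces, so integrating the multiplicity over
  \<open>part B\<close> gives the bound.\<close>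

lemma area_le_part:
 assumes B: "B \<in> sets borel" "B \<subseteq> \<H>"
  and N: "!!w. Im w > 0 ==> finite {\<gamma> \<in> \<Gamma>. mobius \<gamma> w \<in> B} \<and> card {\<gamma> \<in> \<Gamma>. mobius \<gamma> w \<in> B} <= N"
 shows "hyperbolic_area B <= of_nat N * hyperbolic_area (part B)"
proof -
 \<comment> \<open>Finite pieces of the group that exhaust it; the sums stay finite and the measure
   of B is the supremum over n.\<close>
 define T where "T n = {g \<in> \<Gamma>. norm g <= real n}" for n :: nat
 have T: "finite (T n)" "T n \<subseteq> \<Gamma>" for n unfolding T_def by (rule finite_bounded) auto
 define A where "A \<gamma> = B \<inter> (\<H> \<inter> mobius (adj2 \<gamma>) -` F)" for \<gamma>
 have Hb: "\<H> \<in> sets borel" using open_H by simp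
 have Ab: "A \<gamma> \<in> sets borel" for \<gamma>
  unfolding A_def using B(1) F_borel borel_vimage_mobius Hb by (intro sets.Int) auto
 have aA: "hyperbolic_area (A \<gamma>) = hyperbolic_area (F \<inter> mobius \<gamma> -` B)" if \<gamma>: "\<gamma> \<in> \<Gamma>" for \<gamma>
 proof -
  have img: "mobius \<gamma> ` (F \<inter> mobius \<gamma> -` B) = A \<gamma>"
  proof
   show "mobius \<gamma> ` (F \<inter> mobius \<gamma> -` B) \<subseteq> A \<gamma>"
    using F_sub \<gamma> by (auto simp: A_def mobius_adj2 subset_iff)
   show "A \<gamma> \<subseteq> mobius \<gamma> ` (F \<inter> mobius \<gamma> -` B)"
   proof
    fix z assume z: "z \<in> A \<gamma>"
    then have "z = mobius \<gamma> (mobius (adj2 \<gamma>) z)" using \<gamma> by (simp add: A_def mobius_adj2)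
    with z show "z \<in> mobius \<gamma> ` (F \<inter> mobius \<gamma> -` B)" by (auto simp: A_def)
   qed
  qed
  have FB: "F \<inter> mobius \<gamma> -` B \<in> sets borel" using F_borel B(1) borel_vimage_mobius by auto
  have "hyperbolic_area (F \<inter> mobius \<gamma> -` B) <= hyperbolic_area F"
   unfolding hyperbolic_area_def by (intro nn_integral_mono) (auto simp: indicator_def)
  then have "hyperbolic_area (F \<inter> mobius \<gamma> -` B) < \<infinity>" using F_area by (rule le_less_trans)
  then show ?thesis
   using hyperbolic_area_mobius[OF FB _ det1[OF \<gamma>]] F_sub Ab img by auto
 qed
 have Un: "hyperbolic_area (\<Union>\<gamma>\<in>T n. A \<gamma>) <= of_nat N * hyperbolic_area (part B)" for n
 proof -
  have "hyperbolic_area (\<Union>\<gamma>\<in>T n. A \<gamma>) = emeasure hm (\<Union>\<gamma>\<in>T n. A \<gamma>)"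
   using Ab T by (subst emeasure_hm) (auto intro: sets.finite_UN)
  also have "\<dots> <= (\<Sum>\<gamma>\<in>T n. emeasure hm (A \<gamma>))"
   using Ab T by (intro emeasure_subadditive_finite) auto
  also have "\<dots> = (\<Sum>\<gamma>\<in>T n. hyperbolic_area (F \<inter> mobius \<gamma> -` B))"
   using T aA emeasure_hm[OF Ab] by (intro sum.cong) auto
  also have "\<dots> = (\<integral>\<^sup>+w. (\<Sum>\<gamma>\<in>T n. ennreal (1 / (Im w)^2) * indicator (F \<inter> mobius \<gamma> -` B) w) \<partial>lborel)"
   unfolding hyperbolic_area_def
   using F_borel B(1) borel_vimage_mobius by (subst nn_integral_sum) auto
  also have "\<dots> <= (\<integral>\<^sup>+w. of_nat N * (ennreal (1 / (Im w)^2) * indicator (part B) w) \<partial>lborel)"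
  proof (rule nn_integral_mono)
   fix w
   show "(\<Sum>\<gamma>\<in>T n. ennreal (1 / (Im w)^2) * indicator (F \<inter> mobius \<gamma> -` B) w) <=
     of_nat N * (ennreal (1 / (Im w)^2) * indicator (part B) w)"
   proof (cases "w \<in> F")
    case True
    then have wI: "Im w > 0" using F_sub by auto
    have "(\<Sum>\<gamma>\<in>T n. ennreal (1 / (Im w)^2) * indicator (F \<inter> mobius \<gamma> -` B) w) =
      (\<Sum>\<gamma>\<in>T n. if mobius \<gamma> w \<in> B then ennreal (1 / (Im w)^2) else 0)"
     using True by (intro sum.cong) (auto simp: indicator_def)
    also have "\<dots> = (\<Sum>\<gamma>\<in>{\<gamma> \<in> T n. mobius \<gamma> w \<in> B}. ennreal (1 / (Im w)^2))"
     by (rule sum.inter_filter[symmetric]) (rule T)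
    also have "\<dots> = of_nat (card {\<gamma> \<in> T n. mobius \<gamma> w \<in> B}) * ennreal (1 / (Im w)^2)" by simp
    also have "\<dots> <= of_nat N * (ennreal (1 / (Im w)^2) * indicator (part B) w)"
    proof (cases "w \<in> part B")
     case wB: True
     have "card {\<gamma> \<in> T n. mobius \<gamma> w \<in> B} <= card {\<gamma> \<in> \<Gamma>. mobius \<gamma> w \<in> B}"
      using N[OF wI] T(2)[of n] by (intro card_mono) auto
     then have "card {\<gamma> \<in> T n. mobius \<gamma> w \<in> B} <= N" using N[OF wI] by linarith
     then show ?thesis using wB by (auto intro!: mult_right_mono)
    next
     case False
     then have "{\<gamma> \<in> T n. mobius \<gamma> w \<in> B} = {}" using True T(2)[of n] by (auto simp: part_def)
     then show ?thesis by (metis card.empty mult_zero_left of_nat_0 zero_le)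
    qed
    finally show ?thesis .
   qed (auto simp: part_def)
  qed
  also have "\<dots> = of_nat N * hyperbolic_area (part B)"
   unfolding hyperbolic_area_def using part_borel[OF B(1)] by (subst nn_integral_cmult) auto
  finally show ?thesis .
 qed
 have "B = (\<Union>n. \<Union>\<gamma>\<in>T n. A \<gamma>)"
 proof
  show "B \<subseteq> (\<Union>n. \<Union>\<gamma>\<in>T n. A \<gamma>)"
  proof
   fix z assume z: "z \<in> B"
   then have zI: "Im z > 0" using B by auto
   obtain \<gamma> w where g: "\<gamma> \<in> \<Gamma>" "w \<in> F" "z = mobius \<gamma> w" using F_cover[OF zI] by blast
   have "mobius (adj2 \<gamma>) z = w" using g F_sub by (simp add: mobius_adj2 subset_iff)
   then have "z \<in> A \<gamma>" using z zI g by (simp add: A_def)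
   moreover obtain n where "norm \<gamma> <= real n" using real_arch_simple by blast
   ultimately show "z \<in> (\<Union>n. \<Union>\<gamma>\<in>T n. A \<gamma>)" using g by (auto simp: T_def)
  qed
 qed (auto simp: A_def)
 moreover have "emeasure hm (\<Union>n. \<Union>\<gamma>\<in>T n. A \<gamma>) = (SUP n. emeasure hm (\<Union>\<gamma>\<in>T n. A \<gamma>))"
 proof (rule SUP_emeasure_incseq[symmetric])
  show "range (\<lambda>n. \<Union>\<gamma>\<in>T n. A \<gamma>) \<subseteq> sets hm" using Ab T by (auto intro: sets.finite_UN)
  show "incseq (\<lambda>n. \<Union>\<gamma>\<in>T n. A \<gamma>)" by (rule incseq_SucI) (force simp: T_def)
 qed
 moreover have "(SUP n. emeasure hm (\<Union>\<gamma>\<in>T n. A \<gamma>)) <= of_nat N * hyperbolic_area (part B)"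
 proof (rule SUP_least)
  fix n
  have "(\<Union>\<gamma>\<in>T n. A \<gamma>) \<in> sets borel" using Ab T by (auto intro: sets.finite_UN)
  then show "emeasure hm (\<Union>\<gamma>\<in>T n. A \<gamma>) <= of_nat N * hyperbolic_area (part B)"
   using Un[of n] by (simp add: emeasure_hm)
 qed
 ultimately show ?thesis using emeasure_hm[OF B(1)] by metis
qed

text \<open>A lower bound for how far all nontrivial elements are from acting trivially near z,
  comparable to a bound on the injectivity radius.\<close>

definition thick :: "real => complex => bool" where
 "thick \<epsilon> z \<longleftrightarrow> Im z > 0 \<and> (\<forall>\<gamma>\<in>\<Gamma>. \<gamma> ~= I2 --> \<epsilon> <= norm (conj_at z \<gamma> - I2))"

text \<open>Two elements that take w into the disc about z differ by an element which, seen from z,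
  has norm at most 30. Thickness separates these by \<epsilon> / 30, and packing bounds their number
  uniformly in z and w.\<close>

lemma thick_count:
 assumes "\<epsilon> > 0"
 obtains N :: nat where "!!z w. thick \<epsilon> z ==> Im w > 0 ==>
  finite {\<gamma> \<in> \<Gamma>. mobius \<gamma> w \<in> ball z (Im z / 2)} \<and> card {\<gamma> \<in> \<Gamma>. mobius \<gamma> w \<in> ball z (Im z / 2)} <= N"
proof -
 have bd: "bounded {g::real^2^2. norm g <= 30}" by (auto simp: bounded_iff)
 obtain N where N: "!!S. S \<subseteq> {g::real^2^2. norm g <= 30} ==>
   (!!x y. x \<in> S ==> y \<in> S ==> x ~= y ==> \<epsilon> / 30 <= dist x y) ==> finite S \<and> card S <= (N::nat)"
  using separated_card_bound[OF bd, of "\<epsilon> / 30"] assms by (metis divide_pos_pos zero_less_numeral)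
 show thesis
 proof (rule that[of N])
  fix z w assume z: "thick \<epsilon> z" and w: "Im w > 0"
  have zI: "Im z > 0" using z by (simp add: thick_def)
  define T where "T = {\<gamma> \<in> \<Gamma>. mobius \<gamma> w \<in> ball z (Im z / 2)}"
  have "finite T \<and> card T <= N"
  proof (cases "T = {}")
   case False
   then obtain k where k: "k \<in> \<Gamma>" "mobius k w \<in> ball z (Im z / 2)" by (auto simp: T_def)
   define \<phi> where "\<phi> \<gamma> = conj_at z (\<gamma> ** adj2 k)" for \<gamma>
   have inj: "inj_on \<phi> T"
   proof (rule inj_onI)
    fix a b assume ab: "a \<in> T" "b \<in> T" "\<phi> a = \<phi> b"
    then have "a ** adj2 k = b ** adj2 k" using conj_at_inj[OF zI] by (simp add: \<phi>_def)
    then have "a ** adj2 k ** k = b ** adj2 k ** k" by simp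
    then show "a = b" using k by (simp add: adj2_cancel)
   qed
   have nm: "norm (\<phi> a) <= 30" if a: "a \<in> T" for a
   proof -
    have aG: "a \<in> \<Gamma>" "mobius a w \<in> ball z (Im z / 2)" using a by (auto simp: T_def)
    have "mobius (a ** adj2 k) (mobius k w) = mobius (a ** adj2 k ** k) w"
     using aG k w by (simp add: mobius_mult Determinants.det_mul)
    also have "\<dots> = mobius a w" using k by (simp add: adj2_cancel)
    finally have "mobius (a ** adj2 k) (mobius k w) \<in> ball z (Im z / 2)" using aG by simp
    then show ?thesis
     unfolding \<phi>_def conj_at_def
     using norm_le_if_balls_meet[OF _ zI zI k(2), of "a ** adj2 k"] aG k by (simp add: Determinants.det_mul)
   qed
   have "finite (\<phi> ` T) \<and> card (\<phi> ` T) <= N"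
   proof (rule N)
    show "\<phi> ` T \<subseteq> {g. norm g <= 30}" using nm by auto
    fix x y assume "x \<in> \<phi> ` T" "y \<in> \<phi> ` T" "x ~= y"
    then obtain a b where ab: "a \<in> T" "b \<in> T" "x = \<phi> a" "y = \<phi> b" "a ~= b" by blast
    have aG: "a \<in> \<Gamma>" "b \<in> \<Gamma>" using ab by (auto simp: T_def)
    define c where "c = adj2 (a ** adj2 k) ** (b ** adj2 k)"
    have cG: "c \<in> \<Gamma>" unfolding c_def by (intro mult_mem adj_mem aG k)
    have "c ~= I2"
    proof
     assume "c = I2"
     then have "(a ** adj2 k) ** c = a ** adj2 k" by simp
     moreover have "det (a ** adj2 k) = 1" using aG k by (simp add: Determinants.det_mul)
     ultimately have "b ** adj2 k = a ** adj2 k" unfolding c_def by (simp add: adj2_cancel)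
     then have "b ** adj2 k ** k = a ** adj2 k ** k" by simp
     then show False using k ab(5) by (simp add: adj2_cancel)
    qed
    then have "\<epsilon> <= norm (conj_at z c - I2)" using z cG by (simp add: thick_def)
    also have "conj_at z c - I2 = adj2 x ** (y - x)"
    proof -
     have "det x = 1" unfolding ab \<phi>_def conj_at_def using aG k zI by (simp add: Determinants.det_mul)
     then have "adj2 x ** (y - x) = adj2 x ** y - I2" by (simp add: mult_diff_distrib2 adj2_inverse)
     moreover have "conj_at z c = adj2 x ** y"
      unfolding c_def conj_at_mult[OF zI, of "adj2 (a ** adj2 k)"] by (simp only: ab \<phi>_def conj_at_adj2)
     ultimately show ?thesis by simp
    qed
    also have "norm (adj2 x ** (y - x)) <= norm (adj2 x) * norm (y - x)" by (rule norm_mult2_le)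
    also have "\<dots> <= 30 * dist x y"
     using nm[OF ab(1)] by (intro mult_mono) (auto simp: ab dist_norm norm_minus_commute)
    finally show "\<epsilon> / 30 <= dist x y" by simp
   qed
   then show ?thesis using inj by (metis card_image finite_imageD)
  qed simp
  then show "finite {\<gamma> \<in> \<Gamma>. mobius \<gamma> w \<in> ball z (Im z / 2)} \<and>
    card {\<gamma> \<in> \<Gamma>. mobius \<gamma> w \<in> ball z (Im z / 2)} <= N" by (simp add: T_def)
 qed
qed

end

section \<open>Compactness of the thick part and finiteness of the thin pieces\<close>

context finite_area_SL2
begin

text \<open>Take thick points whose discs have pairwise disjoint images in the quotient. Each image
  has area at least 4/(25 N), so their number is bounded. In a family of largest size, the disc of
  every thick point meets a translate of one of the chosen discs.\<close>

lemma thick_reps: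
 assumes "\<epsilon> > 0"
 obtains Z where "finite Z" "!!z. z \<in> Z ==> Im z > 0"
  "!!z. thick \<epsilon> z ==> \<exists>z'\<in>Z. \<exists>\<gamma>\<in>\<Gamma>. norm (adj2 (to_point z') ** \<gamma> ** to_point z) <= 30"
proof -
 obtain N where N: "!!z w. thick \<epsilon> z ==> Im w > 0 ==>
  finite {\<gamma> \<in> \<Gamma>. mobius \<gamma> w \<in> ball z (Im z / 2)} \<and> card {\<gamma> \<in> \<Gamma>. mobius \<gamma> w \<in> ball z (Im z / 2)} <= (N::nat)"
  using thick_count[OF assms] by blast
 define B where "B z = ball z (Im z / 2)" for z
 define meet where "meet z z' \<longleftrightarrow> (\<exists>u\<in>B z. \<exists>\<gamma>\<in>\<Gamma>. mobius \<gamma> u \<in> B z')" for z z'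
 define good where "good Z \<longleftrightarrow> finite Z \<and> (\<forall>z\<in>Z. thick \<epsilon> z) \<and> (\<forall>z\<in>Z. \<forall>z'\<in>Z. z ~= z' --> \<not> meet z z')" for Z
 have BH: "B z \<subseteq> \<H>" for z unfolding B_def using ball_Im_pos(2) by auto
 have bound: "ennreal (real (card Z) * (4/25)) <= of_nat N * hyperbolic_area F" if Z: "good Z" for Z
 proof -
  have fZ: "finite Z" using Z by (simp add: good_def)
  have disj: "disjoint_family_on (\<lambda>z. part (B z)) Z"
   unfolding disjoint_family_on_def
  proof (intro ballI impI)
   fix z z' assume zz: "z \<in> Z" "z' \<in> Z" "z ~= z'"
   show "part (B z) \<inter> part (B z') = {}"
   proof (rule ccontr)
    assume "part (B z) \<inter> part (B z') ~= {}"
    then obtain w a b where w: "w \<in> F" "a \<in> \<Gamma>" "b \<in> \<Gamma>" "mobius a w \<in> B z" "mobius b w \<in> B z'"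
     by (auto simp: part_def)
    have wI: "Im w > 0" using w(1) F_sub by auto
    have "mobius (b ** adj2 a) (mobius a w) = mobius (b ** adj2 a ** a) w"
     using w wI by (simp add: mobius_mult Determinants.det_mul)
    then have "mobius (b ** adj2 a) (mobius a w) = mobius b w" using w by (simp add: adj2_cancel)
    moreover have "b ** adj2 a \<in> \<Gamma>" by (intro mult_mem adj_mem w)
    ultimately have "meet z z'" unfolding meet_def using w by metis
    then show False using Z zz by (auto simp: good_def)
   qed
  qed
  have Bb: "B z \<in> sets borel" for z by (simp add: B_def)
  have "ennreal (real (card Z) * (4/25)) = (\<Sum>z\<in>Z. ennreal (4/25))"
   by (subst ennreal_mult) (simp_all add: ennreal_of_nat_eq_real_of_nat)
  also have "\<dots> <= (\<Sum>z\<in>Z. of_nat N * hyperbolic_area (part (B z)))"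
  proof (rule sum_mono)
   fix z assume "z \<in> Z"
   then have z: "thick \<epsilon> z" using Z by (simp add: good_def)
   then have "ennreal (4/25) <= hyperbolic_area (B z)"
    unfolding B_def by (intro area_ball_ge) (simp add: thick_def)
   also have "\<dots> <= of_nat N * hyperbolic_area (part (B z))"
    by (rule area_le_part[OF Bb BH]) (use N[OF z] in \<open>simp add: B_def\<close>)
   finally show "ennreal (4/25) <= of_nat N * hyperbolic_area (part (B z))" .
  qed
  also have "\<dots> = of_nat N * (\<Sum>z\<in>Z. emeasure hm (part (B z)))"
   using emeasure_hm[OF part_borel[OF Bb]] by (simp add: sum_distrib_left)
  also have "(\<Sum>z\<in>Z. emeasure hm (part (B z))) = emeasure hm (\<Union>z\<in>Z. part (B z))"
   using part_borel[OF Bb] disj fZ by (intro sum_emeasure) auto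
  also have "\<dots> <= emeasure hm F"
   using F_borel by (intro emeasure_mono) (auto simp: part_def)
  finally show ?thesis using F_borel by (simp add: emeasure_hm mult_left_mono)
 qed
 have "of_nat N * hyperbolic_area F < \<infinity>" using F_area by (simp add: ennreal_mult_less_top of_nat_less_top)
 then obtain r where r: "of_nat N * hyperbolic_area F = ennreal r" "r \<ge> 0"
  by (metis ennreal_cases infinity_ennreal_def order_less_irrefl)
 have cb: "card Z <= nat \<lceil>25 * r / 4\<rceil>" if "good Z" for Z
 proof -
  have "real (card Z) * (4/25) <= r" using bound[OF that] r by (simp add: ennreal_le_iff)
  then have "real (card Z) <= 25 * r / 4" by simp
  then show ?thesis by linarith
 qed
 have "good {}" by (simp add: good_def)
 \<comment> \<open>A family of maximal cardinality; it exists because \<open>cb\<close> bounds all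
   cardinalities.\<close>
 then obtain Z where Z: "good Z" "!!Z'. good Z' ==> card Z' <= card Z"
  using ex_has_greatest_nat[of good "{}" card "nat \<lceil>25 * r / 4\<rceil> + 1"] cb by (metis Suc_eq_plus1 le_imp_less_Suc)
 show thesis
 proof (rule that[of Z])
  show "finite Z" "!!z. z \<in> Z ==> Im z > 0" using Z by (auto simp: good_def thick_def)
  fix z assume z: "thick \<epsilon> z"
  have zI: "Im z > 0" using z by (simp add: thick_def)
  have refl: "meet z z"
   unfolding meet_def B_def using zI by (intro bexI[of _ z] bexI[of _ I2]) auto
  have symm: "meet a b" if m: "meet b a" for a b
  proof -
   obtain u \<gamma> where u: "u \<in> B b" "\<gamma> \<in> \<Gamma>" "mobius \<gamma> u \<in> B a" using m by (auto simp: meet_def)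
   have "mobius (adj2 \<gamma>) (mobius \<gamma> u) = u" using u BH[of b] by (intro mobius_adj2) auto
   then show ?thesis unfolding meet_def using u adj_mem by metis
  qed
  have "\<exists>z'\<in>Z. meet z z'"
  proof (rule ccontr)
   assume no: "\<not> (\<exists>z'\<in>Z. meet z z')"
   then have "z \<notin> Z" using refl by blast
   have "good (insert z Z)" using Z(1) z no symm unfolding good_def by blast
   then have "card (insert z Z) <= card Z" by (rule Z(2))
   then show False using \<open>z \<notin> Z\<close> Z(1) by (simp add: good_def)
  qed
  then obtain z' u \<gamma> where m: "z' \<in> Z" "u \<in> B z" "\<gamma> \<in> \<Gamma>" "mobius \<gamma> u \<in> B z'" by (auto simp: meet_def)
  have "Im z' > 0" using m(1) Z(1) by (auto simp: good_def thick_def)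
  then have "norm (adj2 (to_point z') ** \<gamma> ** to_point z) <= 30"
   using norm_le_if_balls_meet[OF det1[OF m(3)] zI, of z' u] m by (simp add: B_def)
  then show "\<exists>z'\<in>Z. \<exists>\<gamma>\<in>\<Gamma>. norm (adj2 (to_point z') ** \<gamma> ** to_point z) <= 30" using m by blast
 qed
qed

text \<open>A thick point has a translate \<open>mobius (to_point z') (mobius k \<i>)\<close> with
  z' from a finite set and k of norm at most 30, which is a compact set of points. The open V around
  it leaves room for the perturbation of a boundary point in \<open>thick_thin\<close>.\<close>

lemma thick_cocompact:
 assumes "\<epsilon> > 0"
 obtains V C where "open V" "compact C" "V \<subseteq> C" "C \<subseteq> \<H>" "!!z. thick \<epsilon> z ==> \<exists>\<gamma>\<in>\<Gamma>. mobius \<gamma> z \<in> V"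
proof -
 obtain Z where Z: "finite Z" "!!z. z \<in> Z ==> Im z > 0"
  "!!z. thick \<epsilon> z ==> \<exists>z'\<in>Z. \<exists>\<gamma>\<in>\<Gamma>. norm (adj2 (to_point z') ** \<gamma> ** to_point z) <= 30"
  using thick_reps[OF assms] by blast
 define K :: "(real^2^2) set" where "K = {k. det k = 1} \<inter> cball 0 30"
 have "closed {k::real^2^2. det k = 1}"
  unfolding det_2 by (intro closed_Collect_eq continuous_intros)
 then have K: "compact K" unfolding K_def by (intro closed_Int_compact compact_cball)
 define f where "f z k = mobius (to_point z) (mobius k \<i>)" for z k
 have fH: "Im (f z k) > 0" if "z \<in> Z" "k \<in> K" for z k using Z(2) that by (simp add: f_def K_def)
 define C0 where "C0 = (\<Union>z\<in>Z. f z ` K)"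
 have "continuous_on K (f z)" if "z \<in> Z" for z
  using jfac_nz[of _ \<i>] unfolding f_def mobius_to_point[OF Z(2)[OF that]] unfolding mobius_eq jfac_def
  by (intro continuous_intros) (auto simp: K_def jfac_def)
 then have C0: "compact C0" unfolding C0_def
  using Z(1) by (intro compact_UN compact_continuous_image K) auto
 have "C0 \<subseteq> \<H>" using fH by (auto simp: C0_def)
 then obtain e where e: "e > 0" "(\<Union>x\<in>C0. cball x e) \<subseteq> \<H>"
  using compact_subset_open_imp_cball_epsilon_subset[OF C0 open_H] by blast
 show thesis
 proof (rule that[of "\<Union>x\<in>C0. ball x e" "\<Union>x\<in>C0. cball x e"])
  show "compact (\<Union>x\<in>C0. cball x e)" by (rule compact_minkowski_sum_cball[OF C0])
  fix z assume z: "thick \<epsilon> z"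
  then have zI: "Im z > 0" by (simp add: thick_def)
  obtain z' \<gamma> where m: "z' \<in> Z" "\<gamma> \<in> \<Gamma>" "norm (adj2 (to_point z') ** \<gamma> ** to_point z) <= 30" using Z(3)[OF z] by blast
  have z'I: "Im z' > 0" using Z(2) m(1) by simp
  define k where "k = adj2 (to_point z') ** \<gamma> ** to_point z"
  have "k \<in> K" using m zI z'I by (simp add: k_def K_def Determinants.det_mul)
  have zi: "mobius (to_point z) \<i> = z" using mobius_to_point[OF zI] by (simp add: complex_eq_iff)
  have "f z' k = mobius (to_point z' ** k ** adj2 (to_point z)) z"
   using \<open>k \<in> K\<close> zI z'I mobius_adj2(1)[of "to_point z" \<i>]
   by (simp add: f_def K_def mobius_mult Determinants.det_mul zi)
  also have "to_point z' ** k ** adj2 (to_point z) = \<gamma>"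
   using zI z'I by (simp add: k_def matrix_mul_assoc[symmetric] adj2_cancel adj2_inverse)
  finally have "mobius \<gamma> z \<in> C0" unfolding C0_def using m(1) \<open>k \<in> K\<close> by (metis UN_I image_eqI)
  then show "\<exists>\<gamma>\<in>\<Gamma>. mobius \<gamma> z \<in> (\<Union>x\<in>C0. ball x e)" using m(2) e(1) centre_in_ball by blast
 qed (use e in auto)
qed

text \<open>For parabolic \<delta> a neighbourhood of its cusp, for hyperbolic \<delta> a
  neighbourhood of its axis. Taking all elements that commute with \<delta> makes the set the same
  for every non-scalar generator of one centralizer.\<close>

definition thin :: "real^2^2 => complex set" where
 "thin \<delta> = {z \<in> \<H>. \<exists>\<alpha>\<in>\<Gamma>. \<alpha> ~= I2 \<and> \<alpha> ** \<delta> = \<delta> ** \<alpha> \<and> norm (conj_at z \<alpha> - I2) < 1/10}"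

lemma continuous_conj_at:
 assumes "\<alpha> \<in> \<Gamma>"
 shows "continuous_on \<H> (\<lambda>z. norm (conj_at z \<alpha> - I2))"
proof -
 have "continuous_on \<H> (\<lambda>z. sqrt ((cmod (quad \<alpha> z) / Im z)^2 + 4 - 2 * trace \<alpha>))"
  unfolding quad_def by (intro continuous_intros) auto
 then show ?thesis
  by (rule continuous_on_eq) (use assms in \<open>simp add: norm_conj_at_diff[symmetric]\<close>)
qed

lemma open_thin: "open (thin \<delta>)"
proof -
 have o: "open {z \<in> \<H>. norm (conj_at z \<alpha> - I2) < 1/10}" if "\<alpha> \<in> \<Gamma>" for \<alpha>
 proof -
  have "open ((\<lambda>z. norm (conj_at z \<alpha> - I2)) -` {..<1/10} \<inter> \<H>)"
   by (rule continuous_on_open_vimage[OF open_H, THEN iffD1, rule_format, OF continuous_conj_at[OF that]]) simp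
  moreover have "(\<lambda>z. norm (conj_at z \<alpha> - I2)) -` {..<1/10} \<inter> \<H> = {z \<in> \<H>. norm (conj_at z \<alpha> - I2) < 1/10}" by auto
  ultimately show ?thesis by simp
 qed
 have "thin \<delta> = (\<Union>\<alpha>\<in>{\<alpha>\<in>\<Gamma>. \<alpha> ~= I2 \<and> \<alpha> ** \<delta> = \<delta> ** \<alpha>}. {z \<in> \<H>. norm (conj_at z \<alpha> - I2) < 1/10})"
  by (auto simp: thin_def)
 then show ?thesis using o by auto
qed

lemma nonscalar:
 assumes "\<alpha> \<in> \<Gamma>" "\<alpha> ~= I2" "norm (conj_at z \<alpha> - I2) < 1/10" "Im z > 0"
 shows "\<alpha> ~= x *\<^sub>R I2"
proof
 assume a: "\<alpha> = x *\<^sub>R I2"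
 then have "\<alpha> = - I2" using scalar_mem[of x] assms by simp
 then have "conj_at z \<alpha> = - I2" using assms(4) by (simp add: conj_at_def uminus_mult_mat2 adj2_inverse)
 then have "\<bar>(conj_at z \<alpha> - I2)$1$1\<bar> = 2" by simp
 then show False using abs_entry_le_norm2[of "conj_at z \<alpha> - I2" 1 1] assms(3) by linarith
qed

lemma near_commute:
 assumes "\<alpha> \<in> \<Gamma>" "\<beta> \<in> \<Gamma>" "norm (conj_at z \<alpha> - I2) < 1/10" "norm (conj_at z \<beta> - I2) < 1/10" and z: "Im z > 0"
 shows "\<alpha> ** \<beta> = \<beta> ** \<alpha>"
proof -
 interpret c: discrete_SL2 "(\<lambda>\<gamma>. adj2 (to_point z) ** \<gamma> ** to_point z) ` \<Gamma>"
  by (rule discrete_SL2_conj) (unfold_locales, use z in simp)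
 have "conj_at z \<alpha> ** conj_at z \<beta> = conj_at z \<beta> ** conj_at z \<alpha>"
  using assms by (intro c.zassenhaus) (auto simp: conj_at_def)
 then have "conj_at z (\<alpha> ** \<beta>) = conj_at z (\<beta> ** \<alpha>)" using z by (simp add: conj_at_mult)
 then show ?thesis using conj_at_inj[OF z] by blast
qed

lemma mobius_conj_at:
 assumes "\<alpha> \<in> \<Gamma>" "\<gamma> \<in> \<Gamma>" "Im z > 0"
 shows "norm (conj_at (mobius \<gamma> z) (\<gamma> ** \<alpha> ** adj2 \<gamma>) - I2) = norm (conj_at z \<alpha> - I2)"
proof -
 have "adj2 \<gamma> ** (\<gamma> ** \<alpha> ** adj2 \<gamma>) ** \<gamma> = \<alpha>"
  using assms by (simp add: matrix_mul_assoc[symmetric] adj2_cancel adj2_inverse)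
 moreover have "trace (\<gamma> ** \<alpha> ** adj2 \<gamma>) = trace \<alpha>"
  using assms by (metis adj2_inverse(2) det1 matrix_mul_assoc matrix_mul_rid trace_mul_sym)
 ultimately have "(norm (conj_at (mobius \<gamma> z) (\<gamma> ** \<alpha> ** adj2 \<gamma>) - I2))^2 = (norm (conj_at z \<alpha> - I2))^2"
  using assms quad_ratio_conj[of \<gamma> z "\<gamma> ** \<alpha> ** adj2 \<gamma>"] by (simp add: norm_conj_at_diff Determinants.det_mul)
 then show ?thesis by (simp add: power2_eq_iff_nonneg)
qed

lemma finite_near_compact:
 assumes "compact C" "C \<subseteq> \<H>"
 shows "finite {\<delta> \<in> \<Gamma>. \<exists>p\<in>C. norm (conj_at p \<delta>) <= r}"
proof -
 have "bounded (to_point ` C)"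
 proof -
  have "continuous_on C (\<lambda>z. \<bar>sqrt (Im z)\<bar> + \<bar>Re z / sqrt (Im z)\<bar> + \<bar>0\<bar> + \<bar>1 / sqrt (Im z)\<bar>)"
   using assms(2) by (intro continuous_intros) auto
  then have "compact ((\<lambda>z. \<bar>sqrt (Im z)\<bar> + \<bar>Re z / sqrt (Im z)\<bar> + \<bar>0\<bar> + \<bar>1 / sqrt (Im z)\<bar>) ` C)"
   by (rule compact_continuous_image[OF _ assms(1)])
  then obtain M where M: "!!z. z \<in> C ==> \<bar>\<bar>sqrt (Im z)\<bar> + \<bar>Re z / sqrt (Im z)\<bar> + \<bar>0\<bar> + \<bar>1 / sqrt (Im z)\<bar>\<bar> <= M"
   by (meson bounded_real compact_imp_bounded imageI)
  have "norm (to_point z) <= M" if "z \<in> C" for z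
   using norm2_le_sum[of "to_point z"] M[OF that] unfolding to_point_def mat2_entries by linarith
  then show ?thesis unfolding bounded_iff by blast
 qed
 then obtain M where M: "M > 0" "!!z. z \<in> C ==> norm (to_point z) <= M"
  unfolding bounded_pos by blast
 have "{\<delta> \<in> \<Gamma>. \<exists>p\<in>C. norm (conj_at p \<delta>) <= r} \<subseteq> {\<delta> \<in> \<Gamma>. norm \<delta> <= M * r * M}"
 proof clarify
  fix \<delta> p assume d: "\<delta> \<in> \<Gamma>" "p \<in> C" "norm (conj_at p \<delta>) <= r"
  have pI: "Im p > 0" using d assms by auto
  have "norm \<delta> = norm (to_point p ** conj_at p \<delta> ** adj2 (to_point p))" using pI by (simp add: conj_at_inverse)
  also have "\<dots> <= norm (to_point p ** conj_at p \<delta>) * norm (to_point p)"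
   using norm_mult2_le[of _ "adj2 (to_point p)"] by simp
  also have "\<dots> <= (norm (to_point p) * norm (conj_at p \<delta>)) * norm (to_point p)"
   by (intro mult_right_mono norm_mult2_le) auto
  also have "\<dots> <= (M * r) * M"
  proof -
   have "r \<ge> 0" using d(3) norm_ge_zero order_trans by blast
   then show ?thesis using M d by (intro mult_mono) auto
  qed
  finally show "norm \<delta> <= M * r * M" .
 qed
 then show ?thesis by (rule finite_subset) (rule finite_bounded)
qed

text \<open>A point that is not thick lies in \<open>thin \<alpha>\<close> for some \<alpha>. Unless
  that set is all of the half plane, connectedness gives it a boundary point. This boundary point is
  thick, so it can be moved into a fixed compact set, near which only finitely many elements come
  close to the identity. Up to conjugation finitely many \<delta> thus suffice.\<close>

lemma thick_thin:
 obtains C D where "compact C" "C \<subseteq> \<H>" "finite D" "D \<subseteq> \<Gamma>" "!!\<delta> x. \<delta> \<in> D ==> \<delta> ~= x *\<^sub>R I2"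
  "!!z. Im z > 0 ==> \<exists>\<gamma>\<in>\<Gamma>. mobius \<gamma> z \<in> C \<or> (\<exists>\<delta>\<in>D. mobius \<gamma> z \<in> thin \<delta>)"
proof -
 obtain V C where VC: "open V" "compact C" "V \<subseteq> C" "C \<subseteq> \<H>" "!!z. thick (1/10) z ==> \<exists>\<gamma>\<in>\<Gamma>. mobius \<gamma> z \<in> V"
  using thick_cocompact[of "1/10"] by auto
 \<comment> \<open>The bound 2 leaves room for the norm of \<open>I2\<close>, below 1.415, plus the
   thinness constant 1/10.\<close>
 define D0 where "D0 = {\<delta> \<in> \<Gamma>. \<exists>p\<in>C. norm (conj_at p \<delta>) <= 2} \<inter> {\<delta>. \<forall>x. \<delta> ~= x *\<^sub>R I2}"
 have D0: "finite D0" unfolding D0_def by (intro finite_Int disjI1 finite_near_compact VC)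
 have not_thick: "\<exists>\<alpha>\<in>\<Gamma>. \<alpha> ~= I2 \<and> norm (conj_at z \<alpha> - I2) < 1/10" if "Im z > 0" "\<not> thick (1/10) z" for z
  using that by (auto simp: thick_def not_le)
 have key: "(\<exists>\<gamma>\<in>\<Gamma>. mobius \<gamma> z \<in> C \<or> (\<exists>\<delta>\<in>D0. mobius \<gamma> z \<in> thin \<delta>)) \<or>
   (\<exists>\<alpha>\<in>\<Gamma>. (\<forall>x. \<alpha> ~= x *\<^sub>R I2) \<and> thin \<alpha> = \<H>)" if z: "Im z > 0" for z
 proof (cases "thick (1/10) z")
  case True
  then show ?thesis using VC by blast
 next
  case False
  obtain \<alpha> where a: "\<alpha> \<in> \<Gamma>" "\<alpha> ~= I2" "norm (conj_at z \<alpha> - I2) < 1/10" using not_thick[OF z False] by blast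
  have ans: "!!x. \<alpha> ~= x *\<^sub>R I2" using nonscalar[OF a z] .
  have zt: "z \<in> thin \<alpha>" using a z by (auto simp: thin_def)
  show ?thesis
  proof (cases "thin \<alpha> = \<H>")
   case True
   then show ?thesis using a ans by blast
  next
   case False
   \<comment> \<open>The thin set is open and nonempty; if it were also relatively closed, it would
     be the whole connected half plane.\<close>
   have "\<not> closedin (top_of_set \<H>) (thin \<alpha>)"
   proof
    assume cl: "closedin (top_of_set \<H>) (thin \<alpha>)"
    have op: "openin (top_of_set \<H>) (thin \<alpha>)" using open_thin by (intro open_subset) (auto simp: thin_def)
    have "thin \<alpha> = {} \<or> thin \<alpha> = \<H>"
     using connected_H op cl unfolding connected_clopen by blast
    then show False using zt False by blast
   qed
   moreover have "closedin (top_of_set \<H>) (thin \<alpha>)" if "\<H> \<inter> closure (thin \<alpha>) \<subseteq> thin \<alpha>"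
   proof -
    have "thin \<alpha> = \<H> \<inter> closure (thin \<alpha>)"
     using that closure_subset[of "thin \<alpha>"] by (auto simp: thin_def)
    then show ?thesis using closedin_closed_Int[OF closed_closure, of \<H> "thin \<alpha>"] by metis
   qed
   ultimately obtain p where p: "p \<in> \<H>" "p \<in> closure (thin \<alpha>)" "p \<notin> thin \<alpha>" by blast
   have pI: "Im p > 0" using p by simp
   \<comment> \<open>Otherwise p lies in an open \<open>thin \<beta>\<close> that overlaps
     \<open>thin \<alpha>\<close>. At a common point the witnesses commute by the Zassenhaus
     property, so \<alpha> and \<beta> commute by transitivity, and \<beta> would put p into
     \<open>thin \<alpha>\<close>.\<close>
   have pt: "thick (1/10) p"
   proof (rule ccontr)
    assume "\<not> thick (1/10) p"
    then obtain \<beta> where b: "\<beta> \<in> \<Gamma>" "\<beta> ~= I2" "norm (conj_at p \<beta> - I2) < 1/10" using not_thick[OF pI] by blast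
    have "p \<in> thin \<beta>" using b p by (auto simp: thin_def)
    then have "thin \<beta> \<inter> thin \<alpha> ~= {}"
     using p(2) open_Int_closure_eq_empty[OF open_thin[of \<beta>], of "thin \<alpha>"] by blast
    then obtain q where q: "q \<in> thin \<alpha>" "q \<in> thin \<beta>" by blast
    then have qI: "Im q > 0" by (auto simp: thin_def)
    obtain a' where a': "a' \<in> \<Gamma>" "a' ~= I2" "a' ** \<alpha> = \<alpha> ** a'" "norm (conj_at q a' - I2) < 1/10" using q by (auto simp: thin_def)
    obtain b' where b': "b' \<in> \<Gamma>" "b' ~= I2" "b' ** \<beta> = \<beta> ** b'" "norm (conj_at q b' - I2) < 1/10" using q by (auto simp: thin_def)
    have ab: "a' ** b' = b' ** a'" by (rule near_commute[OF a'(1) b'(1) a'(4) b'(4) qI])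
    have "\<alpha> ** b' = b' ** \<alpha>"
     by (rule commute_trans2[OF nonscalar[OF a'(1,2,4) qI] a'(3)[symmetric] ab[symmetric]])
    then have "\<alpha> ** \<beta> = \<beta> ** \<alpha>"
     by (rule commute_trans2[OF nonscalar[OF b'(1,2,4) qI] _ b'(3)[symmetric]])
    then have "p \<in> thin \<alpha>" using b p by (auto simp: thin_def)
    then show False using p by blast
   qed
   then obtain \<gamma> where \<gamma>: "\<gamma> \<in> \<Gamma>" "mobius \<gamma> p \<in> V" using VC by blast
   \<comment> \<open>The point p itself is not thin, so a nearby point q of
     \<open>thin \<alpha>\<close> is used; openness of V lets \<gamma> move q into V as
     well.\<close>
   define W where "W = mobius \<gamma> -` V \<inter> \<H>"
   have "open W"
    unfolding W_def using VC(1) continuous_on_open_vimage[OF open_H, of "mobius \<gamma>"]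
     holomorphic_on_imp_continuous_on[OF holomorphic_mobius[OF det1[OF \<gamma>(1)]]] by blast
   moreover have "p \<in> W" using p \<gamma> by (auto simp: W_def)
   ultimately have "W \<inter> thin \<alpha> ~= {}"
    using p(2) open_Int_closure_eq_empty[of W "thin \<alpha>"] by blast
   then obtain q where q: "q \<in> thin \<alpha>" "q \<in> \<H>" "mobius \<gamma> q \<in> V" by (auto simp: W_def)
   have qI: "Im q > 0" using q by simp
   obtain a' where a': "a' \<in> \<Gamma>" "a' ~= I2" "a' ** \<alpha> = \<alpha> ** a'" "norm (conj_at q a' - I2) < 1/10" using q by (auto simp: thin_def)
   have a'ns: "!!x. a' ~= x *\<^sub>R I2" using nonscalar[OF a'(1,2,4) qI] .
   define \<delta> where "\<delta> = \<gamma> ** a' ** adj2 \<gamma>"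
   have dG: "\<delta> \<in> \<Gamma>" unfolding \<delta>_def by (intro mult_mem adj_mem \<gamma> a')
   have bk: "adj2 \<gamma> ** \<delta> ** \<gamma> = a'" using \<gamma> by (simp add: \<delta>_def matrix_mul_assoc[symmetric] adj2_cancel adj2_inverse)
   have dns: "\<delta> ~= x *\<^sub>R I2" for x
   proof
    assume "\<delta> = x *\<^sub>R I2"
    then have "a' = x *\<^sub>R I2" using bk \<gamma> by (simp add: scaleR_mult2 adj2_inverse)
    then show False using a'ns by blast
   qed
   have "norm (conj_at (mobius \<gamma> q) \<delta>) <= 2"
   proof -
    have "norm (conj_at (mobius \<gamma> q) \<delta> - I2) < 1/10"
     unfolding \<delta>_def using mobius_conj_at[OF a'(1) \<gamma>(1) qI] a'(4) by simp
    then show ?thesis using norm_triangle_ineq[of I2 "conj_at (mobius \<gamma> q) \<delta> - I2"] norm_I2_le by simp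
   qed
   then have dD: "\<delta> \<in> D0" unfolding D0_def using dG dns q(3) VC(3) by blast
   have "norm (conj_at (mobius \<gamma> z) (\<gamma> ** \<alpha> ** adj2 \<gamma>) - I2) < 1/10"
    using mobius_conj_at[OF a(1) \<gamma>(1) z] a(3) by simp
   moreover have "(\<gamma> ** \<alpha> ** adj2 \<gamma>) ** \<delta> = \<delta> ** (\<gamma> ** \<alpha> ** adj2 \<gamma>)"
   proof -
    have "(\<gamma> ** x ** adj2 \<gamma>) ** (\<gamma> ** y ** adj2 \<gamma>) = \<gamma> ** (x ** y) ** adj2 \<gamma>" for x y
     using \<gamma> by (simp add: matrix_mul_assoc adj2_cancel)
    then show ?thesis unfolding \<delta>_def using a'(3) by simp
   qed
   moreover have "\<gamma> ** \<alpha> ** adj2 \<gamma> \<in> \<Gamma>" by (intro mult_mem adj_mem \<gamma> a)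
   moreover have "\<gamma> ** \<alpha> ** adj2 \<gamma> ~= I2"
   proof
    assume e: "\<gamma> ** \<alpha> ** adj2 \<gamma> = I2"
    have "\<alpha> = adj2 \<gamma> ** (\<gamma> ** \<alpha> ** adj2 \<gamma>) ** \<gamma>"
     using \<gamma> by (simp add: matrix_mul_assoc[symmetric] adj2_cancel adj2_inverse)
    then have "\<alpha> = I2" unfolding e using \<gamma> by (simp add: adj2_inverse)
    then show False using a by blast
   qed
   ultimately have "mobius \<gamma> z \<in> thin \<delta>" unfolding thin_def using z \<gamma> by auto
   then show ?thesis using dD \<gamma>(1) by blast
  qed
 qed
 \<comment> \<open>If one thin set is the entire half plane, its single element already serves every
   point.\<close>
 show thesis
 proof (cases "\<exists>\<alpha>\<in>\<Gamma>. (\<forall>x. \<alpha> ~= x *\<^sub>R I2) \<and> thin \<alpha> = \<H>")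
  case True
  then obtain \<alpha> where a: "\<alpha> \<in> \<Gamma>" "!!x. \<alpha> ~= x *\<^sub>R I2" "thin \<alpha> = \<H>" by blast
  show thesis
   by (rule that[of C "{\<alpha>}"]) (use a VC one_mem in \<open>auto intro!: bexI[of _ I2]\<close>)
 next
  case False
  show thesis
   by (rule that[of C D0]) (use VC D0 key False in \<open>auto simp: D0_def\<close>)
 qed
qed

end

section \<open>Parabolic elements, centralizers and invariant sets of zeros\<close>

lemma parabolic_normal_form:
 assumes d: "det \<delta> = 1" and ns: "!!x. \<delta> ~= x *\<^sub>R I2" and t: "(trace \<delta>)^2 = 4"
 obtains g e s where "det g = 1" "adj2 g ** \<delta> ** g = mat2 e s 0 e" "s ~= 0" "e^2 = 1"
proof -
 define a b c d' where "a = \<delta>$1$1" and "b = \<delta>$1$2" and "c = \<delta>$2$1" and "d' = \<delta>$2$2"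
 have ad: "a * d' - b * c = 1" using d by (simp add: det_2 a_def b_def c_def d'_def)
 have tt: "(a + d')^2 = 4" using t by (simp add: trace2 a_def d'_def)
 show thesis
 proof (cases "c = 0")
  case False
  \<comment> \<open>The double root of the fixed point equation; the conjugating matrix takes
    infinity to it.\<close>
  define x0 where "x0 = (a - d') / (2 * c)"
  have x0: "2 * c * x0 = a - d'" using False by (simp add: x0_def)
  have e1: "c * x0 + d' = (a + d') / 2" "a - x0 * c = (a + d') / 2" using x0 by (simp_all add: field_simps)
  have "4 * c * (x0 * (c * x0 + d') - (a * x0 + b)) = (2 * c * x0)^2 + 2 * (d' - a) * (2 * c * x0) - 4 * b * c"
   by (simp add: power2_eq_square algebra_simps)
  also have "\<dots> = - ((a + d')^2 - 4 * (a * d' - b * c))" unfolding x0 by (simp add: power2_eq_square algebra_simps)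
  also have "\<dots> = 0" using tt ad by simp
  finally have e2: "x0 * (c * x0 + d') - (a * x0 + b) = 0" using False by simp
  show thesis
  proof (rule that[of "mat2 x0 (-1) 1 0" "(a + d') / 2" "- c"])
   show "adj2 (mat2 x0 (- 1) 1 0) ** \<delta> ** mat2 x0 (- 1) 1 0 = mat2 ((a + d') / 2) (- c) 0 ((a + d') / 2)"
    unfolding mat2_eq_iff mult2_entries adj2_entries mat2_entries
    using e1 e2 by (simp add: a_def[symmetric] b_def[symmetric] c_def[symmetric] d'_def[symmetric] algebra_simps)
   show "((a + d') / 2)^2 = 1" using tt by (simp add: power_divide)
  qed (use False in auto)
 next
  case True
  have "(a - d')^2 = (a + d')^2 - 4 * (a * d')" by (simp add: power2_eq_square algebra_simps)
  then have ad': "a = d'" using tt ad True by simp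
  have "b ~= 0" using ns[of a] True ad' by (auto simp: mat2_eq_iff a_def b_def c_def d'_def)
  moreover have "a^2 = 1" using tt ad' by (simp add: power2_eq_square)
  moreover have "\<delta> = mat2 a b 0 a" using True ad' by (simp add: mat2_eq_iff a_def b_def c_def d'_def)
  ultimately show thesis by (intro that[of I2 a b]) simp_all
 qed
qed

lemma int_multiple_mem:
 fixes T :: "real set"
 assumes "p \<in> T" "!!x y. x \<in> T ==> y \<in> T ==> x + y \<in> T" "!!x. x \<in> T ==> - x \<in> T"
 shows "of_int n * p \<in> T"
proof -
 have z: "0 \<in> T" using assms(2)[OF assms(1) assms(3)[OF assms(1)]] by simp
 have nat: "of_nat k * p \<in> T" for k
  by (induction k) (use z assms(1,2) in \<open>auto simp: algebra_simps\<close>)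
 show ?thesis
  using nat[of "nat n"] assms(3)[OF nat[of "nat (- n)"]] by (cases "n \<ge> 0") simp_all
qed

context finite_area_SL2
begin

text \<open>A centralizing element is x I + y \<delta>. Those with |y| at most 1 and bounded trace
  have bounded norm, hence are finite in number, so the nonzero coefficients y stay away from
  0.\<close>

lemma centralizer_coefficient:
 assumes \<delta>: "\<delta> \<in> \<Gamma>" and ns: "!!x. \<delta> ~= x *\<^sub>R I2"
 shows "\<exists>y0>0. \<forall>\<alpha>\<in>\<Gamma>. (\<forall>x. \<alpha> ~= x *\<^sub>R I2) --> \<alpha> ** \<delta> = \<delta> ** \<alpha> --> \<bar>trace \<alpha>\<bar> <= 3 -->
  (\<exists>x y. \<alpha> = x *\<^sub>R I2 + y *\<^sub>R \<delta> \<and> y0 <= \<bar>y\<bar>)"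
proof -
 \<comment> \<open>The trace of x I + y \<delta> is 2 x + y * trace \<delta>, so |x| is at most (3 +
   |trace \<delta>|) / 2 when |y| is at most 1.\<close>
 define R where "R = (3 + \<bar>trace \<delta>\<bar>) / 2 * norm I2 + norm \<delta>"
 define S where "S = {\<alpha> \<in> \<Gamma>. norm \<alpha> <= R}"
 define Y where "Y = {y. y ~= 0 \<and> \<bar>y\<bar> <= 1 \<and> (\<exists>x. x *\<^sub>R I2 + y *\<^sub>R \<delta> \<in> \<Gamma> \<and> \<bar>trace (x *\<^sub>R I2 + y *\<^sub>R \<delta>)\<bar> <= 3)}"
 \<comment> \<open>Reads off the coefficient y, which is unique since \<delta> is not scalar; it
   turns finiteness of matrices into finiteness of coefficients.\<close>
 define yf where "yf \<alpha> = (SOME y. \<exists>x. \<alpha> = x *\<^sub>R I2 + y *\<^sub>R \<delta>)" for \<alpha>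
 have yf: "yf (x *\<^sub>R I2 + y *\<^sub>R \<delta>) = y" for x y
  unfolding yf_def
 proof (rule some_equality)
  fix y' assume "\<exists>x'. x *\<^sub>R I2 + y *\<^sub>R \<delta> = x' *\<^sub>R I2 + y' *\<^sub>R \<delta>"
  then obtain x' where e: "x *\<^sub>R I2 + y *\<^sub>R \<delta> = x' *\<^sub>R I2 + y' *\<^sub>R \<delta>" by blast
  show "y' = y"
  proof (rule ccontr)
   assume ne: "y' ~= y"
   have "(y - y') *\<^sub>R \<delta> = (x' - x) *\<^sub>R I2" using e by (simp add: scaleR_left_diff_distrib algebra_simps)
   then have "(1 / (y - y')) *\<^sub>R ((y - y') *\<^sub>R \<delta>) = ((x' - x) / (y - y')) *\<^sub>R I2" by simp
   then have "\<delta> = ((x' - x) / (y - y')) *\<^sub>R I2" using ne by simp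
   then show False using ns by blast
  qed
 qed blast
 have "Y \<subseteq> yf ` S"
 proof
  fix y assume "y \<in> Y"
  then obtain x where y: "\<bar>y\<bar> <= 1" "x *\<^sub>R I2 + y *\<^sub>R \<delta> \<in> \<Gamma>" "\<bar>trace (x *\<^sub>R I2 + y *\<^sub>R \<delta>)\<bar> <= 3" by (auto simp: Y_def)
  have "trace (x *\<^sub>R I2 + y *\<^sub>R \<delta>) = 2 * x + y * trace \<delta>" by (simp add: trace2 algebra_simps)
  moreover have yt: "\<bar>y * trace \<delta>\<bar> <= \<bar>trace \<delta>\<bar>" using y(1) by (simp add: abs_mult mult_left_le_one_le)
  ultimately have "2 * x = trace (x *\<^sub>R I2 + y *\<^sub>R \<delta>) - y * trace \<delta>" by simp
  then have "\<bar>2 * x\<bar> <= \<bar>trace (x *\<^sub>R I2 + y *\<^sub>R \<delta>)\<bar> + \<bar>y * trace \<delta>\<bar>" by (metis abs_triangle_ineq4)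
  then have x: "\<bar>x\<bar> <= (3 + \<bar>trace \<delta>\<bar>) / 2" using y(3) yt by simp
  have "norm (x *\<^sub>R I2 + y *\<^sub>R \<delta>) <= \<bar>x\<bar> * norm I2 + \<bar>y\<bar> * norm \<delta>"
   using norm_triangle_ineq[of "x *\<^sub>R I2" "y *\<^sub>R \<delta>"] by simp
  also have "\<dots> <= (3 + \<bar>trace \<delta>\<bar>) / 2 * norm I2 + 1 * norm \<delta>"
   using x y(1) by (intro add_mono mult_right_mono) auto
  finally have "x *\<^sub>R I2 + y *\<^sub>R \<delta> \<in> S" using y(2) by (simp add: S_def R_def)
  then show "y \<in> yf ` S" using yf[of x y] by (metis image_eqI)
 qed
 moreover have "finite S" unfolding S_def by (rule finite_bounded)
 ultimately have finY: "finite (abs ` Y)" using finite_subset by blast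
 define y0 where "y0 = Min (insert 1 (abs ` Y))"
 have pos: "x > 0" if "x \<in> insert 1 (abs ` Y)" for x using that by (auto simp: Y_def)
 have y0: "y0 > 0" unfolding y0_def using finY Min_in[of "insert 1 (abs ` Y)"] pos by blast
 have y01: "y0 <= 1" unfolding y0_def using finY by (intro Min_le) auto
 show ?thesis
 proof (rule exI[of _ y0], intro conjI ballI impI y0)
  fix \<alpha> assume a: "\<alpha> \<in> \<Gamma>" "\<forall>x. \<alpha> ~= x *\<^sub>R I2" "\<alpha> ** \<delta> = \<delta> ** \<alpha>" "\<bar>trace \<alpha>\<bar> <= 3"
  obtain x y where xy: "\<alpha> = x *\<^sub>R I2 + y *\<^sub>R \<delta>" using commute_span2[OF ns a(3)] by blast
  have ynz: "y ~= 0" using a(2) xy by auto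
  have "y0 <= \<bar>y\<bar>"
  proof (cases "\<bar>y\<bar> <= 1")
   case True
   then have "y \<in> Y" unfolding Y_def using ynz a xy by blast
   then show ?thesis unfolding y0_def using finY by (intro Min_le) auto
  qed (use y01 in linarith)
  then show "\<exists>x y. \<alpha> = x *\<^sub>R I2 + y *\<^sub>R \<delta> \<and> y0 <= \<bar>y\<bar>" using xy by blast
 qed
qed

lemma trace_near:
 assumes "Im z > 0"
 shows "\<bar>trace \<alpha> - 2\<bar> <= 2 * norm (conj_at z \<alpha> - I2)"
proof -
 have "trace \<alpha> - 2 = (conj_at z \<alpha> - I2)$1$1 + (conj_at z \<alpha> - I2)$2$2"
  using trace_conj_at[OF assms, of \<alpha>] by (simp add: trace2)
 then show ?thesis
  using abs_entry_le_norm2[of "conj_at z \<alpha> - I2" 1 1] abs_entry_le_norm2[of "conj_at z \<alpha> - I2" 2 2] by linarith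
qed

text \<open>For \<alpha> = x I + y \<delta> the form \<open>quad\<close> is multiplied by y and
  trace^2 - 4 by y^2. For parabolic \<delta>, an \<alpha> close to the identity has trace 2, and its
  distance is |y| times the displacement ratio of \<delta>, which is at least \<eta> on Z. Otherwise
  the trace of \<alpha> keeps a fixed distance from 2.\<close>

lemma centralizer_lower_bound:
 assumes \<delta>: "\<delta> \<in> \<Gamma>" and ns: "!!x. \<delta> ~= x *\<^sub>R I2"
  and cusp: "(trace \<delta>)^2 = 4 ==> \<exists>\<eta>>0. \<forall>z. Im z > 0 --> cmod (quad \<delta> z) < \<eta> * Im z --> z \<notin> Z"
 shows "\<exists>\<epsilon>>0. \<forall>z\<in>Z. \<forall>\<alpha>\<in>\<Gamma>. Im z > 0 --> \<alpha> ~= I2 --> \<alpha> ** \<delta> = \<delta> ** \<alpha> --> \<epsilon> <= norm (conj_at z \<alpha> - I2)"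
proof -
 obtain y0 where y0: "y0 > 0" "!!\<alpha>. \<alpha> \<in> \<Gamma> ==> (!!x. \<alpha> ~= x *\<^sub>R I2) ==> \<alpha> ** \<delta> = \<delta> ** \<alpha> ==>
  \<bar>trace \<alpha>\<bar> <= 3 ==> \<exists>x y. \<alpha> = x *\<^sub>R I2 + y *\<^sub>R \<delta> \<and> y0 <= \<bar>y\<bar>"
  using centralizer_coefficient[OF \<delta> ns] by blast
 define t where "t = trace \<delta>"
 have main: "\<exists>y. y0 <= \<bar>y\<bar> \<and> quad \<alpha> z = of_real y * quad \<delta> z \<and> (trace \<alpha> - 2) * (trace \<alpha> + 2) = y^2 * (t^2 - 4)"
  if a: "\<alpha> \<in> \<Gamma>" "\<alpha> ~= I2" "\<alpha> ** \<delta> = \<delta> ** \<alpha>" "norm (conj_at z \<alpha> - I2) < 1/10" and z: "Im z > 0" for \<alpha> z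
 proof -
  have "\<bar>trace \<alpha>\<bar> <= 3" using trace_near[OF z, of \<alpha>] a(4) by linarith
  then obtain x y where xy: "\<alpha> = x *\<^sub>R I2 + y *\<^sub>R \<delta>" "y0 <= \<bar>y\<bar>"
   using y0(2)[OF a(1) nonscalar[OF a(1,2,4) z] a(3)] by blast
  have "quad \<alpha> z = of_real y * quad \<delta> z" by (simp add: quad_def xy(1) algebra_simps)
  moreover have "(trace \<alpha> - 2) * (trace \<alpha> + 2) = (trace \<alpha>)^2 - 4 * det \<alpha>"
   using a(1) by (simp add: power2_eq_square algebra_simps)
  moreover have "(trace \<alpha>)^2 - 4 * det \<alpha> = y^2 * (t^2 - 4 * det \<delta>)"
   unfolding xy(1) by (simp add: t_def trace2 det_2 power2_eq_square algebra_simps)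
  ultimately show ?thesis using xy(2) \<delta> by auto
 qed
 show ?thesis
 proof (cases "t^2 = 4")
  case True
  obtain \<eta> where e: "\<eta> > 0" "!!z. Im z > 0 ==> cmod (quad \<delta> z) < \<eta> * Im z ==> z \<notin> Z"
   using cusp True by (auto simp: t_def)
  show ?thesis
  proof (intro exI[of _ "min (1/10) (y0 * \<eta>)"] conjI ballI impI, goal_cases)
   case (2 z \<alpha>)
   show ?case
   proof (rule ccontr)
    assume "\<not> ?case"
    then have n: "norm (conj_at z \<alpha> - I2) < 1/10" "norm (conj_at z \<alpha> - I2) < y0 * \<eta>" by auto
    obtain y where y: "y0 <= \<bar>y\<bar>" "quad \<alpha> z = of_real y * quad \<delta> z" "(trace \<alpha> - 2) * (trace \<alpha> + 2) = 0"
     using main[OF 2(2,4,5) n(1) 2(3)] True by auto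
    have "trace \<alpha> + 2 > 0" using trace_near[OF 2(3), of \<alpha>] n(1) by linarith
    then have "trace \<alpha> = 2" using y(3) by simp
    then have "(norm (conj_at z \<alpha> - I2))^2 = (cmod (quad \<alpha> z) / Im z)^2"
     using norm_conj_at_diff[OF 2(3) det1[OF 2(2)]] by simp
    then have "norm (conj_at z \<alpha> - I2) = cmod (quad \<alpha> z) / Im z"
     using 2(3) by (simp add: power2_eq_iff_nonneg)
    also have "\<dots> = \<bar>y\<bar> * (cmod (quad \<delta> z) / Im z)" by (simp add: y(2) norm_mult)
    finally have "norm (conj_at z \<alpha> - I2) = \<bar>y\<bar> * (cmod (quad \<delta> z) / Im z)" .
    moreover have "\<eta> <= cmod (quad \<delta> z) / Im z" using e(2)[OF 2(3)] 2(1,3) by (force simp: pos_le_divide_eq)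
    then have "y0 * \<eta> <= \<bar>y\<bar> * (cmod (quad \<delta> z) / Im z)" using y(1) y0(1) e(1) by (intro mult_mono) auto
    ultimately show False using n(2) by linarith
   qed
  qed (use y0 e in simp)
 next
  case False
  show ?thesis
  \<comment> \<open>The 10 is 2 * 5: the trace differs from 2 by at most twice the norm, and |trace
    + 2| is at most 5.\<close>
  proof (intro exI[of _ "min (1/10) (y0^2 * \<bar>t^2 - 4\<bar> / 10)"] conjI ballI impI, goal_cases)
   case (2 z \<alpha>)
   show ?case
   proof (rule ccontr)
    let ?n = "norm (conj_at z \<alpha> - I2)"
    assume "\<not> ?case"
    then have n: "?n < 1/10" "10 * ?n < y0^2 * \<bar>t^2 - 4\<bar>" by auto
    obtain y where y: "y0 <= \<bar>y\<bar>" "(trace \<alpha> - 2) * (trace \<alpha> + 2) = y^2 * (t^2 - 4)"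
     using main[OF 2(2,4,5) n(1) 2(3)] by auto
    have "y0^2 * \<bar>t^2 - 4\<bar> <= \<bar>y\<bar>^2 * \<bar>t^2 - 4\<bar>" using y(1) y0(1) by (intro mult_right_mono power_mono) auto
    also have "\<dots> = \<bar>trace \<alpha> - 2\<bar> * \<bar>trace \<alpha> + 2\<bar>" using arg_cong[OF y(2), of abs] by (simp add: abs_mult)
    also have "\<dots> <= (2 * ?n) * 5"
     using trace_near[OF 2(3), of \<alpha>] n(1) by (intro mult_mono) linarith+
    finally show False using n(2) by linarith
   qed
  qed (use y0 False in simp)
 qed
qed

text \<open>A point of Z in the thin set of \<delta> is still thick for a smaller constant: an
  element close to the identity there commutes with \<delta>, and the centralizer of \<delta> keeps
  its distance on Z. So Z lies in a compact set up to translation, where local finiteness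
  applies.\<close>

lemma invariant_set_finite:
 assumes Z: "Z \<subseteq> \<H>" and inv: "!!z \<gamma>. z \<in> Z ==> \<gamma> \<in> \<Gamma> ==> mobius \<gamma> z \<in> Z"
  and lf: "!!K. compact K ==> K \<subseteq> \<H> ==> finite (Z \<inter> K)"
  and cusps: "!!\<delta>. \<delta> \<in> \<Gamma> ==> (!!x. \<delta> ~= x *\<^sub>R I2) ==> (trace \<delta>)^2 = 4 ==>
    \<exists>\<eta>>0. \<forall>z. Im z > 0 --> cmod (quad \<delta> z) < \<eta> * Im z --> z \<notin> Z"
 obtains Z0 where "finite Z0" "Z0 \<subseteq> Z" "!!z. z \<in> Z ==> \<exists>\<gamma>\<in>\<Gamma>. mobius \<gamma> z \<in> Z0"
proof -
 obtain C D where CD: "compact C" "C \<subseteq> \<H>" "finite D" "D \<subseteq> \<Gamma>" "!!\<delta> x. \<delta> \<in> D ==> \<delta> ~= x *\<^sub>R I2"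
  "!!z. Im z > 0 ==> \<exists>\<gamma>\<in>\<Gamma>. mobius \<gamma> z \<in> C \<or> (\<exists>\<delta>\<in>D. mobius \<gamma> z \<in> thin \<delta>)"
  using thick_thin by metis
 have "\<forall>\<delta>\<in>D. \<exists>\<epsilon>>0. \<forall>z\<in>Z. \<forall>\<alpha>\<in>\<Gamma>. Im z > 0 --> \<alpha> ~= I2 --> \<alpha> ** \<delta> = \<delta> ** \<alpha> --> \<epsilon> <= norm (conj_at z \<alpha> - I2)"
 proof
  fix \<delta> assume d: "\<delta> \<in> D"
  then have dG: "\<delta> \<in> \<Gamma>" using CD(4) by blast
  show "\<exists>\<epsilon>>0. \<forall>z\<in>Z. \<forall>\<alpha>\<in>\<Gamma>. Im z > 0 --> \<alpha> ~= I2 --> \<alpha> ** \<delta> = \<delta> ** \<alpha> --> \<epsilon> <= norm (conj_at z \<alpha> - I2)"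
   by (rule centralizer_lower_bound[OF dG CD(5)[OF d] cusps[OF dG CD(5)[OF d]]])
 qed
 from bchoice[OF this] obtain e where e: "\<forall>\<delta>\<in>D. e \<delta> > 0 \<and> (\<forall>z\<in>Z. \<forall>\<alpha>\<in>\<Gamma>. Im z > 0 --> \<alpha> ~= I2 -->
  \<alpha> ** \<delta> = \<delta> ** \<alpha> --> e \<delta> <= norm (conj_at z \<alpha> - I2))" ..
 define \<epsilon> where "\<epsilon> = Min (insert (1/10) (e ` D))"
 have \<epsilon>: "\<epsilon> > 0" unfolding \<epsilon>_def using CD(3) e by (subst Min_gr_iff) auto
 have \<epsilon>_le: "\<epsilon> <= x" if "x \<in> insert (1/10) (e ` D)" for x
  unfolding \<epsilon>_def by (rule Min_le[OF _ that]) (use CD(3) in simp)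
 obtain V K where K: "open V" "compact K" "V \<subseteq> K" "K \<subseteq> \<H>" "!!z. thick \<epsilon> z ==> \<exists>\<gamma>\<in>\<Gamma>. mobius \<gamma> z \<in> V"
  by (rule thick_cocompact[OF \<epsilon>]) (rule that)
 have LH: "compact (C \<union> K)" "C \<union> K \<subseteq> \<H>" using CD(1,2) K(2,4) by (auto intro: compact_Un)
 show thesis
 proof (rule that[of "Z \<inter> (C \<union> K)"])
  show "finite (Z \<inter> (C \<union> K))" by (rule lf[OF LH])
  fix z assume z: "z \<in> Z"
  then have zI: "Im z > 0" using Z by auto
  obtain \<gamma> where g: "\<gamma> \<in> \<Gamma>" "mobius \<gamma> z \<in> C \<or> (\<exists>\<delta>\<in>D. mobius \<gamma> z \<in> thin \<delta>)" using CD(6)[OF zI] by blast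
  define w where "w = mobius \<gamma> z"
  have wZ: "w \<in> Z" unfolding w_def using inv z g by blast
  have wI: "Im w > 0" unfolding w_def using g zI by simp
  show "\<exists>\<gamma>\<in>\<Gamma>. mobius \<gamma> z \<in> Z \<inter> (C \<union> K)"
  proof (cases "w \<in> C")
   case True
   then show ?thesis using g wZ by (auto simp: w_def)
  next
   case False
   then obtain \<delta> \<beta> where d: "\<delta> \<in> D" "\<beta> \<in> \<Gamma>" "\<beta> ~= I2" "\<beta> ** \<delta> = \<delta> ** \<beta>" "norm (conj_at w \<beta> - I2) < 1/10"
    using g by (auto simp: w_def thin_def)
   \<comment> \<open>An element closer than \<epsilon> would commute with the thinness witness
     \<beta>, hence with \<delta>, against the choice of \<open>e \<delta>\<close>.\<close>
   have "thick \<epsilon> w"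
    unfolding thick_def
   proof (intro conjI ballI impI wI, rule ccontr)
    fix \<alpha> assume a: "\<alpha> \<in> \<Gamma>" "\<alpha> ~= I2" "\<not> \<epsilon> <= norm (conj_at w \<alpha> - I2)"
    have "norm (conj_at w \<alpha> - I2) < 1/10" using a(3) \<epsilon>_le[of "1/10"] by simp
    then have "\<alpha> ** \<beta> = \<beta> ** \<alpha>" by (intro near_commute[OF a(1) d(2) _ d(5) wI])
    then have "\<alpha> ** \<delta> = \<delta> ** \<alpha>" by (rule commute_trans2[OF nonscalar[OF d(2,3,5) wI] _ d(4)[symmetric]])
    then have "e \<delta> <= norm (conj_at w \<alpha> - I2)" using e d(1) wZ a(1,2) wI by metis
    then show False using a(3) \<epsilon>_le[of "e \<delta>"] d(1) by auto
   qed
   then obtain \<beta> where b: "\<beta> \<in> \<Gamma>" "mobius \<beta> w \<in> K" using K(3) K(5)[of w] by blast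
   have "mobius (\<beta> ** \<gamma>) z = mobius \<beta> w" using b g zI by (simp add: mobius_mult w_def)
   then have "mobius (\<beta> ** \<gamma>) z \<in> Z \<inter> (C \<union> K)" using b inv[OF wZ b(1)] by auto
   then show ?thesis using mult_mem[OF b(1) g(1)] by blast
  qed
 qed simp
qed

end

section \<open>Weight zero functions with poles at the cusps only\<close>

text \<open>Gaussian elimination: equation j is solved for the unknown p and substituted into the
  others. The set of unknowns is quantified inside the statement because it shrinks in the
  induction.\<close>

lemma exists_kernel_vector:
 fixes a :: "'j => 'i => 'k::field"
 assumes "finite J"
 shows "\<forall>I (a :: 'j => 'i => 'k). finite I \<and> card J < card I -->
  (\<exists>c. (\<exists>n\<in>I. c n ~= 0) \<and> (\<forall>j\<in>J. (\<Sum>n\<in>I. c n * a j n) = 0))"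
 using assms
proof (induction J rule: finite_induct)
 case empty
 show ?case
 proof (intro allI impI)
  fix I :: "'i set" and a :: "'j => 'i => 'k"
  assume "finite I \<and> card {} < card I"
  then have "I ~= {}" by auto
  then show "\<exists>c. (\<exists>n\<in>I. c n ~= 0) \<and> (\<forall>j\<in>{}. (\<Sum>n\<in>I. c n * a j n) = 0)"
   by (intro exI[of _ "\<lambda>_. 1"]) auto
 qed
next
 case (insert j J)
 show ?case
 proof (intro allI impI)
  fix I :: "'i set" and a :: "'j => 'i => 'k"
  assume I: "finite I \<and> card (insert j J) < card I"
  show "\<exists>c. (\<exists>n\<in>I. c n ~= 0) \<and> (\<forall>j\<in>insert j J. (\<Sum>n\<in>I. c n * a j n) = 0)"
  proof (cases "\<forall>n\<in>I. a j n = 0")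
   case True
   have "card J < card I" using I insert.hyps by simp
   then obtain c where "\<exists>n\<in>I. c n ~= 0" "\<forall>j\<in>J. (\<Sum>n\<in>I. c n * a j n) = 0"
    using insert.IH[rule_format, of I a] I by blast
   then show ?thesis using True by (intro exI[of _ c]) (auto intro!: sum.neutral)
  next
   case False
   then obtain p where p: "p \<in> I" "a j p ~= 0" by blast
   define a' where "a' j' n = a j' n - a j n / a j p * a j' p" for j' n
   have "Suc (card J) < card I" using I insert.hyps by simp
   then have "card J < card (I - {p})" using p I by (simp add: less_diff_conv)
   then obtain c' where c': "\<exists>n\<in>I - {p}. c' n ~= 0" "\<forall>j\<in>J. (\<Sum>n\<in>I - {p}. c' n * a' j n) = 0"
    using insert.IH[rule_format, of "I - {p}" a'] I by blast
   define s where "s = - (\<Sum>n\<in>I - {p}. c' n * (a j n / a j p))"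
   define c where "c n = (if n = p then s else c' n)" for n
   have sum: "(\<Sum>n\<in>I. c n * a j' n) = s * a j' p + (\<Sum>n\<in>I - {p}. c' n * a j' n)" for j'
    using I p by (subst sum.remove[of I p]) (auto simp: c_def)
   have "(\<Sum>n\<in>I - {p}. c' n * a j n) = - s * a j p"
    using p(2) by (simp add: s_def sum_distrib_right)
   then have "(\<Sum>n\<in>I. c n * a j n) = 0" using sum[of j] by simp
   moreover have "(\<Sum>n\<in>I. c n * a j' n) = 0" if "j' \<in> J" for j'
   proof -
    have "0 = (\<Sum>n\<in>I - {p}. c' n * a' j' n)" using c'(2) that by simp
    also have "\<dots> = (\<Sum>n\<in>I - {p}. c' n * a j' n) - (\<Sum>n\<in>I - {p}. c' n * (a j n / a j p)) * a j' p"
     by (simp add: a'_def right_diff_distrib sum_subtractf sum_distrib_right mult.assoc)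
    finally show ?thesis using sum[of j'] by (simp add: s_def)
   qed
   moreover have "\<exists>n\<in>I. c n ~= 0" using c'(1) by (auto simp: c_def)
   ultimately show ?thesis by (intro exI[of _ c]) auto
  qed
 qed
qed

text \<open>Repeated division by w - z, with a remainder factor that is holomorphic on all of
  S.\<close>

lemma holomorphic_taylor_remainder:
 assumes "f holomorphic_on S" "open S" "z \<in> S"
 shows "\<exists>b r. r holomorphic_on S \<and> (\<forall>w\<in>S. f w = (\<Sum>i<m. b i * (w - z) ^ i) + (w - z) ^ m * r w)"
proof (induction m)
 case 0
 show ?case using assms(1) by (intro exI[of _ undefined] exI[of _ f]) auto
next
 case (Suc m)
 then obtain b r where br: "r holomorphic_on S" "!!w. w \<in> S ==> f w = (\<Sum>i<m. b i * (w - z) ^ i) + (w - z) ^ m * r w"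
  by blast
 define r' where "r' w = (if w = z then deriv r z else (r w - r z) / (w - z))" for w
 have "r' holomorphic_on S"
  unfolding r'_def using pole_lemma[OF br(1)] assms by (simp add: interior_open)
 moreover have "f w = (\<Sum>i<Suc m. (b(m := r z)) i * (w - z) ^ i) + (w - z) ^ Suc m * r' w" if "w \<in> S" for w
 proof -
  have "r w = r z + (w - z) * r' w" by (simp add: r'_def)
  then have "f w = (\<Sum>i<m. b i * (w - z) ^ i) + (w - z) ^ m * (r z + (w - z) * r' w)" using br(2)[OF that] by simp
  then show ?thesis by (simp add: algebra_simps)
 qed
 ultimately show ?case by blast
qed

text \<open>Taking the limit at each point fills all removable singularities at once and glues the
  local extensions into one function without choices.\<close>

lemma Lim_quotient_holomorphic:
 fixes u :: "complex => complex"
 assumes "!!z. z \<in> S ==> \<exists>U k. open U \<and> z \<in> U \<and> k holomorphic_on U \<and> (\<forall>w\<in>U - {z}. u w = k w)"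
 shows "(\<lambda>z. Lim (at z) u) holomorphic_on S"
  "!!z U. open U ==> z \<in> U ==> u holomorphic_on U ==> Lim (at z) u = u z"
proof -
 have L: "Lim (at w) u = k w" if U: "open U" "w \<in> U" "k holomorphic_on U" "\<forall>w'\<in>U - {z}. u w' = k w'" for U w z k
 proof -
  have "isCont k w"
   using holomorphic_on_imp_continuous_on[OF U(3)] U(1,2) continuous_on_eq_continuous_at by blast
  then have "(k \<longlongrightarrow> k w) (at w)" by (simp add: isCont_def)
  moreover have "\<forall>\<^sub>F w' in at w. k w' = u w'"
  proof -
   \<comment> \<open>The exceptional point z is deleted only when it differs from w; at w = z the
     punctured limit avoids it anyway.\<close>
   have o: "open (U - ({z} - {w}))" using U(1) by (intro open_Diff finite_imp_closed) auto
   have "\<forall>\<^sub>F w' in at w. w' \<in> U - ({z} - {w}) \<and> w' ~= w"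
    using eventually_at_in_open[OF o, of w] U(2) by (auto elim: eventually_mono)
   then show ?thesis
    by (rule eventually_mono) (use U(4) in force)
  qed
  ultimately have "(u \<longlongrightarrow> k w) (at w)" by (rule Lim_transform_eventually)
  then show ?thesis by (intro tendsto_Lim) auto
 qed
 show "(\<lambda>z. Lim (at z) u) holomorphic_on S"
  unfolding holomorphic_on_def
 proof
  fix z assume "z \<in> S"
  then obtain U k where U: "open U" "z \<in> U" "k holomorphic_on U" "\<forall>w\<in>U - {z}. u w = k w" using assms by blast
  have "(\<lambda>z. Lim (at z) u) holomorphic_on U"
   by (rule holomorphic_transform[OF U(3)]) (use L[OF U(1) _ U(3,4)] in simp)
  then show "(\<lambda>z. Lim (at z) u) field_differentiable at z within S"
   using U(1,2) holomorphic_on_imp_differentiable_at field_differentiable_at_within by blast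
 qed
 show "!!z U. open U ==> z \<in> U ==> u holomorphic_on U ==> Lim (at z) u = u z"
  using L by blast
qed

definition matpow :: "real^2^2 => nat => real^2^2" where "matpow g n = (((**) g) ^^ n) I2"

lemma matpow_0 [simp]: "matpow g 0 = I2" and matpow_Suc: "matpow g (Suc n) = g ** matpow g n"
 by (simp_all add: matpow_def)

section \<open>Leading behaviour of the series along vertical lines and at all cusps\<close>

context cusp_group
begin

lemma poincare_right_mult:
 assumes "det g = 1" "det k = 1" "Im z > 0"
 shows "poincare n (g ** k) z = poincare n g (mobius k z) / jfac k z ^ 4"
proof -
 have d: "det (g ** k) = 1" using assms by (simp add: Determinants.det_mul)
 have nz: "jfac (g ** k) z ~= 0" "jfac k z ~= 0" using jfac_nz[of "g ** k" z] jfac_nz[of k z] d assms by auto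
 have kz: "Im (mobius k z) > 0" using assms by simp
 have "jfac (g ** k) z ^ 4 * poincare n (g ** k) z = poincare n I2 (mobius (g ** k) z)"
  by (rule poincare_slash[OF d assms(3), symmetric])
 also have "mobius (g ** k) z = mobius g (mobius k z)" using assms by (simp add: mobius_mult)
 also have "poincare n I2 (mobius g (mobius k z)) = jfac g (mobius k z) ^ 4 * poincare n g (mobius k z)"
  by (rule poincare_slash[OF assms(1) kz])
 also have "jfac g (mobius k z) = jfac (g ** k) z / jfac k z" using jfac_mult[of k z g] assms nz by simp
 finally have "jfac (g ** k) z ^ 4 * poincare n (g ** k) z =
   jfac (g ** k) z ^ 4 * (poincare n g (mobius k z) / jfac k z ^ 4)" by (simp add: power_divide)
 moreover have "jfac (g ** k) z ^ 4 ~= 0" using nz by simp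
 ultimately show ?thesis using mult_left_cancel by blast
qed

lemma poincare_invariant:
 assumes "\<gamma> \<in> \<Gamma>" "Im z > 0"
 shows "poincare n I2 (mobius \<gamma> z) = jfac \<gamma> z ^ 4 * poincare n I2 z"
 using poincare_slash[of \<gamma> z n] poincare_left_mult[OF assms(1), of I2 z n] assms by simp

lemma poincare_periodic:
 assumes g: "det g = 1" and \<gamma>: "\<gamma> \<in> \<Gamma>" "\<gamma> ** g = g ** mat2 1 p 0 1" and z: "Im z > 0"
 shows "poincare n g (z + of_real p) = poincare n g z"
proof -
 have "poincare n g z = poincare n (g ** mat2 1 p 0 1) z"
  using poincare_left_mult[OF \<gamma>(1) g z] \<gamma>(2) by simp
 also have "\<dots> = poincare n g (mobius (mat2 1 p 0 1) z)"
  using poincare_right_mult[OF g _ z, of "mat2 1 p 0 1"] by (simp add: jfac_def)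
 finally show ?thesis by (simp add: mobius_eq jfac_def)
qed

lemma eterm_asymp:
 assumes "i <= n"
 shows "((\<lambda>y. eterm i (Complex x y) * of_real (exp (- (2 * pi * n / h * y)))) \<longlongrightarrow>
   (if i = n then exp (- (2 * of_real pi * \<i> * of_nat n * of_real x / of_real h)) else 0)) at_top"
proof -
 have e: "eterm i (Complex x y) * of_real (exp (- (2 * pi * n / h * y))) =
   exp (- (2 * of_real pi * \<i> * of_nat i * of_real x / of_real h)) * of_real (exp (- (2 * pi * (real n - real i) / h * y)))" for y
 proof -
  have "- (2 * of_real pi * \<i> * of_nat i / of_real h) * Complex x y =
    - (2 * of_real pi * \<i> * of_nat i * of_real x / of_real h) + of_real (2 * pi * i / h * y)"
   by (simp add: complex_eq_iff)
  then have "eterm i (Complex x y) = exp (- (2 * of_real pi * \<i> * of_nat i * of_real x / of_real h)) * exp (of_real (2 * pi * i / h * y))"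
   unfolding eterm_def exp_add[symmetric] by (simp only:)
  moreover have "exp (complex_of_real (2 * pi * i / h * y)) * of_real (exp (- (2 * pi * n / h * y)))
    = of_real (exp (- (2 * pi * (real n - real i) / h * y)))"
   unfolding exp_of_real of_real_mult[symmetric] exp_add[symmetric] using h_pos by (simp add: field_simps)
  ultimately show ?thesis by (simp add: mult.assoc)
 qed
 show ?thesis
 proof (cases "i = n")
  case True
  then show ?thesis unfolding e by simp
 next
  case False
  then have "2 * pi * (real n - real i) / h > 0" using assms h_pos by simp
  then have "((\<lambda>y. exp (- (2 * pi * (real n - real i) / h * y))) \<longlongrightarrow> 0) at_top"
   by (intro filterlim_compose[OF exp_at_bot] filterlim_compose[OF filterlim_uminus_at_bot_at_top]
     filterlim_tendsto_pos_mult_at_top[OF tendsto_const] filterlim_ident)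
  then have "((\<lambda>y. complex_of_real (exp (- (2 * pi * (real n - real i) / h * y)))) \<longlongrightarrow> of_real 0) at_top"
   by (rule tendsto_of_real)
  from tendsto_mult_left[OF this, of "exp (- (2 * of_real pi * \<i> * of_nat i * of_real x / of_real h))"] show ?thesis
   unfolding e using False by simp
 qed
qed

lemma bounded_times_decay:
 fixes E :: "real => complex"
 assumes "!!y. 1 <= y ==> cmod (E y) <= C" "a > 0"
 shows "((\<lambda>y. E y * of_real (exp (- (a * y)))) \<longlongrightarrow> 0) at_top"
proof (rule Lim_null_comparison)
 show "\<forall>\<^sub>F y in at_top. norm (E y * of_real (exp (- (a * y)))) <= C * exp (- (a * y))"
  using eventually_ge_at_top[of 1]
  by eventually_elim (use assms(1) in \<open>simp add: norm_mult\<close>)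
 have "((\<lambda>y. exp (- (a * y))) \<longlongrightarrow> 0) at_top"
  by (intro filterlim_compose[OF exp_at_bot] filterlim_compose[OF filterlim_uminus_at_bot_at_top]
    filterlim_tendsto_pos_mult_at_top[OF tendsto_const assms(2)] filterlim_ident)
 from tendsto_mult_left[OF this, of C] show "((\<lambda>y. C * exp (- (a * y))) \<longlongrightarrow> 0) at_top" by simp
qed

lemma poincare_asymp:
 assumes "i <= n" "n > 0"
 shows "((\<lambda>y. poincare i I2 (Complex x y) * of_real (exp (- (2 * pi * n / h * y)))) \<longlongrightarrow>
   (if i = n then 2 * exp (- (2 * of_real pi * \<i> * of_nat n * of_real x / of_real h)) else 0)) at_top"
proof -
 obtain C where C: "!!x' y. \<bar>x'\<bar> <= \<bar>x\<bar> ==> 1 <= y ==>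
   cmod (poincare i I2 (Complex x' y) - 2 * eterm i (Complex x' y)) <= C"
  using poincare_at_infinity[of "\<bar>x\<bar>" i] by metis
 have "2 * pi * n / h > 0" using assms h_pos by simp
 then have "((\<lambda>y. (poincare i I2 (Complex x y) - 2 * eterm i (Complex x y)) * of_real (exp (- (2 * pi * n / h * y)))) \<longlongrightarrow> 0) at_top"
  using C[of x] by (intro bounded_times_decay) auto
 from tendsto_add[OF this tendsto_mult_left[OF eterm_asymp[OF assms(1), of x], of 2]]
 show ?thesis by (simp add: algebra_simps if_distrib cong: if_cong)
qed

text \<open>After normalization only the highest seed survives. The limit keeps the phase exp (-2 pi
  i n x / h), from which translations fixing the function can be detected.\<close>

lemma poincare_sum_asymp:
 assumes "finite I" "n \<in> I" "n > 0" "!!i. i \<in> I ==> c i ~= 0 ==> i <= n"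
 shows "((\<lambda>y. (\<Sum>i\<in>I. c i * poincare i I2 (Complex x y)) * of_real (exp (- (2 * pi * n / h * y)))) \<longlongrightarrow>
   c n * (2 * exp (- (2 * of_real pi * \<i> * of_nat n * of_real x / of_real h)))) at_top"
proof -
 have "((\<lambda>y. \<Sum>i\<in>I. c i * (poincare i I2 (Complex x y) * of_real (exp (- (2 * pi * n / h * y))))) \<longlongrightarrow>
   (\<Sum>i\<in>I. if i = n then c n * (2 * exp (- (2 * of_real pi * \<i> * of_nat n * of_real x / of_real h))) else 0)) at_top"
 proof (rule tendsto_sum)
  fix i assume i: "i \<in> I"
  show "((\<lambda>y. c i * (poincare i I2 (Complex x y) * of_real (exp (- (2 * pi * n / h * y))))) \<longlongrightarrow>
    (if i = n then c n * (2 * exp (- (2 * of_real pi * \<i> * of_nat n * of_real x / of_real h))) else 0)) at_top"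
  proof (cases "c i = 0")
   case False
   from tendsto_mult_left[OF poincare_asymp[OF assms(4)[OF i False] assms(3), of x], of "c i"]
   show ?thesis by (auto simp: if_distrib cong: if_cong)
  qed auto
 qed
 then show ?thesis using assms(1,2) by (simp add: sum_distrib_right mult.assoc)
qed

lemma poincare_nonzero:
 assumes "n > 0"
 obtains z where "Im z > 0" "poincare n I2 z ~= 0"
proof -
 have lim: "((\<lambda>y. poincare n I2 (Complex 0 y) * of_real (exp (- (2 * pi * n / h * y)))) \<longlongrightarrow> 2) at_top"
  using poincare_asymp[OF order_refl assms, of 0] by simp
 have "\<exists>y>0. poincare n I2 (Complex 0 y) ~= 0"
 proof (rule ccontr)
  assume "\<not> (\<exists>y>0. poincare n I2 (Complex 0 y) ~= 0)"
  then have "\<forall>\<^sub>F y in at_top. poincare n I2 (Complex 0 y) * of_real (exp (- (2 * pi * n / h * y))) = 0"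
   by (intro eventually_mono[OF eventually_gt_at_top[of "0::real"]]) auto
  then have "((\<lambda>y. poincare n I2 (Complex 0 y) * of_real (exp (- (2 * pi * n / h * y)))) \<longlongrightarrow> 0) at_top"
   by (rule tendsto_eventually)
  then show False using tendsto_unique[OF _ lim] by fastforce
 qed
 then show thesis using that[of "Complex 0 _"] by auto
qed

text \<open>The relation between \<gamma> and g says that g takes infinity to a cusp of the group
  and that p is a period there. The slashed series is thus periodic, moderate and not zero, so it
  has no zeros high up at this cusp.\<close>

lemma poincare_cusp_lower_bound:
 assumes g: "det g = 1" and p: "p > 0" and \<gamma>: "\<gamma> \<in> \<Gamma>" "\<gamma> ** g = g ** mat2 1 p 0 1" and n: "n > 0"
 obtains c a Y where "c > 0" "Y > 0" "a \<ge> 0" "!!z. Im z \<ge> Y ==> c * exp (- (a * Im z)) <= cmod (poincare n g z)"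
proof -
 obtain z0 where z0: "Im z0 > 0" "poincare n I2 z0 ~= 0" using poincare_nonzero[OF n] by blast
 define w where "w = mobius (adj2 g) z0"
 have w: "Im w > 0" unfolding w_def using g z0 by simp
 have "mobius g w = z0" unfolding w_def using mobius_adj2(2)[OF g z0(1)] .
 then have nz: "poincare n g w ~= 0" using poincare_slash[OF g w, of n] z0 by auto
 show thesis
  by (rule periodic_lower_bound[OF p poincare_holomorphic[OF g] poincare_periodic[OF g \<gamma>]
     poincare_moderate[OF g] w nz]) (use that in blast)+
qed

end

lemma (in discrete_SL2) matpow_mem: "g \<in> \<Gamma> ==> matpow g n \<in> \<Gamma>"
 by (induction n) (auto simp: matpow_Suc mult_mem)

text \<open>Multiplying by the sign e makes \<delta> unipotent, and passing to the inverse if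
  necessary makes the period positive.\<close>

lemma (in discrete_SL2) period_at:
 assumes \<delta>: "\<delta> \<in> \<Gamma>" and g: "det g = 1" "adj2 g ** \<delta> ** g = mat2 e s 0 e" "s ~= 0" "e^2 = 1"
 obtains \<gamma> p where "p > 0" "\<gamma> \<in> \<Gamma>" "\<gamma> ** g = g ** mat2 1 p 0 1"
proof -
 have e: "e = 1 \<or> e = -1" using g(4) by (simp add: power2_eq_1_iff)
 define \<delta>1 where "\<delta>1 = e *\<^sub>R \<delta>"
 have d1: "\<delta>1 \<in> \<Gamma>" using e \<delta> uminus_mem[OF \<delta>] by (auto simp: \<delta>1_def)
 have dg: "\<delta> ** g = g ** mat2 e s 0 e" using g(1,2) by (metis adj2_cancel(1) matrix_mul_assoc)
 have "\<delta>1 ** g = e *\<^sub>R (\<delta> ** g)" by (simp add: \<delta>1_def scaleR_mult2)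
 also have "\<dots> = g ** (e *\<^sub>R mat2 e s 0 e)" unfolding dg by (simp add: scaleR_mult2)
 also have "e *\<^sub>R mat2 e s 0 e = mat2 1 (s * e) 0 1" using g(4) by (simp add: mat2_eq_iff power2_eq_square)
 finally have d1g: "\<delta>1 ** g = g ** mat2 1 (s * e) 0 1" .
 have se: "s * e ~= 0" using g(3) e by auto
 show thesis
 proof (cases "s * e > 0")
  case True
  then show thesis using that d1 d1g by blast
 next
  case False
  have "adj2 \<delta>1 ** g = g ** adj2 (mat2 1 (s * e) 0 1)"
  proof -
   have "adj2 \<delta>1 ** (\<delta>1 ** g) ** adj2 (mat2 1 (s * e) 0 1) = adj2 \<delta>1 ** (g ** mat2 1 (s * e) 0 1) ** adj2 (mat2 1 (s * e) 0 1)"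
    unfolding d1g ..
   then show ?thesis using d1 by (simp add: adj2_cancel matrix_mul_assoc[symmetric] adj2_inverse)
  qed
  moreover have "adj2 (mat2 1 (s * e) 0 1) = mat2 1 (- (s * e)) 0 1" by (simp add: mat2_eq_iff)
  ultimately show thesis using that[of "- (s * e)" "adj2 \<delta>1"] adj_mem[OF d1] False se by auto
 qed
qed

text \<open>Both groups have a cusp at infinity. \<open>R\<close> contains representatives of the
  cosets of the smaller group, and \<open>D\<close> is a common multiple of exponents at which
  powers of elements of the larger group enter the smaller one; it selects the residue class of the
  seeds.\<close>

locale cusp_group_pair =
 G: cusp_group \<Gamma>\<^sub>G h\<^sub>G + H: cusp_group \<Gamma>\<^sub>H h\<^sub>H + area: finite_area_SL2 \<Gamma>\<^sub>G F
 for \<Gamma>\<^sub>G h\<^sub>G \<Gamma>\<^sub>H h\<^sub>H F +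
 fixes R :: "(real^2^2) set" and D :: nat
 assumes sub: "\<Gamma>\<^sub>H \<subseteq> \<Gamma>\<^sub>G"
  and fin_R: "finite R" and R_sub: "R \<subseteq> \<Gamma>\<^sub>G"
  and R_cover: "!!g. g \<in> \<Gamma>\<^sub>G ==> \<exists>\<eta>\<in>\<Gamma>\<^sub>H. \<exists>r\<in>R. g = \<eta> ** r"
  and D_pos: "D > 0"
  and D_pow: "!!g. g \<in> \<Gamma>\<^sub>G ==> \<exists>N>0. N dvd D \<and> matpow g N \<in> \<Gamma>\<^sub>H"
begin

definition Q :: "complex => complex" where "Q = G.poincare 1 I2"

lemma Q_hol: "Q holomorphic_on \<H>"
 unfolding Q_def by (rule G.poincare_holomorphic) simp

lemma Q_inv: "\<gamma> \<in> \<Gamma>\<^sub>G ==> Im z > 0 ==> Q (mobius \<gamma> z) = jfac \<gamma> z ^ 4 * Q z"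
 unfolding Q_def by (rule G.poincare_invariant)

lemma Q_nonzero: obtains z where "Im z > 0" "Q z ~= 0"
 unfolding Q_def using G.poincare_nonzero[of 1] by auto

lemma Q_not_constant: "\<not> Q constant_on \<H>"
proof
 assume "Q constant_on \<H>"
 then obtain c where c: "!!z. Im z > 0 ==> Q z = c" unfolding constant_on_def by auto
 have lim: "((\<lambda>y. G.poincare 1 I2 (Complex 0 y) * of_real (exp (- (2 * pi * 1 / h\<^sub>G * y)))) \<longlongrightarrow> 2) at_top"
  using G.poincare_asymp[of 1 1 0] by simp
 have "((\<lambda>y. c * of_real (exp (- (2 * pi * 1 / h\<^sub>G * y)))) \<longlongrightarrow> 0) at_top"
  using G.h_pos by (intro G.bounded_times_decay[of "\<lambda>_. c" "cmod c"]) auto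
 moreover have "\<forall>\<^sub>F y in at_top. c * of_real (exp (- (2 * pi * 1 / h\<^sub>G * y))) =
   G.poincare 1 I2 (Complex 0 y) * of_real (exp (- (2 * pi * 1 / h\<^sub>G * y)))"
  by (rule eventually_mono[OF eventually_gt_at_top[of 0]]) (use c in \<open>simp add: Q_def\<close>)
 ultimately have "((\<lambda>y. G.poincare 1 I2 (Complex 0 y) * of_real (exp (- (2 * pi * 1 / h\<^sub>G * y)))) \<longlongrightarrow> 0) at_top"
  by (rule Lim_transform_eventually)
 from tendsto_unique[OF _ lim this] show False by simp
qed

definition Z :: "complex set" where "Z = {z \<in> \<H>. Q z = 0}"

lemma Z_locally_finite: "compact K ==> K \<subseteq> \<H> ==> finite (Z \<inter> K)"
proof -
 assume K: "compact K" "K \<subseteq> \<H>"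
 have "finite {z \<in> K. Q z = 0}"
  by (rule holomorphic_compact_finite_zeros[OF Q_hol open_H connected_H K Q_not_constant])
 moreover have "Z \<inter> K = {z \<in> K. Q z = 0}" using K by (auto simp: Z_def)
 ultimately show ?thesis by simp
qed

lemma Z_inv: "z \<in> Z ==> \<gamma> \<in> \<Gamma>\<^sub>G ==> mobius \<gamma> z \<in> Z"
 using Q_inv by (auto simp: Z_def)

text \<open>In the coordinate w at the cusp of \<delta> the displacement ratio is |s| / Im w. A
  ratio below |s| / Y therefore means height above Y, where the denominator has no zeros.\<close>

lemma Z_cusps:
 assumes \<delta>: "\<delta> \<in> \<Gamma>\<^sub>G" and ns: "!!x. \<delta> ~= x *\<^sub>R I2" and t: "(trace \<delta>)^2 = 4"
 shows "\<exists>\<eta>>0. \<forall>z. Im z > 0 --> cmod (quad \<delta> z) < \<eta> * Im z --> z \<notin> Z"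
proof -
 obtain g e s where g: "det g = 1" "adj2 g ** \<delta> ** g = mat2 e s 0 e" "s ~= 0" "e^2 = 1"
  using parabolic_normal_form[OF G.det1[OF \<delta>] ns t] by blast
 obtain \<gamma> p where p: "p > 0" "\<gamma> \<in> \<Gamma>\<^sub>G" "\<gamma> ** g = g ** mat2 1 p 0 1" using G.period_at[OF \<delta> g] by blast
 obtain c a Y where Y: "c > 0" "Y > 0" "a \<ge> 0" "!!z. Im z \<ge> Y ==> c * exp (- (a * Im z)) <= cmod (G.poincare 1 g z)"
  by (rule G.poincare_cusp_lower_bound[OF g(1) p, of 1]) auto
 show ?thesis
 proof (intro exI[of _ "\<bar>s\<bar> / Y"] conjI allI impI)
  show "\<bar>s\<bar> / Y > 0" using g(3) Y(2) by simp
  fix z assume z: "Im z > 0" "cmod (quad \<delta> z) < \<bar>s\<bar> / Y * Im z"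
  define w where "w = mobius (adj2 g) z"
  have wI: "Im w > 0" unfolding w_def using g(1) z(1) by simp
  have zw: "z = mobius g w" unfolding w_def using mobius_adj2(2)[OF g(1) z(1)] by simp
  have eq: "cmod (quad \<delta> z) / Im z = \<bar>s\<bar> / Im w"
   unfolding zw quad_ratio_conj[OF g(1) wI] g(2) by (simp add: quad_def)
  have "cmod (quad \<delta> z) / Im z < \<bar>s\<bar> / Y" using z by (simp add: divide_less_eq)
  then have "\<bar>s\<bar> / Im w < \<bar>s\<bar> / Y" unfolding eq .
  then have "Y <= Im w" using g(3) wI Y(2) by (simp add: field_simps)
  moreover have "c * exp (- (a * Im w)) > 0" using Y(1) by simp
  ultimately have "cmod (G.poincare 1 g w) > 0" using Y(4)[of w] by linarith
  then have "Q z ~= 0"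
   unfolding Q_def zw using G.poincare_slash[OF g(1) wI, of 1] jfac_nz[of g w] g(1) wI by auto
  then show "z \<notin> Z" by (simp add: Z_def)
 qed
qed

lemma Z_reps:
 obtains Z1 where "finite Z1" "Z1 \<subseteq> Z" "!!z. z \<in> Z ==> \<exists>\<gamma>\<in>\<Gamma>\<^sub>H. mobius \<gamma> z \<in> Z1"
proof -
 have ZH: "Z \<subseteq> \<H>" by (auto simp: Z_def)
 obtain Z0 where Z0: "finite Z0" "Z0 \<subseteq> Z" "!!z. z \<in> Z ==> \<exists>\<gamma>\<in>\<Gamma>\<^sub>G. mobius \<gamma> z \<in> Z0"
 proof (rule area.invariant_set_finite[OF ZH])
  show "!!z \<gamma>. z \<in> Z ==> \<gamma> \<in> \<Gamma>\<^sub>G ==> mobius \<gamma> z \<in> Z" by (rule Z_inv)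
  show "!!K. compact K ==> K \<subseteq> \<H> ==> finite (Z \<inter> K)" by (rule Z_locally_finite)
  show "!!\<delta>. \<delta> \<in> \<Gamma>\<^sub>G ==> (!!x. \<delta> ~= x *\<^sub>R I2) ==> (trace \<delta>)^2 = 4 ==>
    \<exists>\<eta>>0. \<forall>z. Im z > 0 --> cmod (quad \<delta> z) < \<eta> * Im z --> z \<notin> Z" by (rule Z_cusps)
 qed blast
 show thesis
 proof (rule that[of "(\<lambda>(r, z). mobius r z) ` (R \<times> Z0)"])
  show "finite ((\<lambda>(r, z). mobius r z) ` (R \<times> Z0))" using fin_R Z0(1) by simp
  show "(\<lambda>(r, z). mobius r z) ` (R \<times> Z0) \<subseteq> Z" using Z0(2) R_sub Z_inv by auto
  fix z assume z: "z \<in> Z"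
  then have zI: "Im z > 0" by (simp add: Z_def)
  obtain \<gamma> where g: "\<gamma> \<in> \<Gamma>\<^sub>G" "mobius \<gamma> z \<in> Z0" using Z0(3)[OF z] by blast
  obtain \<eta> r where er: "\<eta> \<in> \<Gamma>\<^sub>H" "r \<in> R" "adj2 \<gamma> = \<eta> ** r" using R_cover[OF G.adj_mem[OF g(1)]] by blast
  have rG: "r \<in> \<Gamma>\<^sub>G" using er R_sub by blast
  have "mobius (adj2 \<eta>) z = mobius (adj2 \<eta>) (mobius (adj2 \<gamma>) (mobius \<gamma> z))" using g zI by (simp add: mobius_adj2)
  also have "\<dots> = mobius (adj2 \<eta> ** (adj2 \<gamma>)) (mobius \<gamma> z)" using g zI H.det1[OF er(1)] by (simp add: mobius_mult)
  also have "adj2 \<eta> ** adj2 \<gamma> = r" using er H.det1 by (simp add: adj2_cancel)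
  finally show "\<exists>\<gamma>\<in>\<Gamma>\<^sub>H. mobius \<gamma> z \<in> (\<lambda>(r, z). mobius r z) ` (R \<times> Z0)"
   using g(2) er H.adj_mem by force
 qed
qed

lemma local_quotient:
 assumes P: "P holomorphic_on \<H>" and z: "z \<in> \<H>"
  and m: "!!w. w \<in> ball z \<rho> ==> Q w = (w - z) ^ m * q w" "q holomorphic_on ball z \<rho>" "!!w. w \<in> ball z \<rho> ==> q w ~= 0"
   "\<rho> > 0" "ball z \<rho> \<subseteq> \<H>"
  and r: "r holomorphic_on \<H>" "!!w. w \<in> \<H> ==> P w = (w - z) ^ m * r w"
 shows "\<exists>U k. open U \<and> z \<in> U \<and> k holomorphic_on U \<and> (\<forall>w\<in>U - {z}. P w / Q w = k w)"
proof (intro exI conjI ballI)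
 show "open (ball z \<rho>)" "z \<in> ball z \<rho>" using m by auto
 show "(\<lambda>w. r w / q w) holomorphic_on ball z \<rho>"
  using m r by (intro holomorphic_on_divide holomorphic_on_subset[OF r(1)]) auto
 fix w assume "w \<in> ball z \<rho> - {z}"
 then show "P w / Q w = r w / q w" using m r(2)[of w] by (simp add: subset_iff)
qed

text \<open>A combination of the Poincare series of the smaller group vanishes at the finitely many zeros of
 \<open>Q\<close> as soon as it has more terms than there are linear conditions. The exponents are taken congruent
 to 1 modulo \<open>D\<close>, so that the leading term distinguishes the translations of the two groups.\<close>

lemma exists_numerator:
 obtains I c n where "finite I" "n \<in> I" "c n ~= (0::complex)" "!!i. i \<in> I ==> c i ~= 0 ==> i <= n"
  "n mod D = 1 mod D" "n > N0"
  "!!z. z \<in> \<H> ==> \<exists>U k. open U \<and> z \<in> U \<and> k holomorphic_on U \<and>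
    (\<forall>w\<in>U - {z}. (\<Sum>i\<in>I. c i * H.poincare i I2 w) / Q w = k w)"
proof -
 obtain Z1 where Z1: "finite Z1" "Z1 \<subseteq> Z" "!!z. z \<in> Z ==> \<exists>\<gamma>\<in>\<Gamma>\<^sub>H. mobius \<gamma> z \<in> Z1"
  using Z_reps by blast
 have "\<exists>m \<rho> q. \<rho> > 0 \<and> ball z \<rho> \<subseteq> \<H> \<and> q holomorphic_on ball z \<rho> \<and> (\<forall>w\<in>ball z \<rho>. Q w = (w - z) ^ m * q w \<and> q w ~= 0)"
  if z: "z \<in> Z1" for z
 proof -
  have zz: "z \<in> \<H>" "Q z = 0" using z Z1(2) by (auto simp: Z_def)
  show ?thesis
  proof (rule holomorphic_factor_zero_nonconstant[OF Q_hol open_H connected_H zz Q_not_constant])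
   fix g r n assume "0 < (n::nat)" "0 < r" "ball z r \<subseteq> \<H>" "g holomorphic_on ball z r"
    "!!w. w \<in> ball z r ==> Q w = (w - z) ^ n * g w" "!!w. w \<in> ball z r ==> g w ~= 0"
   then show ?thesis by blast
  qed
 qed
 then obtain m \<rho> q where mq: "!!z. z \<in> Z1 ==> \<rho> z > 0 \<and> ball z (\<rho> z) \<subseteq> \<H> \<and> q z holomorphic_on ball z (\<rho> z) \<and>
   (\<forall>w\<in>ball z (\<rho> z). Q w = (w - z) ^ m z * q z w \<and> q z w ~= 0)"
  by metis
 define J where "J = Sigma Z1 (\<lambda>z. {..<m z})"
 \<comment> \<open>One linear condition for each representative zero z and each Taylor coefficient
   of order below its multiplicity \<open>m z\<close>.\<close>
 have J: "finite J" unfolding J_def using Z1(1) by auto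
 have Phol: "H.poincare i I2 holomorphic_on \<H>" for i by (rule H.poincare_holomorphic) simp
 have "\<exists>p. snd p holomorphic_on \<H> \<and> (\<forall>w\<in>\<H>. H.poincare i I2 w = (\<Sum>l<m z. fst p l * (w - z) ^ l) + (w - z) ^ m z * snd p w)"
  if z: "z \<in> Z1" for i z
 proof -
  have "z \<in> \<H>" using z Z1(2) by (auto simp: Z_def)
  from holomorphic_taylor_remainder[OF Phol open_H this, of i "m z"]
  obtain b r where "r holomorphic_on \<H>"
   "\<forall>w\<in>\<H>. H.poincare i I2 w = (\<Sum>l<m z. b l * (w - z) ^ l) + (w - z) ^ m z * r w" by blast
  then show ?thesis by (intro exI[of _ "(b, r)"]) simp
 qed
 then have ex: "!!i z. z \<in> Z1 ==> \<exists>p. snd p holomorphic_on \<H> \<and>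
   (\<forall>w\<in>\<H>. H.poincare i I2 w = (\<Sum>l<m z. fst p l * (w - z) ^ l) + (w - z) ^ m z * snd p w)" .
 define p where "p i z = (SOME p. snd p holomorphic_on \<H> \<and>
   (\<forall>w\<in>\<H>. H.poincare i I2 w = (\<Sum>l<m z. fst p l * (w - z) ^ l) + (w - z) ^ m z * snd p w))" for i z
 have p: "snd (p i z) holomorphic_on \<H> \<and>
   (\<forall>w\<in>\<H>. H.poincare i I2 w = (\<Sum>l<m z. fst (p i z) l * (w - z) ^ l) + (w - z) ^ m z * snd (p i z) w)"
  if "z \<in> Z1" for i z
  unfolding p_def by (rule someI_ex[OF ex[OF that]])
 define b where "b i z = fst (p i z)" for i z
 define r where "r i z = snd (p i z)" for i z
 have br: "r i z holomorphic_on \<H> \<and>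
   (\<forall>w\<in>\<H>. H.poincare i I2 w = (\<Sum>l<m z. b i z l * (w - z) ^ l) + (w - z) ^ m z * r i z w)" if "z \<in> Z1" for i z
  using p[OF that] by (simp add: b_def r_def)
 \<comment> \<open>One exponent more than there are conditions, all above N0 and congruent to 1
   modulo D.\<close>
 define I where "I = (\<lambda>k. 1 + D * (N0 + k)) ` {1..card J + 1}"
 have inj: "inj_on (\<lambda>k. 1 + D * (N0 + k)) {1..card J + 1}" using D_pos by (auto simp: inj_on_def)
 have "card I = card {1..card J + 1}" unfolding I_def by (rule card_image[OF inj])
 then have I: "finite I" "card I = card J + 1" by (simp_all add: I_def)
 define a where "a j i = (case j of (z, l) => b i z l)" for j i
 obtain c where c: "\<exists>n\<in>I. c n ~= 0" "!!j. j \<in> J ==> (\<Sum>n\<in>I. c n * a j n) = 0"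
  using exists_kernel_vector[OF J, rule_format, of I a] I by auto
 define S where "S = {n \<in> I. c n ~= 0}"
 have S: "finite S" "S ~= {}" using I c by (auto simp: S_def)
 define n where "n = Max S"
 have nS: "n \<in> S" unfolding n_def using S by (rule Max_in)
 define P where "P w = (\<Sum>i\<in>I. c i * H.poincare i I2 w)" for w
 have Pho: "P holomorphic_on \<H>" unfolding P_def by (intro holomorphic_intros Phol)
 have loc1: "\<exists>U k. open U \<and> z \<in> U \<and> k holomorphic_on U \<and> (\<forall>w\<in>U - {z}. P w / Q w = k w)" if z: "z \<in> Z1" for z
 proof (rule local_quotient[OF Pho, of z "\<rho> z" "m z" "q z"])
  show "z \<in> \<H>" using z Z1(2) by (auto simp: Z_def)
  show "(\<lambda>w. \<Sum>i\<in>I. c i * r i z w) holomorphic_on \<H>"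
   using br[OF z] by (intro holomorphic_intros) auto
  fix w :: complex assume w: "w \<in> \<H>"
  have "P w = (\<Sum>i\<in>I. c i * ((\<Sum>l<m z. b i z l * (w - z) ^ l) + (w - z) ^ m z * r i z w))"
   unfolding P_def using br[OF z] w by (intro sum.cong) auto
  also have "\<dots> = (\<Sum>i\<in>I. \<Sum>l<m z. c i * b i z l * (w - z) ^ l) + (w - z) ^ m z * (\<Sum>i\<in>I. c i * r i z w)"
   by (simp add: distrib_left sum.distrib sum_distrib_left mult_ac)
  also have "(\<Sum>i\<in>I. \<Sum>l<m z. c i * b i z l * (w - z) ^ l) = (\<Sum>l<m z. (\<Sum>i\<in>I. c i * b i z l) * (w - z) ^ l)"
   by (subst sum.swap) (simp add: sum_distrib_right)
  also have "\<dots> = 0"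
  proof (intro sum.neutral ballI)
   fix l assume "l \<in> {..<m z}"
   then have "(\<Sum>i\<in>I. c i * b i z l) = 0" using c(2)[of "(z, l)"] z by (auto simp: J_def a_def)
   then show "(\<Sum>i\<in>I. c i * b i z l) * (w - z) ^ l = 0" by simp
  qed
  finally show "P w = (w - z) ^ m z * (\<Sum>i\<in>I. c i * r i z w)" by simp
 qed (use mq[OF z] in auto)
 \<comment> \<open>The quotient is invariant under the smaller group, so an extension at one zero is
   carried to all zeros in its orbit.\<close>
 have Pinv: "P (mobius \<gamma> w) / Q (mobius \<gamma> w) = P w / Q w" if "\<gamma> \<in> \<Gamma>\<^sub>H" "Im w > 0" for \<gamma> w
 proof -
  have "P (mobius \<gamma> w) = jfac \<gamma> w ^ 4 * P w"
   unfolding P_def using H.poincare_invariant[OF that] by (simp add: sum_distrib_left mult_ac)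
  moreover have "jfac \<gamma> w ~= 0" using jfac_nz[of \<gamma> w] that H.det1 by simp
  ultimately show ?thesis using Q_inv[of \<gamma> w] that sub by auto
 qed
 have loc: "\<exists>U k. open U \<and> z \<in> U \<and> k holomorphic_on U \<and> (\<forall>w\<in>U - {z}. P w / Q w = k w)" if z: "z \<in> \<H>" for z
 proof (cases "z \<in> Z")
  case True
  obtain \<gamma> where \<gamma>: "\<gamma> \<in> \<Gamma>\<^sub>H" "mobius \<gamma> z \<in> Z1" using Z1(3)[OF True] by blast
  obtain U k where U: "open U" "mobius \<gamma> z \<in> U" "k holomorphic_on U" "\<forall>w\<in>U - {mobius \<gamma> z}. P w / Q w = k w"
   using loc1[OF \<gamma>(2)] by blast
  have d: "det \<gamma> = 1" using \<gamma> by simp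
  define W where "W = mobius \<gamma> -` U \<inter> \<H>"
  have "open W" unfolding W_def
   using U(1) continuous_on_open_vimage[OF open_H, of "mobius \<gamma>"] holomorphic_on_imp_continuous_on[OF holomorphic_mobius[OF d]] by blast
  moreover have "z \<in> W" using z U(2) by (simp add: W_def)
  moreover have "(\<lambda>w. k (mobius \<gamma> w)) holomorphic_on W"
  proof -
   have "mobius \<gamma> holomorphic_on W" by (rule holomorphic_on_subset[OF holomorphic_mobius[OF d]]) (auto simp: W_def)
   moreover have "mobius \<gamma> ` W \<subseteq> U" by (auto simp: W_def)
   ultimately show ?thesis using holomorphic_on_compose_gen[OF _ U(3)] by (simp add: o_def)
  qed
  moreover have "P w / Q w = k (mobius \<gamma> w)" if w: "w \<in> W - {z}" for w
  proof -
   have wI: "Im w > 0" "mobius \<gamma> w \<in> U" using w by (auto simp: W_def)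
   have "mobius \<gamma> w ~= mobius \<gamma> z"
    using mobius_adj2(1)[OF d wI(1)] mobius_adj2(1)[OF d, of z] z w by auto
   then show ?thesis using U(4) wI Pinv[OF \<gamma>(1) wI(1)] by auto
  qed
  ultimately show ?thesis by blast
 next
  case False
  define W where "W = Q -` (- {0}) \<inter> \<H>"
  have "open W" unfolding W_def
   using continuous_on_open_vimage[OF open_H, of Q] holomorphic_on_imp_continuous_on[OF Q_hol] by blast
  moreover have "z \<in> W" using z False by (auto simp: W_def Z_def)
  moreover have "(\<lambda>w. P w / Q w) holomorphic_on W"
   by (intro holomorphic_on_divide holomorphic_on_subset[OF Pho] holomorphic_on_subset[OF Q_hol]) (auto simp: W_def)
  ultimately show ?thesis by blast
 qed
 show thesis
 proof (rule that[of I n c])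
  show "n \<in> I" "c n ~= 0" using nS by (auto simp: S_def)
  show "i <= n" if "i \<in> I" "c i ~= 0" for i unfolding n_def using S(1) that by (intro Max_ge) (auto simp: S_def)
  have "n \<in> I" using nS by (simp add: S_def)
  then obtain k where k: "n = 1 + D * (N0 + k)" "k \<in> {1..card J + 1}" unfolding I_def by blast
  show "n mod D = 1 mod D" unfolding k(1) by (rule mod_mult_self2)
  have "1 * (N0 + k) <= D * (N0 + k)" using D_pos by (intro mult_right_mono) auto
  moreover have "N0 < 1 * (N0 + k)" using k(2) by simp
  ultimately have "N0 < D * (N0 + k)" by (rule less_le_trans[rotated])
  then show "n > N0" using k(1) by simp
  show "!!z. z \<in> \<H> ==> \<exists>U k. open U \<and> z \<in> U \<and> k holomorphic_on U \<and>
    (\<forall>w\<in>U - {z}. (\<Sum>i\<in>I. c i * H.poincare i I2 w) / Q w = k w)" using loc unfolding P_def .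
 qed (rule I)
qed

lemma transl_pow: "matpow (mat2 1 b 0 1) N = mat2 1 (real N * b) 0 1"
 by (induction N) (auto simp: matpow_Suc mat2_eq_iff algebra_simps)

text \<open>f is P / Q with its singularities removed. At a cusp P is moderate and Q is bounded
  below exponentially. If g fixes f, it fixes P under the weight 4 slash. Either no element of the
  coset of g fixes infinity, and then P would be bounded along a vertical line, or g is a
  translation up to sign and up to the smaller group, and the phase of the leading term places it in
  that group.\<close>

theorem exists_weight_zero:
 obtains f where "f holomorphic_on \<H>" "!!\<gamma> z. \<gamma> \<in> \<Gamma>\<^sub>H ==> Im z > 0 ==> f (mobius \<gamma> z) = f z"
  "!!A \<gamma> p. det A = 1 ==> p > 0 ==> \<gamma> \<in> \<Gamma>\<^sub>G ==> \<gamma> ** A = A ** mat2 1 p 0 1 ==> moderate (\<lambda>z. f (mobius A z))"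
  "\<not> f constant_on \<H>"
  "!!g. g \<in> \<Gamma>\<^sub>G ==> (!!z. Im z > 0 ==> f (mobius g z) = f z) ==> g \<in> \<Gamma>\<^sub>H"
proof -
 obtain I c n where Ic: "finite I" "n \<in> I" "c n ~= (0::complex)" "!!i. i \<in> I ==> c i ~= 0 ==> i <= n"
  "n mod D = 1 mod D" "n > nat \<lceil>h\<^sub>H / h\<^sub>G\<rceil>"
  and loc: "!!z. z \<in> \<H> ==> \<exists>U k. open U \<and> z \<in> U \<and> k holomorphic_on U \<and>
    (\<forall>w\<in>U - {z}. (\<Sum>i\<in>I. c i * H.poincare i I2 w) / Q w = k w)"
 proof (rule exists_numerator[of "nat \<lceil>h\<^sub>H / h\<^sub>G\<rceil>"])
  fix I c n
  assume *: "finite I" "n \<in> I" "c n ~= (0::complex)" "!!i. i \<in> I ==> c i ~= 0 ==> i <= n"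
   "n mod D = 1 mod D" "n > nat \<lceil>h\<^sub>H / h\<^sub>G\<rceil>"
   "!!z. z \<in> \<H> ==> \<exists>U k. open U \<and> z \<in> U \<and> k holomorphic_on U \<and>
    (\<forall>w\<in>U - {z}. (\<Sum>i\<in>I. c i * H.poincare i I2 w) / Q w = k w)"
  show thesis by (rule that[OF *])
 qed
 have n0: "n > 0" using Ic(6) by simp
 define P where "P w = (\<Sum>i\<in>I. c i * H.poincare i I2 w)" for w
 have Pho: "P holomorphic_on \<H>" unfolding P_def by (intro holomorphic_intros H.poincare_holomorphic) simp
 define f where "f z = Lim (at z) (\<lambda>w. P w / Q w)" for z
 have fho: "f holomorphic_on \<H>"
  unfolding f_def by (rule Lim_quotient_holomorphic(1)) (use loc in \<open>simp add: P_def\<close>)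
 have oQ: "open (Q -` (- {0}) \<inter> \<H>)"
  using continuous_on_open_vimage[OF open_H, of Q] holomorphic_on_imp_continuous_on[OF Q_hol] by blast
 have fQ0: "f z = P z / Q z" if "Im z > 0" "Q z ~= 0" for z
  unfolding f_def
 proof (rule Lim_quotient_holomorphic(2)[OF _ oQ])
  show "(\<lambda>w. P w / Q w) holomorphic_on Q -` (- {0}) \<inter> \<H>"
   by (intro holomorphic_on_divide holomorphic_on_subset[OF Pho] holomorphic_on_subset[OF Q_hol]) auto
 qed (use that loc in \<open>auto simp: P_def\<close>)
 have neQ: "Q -` (- {0}) \<inter> \<H> ~= {}" 
 proof -
  obtain z where "Im z > 0" "Q z ~= 0" using Q_nonzero by blast
  then have "z \<in> Q -` (- {0}) \<inter> \<H>" by simp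
  then show ?thesis by blast
 qed
 have fQ: "f z * Q z = P z" if "Im z > 0" for z
  by (rule analytic_continuation_open[OF oQ open_H neQ connected_H])
   (use fQ0 that in \<open>auto intro!: holomorphic_intros fho Q_hol Pho\<close>)
 \<comment> \<open>At any matrix of determinant 1 the factor jfac^4 is the same for P and Q, so
   quotients may be computed from the slashed series.\<close>
 have Pslash: "P (mobius g z) = jfac g z ^ 4 * (\<Sum>i\<in>I. c i * H.poincare i g z)" if "det g = 1" "Im z > 0" for g z
  unfolding P_def using H.poincare_slash[OF that] by (simp add: sum_distrib_left mult_ac)
 have Pinv: "P (mobius \<gamma> z) = jfac \<gamma> z ^ 4 * P z" if "\<gamma> \<in> \<Gamma>\<^sub>H" "Im z > 0" for \<gamma> z
  unfolding P_def using H.poincare_invariant[OF that] by (simp add: sum_distrib_left mult_ac)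
 have inv: "f (mobius \<gamma> z) = f z" if g: "\<gamma> \<in> \<Gamma>\<^sub>H" and z: "Im z > 0" for \<gamma> z
 proof (rule analytic_continuation_open[OF oQ open_H neQ connected_H, of "\<lambda>z. f (mobius \<gamma> z)" f])
  show "(\<lambda>z. f (mobius \<gamma> z)) holomorphic_on \<H>" by (rule holomorphic_compose_mobius) (use g fho in auto)
  fix w assume "w \<in> Q -` (- {0}) \<inter> \<H>"
  then have w: "Im w > 0" "Q w ~= 0" by auto
  have j: "jfac \<gamma> w ~= 0" using jfac_nz[of \<gamma> w] g w by simp
  have Qg: "Q (mobius \<gamma> w) = jfac \<gamma> w ^ 4 * Q w" using Q_inv[of \<gamma> w] g sub w by blast
  have "f (mobius \<gamma> w) = P (mobius \<gamma> w) / Q (mobius \<gamma> w)" using Qg j w g by (intro fQ0) auto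
  also have "\<dots> = P w / Q w" using j by (simp add: Qg Pinv[OF g w(1)])
  finally show "f (mobius \<gamma> w) = f w" using fQ0[OF w] by simp
 qed (use fho z in auto)
 have asym: "((\<lambda>y. P (Complex x y) * of_real (exp (- (2 * pi * n / h\<^sub>H * y)))) \<longlongrightarrow>
   c n * (2 * exp (- (2 * of_real pi * \<i> * of_nat n * of_real x / of_real h\<^sub>H)))) at_top" for x
  unfolding P_def by (rule H.poincare_sum_asymp[OF Ic(1,2) n0 Ic(4)])
 have mod: "moderate (\<lambda>z. f (mobius A z))"
  if A: "det A = 1" and p: "p > 0" "\<gamma> \<in> \<Gamma>\<^sub>G" "\<gamma> ** A = A ** mat2 1 p 0 1" for A \<gamma> p
 proof (rule moderate_if_eventually)
  show "continuous_on \<H> (\<lambda>z. f (mobius A z))"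
   by (intro holomorphic_on_imp_continuous_on holomorphic_compose_mobius A fho)
  fix X
  obtain c' a Y where Y: "c' > 0" "Y > 0" "a \<ge> 0" "!!z. Im z \<ge> Y ==> c' * exp (- (a * Im z)) <= cmod (G.poincare 1 A z)"
   by (rule G.poincare_cusp_lower_bound[OF A p, of 1]) auto
  have "moderate (\<lambda>z. \<Sum>i\<in>I. c i * H.poincare i A z)"
   by (intro moderate_sum moderate_mult moderate_const H.poincare_moderate A)
  then obtain C N where CN: "C \<ge> 0" "N \<ge> 0" "!!x y. \<bar>x\<bar> <= X ==> Y <= y ==> cmod (\<Sum>i\<in>I. c i * H.poincare i A (Complex x y)) <= C * exp (N * y)"
   using Y(2) by (rule moderateE[where X = X]) (rule that)
  have "cmod (f (mobius A (Complex x y))) <= C / c' * exp ((N + a) * y)" if xy: "\<bar>x\<bar> <= X" "Y <= y" for x y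
  proof -
   let ?z = "Complex x y"
   have zI: "Im ?z > 0" using xy Y by simp
   have j: "jfac A ?z ~= 0" using jfac_nz[of A ?z] A zI by simp
   have low: "c' * exp (- (a * y)) <= cmod (G.poincare 1 A ?z)" using Y(4)[of ?z] xy by simp
   have lowpos: "c' * exp (- (a * y)) > 0" using Y(1) by simp
   have QA: "Q (mobius A ?z) = jfac A ?z ^ 4 * G.poincare 1 A ?z"
    unfolding Q_def by (rule G.poincare_slash[OF A zI])
   have Gnz: "G.poincare 1 A ?z ~= 0" using low lowpos by auto
   have "f (mobius A ?z) = P (mobius A ?z) / Q (mobius A ?z)"
    using QA j Gnz A zI by (intro fQ0) auto
   also have "\<dots> = (\<Sum>i\<in>I. c i * H.poincare i A ?z) / G.poincare 1 A ?z"
    using j by (simp add: QA Pslash[OF A zI])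
   finally have "cmod (f (mobius A ?z)) = cmod (\<Sum>i\<in>I. c i * H.poincare i A ?z) / cmod (G.poincare 1 A ?z)"
    by (simp add: norm_divide)
   also have "\<dots> <= (C * exp (N * y)) / (c' * exp (- (a * y)))"
    using CN(1) CN(3)[OF xy] low lowpos by (intro frac_le) auto
   also have "\<dots> = C / c' * exp ((N + a) * y)" by (simp add: exp_minus exp_add distrib_right field_simps)
   finally show ?thesis .
  qed
  then show "\<exists>Y C N. \<forall>x y. \<bar>x\<bar> <= X --> Y <= y --> cmod (f (mobius A (Complex x y))) <= C * exp (N * y)"
   by blast
 qed
 have nonconst: "\<not> f constant_on \<H>"
 proof
  assume "f constant_on \<H>"
  then obtain k where k: "!!z. Im z > 0 ==> f z = k" unfolding constant_on_def by auto
  \<comment> \<open>If f were a constant k, P = k Q would grow only like Q, and the normalized limit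
    of P would be 0 although \<open>c n\<close> is not.\<close>
  have "h\<^sub>H / h\<^sub>G < real n" using Ic(6) by linarith
  then have lt: "1 / h\<^sub>G < real n / h\<^sub>H" using G.h_pos H.h_pos by (simp add: field_simps)
  have "((\<lambda>y. G.poincare 1 I2 (Complex 0 y) * of_real (exp (- (2 * pi * 1 / h\<^sub>G * y)))) \<longlongrightarrow> 2) at_top"
   using G.poincare_asymp[of 1 1 0] by simp
  moreover have "((\<lambda>y. 1 * complex_of_real (exp (- (2 * pi * (real n / h\<^sub>H - 1 / h\<^sub>G) * y)))) \<longlongrightarrow> 0) at_top"
   by (rule G.bounded_times_decay[of _ 1]) (use lt in auto)
  ultimately have "((\<lambda>y. (G.poincare 1 I2 (Complex 0 y) * of_real (exp (- (2 * pi * 1 / h\<^sub>G * y)))) *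
    (1 * complex_of_real (exp (- (2 * pi * (real n / h\<^sub>H - 1 / h\<^sub>G) * y))))) \<longlongrightarrow> 2 * 0) at_top"
   by (rule tendsto_mult)
  from tendsto_mult_left[OF this, of k]
  have "((\<lambda>y. k * ((G.poincare 1 I2 (Complex 0 y) * of_real (exp (- (2 * pi * 1 / h\<^sub>G * y)))) *
    (1 * complex_of_real (exp (- (2 * pi * (real n / h\<^sub>H - 1 / h\<^sub>G) * y)))))) \<longlongrightarrow> 0) at_top" by simp
  moreover have "\<forall>\<^sub>F y in at_top. k * ((G.poincare 1 I2 (Complex 0 y) * of_real (exp (- (2 * pi * 1 / h\<^sub>G * y)))) *
    (1 * complex_of_real (exp (- (2 * pi * (real n / h\<^sub>H - 1 / h\<^sub>G) * y))))) = P (Complex 0 y) * of_real (exp (- (2 * pi * n / h\<^sub>H * y)))"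
  proof (rule eventually_mono[OF eventually_gt_at_top[of 0]])
   fix y :: real assume y: "y > 0"
   have "P (Complex 0 y) = k * G.poincare 1 I2 (Complex 0 y)" using fQ[of "Complex 0 y"] k y by (simp add: Q_def)
   moreover have "exp (- (2 * pi * 1 / h\<^sub>G * y)) * exp (- (2 * pi * (real n / h\<^sub>H - 1 / h\<^sub>G) * y)) = exp (- (2 * pi * n / h\<^sub>H * y))"
    unfolding exp_add[symmetric] by (simp add: algebra_simps)
   then have "complex_of_real (exp (- (2 * pi * 1 / h\<^sub>G * y))) * of_real (exp (- (2 * pi * (real n / h\<^sub>H - 1 / h\<^sub>G) * y))) = of_real (exp (- (2 * pi * n / h\<^sub>H * y)))"
    by (metis of_real_mult)
   ultimately show "k * ((G.poincare 1 I2 (Complex 0 y) * of_real (exp (- (2 * pi * 1 / h\<^sub>G * y)))) *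
    (1 * complex_of_real (exp (- (2 * pi * (real n / h\<^sub>H - 1 / h\<^sub>G) * y))))) = P (Complex 0 y) * of_real (exp (- (2 * pi * n / h\<^sub>H * y)))"
    by (simp only: mult.assoc mult_1_left)
  qed
  ultimately have "((\<lambda>y. P (Complex 0 y) * of_real (exp (- (2 * pi * n / h\<^sub>H * y)))) \<longlongrightarrow> 0) at_top"
   by (rule Lim_transform_eventually)
  from tendsto_unique[OF _ asym[of 0] this] show False using Ic(3) by simp
 qed
 have stab: "g \<in> \<Gamma>\<^sub>H" if g: "g \<in> \<Gamma>\<^sub>G" and fg: "!!z. Im z > 0 ==> f (mobius g z) = f z" for g
 proof (rule ccontr)
  assume gH: "g \<notin> \<Gamma>\<^sub>H"
  have Pg: "P (mobius g z) = jfac g z ^ 4 * P z" if z: "Im z > 0" for z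
  proof -
   have "P (mobius g z) = f (mobius g z) * Q (mobius g z)" using fQ[of "mobius g z"] g z by simp
   then show ?thesis using fg[OF z] Q_inv[OF g z] fQ[OF z] by (simp add: mult_ac)
  qed
  show False
  \<comment> \<open>Does the coset of g contain an element fixing infinity? If not, lower left
    entries stay away from 0 and every slashed series is bounded.\<close>
  proof (cases "\<exists>\<gamma>\<in>\<Gamma>\<^sub>H. (\<gamma> ** g)$2$1 = 0")
   case False
   obtain c0 where c0: "c0 > 0" "!!g. g \<in> \<Gamma>\<^sub>G ==> g$2$1 ~= 0 ==> c0 <= \<bar>g$2$1\<bar>"
    using G.lower_left_bound by blast
   have rb: "c0 <= \<bar>row_mult v g $ 1\<bar>" if v: "v \<in> H.rows" for v
   proof -
    obtain \<gamma> where \<gamma>: "\<gamma> \<in> \<Gamma>\<^sub>H" "v = \<gamma>$2" using v by (auto simp: H.rows_def)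
    have "(\<gamma> ** g)$2$1 ~= 0" using False \<gamma> by blast
    moreover have "\<gamma> ** g \<in> \<Gamma>\<^sub>G" using G.mult_mem[of \<gamma> g] \<gamma> sub g by blast
    ultimately show ?thesis using c0(2)[of "\<gamma> ** g"] \<gamma>(2) by simp
   qed
   have "\<exists>C. \<forall>y\<ge>1. cmod (H.poincare i g (Complex 0 y)) <= C" for i
   proof -
    obtain C where "!!x y. \<bar>x\<bar> <= 0 ==> 1 <= y ==> cmod (\<Sum>\<^sub>\<infinity>v\<in>H.rows. H.ptm i g v (Complex x y)) <= C"
     using H.ptm_infsum_bounded[OF G.det1[OF g] order_refl c0(1) rb, of 0 i] by metis
    then show ?thesis by (intro exI[of _ C]) (simp add: H.poincare_def)
   qed
   then obtain C where C: "!!i y. y \<ge> 1 ==> cmod (H.poincare i g (Complex 0 y)) <= C i" by metis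
   have PC: "cmod (P (Complex 0 y)) <= (\<Sum>i\<in>I. cmod (c i) * C i)" if y: "y \<ge> 1" for y
   proof -
    have yI: "Im (Complex 0 y) > 0" using y by simp
    have "jfac g (Complex 0 y) ~= 0" using jfac_nz[of g "Complex 0 y"] g yI by simp
    then have "P (Complex 0 y) = (\<Sum>i\<in>I. c i * H.poincare i g (Complex 0 y))"
     using Pg[OF yI] Pslash[OF G.det1[OF g] yI] by simp
    also have "cmod \<dots> <= (\<Sum>i\<in>I. cmod (c i) * C i)"
     using C[OF y] by (intro order_trans[OF norm_sum] sum_mono) (simp add: norm_mult mult_left_mono)
    finally show ?thesis .
   qed
   have "((\<lambda>y. P (Complex 0 y) * of_real (exp (- (2 * pi * n / h\<^sub>H * y)))) \<longlongrightarrow> 0) at_top"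
    using PC n0 H.h_pos by (intro H.bounded_times_decay) auto
   from tendsto_unique[OF _ asym[of 0] this] show False using Ic(3) by simp
  next
   case True
   then obtain \<gamma> where \<gamma>: "\<gamma> \<in> \<Gamma>\<^sub>H" "(\<gamma> ** g)$2$1 = 0" by blast
   have gG: "\<gamma> ** g \<in> \<Gamma>\<^sub>G" using G.mult_mem[of \<gamma> g] \<gamma> sub g by blast
   obtain k where k: "\<gamma> ** g = G.tr k \<or> \<gamma> ** g = - G.tr k"
    using G.stab_infinity[OF gG \<gamma>(2)] by (auto simp: G.tr_def)
   define b where "b = of_int k * h\<^sub>G"
   have trb: "G.tr k = mat2 1 b 0 1" by (simp add: G.tr_def b_def)
   have shift: "P (z + of_real b) = P z" if z: "Im z > 0" for z
   proof -
    have gz: "Im (mobius g z) > 0" using g z by simp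
    have "mobius (\<gamma> ** g) z = z + of_real b" using k by (auto simp: trb mobius_eq[of "mat2 1 b 0 1"] jfac_def)
    then have "P (z + of_real b) = P (mobius \<gamma> (mobius g z))" using \<gamma> g z by (simp add: mobius_mult)
    also have "\<dots> = (jfac \<gamma> (mobius g z) * jfac g z) ^ 4 * P z"
     using Pinv[OF \<gamma>(1) gz] Pg[OF z] by (simp add: power_mult_distrib mult_ac)
    also have "jfac \<gamma> (mobius g z) * jfac g z = jfac (\<gamma> ** g) z" using jfac_mult[of g z \<gamma>] g z by simp
    also have "jfac (\<gamma> ** g) z ^ 4 = 1"
     using k
    proof
     assume "\<gamma> ** g = G.tr k"
     then show ?thesis by (simp only: trb) (simp add: jfac_def)
    next
     assume "\<gamma> ** g = - G.tr k"
     then show ?thesis by (simp only: trb jfac_uminus) (simp add: jfac_def)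
    qed
    finally show ?thesis by simp
   qed
   have "((\<lambda>y. P (Complex b y) * of_real (exp (- (2 * pi * n / h\<^sub>H * y)))) \<longlongrightarrow> c n * 2) at_top"
   proof (rule Lim_transform_eventually)
    show "((\<lambda>y. P (Complex 0 y) * of_real (exp (- (2 * pi * n / h\<^sub>H * y)))) \<longlongrightarrow> c n * 2) at_top"
     using asym[of 0] by simp
    show "\<forall>\<^sub>F y in at_top. P (Complex 0 y) * of_real (exp (- (2 * pi * n / h\<^sub>H * y))) = P (Complex b y) * of_real (exp (- (2 * pi * n / h\<^sub>H * y)))"
    proof (rule eventually_mono[OF eventually_gt_at_top[of 0]])
     fix y :: real assume "y > 0"
     moreover have "Complex b y = Complex 0 y + of_real b" by (simp add: complex_eq_iff)
     ultimately show "P (Complex 0 y) * of_real (exp (- (2 * pi * n / h\<^sub>H * y))) = P (Complex b y) * of_real (exp (- (2 * pi * n / h\<^sub>H * y)))"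
      using shift[of "Complex 0 y"] by simp
    qed
   qed
   \<comment> \<open>P is invariant under translation by b, so the phases at x = 0 and x = b agree
     and n b / h is an integer, with h the width of the smaller group.\<close>
   from tendsto_unique[OF _ asym[of b] this]
   have "exp (- (2 * of_real pi * \<i> * of_nat n * of_real b / of_real h\<^sub>H)) = 1" using Ic(3) by simp
   then obtain l :: int where "Im (- (2 * of_real pi * \<i> * of_nat n * of_real b / of_real h\<^sub>H)) = of_int (2 * l) * pi"
    unfolding exp_eq_1 by blast
   moreover have "- (2 * of_real pi * \<i> * of_nat n * of_real b / of_real h\<^sub>H) = \<i> * complex_of_real (- (2 * pi * (n * b / h\<^sub>H)))"
    by simp
   ultimately have "Im (\<i> * complex_of_real (- (2 * pi * (n * b / h\<^sub>H)))) = of_int (2 * l) * pi" by simp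
   then have "2 * pi * (real n * b / h\<^sub>H) = 2 * pi * of_int (- l)" by (simp add: mult_ac)
   then have nb: "real n * b / h\<^sub>H = of_int (- l)" by (simp only: mult_cancel_left) simp
   obtain N where N: "N > 0" "N dvd D" "matpow (G.tr k) N \<in> \<Gamma>\<^sub>H" using D_pow[OF G.tr_mem] by blast
   have "mat2 1 (real N * b) 0 1 \<in> \<Gamma>\<^sub>H" using N(3) by (simp add: trb transl_pow)
   then obtain l' where l': "mat2 1 (real N * b) 0 1 = H.tr l' \<or> mat2 1 (real N * b) 0 1 = - H.tr l'"
    using H.stab_infinity[of "mat2 1 (real N * b) 0 1"] by (auto simp: H.tr_def)
   then have "real N * b = of_int l' * h\<^sub>H" by (auto simp: mat2_eq_iff)
   then have Nb: "real N * (b / h\<^sub>H) = of_int l'" using H.h_pos by (simp add: field_simps)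
   obtain M where M: "D = N * M" using N(2) by blast
   obtain t where t: "int n = 1 + int D * t"
   proof -
    have "int n mod int D = 1 mod int D" using Ic(5) by (metis of_nat_1 zmod_int)
    then have "int D dvd int n - 1" by (metis mod_eq_dvd_iff)
    then obtain t where "int n - 1 = int D * t" by blast
    then show thesis using that[of t] by simp
   qed
   \<comment> \<open>Also N b / h is an integer for some divisor N of D. As n is congruent to 1
     modulo D, subtracting a multiple of the second integer from the first leaves b / h, which is
     hence an integer.\<close>
   have "real n = 1 + real D * of_int t" using t by (metis of_int_1 of_int_add of_int_mult of_int_of_nat_eq)
   then have "b / h\<^sub>H = real n * b / h\<^sub>H - real M * of_int t * (real N * (b / h\<^sub>H))"
    by (simp add: M algebra_simps add_divide_distrib)
   also have "\<dots> = of_int (- l - int M * t * l')" unfolding nb Nb by simp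
   finally have "b = of_int (- l - int M * t * l') * h\<^sub>H" using H.h_pos by (simp add: field_simps)
   then have "G.tr k = H.tr (- l - int M * t * l')" by (simp add: trb H.tr_def)
   then have "G.tr k \<in> \<Gamma>\<^sub>H" using H.tr_mem by simp
   then have "\<gamma> ** g \<in> \<Gamma>\<^sub>H" using k H.uminus_mem by metis
   then have "adj2 \<gamma> ** (\<gamma> ** g) \<in> \<Gamma>\<^sub>H" using H.mult_mem[OF H.adj_mem[OF \<gamma>(1)]] by blast
   then show False using gH \<gamma> by (simp add: adj2_cancel)
  qed
 qed
 show thesis by (rule that[OF fho inv mod nonconst stab])
qed

end

section \<open>Cusps and their widths\<close>

abbreviation conj_grp :: "(real^2^2) set => real^2^2 => (real^2^2) set" where
 "conj_grp \<Gamma> A \<equiv> (\<lambda>\<gamma>. adj2 A ** \<gamma> ** A) ` \<Gamma>"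

lemma conj_grp_iff:
 assumes "det A = 1"
 shows "g \<in> conj_grp \<Gamma> A \<longleftrightarrow> A ** g ** adj2 A \<in> \<Gamma>"
proof
 assume "A ** g ** adj2 A \<in> \<Gamma>"
 then have "adj2 A ** (A ** g ** adj2 A) ** A \<in> conj_grp \<Gamma> A" by (rule imageI)
 then show "g \<in> conj_grp \<Gamma> A" using assms by (simp add: matrix_mul_assoc[symmetric] adj2_cancel adj2_inverse)
qed (use assms in \<open>auto simp: matrix_mul_assoc[symmetric] adj2_cancel adj2_inverse\<close>)

lemma det_cusp_mat [simp]: "det (cusp_mat c) = 1"
 by (cases c) auto

lemma cusp_transl_eq: "cusp_transl c h = cusp_mat c ** mat2 1 h 0 1 ** adj2 (cusp_mat c)"
 by (simp add: cusp_transl_def)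

text \<open>\<open>cusp_mat c\<close> takes infinity to c, so fixing c means that the conjugate
  fixes infinity.\<close>

lemma boundary_fixed_iff:
 assumes "det g = 1"
 shows "boundary_mobius g c = c \<longleftrightarrow> (adj2 (cusp_mat c) ** g ** cusp_mat c)$2$1 = 0"
proof (cases c)
 case (Some x)
 have d: "g$1$1 * g$2$2 - g$1$2 * g$2$1 = 1" using assms by (simp add: det_2)
 have l: "(adj2 (cusp_mat c) ** g ** cusp_mat c)$2$1 = x * (g$2$1 * x + g$2$2) - (g$1$1 * x + g$1$2)"
  by (simp add: Some algebra_simps)
 show ?thesis
 proof (cases "g$2$1 * x + g$2$2 = 0")
  case True
  have "g$1$1 * x + g$1$2 ~= 0"
  proof
   assume a: "g$1$1 * x + g$1$2 = 0"
   have "g$1$1 * (g$2$1 * x + g$2$2) - g$2$1 * (g$1$1 * x + g$1$2) = 1" using d by (simp add: algebra_simps)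
   then show False using a True by simp
  qed
  with True show ?thesis unfolding l by (simp add: Some)
 next
  case False
  then show ?thesis unfolding l by (auto simp: Some moebius_def field_simps)
 qed
qed simp

lemma transl_mult: "mat2 1 a 0 1 ** mat2 1 b 0 1 = mat2 1 (a + b) 0 1"
 and transl_adj: "adj2 (mat2 1 a 0 1) = mat2 1 (- a) 0 1"
 by (simp_all add: mat2_eq_iff)

text \<open>In a discrete group a translation cannot share its fixed point with a hyperbolic
  element: conjugation would multiply the translation length by a square below 1 again and again and
  produce infinitely many elements of bounded norm.\<close>

lemma (in discrete_SL2) upper_triangular_mem:
 assumes s: "mat2 1 s 0 1 \<in> \<Gamma>" "s ~= 0" and g: "g \<in> \<Gamma>" "g$2$1 = 0"
 shows "\<exists>b. g = mat2 1 b 0 1 \<or> g = - mat2 1 b 0 1"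
proof -
 have contr: False if r: "\<bar>r\<bar> < 1" "r ~= 0" and g: "g \<in> \<Gamma>" "g$2$1 = 0" "g$1$1 = r" for r g
 proof -
  have d: "r * g$2$2 = 1" using det1[OF g(1)] g by (simp add: det_2)
  have mem: "mat2 1 ((r^2)^n * s) 0 1 \<in> \<Gamma>" for n
  proof (induction n)
   case (Suc n)
   have "g ** mat2 1 ((r^2)^n * s) 0 1 ** adj2 g \<in> \<Gamma>" by (intro mult_mem adj_mem Suc g)
   also have "g ** mat2 1 ((r^2)^n * s) 0 1 ** adj2 g = mat2 1 ((r^2)^Suc n * s) 0 1"
    using d g by (simp add: mat2_eq_iff power2_eq_square algebra_simps)
   finally show ?case .
  qed (use s in simp)
  have r2: "0 < r^2" "r^2 < 1" using r by (simp_all add: abs_square_less_1)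
  define q where "q = r^2"
  have q: "0 < q" "q < 1" using r2 by (simp_all add: q_def)
  have "range (\<lambda>n. mat2 1 (q^n * s) 0 1) \<subseteq> {g \<in> \<Gamma>. norm g <= sqrt (2 + s^2)}"
  proof clarify
   fix n
   have "(q^n * s)^2 <= s^2"
    unfolding power_mult_distrib using q power_le_one[of "q^n" 2] power_le_one[of q n]
    by (intro mult_left_le_one_le) auto
   then have "(norm (mat2 1 (q^n * s) 0 1))^2 <= (sqrt (2 + s^2))^2" by (simp add: norm_sq2)
   then have "norm (mat2 1 (q^n * s) 0 1) <= sqrt (2 + s^2)" by (rule power2_le_imp_le) simp
   then show "mat2 1 (q^n * s) 0 1 \<in> \<Gamma> \<and> norm (mat2 1 (q^n * s) 0 1) <= sqrt (2 + s^2)"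
    using mem[of n] by (simp add: q_def)
  qed
  then have "finite (range (\<lambda>n. mat2 1 (q^n * s) 0 1))" by (rule finite_subset[OF _ finite_bounded])
  moreover have "inj (\<lambda>n. mat2 1 (q^n * s) 0 1)"
  proof (rule injI)
   fix m n assume "mat2 1 (q^m * s) 0 1 = mat2 1 (q^n * s) 0 1"
   then have "q^m = q^n" using s(2) by (simp add: mat2_eq_iff)
   then show "m = n" using q by (metis less_irrefl linorder_neqE_nat power_strict_decreasing)
  qed
  ultimately show False using finite_imageD infinite_UNIV_nat by blast
 qed
 have d: "g$1$1 * g$2$2 = 1" using det1[OF g(1)] g by (simp add: det_2)
 have "\<bar>g$1$1\<bar> = 1"
 proof (rule ccontr)
  assume n: "\<bar>g$1$1\<bar> ~= 1"
  have nz: "g$1$1 ~= 0" "g$2$2 ~= 0" using d by auto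
  have "\<bar>g$1$1\<bar> * \<bar>g$2$2\<bar> = 1" using d by (metis abs_mult abs_one)
  show False
  \<comment> \<open>If the first diagonal entry exceeds 1, the inverse has the small entry in that
    place.\<close>
  proof (cases "\<bar>g$1$1\<bar> < 1")
   case True
   show False by (rule contr[OF True nz(1) g]) simp
  next
   case False
   then have "1 < \<bar>g$1$1\<bar>" using n by linarith
   then have "\<bar>g$2$2\<bar> * 1 < \<bar>g$2$2\<bar> * \<bar>g$1$1\<bar>" using nz by (intro mult_strict_left_mono) auto
   then have "\<bar>g$2$2\<bar> < 1" using \<open>\<bar>g$1$1\<bar> * \<bar>g$2$2\<bar> = 1\<close> by (simp add: mult.commute)
   then show False by (rule contr[OF _ nz(2) adj_mem[OF g(1)]]) (use g in auto)
  qed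
 qed
 then have "g$1$1 = 1 \<and> g$2$2 = 1 \<or> g$1$1 = -1 \<and> g$2$2 = -1" using d by (auto simp: abs_if split: if_splits)
 then show ?thesis
 proof
  assume "g$1$1 = 1 \<and> g$2$2 = 1"
  then show ?thesis using g(2) by (intro exI[of _ "g$1$2"]) (simp add: mat2_eq_iff)
 next
  assume "g$1$1 = -1 \<and> g$2$2 = -1"
  then show ?thesis using g(2) by (intro exI[of _ "- (g$1$2)"]) (simp add: mat2_eq_iff)
 qed
qed

text \<open>The width is the smallest positive translation length; division with remainder shows
  that all others are integer multiples of it.\<close>

lemma (in discrete_SL2) exists_cusp_group:
 assumes s: "mat2 1 s 0 1 \<in> \<Gamma>" "s ~= 0"
 obtains h where "cusp_group \<Gamma> h"
proof -
 define T where "T = {x. mat2 1 x 0 1 \<in> \<Gamma>}"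
 have Tadd: "x + y \<in> T" if "x \<in> T" "y \<in> T" for x y
  using mult_mem[of "mat2 1 x 0 1" "mat2 1 y 0 1"] that by (simp add: T_def transl_mult)
 have Tneg: "- x \<in> T" if "x \<in> T" for x
  using adj_mem[of "mat2 1 x 0 1"] that by (simp add: T_def transl_adj)
 have fin: "finite {x \<in> T. \<bar>x\<bar> <= c}" for c
 proof -
  have "(\<lambda>x. mat2 1 x 0 1) ` {x \<in> T. \<bar>x\<bar> <= c} \<subseteq> {g \<in> \<Gamma>. norm g <= sqrt (2 + c^2)}"
  proof clarify
   fix x assume x: "x \<in> T" "\<bar>x\<bar> <= c"
   have "x^2 <= c^2" using x(2) by (metis abs_ge_zero abs_of_nonneg order_trans power2_abs power_mono)
   then have "(norm (mat2 1 x 0 1))^2 <= (sqrt (2 + c^2))^2" by (simp add: norm_sq2)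
   then have "norm (mat2 1 x 0 1) <= sqrt (2 + c^2)" by (rule power2_le_imp_le) simp
   then show "mat2 1 x 0 1 \<in> \<Gamma> \<and> norm (mat2 1 x 0 1) <= sqrt (2 + c^2)" using x by (simp add: T_def)
  qed
  then have "finite ((\<lambda>x. mat2 1 x 0 1) ` {x \<in> T. \<bar>x\<bar> <= c})" by (rule finite_subset[OF _ finite_bounded])
  moreover have "inj_on (\<lambda>x. mat2 1 x 0 1) {x \<in> T. \<bar>x\<bar> <= c}" by (auto simp: inj_on_def mat2_eq_iff)
  ultimately show ?thesis by (rule finite_imageD)
 qed
 define P where "P = {x \<in> T. 0 < x \<and> x <= \<bar>s\<bar>}"
 have finP: "finite P" by (rule finite_subset[OF _ fin[of "\<bar>s\<bar>"]]) (auto simp: P_def)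
 have sP: "\<bar>s\<bar> \<in> P" using s Tneg[of s] by (auto simp: P_def T_def abs_if)
 define h where "h = Min P"
 have "P ~= {}" using sP by blast
 with finP have hP: "h \<in> P" unfolding h_def by (rule Min_in)
 have P2: "h <= x" if "x \<in> P" for x unfolding h_def by (rule Min_le[OF finP that])
 have h: "h \<in> T" "h > 0" "h <= \<bar>s\<bar>" using hP by (auto simp: P_def)
 have mult: "\<exists>n::int. x = of_int n * h" if x: "x \<in> T" for x
 proof (intro exI)
  let ?n = "\<lfloor>x / h\<rfloor>"
  have "of_int (- ?n) * h \<in> T" by (rule int_multiple_mem[OF h(1) Tadd Tneg])
  from Tadd[OF x this] have r: "x - of_int ?n * h \<in> T" by simp
  have "of_int ?n * h <= x" "x < (of_int ?n + 1) * h"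
   using h(2) floor_divide_lower[of h x] floor_divide_upper[of h x] by auto
  then have b: "0 <= x - of_int ?n * h" "x - of_int ?n * h < h" by (auto simp: algebra_simps)
  have "\<not> 0 < x - of_int ?n * h"
  proof
   assume "0 < x - of_int ?n * h"
   moreover have "x - of_int ?n * h <= \<bar>s\<bar>" using b(2) h(3) by linarith
   ultimately have "x - of_int ?n * h \<in> P" using r unfolding P_def by blast
   from P2[OF this] b(2) show False by linarith
  qed
  then show "x = of_int ?n * h" using b(1) by linarith
 qed
 have "cusp_group \<Gamma> h"
 proof
  show "h > 0" by (rule h)
  show "mat2 1 h 0 1 \<in> \<Gamma>" using h by (simp add: T_def)
  fix g assume g: "g \<in> \<Gamma>" "g$2$1 = 0"
  obtain b where b: "g = mat2 1 b 0 1 \<or> g = - mat2 1 b 0 1" using upper_triangular_mem[OF s g] by blast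
  have "b \<in> T" using b g(1) uminus_mem[OF g(1)] by (auto simp: T_def)
  then obtain n :: int where "b = of_int n * h" using mult by blast
  then show "\<exists>n::int. g = mat2 1 (of_int n * h) 0 1 \<or> g = - mat2 1 (of_int n * h) 0 1" using b by blast
 qed
 then show thesis by (rule that)
qed

section \<open>Stabilizers of cusps in the projective group\<close>

lemma psl_uminus: "psl (- g) = psl g"
 by (auto simp: psl_eq)

lemma psl_mult:
 assumes "det g = 1" "det h = 1"
 shows "psl g \<otimes>\<^bsub>PSL2R\<^esub> psl h = psl (g ** h)"
proof -
 interpret normal "{I2, - I2}" SL2R by (rule normal_center_SL2R)
 show ?thesis using rcos_sum[of g h] assms by (simp add: PSL2R_def psl_def)
qed

lemma group_PSL2R: "group PSL2R"
 unfolding PSL2R_def by (rule normal.factorgroup_is_group[OF normal_center_SL2R])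

lemma one_PSL2R: "\<one>\<^bsub>PSL2R\<^esub> = psl I2"
 by (simp add: PSL2R_def psl_eq)

lemma inv_psl:
 assumes "det g = 1"
 shows "inv\<^bsub>PSL2R\<^esub> (psl g) = psl (adj2 g)"
proof (rule group.inv_equality[OF group_PSL2R])
 show "psl (adj2 g) \<otimes>\<^bsub>PSL2R\<^esub> psl g = \<one>\<^bsub>PSL2R\<^esub>"
  using assms by (simp add: psl_mult adj2_inverse one_PSL2R)
qed (use assms in \<open>auto simp: carrier_PSL2R\<close>)

lemma cusp_transl_mult: "cusp_transl c a ** cusp_transl c b = cusp_transl c (a + b)"
 unfolding cusp_transl_eq transl_mult[symmetric] by (simp add: matrix_mul_assoc[symmetric] adj2_cancel)

lemma cusp_transl_adj: "adj2 (cusp_transl c a) = cusp_transl c (- a)"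
 unfolding cusp_transl_eq adj2_mult adj2_adj2 transl_adj by (simp add: matrix_mul_assoc)

lemma cusp_transl_0: "cusp_transl c 0 = I2"
proof -
 have "mat2 1 0 0 1 = I2" by (simp add: mat2_eq_iff)
 then show ?thesis by (simp add: cusp_transl_eq adj2_inverse)
qed

lemma det_cusp_transl [simp]: "det (cusp_transl c a) = 1"
 by (simp add: cusp_transl_eq Determinants.det_mul)

lemma conj_cusp_transl: "adj2 (cusp_mat c) ** cusp_transl c a ** cusp_mat c = mat2 1 a 0 1"
 by (simp add: cusp_transl_eq matrix_mul_assoc[symmetric] adj2_cancel adj2_inverse)

lemma psl_cusp_transl_inj:
 assumes "psl (cusp_transl c a) = psl (cusp_transl c b)"
 shows "a = b"
proof -
 have "cusp_transl c a = cusp_transl c b \<or> cusp_transl c a = - cusp_transl c b"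
  using assms by (auto simp: psl_eq)
 then have "mat2 1 a 0 1 = mat2 1 b 0 1 \<or> mat2 1 a 0 1 = - mat2 1 b 0 1"
  using conj_cusp_transl[of c a] conj_cusp_transl[of c b] by (auto simp: uminus_mult_mat2)
 then show ?thesis by (auto simp: mat2_eq_iff)
qed

lemma generate_cusp_transl:
 "generate PSL2R {psl (cusp_transl c h)} = {psl (cusp_transl c (of_int n * h)) | n. True}" (is "?L = ?R")
proof
 show "?L \<subseteq> ?R"
 proof
  fix x assume "x \<in> ?L"
  then show "x \<in> ?R"
  proof induction
   case one
   have "psl I2 = psl (cusp_transl c (of_int 0 * h))" by (simp add: cusp_transl_0)
   then show ?case unfolding one_PSL2R by blast
  next
   case (incl x)
   then have "x = psl (cusp_transl c (of_int 1 * h))" by simp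
   then show ?case by blast
  next
   case (inv x)
   then have "inv\<^bsub>PSL2R\<^esub> x = psl (cusp_transl c (of_int (-1) * h))" by (simp add: inv_psl cusp_transl_adj)
   then show ?case by blast
  next
   case (eng x y)
   then obtain m n where "x = psl (cusp_transl c (of_int m * h))" "y = psl (cusp_transl c (of_int n * h))" by blast
   then have "x \<otimes>\<^bsub>PSL2R\<^esub> y = psl (cusp_transl c (of_int (m + n) * h))"
    by (simp add: psl_mult cusp_transl_mult algebra_simps)
   then show ?case by blast
  qed
 qed
 show "?R \<subseteq> ?L"
 proof clarify
  fix n :: int
  have step: "psl (cusp_transl c (x + h)) \<in> ?L" "psl (cusp_transl c (x - h)) \<in> ?L" if "psl (cusp_transl c x) \<in> ?L" for x
   using generate.eng[OF that generate.incl[of "psl (cusp_transl c h)"]]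
    generate.eng[OF that generate.inv[of "psl (cusp_transl c h)"]]
   by (simp_all add: psl_mult inv_psl cusp_transl_mult cusp_transl_adj)
  show "psl (cusp_transl c (of_int n * h)) \<in> ?L"
  proof (induction n rule: int_induct[where k = 0])
   case base
   show ?case using generate.one[of PSL2R] by (simp add: one_PSL2R cusp_transl_0)
  next
   case (step1 i)
   then show ?case using step(1) by (simp add: distrib_right)
  next
   case (step2 i)
   then show ?case using step(2) by (simp add: left_diff_distrib)
  qed
 qed
qed

text \<open>The description in \<open>cusp_width\<close> has exactly one solution. A parabolic
  element at c becomes a translation up to sign after conjugation, which yields a width.\<close>

theorem cusp_width_props:
 assumes "discrete_SL2 \<Gamma>" "is_cusp \<Gamma> c"
 shows "cusp_group (conj_grp \<Gamma> (cusp_mat c)) (cusp_width \<Gamma> c)"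
  and "cusp_generator \<Gamma> c \<in> \<Gamma>"
proof -
 interpret discrete_SL2 \<Gamma> by fact
 let ?A = "cusp_mat c" and ?\<Gamma> = "conj_grp \<Gamma> (cusp_mat c)"
 interpret C: discrete_SL2 ?\<Gamma> by (rule discrete_SL2_conj[OF assms(1)]) simp
 obtain g where g: "g \<in> \<Gamma>" "parabolic g" "g \<notin> {I2, - I2}" "boundary_mobius g c = c"
  using assms(2) by (auto simp: is_cusp_def)
 define u where "u = adj2 ?A ** g ** ?A"
 have uC: "u \<in> ?\<Gamma>" using g by (simp add: u_def)
 have gu: "g = ?A ** u ** adj2 ?A"
  by (simp add: u_def matrix_mul_assoc[symmetric] adj2_cancel adj2_inverse)
 have u21: "u$2$1 = 0" using g boundary_fixed_iff[OF det1[OF g(1)], of c] by (simp add: u_def)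
 have du: "u$1$1 * u$2$2 = 1" using C.det1[OF uC] u21 by (simp add: det_2)
 have tru: "trace u = trace g"
  unfolding u_def using trace_mul_sym[of "adj2 ?A ** g" ?A]
  by (simp add: matrix_mul_assoc adj2_inverse)
 then have "(u$1$1 + u$2$2)^2 = 4" using g(2) by (auto simp: parabolic_def trace2)
 then have "(u$1$1 - u$2$2)^2 = 0" using du by (simp add: power2_eq_square algebra_simps)
 then have eq: "u$1$1 = u$2$2" by simp
 then have e: "u$1$1 = 1 \<or> u$1$1 = -1" using du by (simp add: square_eq_1_iff)
 obtain s where s: "mat2 1 s 0 1 \<in> ?\<Gamma>" "s ~= 0"
 proof -
  have nz: "u$1$2 ~= 0"
  proof
   assume "u$1$2 = 0"
   then have "u = I2 \<or> u = - I2" using e eq u21 by (auto simp: mat2_eq_iff)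
   then show False using g(3) gu by (auto simp: adj2_inverse uminus_mult_mat2)
  qed
  from e show thesis
  proof
   assume "u$1$1 = 1"
   then have "u = mat2 1 (u$1$2) 0 1" using eq u21 by (simp add: mat2_eq_iff)
   then show thesis using that uC nz by metis
  next
   assume "u$1$1 = -1"
   then have "- u = mat2 1 (- (u$1$2)) 0 1" using eq u21 by (simp add: mat2_eq_iff)
   then show thesis using that[of "- (u$1$2)"] C.uminus_mem[OF uC] nz by simp
  qed
 qed
 obtain h where "cusp_group ?\<Gamma> h" using C.exists_cusp_group[OF s] by blast
 then interpret P: cusp_group ?\<Gamma> h .
 have mem: "cusp_transl c (of_int n * h) \<in> \<Gamma>" for n
  using P.tr_mem[of n] unfolding P.tr_def by (simp add: conj_grp_iff cusp_transl_eq)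
 have stab: "cusp_stabilizer \<Gamma> c = {psl (cusp_transl c (of_int n * h)) | n. True}"
 proof
  show "cusp_stabilizer \<Gamma> c \<subseteq> {psl (cusp_transl c (of_int n * h)) | n. True}"
  proof
   fix C assume "C \<in> cusp_stabilizer \<Gamma> c"
   then obtain \<gamma> where \<gamma>: "\<gamma> \<in> \<Gamma>" "C = psl \<gamma>" "boundary_mobius \<gamma> c = c"
    by (auto simp: cusp_stabilizer_def psl_image_def psl_eq)
   have "(adj2 ?A ** \<gamma> ** ?A)$2$1 = 0" using \<gamma> boundary_fixed_iff[OF det1[OF \<gamma>(1)], of c] by simp
   moreover have "adj2 ?A ** \<gamma> ** ?A \<in> ?\<Gamma>" using \<gamma> by blast
   ultimately obtain n :: int where "adj2 ?A ** \<gamma> ** ?A = mat2 1 (of_int n * h) 0 1 \<or>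
    adj2 ?A ** \<gamma> ** ?A = - mat2 1 (of_int n * h) 0 1" using P.stab_infinity by blast
   moreover have "\<gamma> = ?A ** (adj2 ?A ** \<gamma> ** ?A) ** adj2 ?A"
    by (simp add: matrix_mul_assoc[symmetric] adj2_cancel adj2_inverse)
   ultimately have "\<gamma> = cusp_transl c (of_int n * h) \<or> \<gamma> = - cusp_transl c (of_int n * h)"
    by (auto simp: cusp_transl_eq uminus_mult_mat2)
   then show "C \<in> {psl (cusp_transl c (of_int n * h)) | n. True}" using \<gamma>(2) psl_uminus by auto
  qed
  show "{psl (cusp_transl c (of_int n * h)) | n. True} \<subseteq> cusp_stabilizer \<Gamma> c"
  proof clarify
   fix n :: int
   have "boundary_mobius g c = c" if "g \<in> psl (cusp_transl c (of_int n * h))" for g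
   proof -
    have "g = cusp_transl c (of_int n * h) \<or> g = - cusp_transl c (of_int n * h)" using that by (auto simp: psl_eq)
    moreover have "det (- cusp_transl c (of_int n * h)) = 1"
     using det1[OF uminus_mem[OF mem[of n]]] .
    ultimately show ?thesis
     using conj_cusp_transl[of c "of_int n * h"] boundary_fixed_iff[of g c]
     by (auto simp: uminus_mult_mat2 simp del: mult2_entries)
   qed
   then show "psl (cusp_transl c (of_int n * h)) \<in> cusp_stabilizer \<Gamma> c"
    using mem[of n] by (auto simp: cusp_stabilizer_def psl_image_def)
  qed
 qed
 have "cusp_width \<Gamma> c = h"
  unfolding cusp_width_def
 proof (rule the_equality)
  show "h > 0 \<and> cusp_stabilizer \<Gamma> c = generate PSL2R {psl (cusp_transl c h)}"
   using P.h_pos stab by (simp add: generate_cusp_transl)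
  \<comment> \<open>Two positive generators are integer multiples of each other, so both multipliers
    are 1.\<close>
  fix h' assume h': "h' > 0 \<and> cusp_stabilizer \<Gamma> c = generate PSL2R {psl (cusp_transl c h')}"
  then have eq: "{psl (cusp_transl c (of_int n * h)) | n. True} = {psl (cusp_transl c (of_int n * h')) | n. True}"
   using stab by (simp add: generate_cusp_transl)
  have "psl (cusp_transl c (of_int 1 * h)) \<in> {psl (cusp_transl c (of_int n * h')) | n. True}"
   unfolding eq[symmetric] by blast
  then obtain a where "psl (cusp_transl c (of_int 1 * h)) = psl (cusp_transl c (of_int a * h'))" by blast
  then have a: "h = of_int a * h'" using psl_cusp_transl_inj by fastforce
  have "psl (cusp_transl c (of_int 1 * h')) \<in> {psl (cusp_transl c (of_int n * h)) | n. True}"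
   unfolding eq by blast
  then obtain b where "psl (cusp_transl c (of_int 1 * h')) = psl (cusp_transl c (of_int b * h))" by blast
  then have b: "h' = of_int b * h" using psl_cusp_transl_inj by fastforce
  have "h * 1 = h * of_int (a * b)" using a b by (simp add: mult_ac)
  then have ab: "a * b = 1" using P.h_pos by (metis less_irrefl mult_cancel_left of_int_1 of_int_eq_iff)
  have "a > 0" using a h' P.h_pos by (metis of_int_0_less_iff zero_less_mult_pos2)
  then have "a = 1" using ab by (metis pos_zmult_eq_1_iff)
  then show "h' = h" using a by simp
 qed
 then show "cusp_group ?\<Gamma> (cusp_width \<Gamma> c)" using P.cusp_group_axioms by simp
 show "cusp_generator \<Gamma> c \<in> \<Gamma>" using mem[of 1] \<open>cusp_width \<Gamma> c = h\<close> by (simp add: cusp_generator_def)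
qed

section \<open>Logarithmic expansions and moderate growth\<close>

text \<open>These are the functions that have a Laurent series in \<open>nome\<close> with finitely
  many negative exponents.\<close>

definition periodic_moderate :: "real => (complex => complex) => bool" where
 "periodic_moderate h \<phi> \<longleftrightarrow> \<phi> holomorphic_on \<H> \<and> moderate \<phi> \<and> (\<forall>z. Im z > 0 --> \<phi> (z + of_real h) = \<phi> z)"

lemma gbinomial_polynomial: "\<exists>c. \<forall>x::complex. x gchoose l = (\<Sum>j\<le>l. c j * x ^ j)"
proof -
 define p :: "complex poly" where "p = (\<Prod>i = 0..<l. [:- of_nat i, 1:])"
 have "degree p <= (\<Sum>i = 0..<l. degree [:- of_nat i, 1::complex:])"
  unfolding p_def by (rule order_trans[OF degree_prod_sum_le]) (simp_all add: o_def)
 then have d: "degree p <= l" by simp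
 have "x gchoose l = (\<Sum>j\<le>l. (coeff p j / fact l) * x ^ j)" for x :: complex
 proof -
  have "x gchoose l = poly p x / fact l" by (simp add: gbinomial_prod_rev p_def poly_prod)
  also have "poly p x = (\<Sum>j\<le>l. coeff p j * x ^ j)" 
   unfolding poly_altdef using d by (intro sum.mono_neutral_left) (auto intro: coeff_eq_0)
  finally show ?thesis by (simp add: sum_divide_distrib)
 qed
 then show ?thesis by (intro exI[of _ "\<lambda>j. coeff p j / fact l"]) blast
qed

lemma holomorphic_gbinomial: "(\<lambda>z. (z / of_real h) gchoose l :: complex) holomorphic_on S"
 unfolding gbinomial_prod_rev by (cases "h = 0") (auto intro!: holomorphic_intros)

lemma moderate_gbinomial: "moderate (\<lambda>z. (z / of_real h) gchoose l)"
proof -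
 have "moderate (\<lambda>z. (\<Prod>i = 0..<l. (inverse (of_real h) * z) - of_nat i) * inverse (fact l))"
  by (intro moderate_mult moderate_prod moderate_diff moderate_const moderate_ident)
 then show ?thesis by (simp add: gbinomial_prod_rev divide_inverse mult.commute)
qed

text \<open>Newton's forward difference formula with periodic coefficients.\<close>

lemma unipotent_decomposition:
 assumes h: "h > 0" and u: "!!r. r < n ==> u r holomorphic_on \<H>" "!!r. r < n ==> moderate (u r)"
  and step: "!!r z. r < n ==> Im z > 0 ==> u r (z + of_real h) = u r z + u (Suc r) z"
  and n0: "!!z. u n z = 0"
 obtains \<phi> where "!!r. r < n ==> periodic_moderate h (\<phi> r)"
  "!!r z. r < n ==> Im z > 0 ==> u r z = (\<Sum>l<n - r. ((z / of_real h) gchoose l) * \<phi> (r + l) z)"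
proof -
 have "\<exists>\<phi>. \<forall>r<n. n - k <= r --> periodic_moderate h (\<phi> r) \<and>
   (\<forall>z. Im z > 0 --> u r z = (\<Sum>l<n - r. ((z / of_real h) gchoose l) * \<phi> (r + l) z))" if "k <= n" for k
  using that
 proof (induction k)
  case (Suc k)
  then obtain \<phi> where \<phi>: "!!r. r < n ==> n - k <= r ==> periodic_moderate h (\<phi> r)"
   "!!r z. r < n ==> n - k <= r ==> Im z > 0 ==> u r z = (\<Sum>l<n - r. ((z / of_real h) gchoose l) * \<phi> (r + l) z)"
   by auto
  define s where "s = n - Suc k"
  have s: "s < n" "Suc s = n - k" "n - s = Suc k" "!!l. l < k ==> Suc s + l < n" using Suc.prems by (auto simp: s_def)
  \<comment> \<open>Downward induction: subtract from \<open>u s\<close> what the coefficients found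
    so far contribute. By Pascal's rule the shift of that sum adds exactly \<open>u (Suc s)\<close>,
    so the remainder is periodic.\<close>
  define \<psi> where "\<psi> z = u s z - (\<Sum>l<k. ((z / of_real h) gchoose Suc l) * \<phi> (Suc s + l) z)" for z
  have pm: "periodic_moderate h (\<phi> (Suc s + l))" if "l < k" for l using \<phi>(1)[of "Suc s + l"] s that by simp
  have uS: "u (Suc s) z = (\<Sum>l<k. ((z / of_real h) gchoose l) * \<phi> (Suc s + l) z)" if "Im z > 0" for z
  proof (cases "k = 0")
   case True
   then show ?thesis using s n0 by simp
  next
   case False
   then show ?thesis using \<phi>(2)[of "Suc s" z] s that by simp
  qed
  have "periodic_moderate h \<psi>"
   unfolding periodic_moderate_def
  proof (intro conjI allI impI)
   show "\<psi> holomorphic_on \<H>"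
    unfolding \<psi>_def using pm by (intro holomorphic_intros u s holomorphic_gbinomial) (auto simp: periodic_moderate_def)
   show "moderate \<psi>"
    unfolding \<psi>_def using pm
    by (intro moderate_diff moderate_sum moderate_mult moderate_gbinomial u s) (auto simp: periodic_moderate_def)
   fix z :: complex assume z: "Im z > 0"
   have g: "((z + of_real h) / of_real h) gchoose Suc l = ((z / of_real h) gchoose l) + ((z / of_real h) gchoose Suc l)" for l
    using gbinomial_Suc_Suc[of "z / of_real h" l] h by (simp add: add_divide_distrib)
   have "(\<Sum>l<k. (((z + of_real h) / of_real h) gchoose Suc l) * \<phi> (Suc s + l) (z + of_real h)) =
     (\<Sum>l<k. ((z / of_real h) gchoose l) * \<phi> (Suc s + l) z + ((z / of_real h) gchoose Suc l) * \<phi> (Suc s + l) z)"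
    using pm z unfolding g by (intro sum.cong) (auto simp: periodic_moderate_def algebra_simps)
   then show "\<psi> (z + of_real h) = \<psi> z"
    by (simp add: \<psi>_def step[OF s(1) z] uS[OF z] sum.distrib)
  qed
  moreover have "u s z = (\<Sum>l<n - s. ((z / of_real h) gchoose l) * (\<phi>(s := \<psi>)) (s + l) z)" for z
   unfolding s(3) sum.lessThan_Suc_shift by (simp add: \<psi>_def)
  moreover have "u r z = (\<Sum>l<n - r. ((z / of_real h) gchoose l) * (\<phi>(s := \<psi>)) (r + l) z)"
   if "r < n" "n - k <= r" "Im z > 0" for r z
   using \<phi>(2)[OF that] s(2) that(2) by simp
  moreover have "r = s \<or> r ~= s \<and> n - k <= r" if "n - Suc k <= r" for r
   using that s(2) by (auto simp: s_def)
  ultimately have "periodic_moderate h ((\<phi>(s := \<psi>)) r) \<and>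
   (\<forall>z. Im z > 0 --> u r z = (\<Sum>l<n - r. ((z / of_real h) gchoose l) * (\<phi>(s := \<psi>)) (r + l) z))"
   if "r < n" "n - Suc k <= r" for r
   using \<phi>(1)[of r] that by (cases "r = s") (auto simp del: fun_upd_apply simp: fun_upd_same fun_upd_other)
  then show ?case by blast
 qed auto
 from this[of n] that show thesis by auto
qed

definition lq :: "real => complex => complex" where
 "lq h z = 2 * of_real pi * \<i> * z / of_real h"

lemma exp_lq: "exp (lq h z) = nome h z"
 by (simp add: lq_def nome_def)

lemma holomorphic_lq [holomorphic_intros]: "lq h holomorphic_on S"
 unfolding lq_def by (cases "h = 0") (auto intro!: holomorphic_intros)

lemma moderate_lq: "moderate (lq h)"
proof -
 have "moderate (\<lambda>z. (2 * of_real pi * \<i> / of_real h) * z)" by (intro moderate_mult moderate_const moderate_ident)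
 then show ?thesis by (simp add: lq_def[abs_def])
qed

lemma moderate_exp_lq: "moderate (\<lambda>z. exp (c * lq h z))"
 using moderate_exp_bounded[of "c * (2 * of_real pi * \<i> / of_real h)"] by (simp add: lq_def mult.assoc)

lemma gbinomial_lq: "\<exists>c. \<forall>l<n. \<forall>z. h ~= 0 --> (z / of_real h) gchoose l = (\<Sum>j<n. c l j * lq h z ^ j)"
proof -
 have "\<forall>l. \<exists>c. \<forall>x::complex. x gchoose l = (\<Sum>j\<le>l. c j * x ^ j)" using gbinomial_polynomial by blast
 then obtain c where c: "!!l x. (x::complex) gchoose l = (\<Sum>j\<le>l. c l j * x ^ j)" by metis
 define e where "e l j = (if j <= l then c l j / (2 * of_real pi * \<i>) ^ j else 0)" for l j
 have "(z / of_real h) gchoose l = (\<Sum>j<n. e l j * lq h z ^ j)" if "l < n" "h ~= 0" for l z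
 proof -
  have zl: "z / of_real h = lq h z / (2 * of_real pi * \<i>)" by (simp add: lq_def)
  have "(z / of_real h) gchoose l = (\<Sum>j\<le>l. e l j * lq h z ^ j)"
   unfolding c zl by (intro sum.cong) (auto simp: e_def power_divide)
  also have "\<dots> = (\<Sum>j<n. e l j * lq h z ^ j)"
   using that by (intro sum.mono_neutral_left) (auto simp: e_def)
  finally show ?thesis .
 qed
 then show ?thesis by blast
qed

lemma periodic_moderate_sum:
 assumes "!!i. i \<in> I ==> periodic_moderate h (\<phi> i)"
 shows "periodic_moderate h (\<lambda>z. \<Sum>i\<in>I. c i * \<phi> i z)"
 unfolding periodic_moderate_def
proof (intro conjI allI impI)
 show "(\<lambda>z. \<Sum>i\<in>I. c i * \<phi> i z) holomorphic_on \<H>"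
  using assms by (intro holomorphic_intros) (auto simp: periodic_moderate_def)
 show "moderate (\<lambda>z. \<Sum>i\<in>I. c i * \<phi> i z)"
  using assms by (intro moderate_sum moderate_mult moderate_const) (auto simp: periodic_moderate_def)
qed (use assms in \<open>auto simp: periodic_moderate_def intro!: sum.cong\<close>)

lemma periodic_moderate_zero: "periodic_moderate h (\<lambda>z. 0)"
 using periodic_moderate_sum[of "{}" h "\<lambda>i z. 0"] by simp

text \<open>Dividing by q^\<mu> removes the eigenvalue l, and the weights l^(-r) restore ones above
  the diagonal, so a Jordan block becomes unipotent and Newton's formula applies. Binomials in z/h
  are then rewritten in powers of log q.\<close>

lemma jordan_block_decomposition:
 assumes h: "h > 0" and g: "!!r. r < n ==> g r holomorphic_on \<H>" "!!r. r < n ==> moderate (g r)"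
  and step: "!!r z. r < n ==> Im z > 0 ==> g r (z + of_real h) = exp (2 * of_real pi * \<i> * \<mu>) * g r z + g (Suc r) z"
  and n0: "!!z. g n z = 0" and r: "r < n"
 shows "\<exists>\<Phi>. (\<forall>j<n. periodic_moderate h (\<Phi> j)) \<and>
  (\<forall>z. Im z > 0 --> g r z = (\<Sum>j<n. lq h z ^ j * exp (\<mu> * lq h z) * \<Phi> j z))"
proof -
 define l where "l = exp (2 * of_real pi * \<i> * \<mu>)"
 define u where "u r z = inverse l ^ r * exp (- \<mu> * lq h z) * g r z" for r z
 have l0: "l ~= 0" by (simp add: l_def)
 have sh: "exp (- \<mu> * lq h (z + of_real h)) = exp (- \<mu> * lq h z) / l" for z
 proof -
  have "- \<mu> * lq h (z + of_real h) = - \<mu> * lq h z - 2 * of_real pi * \<i> * \<mu>"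
   using h by (simp add: lq_def field_simps)
  then show ?thesis by (simp add: exp_diff l_def)
 qed
 obtain \<phi> where \<phi>: "!!r. r < n ==> periodic_moderate h (\<phi> r)"
  "!!r z. r < n ==> Im z > 0 ==> u r z = (\<Sum>l<n - r. ((z / of_real h) gchoose l) * \<phi> (r + l) z)"
 proof (rule unipotent_decomposition[OF h, of n u])
  show "u r holomorphic_on \<H>" "moderate (u r)" if "r < n" for r
   unfolding u_def by (intro holomorphic_intros moderate_mult moderate_const moderate_exp_lq g that)+
  show "u r (z + of_real h) = u r z + u (Suc r) z" if "r < n" "Im z > 0" for r z
   using step[OF that] l0 unfolding u_def sh l_def[symmetric] by (simp add: field_simps)
  show "u n z = 0" for z by (simp add: u_def n0)
 qed (rule that)
 obtain c where c: "!!l z. l < n ==> (z / of_real h) gchoose l = (\<Sum>j<n. c l j * lq h z ^ j)"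
  using gbinomial_lq[of n h] h by auto
 define \<Phi> where "\<Phi> j z = (\<Sum>k<n - r. (l ^ r * c k j) * \<phi> (r + k) z)" for j z
 have "periodic_moderate h (\<Phi> j)" for j
  unfolding \<Phi>_def by (intro periodic_moderate_sum \<phi>(1)) simp
 moreover have "g r z = (\<Sum>j<n. lq h z ^ j * exp (\<mu> * lq h z) * \<Phi> j z)" if z: "Im z > 0" for z
 proof -
  have "g r z = l ^ r * exp (\<mu> * lq h z) * u r z"
   using l0 by (simp add: u_def exp_minus field_simps)
  also have "u r z = (\<Sum>k<n - r. \<Sum>j<n. c k j * lq h z ^ j * \<phi> (r + k) z)"
   unfolding \<phi>(2)[OF r z] by (intro sum.cong) (auto simp: c sum_distrib_right)
  also have "\<dots> = (\<Sum>j<n. \<Sum>k<n - r. c k j * lq h z ^ j * \<phi> (r + k) z)" by (rule sum.swap)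
  finally show ?thesis by (simp add: \<Phi>_def sum_distrib_left mult_ac)
 qed
 ultimately show ?thesis by blast
qed

text \<open>The shape of a logarithmic expansion before its periodic coefficients are expanded in
  powers of q.\<close>

definition log_comb :: "real => (nat \<times> complex) list => (complex => complex) => bool" where
 "log_comb h bs F \<longleftrightarrow> (\<exists>\<Phi>. (\<forall>b<length bs. \<forall>j<fst (bs ! b). periodic_moderate h (\<Phi> b j)) \<and>
   (\<forall>z. Im z > 0 --> F z = (\<Sum>b<length bs. \<Sum>j<fst (bs ! b).
    lq h z ^ j * exp (of_real (exponent_of (snd (bs ! b))) * lq h z) * \<Phi> b j z)))"

lemma log_comb_sum:
 assumes "!!k. k \<in> K ==> log_comb h bs (F k)"
 shows "log_comb h bs (\<lambda>z. \<Sum>k\<in>K. c k * F k z)"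
proof -
 have "\<forall>k\<in>K. \<exists>\<Phi>. (\<forall>b<length bs. \<forall>j<fst (bs ! b). periodic_moderate h (\<Phi> b j)) \<and>
   (\<forall>z. Im z > 0 --> F k z = (\<Sum>b<length bs. \<Sum>j<fst (bs ! b).
    lq h z ^ j * exp (of_real (exponent_of (snd (bs ! b))) * lq h z) * \<Phi> b j z))"
  using assms unfolding log_comb_def by blast
 from bchoice[OF this] obtain \<Phi> where
  "\<forall>k\<in>K. (\<forall>b<length bs. \<forall>j<fst (bs ! b). periodic_moderate h (\<Phi> k b j)) \<and>
   (\<forall>z. Im z > 0 --> F k z = (\<Sum>b<length bs. \<Sum>j<fst (bs ! b).
    lq h z ^ j * exp (of_real (exponent_of (snd (bs ! b))) * lq h z) * \<Phi> k b j z))" ..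
 then have \<Phi>: "!!k b j. k \<in> K ==> b < length bs ==> j < fst (bs ! b) ==> periodic_moderate h (\<Phi> k b j)"
   "!!k z. k \<in> K ==> Im z > 0 ==> F k z = (\<Sum>b<length bs. \<Sum>j<fst (bs ! b).
    lq h z ^ j * exp (of_real (exponent_of (snd (bs ! b))) * lq h z) * \<Phi> k b j z)"
  by blast+
 show ?thesis unfolding log_comb_def
 proof (intro exI conjI allI impI)
  show "periodic_moderate h (\<lambda>z. \<Sum>k\<in>K. c k * \<Phi> k b j z)" if "b < length bs" "j < fst (bs ! b)" for b j
   using \<Phi>(1) that by (intro periodic_moderate_sum) auto
  fix z :: complex assume z: "Im z > 0"
  let ?e = "\<lambda>b j. lq h z ^ j * exp (of_real (exponent_of (snd (bs ! b))) * lq h z)"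
  have "(\<Sum>k\<in>K. c k * F k z) = (\<Sum>k\<in>K. \<Sum>b<length bs. \<Sum>j<fst (bs ! b). c k * (?e b j * \<Phi> k b j z))"
   by (intro sum.cong) (auto simp: \<Phi>(2) z sum_distrib_left)
  also have "\<dots> = (\<Sum>b<length bs. \<Sum>k\<in>K. \<Sum>j<fst (bs ! b). c k * (?e b j * \<Phi> k b j z))" by (rule sum.swap)
  also have "\<dots> = (\<Sum>b<length bs. \<Sum>j<fst (bs ! b). \<Sum>k\<in>K. c k * (?e b j * \<Phi> k b j z))"
   by (intro sum.cong sum.swap) auto
  also have "\<dots> = (\<Sum>b<length bs. \<Sum>j<fst (bs ! b). ?e b j * (\<Sum>k\<in>K. c k * \<Phi> k b j z))"
   unfolding sum_distrib_left by (simp only: mult.left_commute mult.assoc)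
  finally show "(\<Sum>k\<in>K. c k * F k z) = (\<Sum>b<length bs. \<Sum>j<fst (bs ! b). ?e b j * (\<Sum>k\<in>K. c k * \<Phi> k b j z))" .
 qed
qed

lemma log_comb_Cons:
 assumes "log_comb h bs F"
 shows "log_comb h (p # bs) F"
proof -
 obtain \<Phi> where \<Phi>: "!!b j. b < length bs ==> j < fst (bs ! b) ==> periodic_moderate h (\<Phi> b j)"
   "!!z. Im z > 0 ==> F z = (\<Sum>b<length bs. \<Sum>j<fst (bs ! b).
    lq h z ^ j * exp (of_real (exponent_of (snd (bs ! b))) * lq h z) * \<Phi> b j z)"
  using assms unfolding log_comb_def by blast
 show ?thesis unfolding log_comb_def
 proof (intro exI[of _ "\<lambda>b. case b of 0 => (\<lambda>j z. 0) | Suc b => \<Phi> b"] conjI allI impI)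
  show "periodic_moderate h ((case b of 0 => (\<lambda>j z. 0) | Suc b => \<Phi> b) j)"
   if "b < length (p # bs)" "j < fst ((p # bs) ! b)" for b j
   using that \<Phi>(1) periodic_moderate_zero by (cases b) auto
 qed (simp add: \<Phi>(2) sum.lessThan_Suc_shift del: sum.lessThan_Suc)
qed

lemma log_comb_head:
 assumes "!!j. j < n ==> periodic_moderate h (\<Phi> j)"
  "!!z. Im z > 0 ==> F z = (\<Sum>j<n. lq h z ^ j * exp (of_real (exponent_of a) * lq h z) * \<Phi> j z)"
 shows "log_comb h ((n, a) # bs) F"
 unfolding log_comb_def
proof (intro exI[of _ "\<lambda>b. case b of 0 => \<Phi> | Suc b => (\<lambda>j z. 0)"] conjI allI impI)
 show "periodic_moderate h ((case b of 0 => \<Phi> | Suc b => (\<lambda>j z. 0)) j)"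
  if "b < length ((n, a) # bs)" "j < fst (((n, a) # bs) ! b)" for b j
  using that assms(1) periodic_moderate_zero by (cases b) auto
qed (simp add: assms(2) sum.lessThan_Suc_shift del: sum.lessThan_Suc)

lemma exp_exponent_of:
 assumes "cmod l = 1"
 shows "exp (2 * of_real pi * \<i> * of_real (exponent_of l)) = l"
proof -
 have "l = of_real (cmod l) * exp (\<i> * of_real (Arg2pi l))" by (rule Arg2pi_eq)
 then show ?thesis using assms by (simp add: exponent_of_def mult_ac)
qed

lemma sum_lessThan_add: "(\<Sum>k<n + m. f k) = (\<Sum>k<n. f k) + (\<Sum>k<m. f (n + k) :: 'a::comm_monoid_add)" for n m :: nat
 by (induction m) (simp_all add: add.assoc)

lemma jordan_matrix_decomposition:
 assumes h: "h > 0" and "!!p. p \<in> set bs ==> cmod (snd p) = 1"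
  and "!!i. i < sum_list (map fst bs) ==> g i holomorphic_on \<H>"
  and "!!i. i < sum_list (map fst bs) ==> moderate (g i)"
  and "!!i z. i < sum_list (map fst bs) ==> Im z > 0 ==>
   g i (z + of_real h) = (\<Sum>k<sum_list (map fst bs). jordan_matrix bs $$ (i, k) * g k z)"
  and "i < sum_list (map fst bs)"
 shows "log_comb h bs (g i)"
 using assms(2-)
proof (induction bs arbitrary: g i)
 case (Cons p bs)
 obtain n a where p: "p = (n, a)" by (cases p)
 define N where "N = sum_list (map fst bs)"
 have S: "sum_list (map fst (p # bs)) = n + N" by (simp add: p N_def)
 note C = Cons.prems[unfolded S]
 have a: "cmod a = 1" using C(1)[of p] p by simp
 have jm: "jordan_matrix (p # bs) $$ (i, k) =
   (if i < n then if k < n then jordan_block n a $$ (i, k) else 0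
    else if k < n then 0 else jordan_matrix bs $$ (i - n, k - n))" if "i < n + N" "k < n + N" for i k
  using that unfolding p jordan_matrix_Cons N_def[symmetric] by (simp add: N_def)
 show ?case
 proof (cases "i < n")
  case True
  \<comment> \<open>The functions of the next block are cut off because the chain of a single block
    has to end in 0.\<close>
  define g' where "g' r = (if r < n then g r else (\<lambda>z. 0))" for r
  have "\<exists>\<Phi>. (\<forall>j<n. periodic_moderate h (\<Phi> j)) \<and>
   (\<forall>z. Im z > 0 --> g' i z = (\<Sum>j<n. lq h z ^ j * exp (of_real (exponent_of a) * lq h z) * \<Phi> j z))"
  proof (rule jordan_block_decomposition[OF h])
   fix r assume r: "r < n"
   show "g' r holomorphic_on \<H>" "moderate (g' r)" using r C(2,3) by (auto simp: g'_def)
   fix z :: complex assume z: "Im z > 0"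
   have "g r (z + of_real h) = (\<Sum>k<n + N. jordan_matrix (p # bs) $$ (r, k) * g k z)"
    using C(4)[of r z] r z by simp
   also have "\<dots> = (\<Sum>k<n. jordan_block n a $$ (r, k) * g k z)"
    unfolding sum_lessThan_add using r by (simp add: jm)
   also have "\<dots> = (\<Sum>k<n. (if k = r then a * g k z else 0) + (if k = Suc r then g k z else 0))"
    using r by (intro sum.cong) auto
   also have "\<dots> = a * g r z + g' (Suc r) z"
    using r by (simp add: sum.distrib g'_def)
   finally show "g' r (z + of_real h) = exp (2 * of_real pi * \<i> * of_real (exponent_of a)) * g' r z + g' (Suc r) z"
    using r by (simp add: exp_exponent_of[OF a] g'_def)
  qed (use True in \<open>auto simp: g'_def\<close>)
  then show ?thesis unfolding p using True by (auto simp: g'_def intro: log_comb_head)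
 next
  case False
  have "log_comb h bs (g (n + (i - n)))"
  proof (rule Cons.IH[of "\<lambda>i. g (n + i)" "i - n"])
   fix i' z assume i': "i' < sum_list (map fst bs)" and z: "Im z > 0"
   have "g (n + i') (z + of_real h) = (\<Sum>k<n + N. jordan_matrix (p # bs) $$ (n + i', k) * g k z)"
    using C(4)[of "n + i'" z] i' z by (simp add: N_def)
   also have "\<dots> = (\<Sum>k<N. jordan_matrix bs $$ (i', k) * g (n + k) z)"
    unfolding sum_lessThan_add using i' by (simp add: jm N_def)
   finally show "g (n + i') (z + of_real h) = (\<Sum>k<sum_list (map fst bs). jordan_matrix bs $$ (i', k) * g (n + k) z)"
    by (simp add: N_def)
  qed (use C False in \<open>auto simp: N_def\<close>)
  then show ?thesis using False by (simp add: log_comb_Cons)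
 qed
qed simp

section \<open>Expansion at a cusp against growth at a cusp, for vector-valued forms\<close>

lemma moderate_jfac: "moderate (jfac A)"
 unfolding jfac_def[abs_def] by (intro moderate_add moderate_mult moderate_const moderate_ident)

lemma moderate_inverse_jfac: "moderate (\<lambda>z. inverse (jfac A z))"
proof (cases "A$2$1 = 0")
 case True
 then show ?thesis by (simp add: jfac_def moderate_const)
next
 case False
 have "moderate (\<lambda>z. inverse (of_real (A$2$1)) * inverse (of_real 1 * z + of_real (A$2$2 / A$2$1)))"
  by (intro moderate_mult moderate_const moderate_affine[OF moderate_inverse_ident]) simp
 moreover have "inverse (of_real (A$2$1)) * inverse (of_real 1 * z + of_real (A$2$2 / A$2$1)) = inverse (jfac A z)" for z
  using False unfolding jfac_def inverse_mult_distrib[symmetric] by (simp add: distrib_left)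
 ultimately show ?thesis by simp
qed

lemma moderate_jfac_powi: "moderate (\<lambda>z. jfac A z powi n)"
proof (cases "n \<ge> 0")
 case True
 then show ?thesis by (simp add: power_int_def moderate_power moderate_jfac)
next
 case False
 then show ?thesis by (simp add: power_int_def moderate_power moderate_inverse_jfac)
qed

text \<open>At a finite cusp x the matrix sends z to x - 1/z, so the factor is (-z)^k; the sign
  (-1)^k is the constant e.\<close>

lemma cusp_factor_jfac:
 obtains e where "e ~= 0" "!!z. Im z > 0 ==> cusp_factor k c (mobius (cusp_mat c) z) = e * jfac (cusp_mat c) z powi k"
proof (cases c)
 case None
 then show thesis using that[of 1] by simp
next
 case (Some x)
 have "cusp_factor k c (mobius (cusp_mat c) z) = (-1) powi k * jfac (cusp_mat c) z powi k" if z: "Im z > 0" for z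
 proof -
  have "z ~= 0" using z by auto
  then have "mobius (cusp_mat c) z - of_real x = inverse (- z)"
   by (simp add: Some mobius_eq jfac_def field_simps)
  then have "cusp_factor k c (mobius (cusp_mat c) z) = inverse (- z) powi (- k)"
   by (simp only: Some cusp_factor.simps)
  also have "\<dots> = (- z) powi k"
   by (simp only: power_int_minus power_int_inverse inverse_inverse_eq)
  also have "\<dots> = (-1 * z) powi k" by simp
  finally show ?thesis unfolding power_int_mult_distrib by (simp add: Some jfac_def)
 qed
 then show thesis using that[of "(-1) powi k"] by simp
qed

lemma periodic_moderate_expansion:
 assumes h: "h > 0" and \<phi>: "periodic_moderate h \<phi>"
 shows "\<exists>M0::nat. \<forall>M\<ge>M0. \<exists>C :: int => complex. \<forall>z. Im z > 0 -->
  ((\<lambda>n. C n * nome h z powi n) has_sum \<phi> z) {- int M..}"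
proof -
 have p: "\<phi> holomorphic_on \<H>" "!!z. Im z > 0 ==> \<phi> (z + of_real h) = \<phi> z" "moderate \<phi>"
  using \<phi> by (auto simp: periodic_moderate_def)
 obtain M0 \<Psi> where \<Psi>: "\<Psi> holomorphic_on ball 0 1" "!!z. Im z > 0 ==> nome h z ^ M0 * \<phi> z = \<Psi> (nome h z)"
 proof (rule periodic_factors_nome[OF h p])
  fix M' \<Phi>' assume "\<Phi>' holomorphic_on ball 0 1" "!!z. Im z > 0 ==> nome h z ^ M' * \<phi> z = \<Phi>' (nome h z)"
  then show thesis by (rule that)
 qed
 have "\<exists>C :: int => complex. \<forall>z. Im z > 0 --> ((\<lambda>n. C n * nome h z powi n) has_sum \<phi> z) {- int M..}" if M: "M \<ge> M0" for M
 proof -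
  define \<Theta> where "\<Theta> q = q ^ (M - M0) * \<Psi> q" for q
  have hol: "\<Theta> holomorphic_on ball 0 1" unfolding \<Theta>_def by (intro holomorphic_intros \<Psi>)
  define a where "a n = (deriv ^^ n) \<Theta> 0 / fact n" for n
  have sums: "(\<lambda>n. a n * q ^ n) sums \<Theta> q" if "cmod q < 1" for q
   using holomorphic_power_series[OF hol, of q] that by (simp add: a_def)
  have hs: "((\<lambda>n. a n * q ^ n) has_sum \<Theta> q) UNIV" if q: "cmod q < 1" for q
  proof (rule norm_summable_imp_has_sum[OF _ sums[OF q]])
   \<comment> \<open>\<open>has_sum\<close> is unconditional; absolute convergence at q follows from
     convergence at a real r with |q| < r < 1.\<close>
   obtain r where r: "cmod q < r" "r < 1" using dense[OF q] by blast
   have r0: "0 < r" using r(1) norm_ge_zero[of q] by linarith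
   then have "cmod (of_real r) < 1" using r by simp
   then have "summable (\<lambda>n. a n * of_real r ^ n)" using sums sums_summable by blast
   then show "summable (\<lambda>n. norm (a n * q ^ n))"
    by (rule powser_insidea) (use r r0 in simp)
  qed
  have "((\<lambda>n. a (nat (n + int M)) * nome h z powi n) has_sum \<phi> z) {- int M..}" if z: "Im z > 0" for z
  proof -
   let ?q = "nome h z"
   have q: "cmod ?q < 1" using norm_nome_less[OF h z] .
   let ?G = "\<lambda>n. a (nat (n + int M)) * ?q powi n"
   have "?q powi (- int M) * (a n * ?q ^ n) = (?G \<circ> (\<lambda>n. int n - int M)) n" for n
   proof -
    have "?q powi (int n - int M) = ?q powi (int n) * ?q powi (- int M)"
     using power_int_add[of ?q "int n" "- int M"] by simp
    then show ?thesis by simp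
   qed
   then have e: "(\<lambda>n. ?q powi (- int M) * (a n * ?q ^ n)) = ?G \<circ> (\<lambda>n. int n - int M)" by (rule ext)
   have "\<Theta> ?q = ?q ^ (M - M0) * ?q ^ M0 * \<phi> z" unfolding \<Theta>_def using \<Psi>(2)[OF z] by (simp add: mult.assoc)
   also have "?q ^ (M - M0) * ?q ^ M0 = ?q ^ M" using M by (simp add: power_add[symmetric])
   finally have \<phi>: "?q powi (- int M) * \<Theta> ?q = \<phi> z" by (simp add: power_int_minus)
   have "((\<lambda>n. ?q powi (- int M) * (a n * ?q ^ n)) has_sum (?q powi (- int M) * \<Theta> ?q)) UNIV"
    by (intro has_sum_cmult_right hs q)
   then have "((?G \<circ> (\<lambda>n. int n - int M)) has_sum \<phi> z) UNIV" unfolding e \<phi> .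
   moreover have "inj_on (\<lambda>n. int n - int M) UNIV" by (simp add: inj_on_def)
   ultimately have "(?G has_sum \<phi> z) ((\<lambda>n. int n - int M) ` UNIV)"
    by (simp only: has_sum_reindex)
   moreover have "(\<lambda>n. int n - int M) ` UNIV = {- int M..}"
   proof
    show "{- int M..} \<subseteq> (\<lambda>n. int n - int M) ` UNIV"
    proof
     fix x assume "x \<in> {- int M..}"
     then have "x = int (nat (x + int M)) - int M" by simp
     then show "x \<in> (\<lambda>n. int n - int M) ` UNIV" by blast
    qed
   qed auto
   ultimately show ?thesis by (simp only:)
  qed
  then show ?thesis by (intro exI[of _ "\<lambda>n. a (nat (n + int M))"]) simp
 qed
 then show ?thesis by blast
qed

text \<open>Compare with the point of height \<open>y0\<close> on the imaginary axis, whose nome has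
  absolute value t. Since |q| is at most t there is |q|^n <= |q|^(-M) t^M t^n for n >= -M, and the
  absolutely convergent series at that point bounds all others.\<close>

lemma moderate_nome_series:
 assumes h: "h > 0" and s: "!!z. Im z > 0 ==> (\<lambda>n::int. C n * nome h z powi n) summable_on {- M..}"
 shows "moderate (\<lambda>z. \<Sum>\<^sub>\<infinity>n\<in>{- M..}. C n * nome h z powi n)"
proof (rule moderateI)
 fix X y0 :: real assume y0: "y0 > 0"
 let ?t = "cmod (nome h (Complex 0 y0))"
 have q0: "0 < ?t" by simp
 have S: "(\<lambda>n::int. cmod (C n * nome h (Complex 0 y0) powi n)) summable_on {- M..}"
  using s[of "Complex 0 y0"] y0 by (simp add: summable_on_iff_abs_summable_on_complex)
 define B where "B = (\<Sum>\<^sub>\<infinity>n\<in>{- M..}. cmod (C n * nome h (Complex 0 y0) powi n))"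
 have "cmod (\<Sum>\<^sub>\<infinity>n\<in>{- M..}. C n * nome h (Complex x y) powi n) <= (B * ?t powi M) * exp ((2 * pi / h * M) * y)"
  if xy: "\<bar>x\<bar> <= X" "y0 <= y" for x y
 proof -
  let ?q = "cmod (nome h (Complex x y))"
  have q: "0 < ?q" by simp
  have qq: "?q <= ?t" using xy h by (simp add: norm_nome divide_right_mono mult_left_mono)
  define r where "r = ?q powi (- M) * ?t powi M"
  have r0: "r \<ge> 0" by (simp add: r_def)
  have le: "cmod (C n * nome h (Complex x y) powi n) <= r * cmod (C n * nome h (Complex 0 y0) powi n)" if n: "n \<ge> - M" for n
  proof -
   have e: "c powi n = c powi (- M) * c ^ nat (n + M)" if "c > 0" for c :: real
   proof -
    have "c powi n = c powi (- M + int (nat (n + M)))" using n by simp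
    also have "\<dots> = c powi (- M) * c powi int (nat (n + M))" using that by (subst power_int_add) auto
    finally show ?thesis by (simp only: power_int_of_nat)
   qed
   have "?q ^ nat (n + M) <= ?t ^ nat (n + M)" using qq by (intro power_mono) auto
   then have "?q powi n <= ?q powi (- M) * ?t ^ nat (n + M)"
    unfolding e[OF q] by (intro mult_left_mono) auto
   also have "?t ^ nat (n + M) = ?t powi M * ?t powi n"
    using e[OF q0] q0 by (simp add: power_int_minus)
   finally have "?q powi n <= r * ?t powi n" by (simp add: r_def mult.assoc)
   then have "cmod (C n) * ?q powi n <= cmod (C n) * (r * ?t powi n)" by (intro mult_left_mono) auto
   then show ?thesis by (simp add: norm_mult norm_power_int mult_ac)
  qed
  have S2: "(\<lambda>n. r * cmod (C n * nome h (Complex 0 y0) powi n)) summable_on {- M..}"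
   by (intro summable_on_cmult_right S)
  have abs: "(\<lambda>n::int. cmod (C n * nome h (Complex x y) powi n)) summable_on {- M..}"
   using s[of "Complex x y"] y0 xy by (simp add: summable_on_iff_abs_summable_on_complex)
  have "cmod (\<Sum>\<^sub>\<infinity>n\<in>{- M..}. C n * nome h (Complex x y) powi n) <=
    (\<Sum>\<^sub>\<infinity>n\<in>{- M..}. cmod (C n * nome h (Complex x y) powi n))"
   by (rule norm_infsum_bound[OF abs])
  also have "\<dots> <= (\<Sum>\<^sub>\<infinity>n\<in>{- M..}. r * cmod (C n * nome h (Complex 0 y0) powi n))"
   by (rule infsum_mono[OF abs S2]) (use le in auto)
  also have "\<dots> = r * B" unfolding B_def by (rule infsum_cmult_right) (use S in blast)
  also have "?q powi (- M) = exp ((2 * pi / h * M) * y)"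
   by (simp add: norm_nome power_int_minus exp_minus[symmetric] exp_power_int)
  then have "r * B = (B * ?t powi M) * exp ((2 * pi / h * M) * y)" by (simp add: r_def)
  finally show ?thesis .
 qed
 then show "\<exists>C' N. \<forall>x y. \<bar>x\<bar> <= X --> y0 <= y -->
   cmod (\<Sum>\<^sub>\<infinity>n\<in>{- M..}. C n * nome h (Complex x y) powi n) <= C' * exp (N * y)" by blast
qed

lemma jordan_nf_complex:
 assumes "A \<in> carrier_mat m m" "!!l::complex. eigenvalue A l ==> cmod l = 1"
 obtains bs where "jordan_nf A bs" "!!p. p \<in> set bs ==> cmod (snd p) = 1"
proof -
 obtain as where "char_poly A = (\<Prod>a\<leftarrow>as. [:- a, 1:])" using char_poly_factorized[OF assms(1)] by blast
 then obtain bs where bs: "jordan_nf A bs" using jordan_nf_exists[OF assms(1)] by blast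
 have "cmod (snd p) = 1" if p: "p \<in> set bs" for p
 proof (rule assms(2))
  have n0: "fst p ~= 0" using bs p by (force simp: jordan_nf_def)
  have "poly (char_poly A) (snd p) = 0"
   unfolding jordan_nf_char_poly[OF bs] poly_prod_list prod_list_zero_iff
   using p n0 by (auto simp: case_prod_unfold poly_power intro!: image_eqI[of _ _ p])
  then show "eigenvalue A (snd p)" using eigenvalue_root_char_poly[OF assms(1)] by blast
 qed
 then show thesis by (rule that[OF bs])
qed

lemma similar_mat_wit_vec:
 assumes A: "A \<in> carrier_mat n n" and w: "similar_mat_wit A B P Q" and x: "x \<in> carrier_vec n"
 shows "B \<in> carrier_mat n n" "P \<in> carrier_mat n n" "Q \<in> carrier_mat n n"
  "P *\<^sub>v (Q *\<^sub>v x) = x" "Q *\<^sub>v (P *\<^sub>v x) = x"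
  "A *\<^sub>v (P *\<^sub>v x) = P *\<^sub>v (B *\<^sub>v x)" "Q *\<^sub>v (A *\<^sub>v x) = B *\<^sub>v (Q *\<^sub>v x)"
proof -
 note d = similar_mat_witD2[OF A w]
 show c: "B \<in> carrier_mat n n" "P \<in> carrier_mat n n" "Q \<in> carrier_mat n n" using d by auto
 note cv = mult_mat_vec_carrier
 have inv: "P *\<^sub>v (Q *\<^sub>v y) = y" "Q *\<^sub>v (P *\<^sub>v y) = y" if "y \<in> carrier_vec n" for y
  using assoc_mult_mat_vec[OF c(2,3) that, symmetric] assoc_mult_mat_vec[OF c(3,2) that, symmetric]
  by (simp_all only: d(1,2) one_mult_mat_vec[OF that])
 then show "P *\<^sub>v (Q *\<^sub>v x) = x" "Q *\<^sub>v (P *\<^sub>v x) = x" using x by auto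
 have A': "A *\<^sub>v y = P *\<^sub>v (B *\<^sub>v (Q *\<^sub>v y))" if "y \<in> carrier_vec n" for y
  unfolding d(3) assoc_mult_mat_vec[OF mult_carrier_mat[OF c(2,1)] c(3) that]
  by (rule assoc_mult_mat_vec[OF c(2,1) cv[OF c(3) that]])
 show "A *\<^sub>v (P *\<^sub>v x) = P *\<^sub>v (B *\<^sub>v x)" unfolding A'[OF cv[OF c(2) x]] inv(2)[OF x] ..
 show "Q *\<^sub>v (A *\<^sub>v x) = B *\<^sub>v (Q *\<^sub>v x)" unfolding A'[OF x] by (rule inv(2)[OF cv[OF c(1) cv[OF c(3) x]]])
qed

text \<open>The change of basis to Jordan form and back mixes components with constant coefficients,
  under which \<open>log_comb\<close> is closed.\<close>

lemma matrix_decomposition: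
 assumes h: "h > 0" and A: "A \<in> carrier_mat m m" and bs: "jordan_nf A bs" "!!p. p \<in> set bs ==> cmod (snd p) = 1"
  and f: "!!z. Im z > 0 ==> f z \<in> carrier_vec m"
   "!!i. i < m ==> (\<lambda>z. vec_index (f z) i) holomorphic_on \<H>"
   "!!i. i < m ==> moderate (\<lambda>z. vec_index (f z) i)"
  and step: "!!z. Im z > 0 ==> f (z + of_real h) = A *\<^sub>v f z"
  and i: "i < m"
 shows "log_comb h bs (\<lambda>z. vec_index (f z) i)"
proof -
 let ?J = "jordan_matrix bs"
 obtain P Q where PQ: "similar_mat_wit A ?J P Q" using bs(1) unfolding jordan_nf_def similar_mat_def by blast
 note w = similar_mat_wit_vec[OF A PQ]
 have J: "?J \<in> carrier_mat m m" and P: "P \<in> carrier_mat m m" and Q: "Q \<in> carrier_mat m m"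
  using w(1-3)[OF zero_carrier_vec] by auto
 have dim: "sum_list (map fst bs) = m" using carrier_matD(1)[OF J] by simp
 define g where "g z = Q *\<^sub>v f z" for z
 have gc: "g z \<in> carrier_vec m" if "Im z > 0" for z using Q f(1)[OF that] by (simp add: g_def)
 have gi: "vec_index (g z) k = (\<Sum>l<m. Q $$ (k, l) * vec_index (f z) l)" if "k < m" "Im z > 0" for k z
  using Q f(1)[OF that(2)] that by (simp add: g_def scalar_prod_def atLeast0LessThan)
 have fg: "vec_index (f z) i = (\<Sum>k<m. P $$ (i, k) * vec_index (g z) k)" if z: "Im z > 0" for z
 proof -
  have "f z = P *\<^sub>v g z" unfolding g_def by (rule w(4)[OF f(1)[OF z], symmetric])
  then show ?thesis using P gc[OF z] i by (simp add: scalar_prod_def atLeast0LessThan)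
 qed
 have gstep: "g (z + of_real h) = ?J *\<^sub>v g z" if z: "Im z > 0" for z
  unfolding g_def step[OF z] by (rule w(7)[OF f(1)[OF z]])
 have G: "log_comb h bs (\<lambda>z. if Im z > 0 then vec_index (g z) k else 0)" if k: "k < m" for k
 proof (rule jordan_matrix_decomposition[OF h bs(2), of bs "\<lambda>k z. if Im z > 0 then vec_index (g z) k else 0" k, unfolded dim])
  fix k assume k: "k < m"
  have hol: "(\<lambda>z. \<Sum>l<m. Q $$ (k, l) * vec_index (f z) l) holomorphic_on \<H>"
   using f(2) by (intro holomorphic_intros) auto
  show "(\<lambda>z. if Im z > 0 then vec_index (g z) k else 0) holomorphic_on \<H>"
   by (rule holomorphic_transform[OF hol]) (simp add: gi[OF k])
  have "moderate (\<lambda>z. \<Sum>l<m. Q $$ (k, l) * vec_index (f z) l)"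
   using f(3) by (intro moderate_sum moderate_mult moderate_const) auto
  then show "moderate (\<lambda>z. if Im z > 0 then vec_index (g z) k else 0)"
   by (rule moderate_cong) (simp add: gi[OF k])
  fix z :: complex assume z: "Im z > 0"
  show "(if Im (z + of_real h) > 0 then vec_index (g (z + of_real h)) k else 0) =
   (\<Sum>ka<m. ?J $$ (k, ka) * (if Im z > 0 then vec_index (g z) ka else 0))"
   using gstep[OF z] z J gc[OF z] k by (simp add: scalar_prod_def atLeast0LessThan dim)
 qed (use k in auto)
 have "log_comb h bs (\<lambda>z. \<Sum>k<m. P $$ (i, k) * (if Im z > 0 then vec_index (g z) k else 0))"
  using G by (intro log_comb_sum) auto
 then show ?thesis unfolding log_comb_def using fg by auto
qed

lemma log_q_mobius:
 assumes "Im z > 0"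
 shows "log_q \<Gamma> c (mobius (cusp_mat c) z) = lq (cusp_width \<Gamma> c) z"
 using assms by (simp add: log_q_def lq_def mobius_adj2)

lemma log_expansion_imp_moderate:
 assumes h: "cusp_width \<Gamma> c > 0" and ex: "log_expansion_at k \<Gamma> m \<rho> X c" and i: "i < m"
 shows "moderate (\<lambda>z. vec_index (X (mobius (cusp_mat c) z)) i)"
proof -
 define h where "h = cusp_width \<Gamma> c"
 let ?A = "cusp_mat c"
 obtain bs M C where
  S: "!!\<tau> b j. \<tau> \<in> \<H> ==> b < length bs ==> j < fst (bs ! b) ==>
   (\<lambda>n. vec_index (C b j n) i * exp (log_q \<Gamma> c \<tau>) powi n) summable_on {- M..}"
  and X: "!!\<tau>. \<tau> \<in> \<H> ==> vec_index (X \<tau>) i = cusp_factor k c \<tau> * (\<Sum>b<length bs. \<Sum>j<fst (bs ! b).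
   log_q \<Gamma> c \<tau> ^ j * exp (of_real (exponent_of (snd (bs ! b))) * log_q \<Gamma> c \<tau>) *
   (\<Sum>\<^sub>\<infinity>n\<in>{- M..}. vec_index (C b j n) i * exp (log_q \<Gamma> c \<tau>) powi n))"
  using ex i unfolding log_expansion_at_def by blast
 obtain e where e: "!!z. Im z > 0 ==> cusp_factor k c (mobius ?A z) = e * jfac ?A z powi k"
  using cusp_factor_jfac[of k c] by blast
 have hp: "h > 0" using h by (simp add: h_def)
 define F where "F z = (e * jfac ?A z powi k) * (\<Sum>b<length bs. \<Sum>j<fst (bs ! b).
   lq h z ^ j * exp (of_real (exponent_of (snd (bs ! b))) * lq h z) *
   (\<Sum>\<^sub>\<infinity>n\<in>{- M..}. vec_index (C b j n) i * nome h z powi n))" for z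
 have "moderate F"
  unfolding F_def
 proof (intro moderate_mult moderate_const moderate_jfac_powi moderate_sum moderate_power moderate_lq moderate_exp_lq
   moderate_nome_series[OF hp])
  fix b j z assume "b \<in> {..<length bs}" "j \<in> {..<fst (bs ! b)}" and z: "Im z > 0"
  then show "(\<lambda>n. vec_index (C b j n) i * nome h z powi n) summable_on {- M..}"
   using S[of "mobius ?A z" b j] by (simp add: log_q_mobius[OF z] exp_lq h_def)
 qed
 moreover have "vec_index (X (mobius ?A z)) i = F z" if z: "Im z > 0" for z
  using X[of "mobius ?A z"] z by (simp add: F_def e log_q_mobius[OF z] exp_lq h_def)
 ultimately show ?thesis by (rule moderate_cong)
qed

text \<open>Dividing by the cusp factor turns the weight k law for the generator of the stabilizer
  into plain quasi-periodicity with the matrix A.\<close>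

lemma cusp_step:
 assumes t: "cusp_generator \<Gamma> c = t" "det t = 1" and X: "!!\<tau>. \<tau> \<in> \<H> ==> slash k t X \<tau> = A *\<^sub>v X \<tau>"
  and A: "A \<in> carrier_mat m m" and Xc: "!!\<tau>. \<tau> \<in> \<H> ==> X \<tau> \<in> carrier_vec m" and z: "Im z > 0"
  and f: "!!z. f z = (inverse (e * jfac (cusp_mat c) z powi k)) \<cdot>\<^sub>v X (mobius (cusp_mat c) z)"
 shows "f (z + of_real (cusp_width \<Gamma> c)) = A *\<^sub>v f z"
proof -
 let ?B = "cusp_mat c"
 define h where "h = cusp_width \<Gamma> c"
 have tB: "t ** ?B = ?B ** mat2 1 h 0 1"
  using t(1) by (simp add: cusp_generator_def h_def cusp_transl_eq[of c] matrix_mul_assoc[symmetric] adj2_inverse flip: t(1))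
 have zh: "Im (z + of_real h) > 0" using z by simp
 have T: "mobius (mat2 1 h 0 1) z = z + of_real h" "jfac (mat2 1 h 0 1) z = 1"
  by (simp_all add: mobius_eq jfac_def)
 have mt: "mobius t (mobius ?B z) = mobius ?B (z + of_real h)"
  using mobius_mult[of t ?B z] mobius_mult[of ?B "mat2 1 h 0 1" z] t(2) z by (simp add: tB T)
 have "jfac t (mobius ?B z) * jfac ?B z = jfac (t ** ?B) z" using z by (simp add: jfac_mult)
 also have "\<dots> = jfac ?B (z + of_real h)" unfolding tB using z by (simp add: jfac_mult T)
 finally have jt: "jfac t (mobius ?B z) * jfac ?B z = jfac ?B (z + of_real h)" .
 have nz: "jfac ?B z ~= 0" "jfac ?B (z + of_real h) ~= 0" using jfac_nz z zh by simp_all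
 have c: "X (mobius ?B z) \<in> carrier_vec m" using Xc z by simp
 have "A *\<^sub>v X (mobius ?B z) = (jfac t (mobius ?B z) powi (- k)) \<cdot>\<^sub>v X (mobius ?B (z + of_real h))"
  using X[of "mobius ?B z"] z unfolding slash_def mt jfac_def[symmetric] by simp
 then have "A *\<^sub>v f z = (inverse (e * jfac ?B z powi k)) \<cdot>\<^sub>v ((jfac t (mobius ?B z) powi (- k)) \<cdot>\<^sub>v X (mobius ?B (z + of_real h)))"
  unfolding f by (simp add: mult_mat_vec[OF A c])
 also have "\<dots> = (inverse (e * jfac ?B z powi k) * jfac t (mobius ?B z) powi (- k)) \<cdot>\<^sub>v X (mobius ?B (z + of_real h))"
  by (rule smult_smult_assoc)
 also have "inverse (e * jfac ?B z powi k) * jfac t (mobius ?B z) powi (- k) = inverse (e * (jfac t (mobius ?B z) * jfac ?B z) powi k)"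
  by (simp add: power_int_minus power_int_mult_distrib mult_ac)
 also have "\<dots> = inverse (e * jfac ?B (z + of_real h) powi k)" unfolding jt ..
 finally show ?thesis unfolding f h_def by simp
qed

lemma moderate_imp_log_expansion:
 assumes h: "cusp_width \<Gamma> c > 0" and t: "det (cusp_generator \<Gamma> c) = 1"
  and X: "!!\<tau>. \<tau> \<in> \<H> ==> slash k (cusp_generator \<Gamma> c) X \<tau> = \<rho> (cusp_generator \<Gamma> c) *\<^sub>v X \<tau>"
  and A: "\<rho> (cusp_generator \<Gamma> c) \<in> carrier_mat m m"
  and ev: "!!l. eigenvalue (\<rho> (cusp_generator \<Gamma> c)) l ==> cmod l = 1"
  and Xc: "!!\<tau>. \<tau> \<in> \<H> ==> X \<tau> \<in> carrier_vec m"
  and hol: "!!i. i < m ==> (\<lambda>\<tau>. vec_index (X \<tau>) i) holomorphic_on \<H>"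
  and mod: "!!i. i < m ==> moderate (\<lambda>z. vec_index (X (mobius (cusp_mat c) z)) i)"
 shows "log_expansion_at k \<Gamma> m \<rho> X c"
proof -
 define h where "h = cusp_width \<Gamma> c"
 let ?B = "cusp_mat c" and ?t = "cusp_generator \<Gamma> c"
 have hp: "h > 0" using h by (simp add: h_def)
 obtain e where e: "e ~= 0" "!!z. Im z > 0 ==> cusp_factor k c (mobius ?B z) = e * jfac ?B z powi k"
  using cusp_factor_jfac[of k c] by blast
 define f where "f z = (inverse (e * jfac ?B z powi k)) \<cdot>\<^sub>v X (mobius ?B z)" for z
 have fi: "vec_index (f z) i = inverse e * jfac ?B z powi (- k) * vec_index (X (mobius ?B z)) i" if "Im z > 0" "i < m" for z i
  using Xc[of "mobius ?B z"] that by (simp add: f_def power_int_minus)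
 obtain bs where bs: "jordan_nf (\<rho> ?t) bs" "!!p. p \<in> set bs ==> cmod (snd p) = 1"
  using jordan_nf_complex[OF A ev] by blast
 have "log_comb h bs (\<lambda>z. vec_index (f z) i)" if i: "i < m" for i
 proof (rule matrix_decomposition[OF hp A bs _ _ _ _ i])
  show "f z \<in> carrier_vec m" if "Im z > 0" for z using Xc[of "mobius ?B z"] that by (simp add: f_def)
  fix i assume i: "i < m"
  have "(\<lambda>z. inverse e * jfac ?B z powi (- k) * vec_index (X (mobius ?B z)) i) holomorphic_on \<H>"
   using jfac_nz by (intro holomorphic_intros holomorphic_compose_mobius[OF _ hol[OF i]]) auto
  then show "(\<lambda>z. vec_index (f z) i) holomorphic_on \<H>"
   by (rule holomorphic_transform) (simp add: fi i)
  have "moderate (\<lambda>z. inverse e * jfac ?B z powi (- k) * vec_index (X (mobius ?B z)) i)"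
   by (intro moderate_mult moderate_const moderate_jfac_powi mod i)
  then show "moderate (\<lambda>z. vec_index (f z) i)" by (rule moderate_cong) (simp add: fi i)
 next
  fix z :: complex assume z: "Im z > 0"
  show "f (z + of_real h) = \<rho> ?t *\<^sub>v f z"
   unfolding h_def by (rule cusp_step[OF refl t X A Xc z f_def])
 qed
 then have "\<forall>i\<in>{..<m}. \<exists>\<Phi>. (\<forall>b<length bs. \<forall>j<fst (bs ! b). periodic_moderate h (\<Phi> b j)) \<and>
   (\<forall>z. Im z > 0 --> vec_index (f z) i = (\<Sum>b<length bs. \<Sum>j<fst (bs ! b).
    lq h z ^ j * exp (of_real (exponent_of (snd (bs ! b))) * lq h z) * \<Phi> b j z))"
  unfolding log_comb_def by simp
 from bchoice[OF this] obtain \<Phi> where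
  "\<forall>i\<in>{..<m}. (\<forall>b<length bs. \<forall>j<fst (bs ! b). periodic_moderate h (\<Phi> i b j)) \<and>
   (\<forall>z. Im z > 0 --> vec_index (f z) i = (\<Sum>b<length bs. \<Sum>j<fst (bs ! b).
    lq h z ^ j * exp (of_real (exponent_of (snd (bs ! b))) * lq h z) * \<Phi> i b j z))" ..
 then have \<Phi>: "!!i b j. i < m ==> b < length bs ==> j < fst (bs ! b) ==> periodic_moderate h (\<Phi> i b j)"
  "!!i z. i < m ==> Im z > 0 ==> vec_index (f z) i = (\<Sum>b<length bs. \<Sum>j<fst (bs ! b).
    lq h z ^ j * exp (of_real (exponent_of (snd (bs ! b))) * lq h z) * \<Phi> i b j z)" by blast+
 define I where "I = (SIGMA i:{..<m}. SIGMA b:{..<length bs}. {..<fst (bs ! b)})"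
 have fin: "finite I" unfolding I_def by (intro finite_SigmaI) auto
 define P where "P x = (\<lambda>(i, b, j). \<Phi> i b j) x" for x
 have "\<forall>x\<in>I. \<exists>M0::nat. \<forall>M\<ge>M0. \<exists>C :: int => complex. \<forall>z. Im z > 0 -->
  ((\<lambda>n. C n * nome h z powi n) has_sum P x z) {- int M..}"
  using periodic_moderate_expansion[OF hp] \<Phi>(1) by (auto simp: I_def P_def)
 from bchoice[OF this] obtain M0 where M0: "\<forall>x\<in>I. \<forall>M\<ge>M0 x. \<exists>C :: int => complex. \<forall>z. Im z > 0 -->
  ((\<lambda>n. C n * nome h z powi n) has_sum P x z) {- int M..}" ..
 \<comment> \<open>One M for all components, blocks and powers, as \<open>log_expansion_at\<close>
   demands.\<close>
 define M where "M = Max (insert 0 (M0 ` I))"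
 have "M0 x <= M" if "x \<in> I" for x unfolding M_def using fin that by (intro Max_ge) auto
 with M0 have "\<forall>x\<in>I. \<exists>C :: int => complex. \<forall>z. Im z > 0 --> ((\<lambda>n. C n * nome h z powi n) has_sum P x z) {- int M..}"
  by blast
 from bchoice[OF this] obtain C where C: "\<forall>x\<in>I. \<forall>z. Im z > 0 --> ((\<lambda>n. C x n * nome h z powi n) has_sum P x z) {- int M..}" ..
 define D where "D b j n = Matrix.vec m (\<lambda>i. C (i, b, j) n)" for b j n
 have D: "((\<lambda>n. vec_index (D b j n) i * nome h z powi n) has_sum \<Phi> i b j z) {- int M..}"
  if "i < m" "b < length bs" "j < fst (bs ! b)" "Im z > 0" for i b j z
  using C[rule_format, of "(i, b, j)" z] that by (simp add: I_def P_def D_def)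
 show ?thesis
  unfolding log_expansion_at_def
 proof (intro exI conjI allI impI ballI)
  show "jordan_nf (\<rho> ?t) bs" by (rule bs)
  show "D b j n \<in> carrier_vec m" for b j n by (simp add: D_def)
  fix \<tau> i assume \<tau>: "\<tau> \<in> \<H>" and i: "i < m"
  define z where "z = mobius (adj2 ?B) \<tau>"
  have z: "Im z > 0" "\<tau> = mobius ?B z" using \<tau> by (auto simp: z_def mobius_adj2)
  have lz: "log_q \<Gamma> c \<tau> = lq h z" unfolding z(2) h_def by (rule log_q_mobius[OF z(1)])
  show "(\<lambda>n. vec_index (D b j n) i * exp (log_q \<Gamma> c \<tau>) powi n) summable_on {- int M..}"
   if "b < length bs" "j < fst (bs ! b)" for b j
   using D[OF i that z(1)] unfolding lz exp_lq by (rule has_sum_imp_summable)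
  have j: "jfac ?B z ~= 0" using jfac_nz[of ?B z] z by simp
  have "vec_index (X \<tau>) i = (e * jfac ?B z powi k) * vec_index (f z) i"
   using e(1) j by (simp add: fi[OF z(1) i] z(2) power_int_minus field_simps)
  also have "\<dots> = cusp_factor k c \<tau> * (\<Sum>b<length bs. \<Sum>j<fst (bs ! b).
    lq h z ^ j * exp (of_real (exponent_of (snd (bs ! b))) * lq h z) *
    (\<Sum>\<^sub>\<infinity>n\<in>{- int M..}. vec_index (D b j n) i * nome h z powi n))"
   unfolding \<Phi>(2)[OF i z(1)] z(2) e(2)[OF z(1)] using infsumI[OF D[OF i _ _ z(1)]]
   by (intro arg_cong2[of _ _ _ _ "(*)"] refl sum.cong) auto
  finally show "vec_index (X \<tau>) i = cusp_factor k c \<tau> * (\<Sum>b<length bs. \<Sum>j<fst (bs ! b).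
    log_q \<Gamma> c \<tau> ^ j * exp (of_real (exponent_of (snd (bs ! b))) * log_q \<Gamma> c \<tau>) *
    (\<Sum>\<^sub>\<infinity>n\<in>{- int M..}. vec_index (D b j n) i * exp (log_q \<Gamma> c \<tau>) powi n))"
   unfolding lz exp_lq .
 qed
qed

text \<open>A takes infinity to a cusp, with any positive period in place of the width and with
  arbitrary scaling. This makes the notion insensitive to passing to a subgroup of finite
  index.\<close>

definition cuspidal :: "(real^2^2) set => real^2^2 => bool" where
 "cuspidal \<Gamma> A \<longleftrightarrow> det A = 1 \<and> (\<exists>p>0. A ** mat2 1 p 0 1 ** adj2 A \<in> \<Gamma>)"

lemma cuspidal_cusp_mat:
 assumes "discrete_SL2 \<Gamma>" "is_cusp \<Gamma> c"
 shows "cuspidal \<Gamma> (cusp_mat c)"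
proof -
 interpret cusp_group "conj_grp \<Gamma> (cusp_mat c)" "cusp_width \<Gamma> c" by (rule cusp_width_props[OF assms])
 show ?thesis using h_pos transl_mem by (auto simp: cuspidal_def conj_grp_iff)
qed

lemma upper_triangular_mobius:
 assumes "det U = 1" "U$2$1 = 0"
 shows "\<exists>a>0. \<exists>b. \<forall>z. mobius U z = of_real a * z + of_real b"
proof (intro exI conjI allI)
 have d: "U$1$1 * U$2$2 = 1" using assms by (simp add: det_2)
 then have nz: "U$1$1 ~= 0" "U$2$2 ~= 0" by auto
 show "(U$1$1)^2 > 0" using nz by simp
 fix z
 have i: "U$1$1 = inverse (U$2$2)" using d nz by (metis inverse_unique mult.commute)
 have "mobius U z = (of_real (U$1$1) * z + of_real (U$1$2)) * of_real (inverse (U$2$2))"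
  by (simp add: mobius_eq jfac_def assms(2) divide_inverse)
 then show "mobius U z = of_real ((U$1$1)^2) * z + of_real (U$1$2 * U$1$1)"
  unfolding i[symmetric] by (simp add: power2_eq_square algebra_simps)
qed

text \<open>With c the image of infinity under A, the quotient of A by \<open>cusp_mat c\<close>
  fixes infinity and is therefore an affine map.\<close>

lemma cuspidal_cusp:
 assumes G: "!!g. g \<in> \<Gamma> ==> det g = 1" and A: "cuspidal \<Gamma> A"
 obtains c a b where "is_cusp \<Gamma> c" "a > 0" "!!z. Im z > 0 ==> mobius A z = mobius (cusp_mat c) (of_real a * z + of_real b)"
proof -
 obtain p where p: "p > 0" "A ** mat2 1 p 0 1 ** adj2 A \<in> \<Gamma>" and d: "det A = 1"
  using A by (auto simp: cuspidal_def)
 define c where "c = (if A$2$1 = 0 then None else Some (A$1$1 / A$2$1))"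
 define U where "U = adj2 (cusp_mat c) ** A"
 have dU: "det U = 1" using d by (simp add: U_def Determinants.det_mul)
 have U0: "U$2$1 = 0" by (auto simp: U_def c_def)
 define g where "g = A ** mat2 1 p 0 1 ** adj2 A"
 have dg: "det g = 1" using G p(2) by (simp add: g_def)
 have "adj2 (cusp_mat c) ** g ** cusp_mat c = U ** mat2 1 p 0 1 ** adj2 U"
  by (simp add: U_def g_def adj2_mult matrix_mul_assoc)
 moreover have "(U ** mat2 1 p 0 1 ** adj2 U)$2$1 = 0" using U0 by simp
 ultimately have "boundary_mobius g c = c" using boundary_fixed_iff[OF dg, of c] by simp
 moreover have "parabolic g"
  unfolding parabolic_def g_def using trace_mul_sym[of "A ** mat2 1 p 0 1" "adj2 A"] d
  by (simp add: matrix_mul_assoc adj2_inverse) (simp add: trace2)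
 moreover have "g \<notin> {I2, - I2}"
 proof
  assume "g \<in> {I2, - I2}"
  moreover have "mat2 1 p 0 1 = adj2 A ** g ** A" using d by (simp add: g_def matrix_mul_assoc[symmetric] adj2_cancel adj2_inverse)
  ultimately have "mat2 1 p 0 1 = I2 \<or> mat2 1 p 0 1 = - I2" using d by (auto simp: uminus_mult_mat2 adj2_inverse)
  then show False using p(1) by (auto simp: mat2_eq_iff)
 qed
 ultimately have cusp: "is_cusp \<Gamma> c" using p(2) by (auto simp: is_cusp_def g_def)
 obtain a b where ab: "a > 0" "!!z. mobius U z = of_real a * z + of_real b"
  using upper_triangular_mobius[OF dU U0] by blast
 have AU: "A = cusp_mat c ** U" by (simp add: U_def adj2_cancel)
 show thesis
 proof (rule that[OF cusp ab(1)])
  fix z :: complex assume "Im z > 0"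
  then show "mobius A z = mobius (cusp_mat c) (of_real a * z + of_real b)"
   unfolding ab(2)[symmetric] AU using dU by (intro mobius_mult) auto
 qed
qed

definition moderate_at_cusps :: "(real^2^2) set => (complex => complex) => bool" where
 "moderate_at_cusps \<Gamma> F \<longleftrightarrow> (\<forall>A. cuspidal \<Gamma> A --> moderate (\<lambda>z. F (mobius A z)))"

lemma moderate_at_cusps_iff:
 assumes "discrete_SL2 \<Gamma>"
 shows "moderate_at_cusps \<Gamma> F \<longleftrightarrow> (\<forall>c. is_cusp \<Gamma> c --> moderate (\<lambda>z. F (mobius (cusp_mat c) z)))"
proof
 assume "moderate_at_cusps \<Gamma> F"
 then show "\<forall>c. is_cusp \<Gamma> c --> moderate (\<lambda>z. F (mobius (cusp_mat c) z))"
  using cuspidal_cusp_mat[OF assms] by (simp add: moderate_at_cusps_def)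
next
 assume *: "\<forall>c. is_cusp \<Gamma> c --> moderate (\<lambda>z. F (mobius (cusp_mat c) z))"
 interpret discrete_SL2 \<Gamma> by fact
 show "moderate_at_cusps \<Gamma> F"
  unfolding moderate_at_cusps_def
 proof (intro allI impI)
  fix A assume A: "cuspidal \<Gamma> A"
  obtain c a b where c: "is_cusp \<Gamma> c" "a > 0"
   "!!z. Im z > 0 ==> mobius A z = mobius (cusp_mat c) (of_real a * z + of_real b)"
   by (rule cuspidal_cusp[OF _ A], erule det1, rule that)
  have "moderate (\<lambda>z. F (mobius (cusp_mat c) (of_real a * z + of_real b)))"
   using * c(1,2) by (intro moderate_affine) auto
  then show "moderate (\<lambda>z. F (mobius A z))" by (rule moderate_cong) (simp add: c(3))
 qed
qed

text \<open>An expansion of the prescribed shape always grows moderately. Conversely, the generator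
  of a cusp stabilizer is parabolic, so the logarithmic condition puts its eigenvalues on the unit
  circle, and growth together with the Jordan form produces the expansion.\<close>

theorem weakly_holomorphic_log_vvaf_iff:
 assumes \<Gamma>: "discrete_SL2 \<Gamma>" and \<rho>: "\<forall>g\<in>\<Gamma>. \<rho> g \<in> carrier_mat m m"
 shows "weakly_holomorphic_log_vvaf k \<Gamma> m \<rho> X \<longleftrightarrow>
  logarithmic \<Gamma> \<rho> \<and> \<rho> I2 = exp (\<i> * of_real pi * of_int k) \<cdot>\<^sub>m \<rho> (- I2) \<and>
  (\<forall>\<tau>\<in>\<H>. X \<tau> \<in> carrier_vec m) \<and>
  (\<forall>i<m. (\<lambda>\<tau>. vec_index (X \<tau>) i) holomorphic_on \<H>) \<and>
  (\<forall>g\<in>\<Gamma>. \<forall>\<tau>\<in>\<H>. slash k g X \<tau> = \<rho> g *\<^sub>v X \<tau>) \<and>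
  (\<forall>i<m. moderate_at_cusps \<Gamma> (\<lambda>\<tau>. vec_index (X \<tau>) i))"
  (is "_ \<longleftrightarrow> ?L \<and> ?E \<and> ?C \<and> ?H \<and> ?S \<and> ?M")
proof -
 interpret discrete_SL2 \<Gamma> by fact
 have "log_expansion_at k \<Gamma> m \<rho> X c \<longleftrightarrow> (\<forall>i<m. moderate (\<lambda>z. vec_index (X (mobius (cusp_mat c) z)) i))"
  if LC: ?L ?C ?H ?S and c: "is_cusp \<Gamma> c" for c
 proof -
  interpret C: cusp_group "conj_grp \<Gamma> (cusp_mat c)" "cusp_width \<Gamma> c" by (rule cusp_width_props[OF \<Gamma> c])
  have t: "cusp_generator \<Gamma> c \<in> \<Gamma>" by (rule cusp_width_props[OF \<Gamma> c])
  have "trace (cusp_generator \<Gamma> c) = trace (mat2 1 (cusp_width \<Gamma> c) 0 1)"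
   unfolding cusp_generator_def cusp_transl_eq
   by (subst trace_mul_sym) (simp add: matrix_mul_assoc adj2_inverse)
  then have "parabolic (cusp_generator \<Gamma> c)" by (simp add: parabolic_def trace2)
  then have ev: "cmod l = 1" if "eigenvalue (\<rho> (cusp_generator \<Gamma> c)) l" for l
   using LC(1) t that by (auto simp: logarithmic_def)
  show ?thesis
  proof
   show "\<forall>i<m. moderate (\<lambda>z. vec_index (X (mobius (cusp_mat c) z)) i)" if "log_expansion_at k \<Gamma> m \<rho> X c"
    using log_expansion_imp_moderate[OF C.h_pos that] by blast
   assume *: "\<forall>i<m. moderate (\<lambda>z. vec_index (X (mobius (cusp_mat c) z)) i)"
   show "log_expansion_at k \<Gamma> m \<rho> X c"
    by (rule moderate_imp_log_expansion[where \<Gamma> = \<Gamma> and c = c and \<rho> = \<rho> and m = m and k = k and X = X])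
     (use LC(2-4) t * ev bspec[OF \<rho> t] C.h_pos in auto)
  qed
 qed
 then show ?thesis
  unfolding weakly_holomorphic_log_vvaf_def moderate_at_cusps_iff[OF \<Gamma>] by blast
qed

section \<open>Pairs of groups of finite index\<close>

lemma matpow_add: "matpow g (m + n) = matpow g m ** matpow g n"
 by (induction m) (simp_all add: matpow_Suc matrix_mul_assoc)

lemma matpow_conj:
 assumes "det A = 1"
 shows "matpow (adj2 A ** g ** A) n = adj2 A ** matpow g n ** A"
proof (induction n)
 case (Suc n)
 then show ?case using assms by (simp add: matpow_Suc matrix_mul_assoc[symmetric] adj2_cancel)
qed (use assms in \<open>simp add: adj2_inverse\<close>)

section \<open>Growth at all cusps and its behaviour under finite index\<close>

lemma moderate_at_cusps_cong:
 assumes "moderate_at_cusps \<Gamma> F" "!!z. Im z > 0 ==> G z = F z"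
 shows "moderate_at_cusps \<Gamma> G"
 unfolding moderate_at_cusps_def
proof (intro allI impI)
 fix A assume A: "cuspidal \<Gamma> A"
 then have "moderate (\<lambda>z. F (mobius A z))" using assms(1) by (simp add: moderate_at_cusps_def)
 then show "moderate (\<lambda>z. G (mobius A z))"
  by (rule moderate_cong) (use A assms(2) in \<open>simp add: cuspidal_def\<close>)
qed

lemma moderate_at_cusps_const: "moderate_at_cusps \<Gamma> (\<lambda>z. c)"
 by (simp add: moderate_at_cusps_def moderate_const)

lemma moderate_at_cusps_mult:
 "moderate_at_cusps \<Gamma> F ==> moderate_at_cusps \<Gamma> G ==> moderate_at_cusps \<Gamma> (\<lambda>z. F z * G z)"
 by (simp add: moderate_at_cusps_def moderate_mult)

lemma moderate_at_cusps_sum: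
 "(!!i. i \<in> I ==> moderate_at_cusps \<Gamma> (F i)) ==> moderate_at_cusps \<Gamma> (\<lambda>z. \<Sum>i\<in>I. F i z)"
 by (simp add: moderate_at_cusps_def moderate_sum)

lemma moderate_at_cusps_prod:
 "(!!i. i \<in> I ==> moderate_at_cusps \<Gamma> (F i)) ==> moderate_at_cusps \<Gamma> (\<lambda>z. \<Prod>i\<in>I. F i z)"
 by (simp add: moderate_at_cusps_def moderate_prod)

lemma moderate_at_cusps_diff:
 "moderate_at_cusps \<Gamma> F ==> moderate_at_cusps \<Gamma> G ==> moderate_at_cusps \<Gamma> (\<lambda>z. F z - G z)"
 by (simp add: moderate_at_cusps_def moderate_diff)

lemma moderate_at_cusps_jfac:
 assumes "det g = 1"
 shows "moderate_at_cusps \<Gamma> (\<lambda>z. jfac g z powi n)"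
 unfolding moderate_at_cusps_def
proof (intro allI impI)
 fix A assume "cuspidal \<Gamma> A"
 then have d: "det A = 1" by (simp add: cuspidal_def)
 have "moderate (\<lambda>z. jfac (g ** A) z powi n * jfac A z powi (- n))"
  by (intro moderate_mult moderate_jfac_powi)
 then show "moderate (\<lambda>z. jfac g (mobius A z) powi n)"
 proof (rule moderate_cong)
  fix z :: complex assume z: "Im z > 0"
  have "jfac A z ~= 0" using d jfac_nz[of A z] z by simp
  then show "jfac g (mobius A z) powi n = jfac (g ** A) z powi n * jfac A z powi (- n)"
   using d z by (simp add: jfac_mult power_int_mult_distrib power_int_minus)
 qed
qed

lemma (in discrete_SL2) moderate_at_cusps_mobius:
 assumes F: "moderate_at_cusps \<Gamma> F" and g: "g \<in> \<Gamma>"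
 shows "moderate_at_cusps \<Gamma> (\<lambda>z. F (mobius g z))"
 unfolding moderate_at_cusps_def
proof (intro allI impI)
 fix A assume A: "cuspidal \<Gamma> A"
 then obtain p where p: "p > 0" "A ** mat2 1 p 0 1 ** adj2 A \<in> \<Gamma>" and d: "det A = 1"
  by (auto simp: cuspidal_def)
 have "g ** (A ** mat2 1 p 0 1 ** adj2 A) ** adj2 g \<in> \<Gamma>" by (intro mult_mem adj_mem g p)
 also have "g ** (A ** mat2 1 p 0 1 ** adj2 A) ** adj2 g = (g ** A) ** mat2 1 p 0 1 ** adj2 (g ** A)"
  by (simp add: adj2_mult matrix_mul_assoc)
 finally have "cuspidal \<Gamma> (g ** A)" using p(1) d g by (auto simp: cuspidal_def Determinants.det_mul)
 then have "moderate (\<lambda>z. F (mobius (g ** A) z))" using F by (simp add: moderate_at_cusps_def)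
 then show "moderate (\<lambda>z. F (mobius g (mobius A z)))"
  by (rule moderate_cong) (use d g in \<open>simp add: mobius_mult\<close>)
qed

locale coset_pair = G: discrete_SL2 G + H: discrete_SL2 H for G H +
 fixes d :: nat and \<gamma> :: "nat => real^2^2"
 assumes H_sub: "H \<subseteq> G" and \<gamma>_mem: "a < d ==> \<gamma> a \<in> G"
  and coset_ex: "g \<in> G ==> \<exists>a<d. adj2 (\<gamma> a) ** g \<in> H"
  and coset_unique: "a < d ==> b < d ==> adj2 (\<gamma> a) ** \<gamma> b \<in> H ==> a = b"
begin

definition idx :: "real^2^2 => nat" where
 "idx g = (SOME a. a < d \<and> adj2 (\<gamma> a) ** g \<in> H)"

lemma idx: assumes "g \<in> G" shows "idx g < d" "adj2 (\<gamma> (idx g)) ** g \<in> H"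
 using someI_ex[OF coset_ex[OF assms]] by (auto simp: idx_def)

lemma same_coset:
 assumes "a < d" "b < d" "adj2 (\<gamma> a) ** g \<in> H" "adj2 (\<gamma> b) ** g \<in> H" "g \<in> G"
 shows "a = b"
proof (rule coset_unique[OF assms(1,2)])
 have "adj2 (\<gamma> a) ** g ** adj2 (adj2 (\<gamma> b) ** g) \<in> H" by (intro H.mult_mem H.adj_mem assms)
 also have "adj2 (\<gamma> a) ** g ** adj2 (adj2 (\<gamma> b) ** g) = adj2 (\<gamma> a) ** \<gamma> b"
  using assms(5) by (simp add: adj2_mult matrix_mul_assoc[symmetric] adj2_cancel)
 finally show "adj2 (\<gamma> a) ** \<gamma> b \<in> H" .
qed

lemma idx_unique: "g \<in> G ==> a < d ==> adj2 (\<gamma> a) ** g \<in> H ==> idx g = a"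
 using same_coset[OF idx(1) _ idx(2)] by blast

text \<open>Among the d + 1 powers from 0 to d two lie in the same coset, and the difference of
  their exponents, being at most d, divides d!.\<close>

lemma power_mem:
 assumes "g \<in> G"
 shows "\<exists>N>0. N dvd fact d \<and> matpow g N \<in> H"
proof -
 have pow: "matpow g n \<in> G" for n by (rule G.matpow_mem[OF assms])
 have "\<not> inj_on (\<lambda>n. idx (matpow g n)) {..d}"
 proof
  assume "inj_on (\<lambda>n. idx (matpow g n)) {..d}"
  then have "card {..d} <= card {..<d}" by (rule card_inj_on_le) (use idx(1)[OF pow] in auto)
  then show False by simp
 qed
 then obtain m' n' where mn': "m' <= d" "n' <= d" "m' ~= n'" "idx (matpow g m') = idx (matpow g n')"
  by (auto simp: inj_on_def)
 obtain m n where mn: "m < n" "n <= d" "idx (matpow g m) = idx (matpow g n)"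
  using mn' by (metis linorder_neqE_nat)
 have "adj2 (adj2 (\<gamma> (idx (matpow g m))) ** matpow g m) ** (adj2 (\<gamma> (idx (matpow g n))) ** matpow g n) \<in> H"
  by (intro H.mult_mem H.adj_mem idx pow)
 also have "adj2 (adj2 (\<gamma> (idx (matpow g m))) ** matpow g m) ** (adj2 (\<gamma> (idx (matpow g n))) ** matpow g n) = adj2 (matpow g m) ** matpow g n"
  using G.det1[OF \<gamma>_mem[OF idx(1)[OF pow[of n]]]] by (simp add: mn(3) adj2_mult matrix_mul_assoc[symmetric] adj2_cancel)
 also have "matpow g n = matpow g m ** matpow g (n - m)" using mn(1) by (simp add: matpow_add[symmetric])
 finally have "matpow g (n - m) \<in> H" using G.det1[OF pow[of m]] by (simp add: adj2_cancel)
 moreover have "n - m dvd fact d" by (rule dvd_fact) (use mn in auto)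
 ultimately show ?thesis using mn(1) by (intro exI[of _ "n - m"]) auto
qed

text \<open>Some power of a translation at a cusp of G lies in H; its period is a multiple of the
  original one.\<close>

lemma cuspidal_H_iff: "cuspidal H A \<longleftrightarrow> cuspidal G A"
proof
 assume "cuspidal H A" then show "cuspidal G A" using H_sub by (auto simp: cuspidal_def)
next
 assume "cuspidal G A"
 then obtain p where p: "p > 0" "A ** mat2 1 p 0 1 ** adj2 A \<in> G" and d: "det A = 1"
  by (auto simp: cuspidal_def)
 obtain N where N: "N > 0" "matpow (A ** mat2 1 p 0 1 ** adj2 A) N \<in> H" using power_mem[OF p(2)] by blast
 have "matpow (A ** mat2 1 p 0 1 ** adj2 A) N = A ** matpow (mat2 1 p 0 1) N ** adj2 A"
  using matpow_conj[of "adj2 A" "mat2 1 p 0 1" N] d by simp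
 also have "matpow (mat2 1 p 0 1) n = mat2 1 (real n * p) 0 1" for n
  by (induction n) (auto simp: matpow_Suc mat2_eq_iff algebra_simps)
 finally have "A ** mat2 1 (real N * p) 0 1 ** adj2 A \<in> H" using N(2) by simp
 moreover have "real N * p > 0" using N(1) p(1) by simp
 ultimately show "cuspidal H A" using d by (auto simp: cuspidal_def)
qed

lemma moderate_at_cusps_H_iff: "moderate_at_cusps H F \<longleftrightarrow> moderate_at_cusps G F"
 by (simp add: moderate_at_cusps_def cuspidal_H_iff)

end

lemma coset_pairI:
 assumes G: "discrete_SL2 G" and H: "discrete_SL2 H" and HG: "H \<subseteq> G"
  and reps: "left_coset_reps G H d \<gamma>"
 shows "coset_pair G H d \<gamma>"
proof -
 interpret G: discrete_SL2 G by fact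
 interpret H: discrete_SL2 H by fact
 have lc: "g <#\<^bsub>SL2R\<^esub> H = (\<lambda>h. g ** h) ` H" for g by (auto simp: l_coset_def)
 have lcG: "lcosets\<^bsub>SL2R\<lparr>carrier := G\<rparr>\<^esub> H = (\<lambda>g. (\<lambda>h. g ** h) ` H) ` G"
  by (auto simp: LCOSETS_def l_coset_def)
 have \<gamma>: "\<gamma> a \<in> G" if "a < d" for a using reps that by (auto simp: left_coset_reps_def)
 have inj: "inj_on (\<lambda>a. (\<lambda>h. \<gamma> a ** h) ` H) {..<d}" and img: "(\<lambda>a. (\<lambda>h. \<gamma> a ** h) ` H) ` {..<d} = (\<lambda>g. (\<lambda>h. g ** h) ` H) ` G"
  using reps by (simp_all add: left_coset_reps_def bij_betw_def lc lcG)
 show ?thesis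
 proof
  show "H \<subseteq> G" by fact
  show "\<gamma> a \<in> G" if "a < d" for a by (rule \<gamma>[OF that])
  show "\<exists>a<d. adj2 (\<gamma> a) ** g \<in> H" if g: "g \<in> G" for g
  proof -
   have "(\<lambda>h. g ** h) ` H \<in> (\<lambda>a. (\<lambda>h. \<gamma> a ** h) ` H) ` {..<d}" unfolding img using g by blast
   then obtain a where a: "a < d" "(\<lambda>h. g ** h) ` H = (\<lambda>h. \<gamma> a ** h) ` H" by blast
   have "g ** I2 \<in> (\<lambda>h. g ** h) ` H" using H.one_mem by blast
   then obtain h where h: "h \<in> H" "g = \<gamma> a ** h" unfolding a(2) by auto
   then have "adj2 (\<gamma> a) ** g = h" using \<gamma>[OF a(1)] by (simp add: adj2_cancel)
   then show ?thesis using h a by auto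
  qed
  show "a = b" if ab: "a < d" "b < d" "adj2 (\<gamma> a) ** \<gamma> b \<in> H" for a b
  proof -
   define u where "u = adj2 (\<gamma> a) ** \<gamma> b"
   have gb: "\<gamma> b = \<gamma> a ** u" using \<gamma>[OF ab(1)] by (simp add: u_def adj2_cancel)
   have u: "u \<in> H" "det u = 1" using ab(3) H.det1 by (auto simp: u_def)
   have "(\<lambda>h. \<gamma> a ** h) ` H = (\<lambda>h. \<gamma> b ** h) ` H"
   proof
    show "(\<lambda>h. \<gamma> b ** h) ` H \<subseteq> (\<lambda>h. \<gamma> a ** h) ` H"
     unfolding gb using H.mult_mem[OF u(1)] by (auto simp: matrix_mul_assoc[symmetric])
    show "(\<lambda>h. \<gamma> a ** h) ` H \<subseteq> (\<lambda>h. \<gamma> b ** h) ` H"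
    proof clarify
     fix h assume h: "h \<in> H"
     have "\<gamma> a ** h = \<gamma> b ** (adj2 u ** h)" unfolding gb using u(2) by (simp add: matrix_mul_assoc[symmetric] adj2_cancel)
     then show "\<gamma> a ** h \<in> (\<lambda>h. \<gamma> b ** h) ` H" using H.mult_mem[OF H.adj_mem[OF u(1)] h] by blast
    qed
   qed
   then show ?thesis using inj ab(1,2) by (auto simp: inj_on_def)
  qed
 qed
qed

lemma finite_area_conj:
 assumes G: "discrete_SL2 G" and fk: "fuchsian_first_kind (psl_image G)" and A: "det A = 1"
 obtains F where "finite_area_SL2 (conj_grp G A) F"
proof -
 interpret G: discrete_SL2 G by fact
 interpret C: discrete_SL2 "conj_grp G A" by (rule discrete_SL2_conj[OF G A])
 obtain F where F: "fundamental_domain (psl_image G) F" "hyperbolic_area F < \<infinity>"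
  using fk by (auto simp: fuchsian_first_kind_def)
 have U: "\<Union>(psl_image G) = G" using G.uminus_mem by (auto simp: psl_image_def psl_eq)
 have FH: "F \<subseteq> \<H>" "F = closure (interior F) \<inter> \<H>" and cov: "(\<Union>g\<in>G. mobius g ` F) = \<H>"
  using F(1) unfolding fundamental_domain_def U by auto
 have bor: "F \<in> sets borel"
  by (subst FH(2)) (intro sets.Int borel_closed borel_open closed_closure open_H)
 define F' where "F' = mobius (adj2 A) ` F"
 have F': "F' = \<H> \<inter> mobius A -` F"
 proof
  show "F' \<subseteq> \<H> \<inter> mobius A -` F" using FH(1) A by (auto simp: F'_def mobius_adj2 subset_iff)
  show "\<H> \<inter> mobius A -` F \<subseteq> F'"
  proof
   fix z assume "z \<in> \<H> \<inter> mobius A -` F"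
   then have "z = mobius (adj2 A) (mobius A z)" "mobius A z \<in> F" using A by (auto simp: mobius_adj2)
   then show "z \<in> F'" unfolding F'_def by blast
  qed
 qed
 have bor': "F' \<in> sets borel" unfolding F' by (rule sets.Int[OF borel_open[OF open_H] borel_vimage_mobius[OF bor]])
 have "hyperbolic_area F' = hyperbolic_area F"
  unfolding F'_def by (rule hyperbolic_area_mobius[OF bor FH(1) _ F(2)]) (use A bor' in \<open>auto simp: F'_def\<close>)
 then have "finite_area_SL2 (conj_grp G A) F'"
 proof unfold_locales
  show "F' \<subseteq> \<H>" by (simp add: F')
  show "F' \<in> sets borel" by (rule bor')
  show "hyperbolic_area F' < \<infinity>" if "hyperbolic_area F' = hyperbolic_area F" using that F(2) by simp
  fix z :: complex assume z: "Im z > 0"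
  then have "mobius A z \<in> (\<Union>g\<in>G. mobius g ` F)" unfolding cov using A by simp
  then obtain g w where g: "g \<in> G" "w \<in> F" "mobius A z = mobius g w" by blast
  have w: "Im w > 0" using g(2) FH(1) by auto
  have "mobius (adj2 A ** g ** A) (mobius (adj2 A) w) = mobius (adj2 A ** g) w"
   using A g w by (simp add: mobius_mult mobius_adj2 Determinants.det_mul)
  also have "\<dots> = mobius (adj2 A) (mobius A z)" using A g w by (simp add: mobius_mult)
  also have "\<dots> = z" using A z by (simp add: mobius_adj2)
  finally show "\<exists>\<gamma>\<in>conj_grp G A. \<exists>w\<in>F'. z = mobius \<gamma> w" using g(1,2) unfolding F'_def by blast
 qed
 then show thesis by (rule that)
qed

text \<open>Conjugation by A moves the cusp to infinity for both groups, and the function obtained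
  there is carried back by the inverse of A.\<close>

theorem (in coset_pair) exists_invariant_function:
 assumes fk: "fuchsian_first_kind (psl_image G)" and c: "is_cusp H c"
 obtains f where "f holomorphic_on \<H>" "!!h z. h \<in> H ==> Im z > 0 ==> f (mobius h z) = f z"
  "moderate_at_cusps G f" "\<not> f constant_on \<H>"
  "!!g. g \<in> G ==> (!!z. Im z > 0 ==> f (mobius g z) = f z) ==> g \<in> H"
proof -
 define A where "A = cusp_mat c"
 have A: "det A = 1" by (simp add: A_def)
 have cG: "is_cusp G c" using c H_sub by (auto simp: is_cusp_def)
 obtain F where F: "finite_area_SL2 (conj_grp G A) F" using finite_area_conj[OF G.discrete_SL2_axioms fk A] by blast
 interpret area: finite_area_SL2 "conj_grp G A" F by (rule F)
 interpret CG: cusp_group "conj_grp G A" "cusp_width G c"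
  unfolding A_def by (rule cusp_width_props[OF G.discrete_SL2_axioms cG])
 interpret CH: cusp_group "conj_grp H A" "cusp_width H c"
  unfolding A_def by (rule cusp_width_props[OF H.discrete_SL2_axioms c])
 \<comment> \<open>The inverses of the left coset representatives serve as right coset
   representatives, and d! as the exponent D.\<close>
 interpret P: cusp_group_pair "conj_grp G A" "cusp_width G c" "conj_grp H A" "cusp_width H c" F
  "conj_grp ((\<lambda>a. adj2 (\<gamma> a)) ` {..<d}) A" "fact d"
 proof
  show "conj_grp H A \<subseteq> conj_grp G A" using H_sub by blast
  show "finite (conj_grp ((\<lambda>a. adj2 (\<gamma> a)) ` {..<d}) A)" by simp
  show "conj_grp ((\<lambda>a. adj2 (\<gamma> a)) ` {..<d}) A \<subseteq> conj_grp G A" using G.adj_mem \<gamma>_mem by blast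
  show "(0::nat) < fact d" by simp
  show "\<exists>\<eta>\<in>conj_grp H A. \<exists>r\<in>conj_grp ((\<lambda>a. adj2 (\<gamma> a)) ` {..<d}) A. x = \<eta> ** r" if "x \<in> conj_grp G A" for x
  proof -
   from that obtain g where g: "g \<in> G" "x = adj2 A ** g ** A" by blast
   define a where "a = idx (adj2 g)"
   have a: "a < d" "adj2 (\<gamma> a) ** adj2 g \<in> H" using idx[OF G.adj_mem[OF g(1)]] by (auto simp: a_def)
   have h: "g ** \<gamma> a \<in> H" using H.adj_mem[OF a(2)] by (simp add: adj2_mult)
   have "x = (adj2 A ** (g ** \<gamma> a) ** A) ** (adj2 A ** adj2 (\<gamma> a) ** A)"
    using A G.det1[OF \<gamma>_mem[OF a(1)]] by (simp add: g(2) matrix_mul_assoc[symmetric] adj2_cancel)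
   then show ?thesis using h a(1) by blast
  qed
  show "\<exists>N>0. N dvd fact d \<and> matpow x N \<in> conj_grp H A" if "x \<in> conj_grp G A" for x
  proof -
   from that obtain g where g: "g \<in> G" "x = adj2 A ** g ** A" by blast
   obtain N where "N > 0" "N dvd fact d" "matpow g N \<in> H" using power_mem[OF g(1)] by blast
   then show ?thesis unfolding g(2) matpow_conj[OF A] by blast
  qed
 qed
 obtain f where f: "f holomorphic_on \<H>" "!!h z. h \<in> conj_grp H A ==> Im z > 0 ==> f (mobius h z) = f z"
  "!!B \<gamma> p. det B = 1 ==> p > 0 ==> \<gamma> \<in> conj_grp G A ==> \<gamma> ** B = B ** mat2 1 p 0 1 ==> moderate (\<lambda>z. f (mobius B z))"
  "\<not> f constant_on \<H>"
  "!!g. g \<in> conj_grp G A ==> (!!z. Im z > 0 ==> f (mobius g z) = f z) ==> g \<in> conj_grp H A"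
 proof (rule P.exists_weight_zero)
  fix f assume *: "f holomorphic_on \<H>" "!!h z. h \<in> conj_grp H A ==> Im z > 0 ==> f (mobius h z) = f z"
   "!!B \<gamma> p. det B = 1 ==> p > 0 ==> \<gamma> \<in> conj_grp G A ==> \<gamma> ** B = B ** mat2 1 p 0 1 ==> moderate (\<lambda>z. f (mobius B z))"
   "\<not> f constant_on \<H>"
   "!!g. g \<in> conj_grp G A ==> (!!z. Im z > 0 ==> f (mobius g z) = f z) ==> g \<in> conj_grp H A"
  show thesis by (rule that[OF *])
 qed
 have conj: "mobius (adj2 A) (mobius g z) = mobius (adj2 A ** g ** A) (mobius (adj2 A) z)"
  if "g \<in> G" "Im z > 0" for g z
  using that A by (simp add: mobius_mult mobius_adj2 Determinants.det_mul)
 show thesis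
 proof (rule that[of "\<lambda>z. f (mobius (adj2 A) z)"])
  show "(\<lambda>z. f (mobius (adj2 A) z)) holomorphic_on \<H>" by (rule holomorphic_compose_mobius[OF _ f(1)]) (simp add: A)
  show "f (mobius (adj2 A) (mobius h z)) = f (mobius (adj2 A) z)" if "h \<in> H" "Im z > 0" for h z
   using that H_sub A by (subst conj) (auto intro!: f(2))
  show "moderate_at_cusps G (\<lambda>z. f (mobius (adj2 A) z))"
   unfolding moderate_at_cusps_def
  proof (intro allI impI)
   fix B assume "cuspidal G B"
   then obtain p where p: "p > 0" "B ** mat2 1 p 0 1 ** adj2 B \<in> G" and B: "det B = 1"
    by (auto simp: cuspidal_def)
   have "moderate (\<lambda>z. f (mobius (adj2 A ** B) z))"
   proof (rule f(3)[OF _ p(1)])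
    show "adj2 A ** (B ** mat2 1 p 0 1 ** adj2 B) ** A \<in> conj_grp G A" using p(2) by blast
    show "adj2 A ** (B ** mat2 1 p 0 1 ** adj2 B) ** A ** (adj2 A ** B) = adj2 A ** B ** mat2 1 p 0 1"
     using A B by (simp add: matrix_mul_assoc[symmetric] adj2_cancel adj2_inverse)
   qed (use A B in \<open>simp add: Determinants.det_mul\<close>)
   then show "moderate (\<lambda>z. f (mobius (adj2 A) (mobius B z)))"
    by (rule moderate_cong) (use A B in \<open>simp add: mobius_mult\<close>)
  qed
  show "\<not> (\<lambda>z. f (mobius (adj2 A) z)) constant_on \<H>"
  proof
   assume "(\<lambda>z. f (mobius (adj2 A) z)) constant_on \<H>"
   then obtain k where k: "!!z. Im z > 0 ==> f (mobius (adj2 A) z) = k" by (auto simp: constant_on_def)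
   have "f z = k" if "Im z > 0" for z using k[of "mobius A z"] that A by (simp add: mobius_adj2)
   then show False using f(4) by (auto simp: constant_on_def)
  qed
  show "g \<in> H" if g: "g \<in> G" and inv: "!!z. Im z > 0 ==> f (mobius (adj2 A) (mobius g z)) = f (mobius (adj2 A) z)" for g
  proof -
   have "adj2 A ** g ** A \<in> conj_grp H A"
   proof (rule f(5))
    show "adj2 A ** g ** A \<in> conj_grp G A" using g by blast
    fix z :: complex assume z: "Im z > 0"
    have "f (mobius (adj2 A ** g ** A) z) = f (mobius (adj2 A) (mobius g (mobius A z)))"
     using conj[OF g, of "mobius A z"] A z by (simp add: mobius_adj2)
    also have "\<dots> = f z" using inv[of "mobius A z"] A z by (simp add: mobius_adj2)
    finally show "f (mobius (adj2 A ** g ** A) z) = f z" .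
   qed
   then obtain h where h: "h \<in> H" "adj2 A ** g ** A = adj2 A ** h ** A" by blast
   have "g = A ** (adj2 A ** g ** A) ** adj2 A" using A by (simp add: matrix_mul_assoc[symmetric] adj2_cancel adj2_inverse)
   also have "\<dots> = h" unfolding h(2) using A by (simp add: matrix_mul_assoc[symmetric] adj2_cancel adj2_inverse)
   finally show ?thesis using h(1) by simp
  qed
 qed
qed

section \<open>Representations and induction\<close>

lemma matrix_rep_props:
 assumes \<Gamma>: "subgroup \<Gamma> SL2R" and \<rho>: "matrix_rep \<Gamma> m \<rho>"
 shows "!!g. g \<in> \<Gamma> ==> \<rho> g \<in> carrier_mat m m"
  and "!!g h. g \<in> \<Gamma> ==> h \<in> \<Gamma> ==> \<rho> (g ** h) = \<rho> g * \<rho> h"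
  and "\<rho> I2 = 1\<^sub>m m"
proof -
 interpret R: ring "ring_mat TYPE(complex) m ()" by (rule ring_mat)
 have hom: "\<rho> \<in> hom (SL2R\<lparr>carrier := \<Gamma>\<rparr>) (GL m)" using \<rho> by (simp add: matrix_rep_def)
 have GL: "carrier (GL m) \<subseteq> carrier_mat m m"
  by (auto simp: GL_def units_of_def Units_def ring_mat_def)
 show c: "\<rho> g \<in> carrier_mat m m" if "g \<in> \<Gamma>" for g
  using hom that GL by (auto simp: hom_def)
 show "\<rho> (g ** h) = \<rho> g * \<rho> h" if "g \<in> \<Gamma>" "h \<in> \<Gamma>" for g h
  using hom that by (simp add: hom_def GL_def units_of_def ring_mat_def)
 have "group (GL m)" unfolding GL_def by (rule R.units_group)
 moreover have "group (SL2R\<lparr>carrier := \<Gamma>\<rparr>)" using \<Gamma> group_SL2R by (simp add: subgroup.subgroup_is_group)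
 ultimately have "group_hom (SL2R\<lparr>carrier := \<Gamma>\<rparr>) (GL m) \<rho>" using hom by (simp add: group_hom_def group_hom_axioms_def)
 then have "\<rho> \<one>\<^bsub>SL2R\<lparr>carrier := \<Gamma>\<rparr>\<^esub> = \<one>\<^bsub>GL m\<^esub>" by (rule group_hom.hom_one)
 then show "\<rho> I2 = 1\<^sub>m m" by (simp add: GL_def units_of_def ring_mat_def)
qed

section \<open>Powers of parabolic elements and Jordan chains\<close>

lemma cayley_hamilton2: "det g = 1 ==> g ** g = trace g *\<^sub>R g - I2"
 by (simp add: mat2_eq_iff trace2 det_2 algebra_simps)

text \<open>Cayley-Hamilton gives a two-term recursion for the traces of powers; with e of square 1
  its solution is 2 e^n.\<close>

lemma trace_matpow_parabolic:
 assumes "det g = 1" "trace g = 2 * e" "e^2 = 1"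
 shows "trace (matpow g n) = 2 * e ^ n"
proof (induction n rule: induct_nat_012)
 case 0
 then show ?case by (simp add: trace2)
next
 case 1
 then show ?case using assms by (simp add: matpow_Suc)
next
 case (ge2 n)
 have "matpow g (Suc (Suc n)) = (trace g *\<^sub>R g - I2) ** matpow g n"
  unfolding matpow_Suc matrix_mul_assoc cayley_hamilton2[OF assms(1)] ..
 also have "\<dots> = trace g *\<^sub>R matpow g (Suc n) - matpow g n"
  by (simp add: matpow_Suc mat2_eq_iff algebra_simps)
 also have "trace (c *\<^sub>R A - B) = c * trace A - trace B" for c and A B :: "real^2^2"
  by (simp add: trace2 algebra_simps)
 finally have "trace (matpow g (Suc (Suc n))) = trace g * trace (matpow g (Suc n)) - trace (matpow g n)" .
 then have "trace (matpow g (Suc (Suc n))) = 2 * (2 * e^2 * e ^ n - e ^ n)"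
  unfolding ge2 assms(2) by (simp add: power2_eq_square algebra_simps)
 then have "trace (matpow g (Suc (Suc n))) = 2 * (e^2 * e ^ n)" unfolding assms(3) by simp
 then show ?case by (simp add: power2_eq_square)
qed

lemma parabolic_matpow:
 assumes "det g = 1" "parabolic g"
 shows "parabolic (matpow g n)"
proof -
 obtain e :: real where e: "trace g = 2 * e" "e = 1 \<or> e = -1"
  using assms(2) unfolding parabolic_def by (metis mult.right_neutral mult_minus_right)
 then have "trace (matpow g n) = 2 * e ^ n" using assms(1) by (intro trace_matpow_parabolic) auto
 moreover have "e ^ n = 1 \<or> e ^ n = -1" using e(2) by (cases "even n") auto
 ultimately show ?thesis by (auto simp: parabolic_def)
qed

lemma parabolic_conj:
 assumes "det A = 1"
 shows "parabolic (adj2 A ** g ** A) \<longleftrightarrow> parabolic g"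
proof -
 have "trace (adj2 A ** g ** A) = trace g"
  using trace_mul_sym[of "adj2 A ** g" A] assms by (simp add: matrix_mul_assoc adj2_inverse)
 then show ?thesis by (simp add: parabolic_def)
qed

text \<open>A Jordan chain of length two. Being stated with vectors only, it can be pushed through
  an embedding or restricted to a block.\<close>

definition jordan_pair :: "nat => complex mat => complex => complex vec => complex vec => bool" where
 "jordan_pair n A l v w \<longleftrightarrow> v \<in> carrier_vec n \<and> w \<in> carrier_vec n \<and> w ~= 0\<^sub>v n \<and>
   A *\<^sub>v v = l \<cdot>\<^sub>v v + w \<and> A *\<^sub>v w = l \<cdot>\<^sub>v w"

lemma jordan_matrix_pair:
 assumes "p \<in> set bs" "fst p \<ge> 2"
 shows "\<exists>k l. Suc k < sum_list (map fst bs) \<and> (\<forall>i<sum_list (map fst bs).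
  jordan_matrix bs $$ (i, k) = (if i = k then l else (0::complex)) \<and>
  jordan_matrix bs $$ (i, Suc k) = (if i = Suc k then l else if i = k then 1 else 0))"
 using assms
proof (induction bs)
 case (Cons q bs)
 obtain n a where q: "q = (n, a)" by (cases q)
 define N where "N = sum_list (map fst bs)"
 have S: "sum_list (map fst (q # bs)) = n + N" by (simp add: q N_def)
 have jm: "jordan_matrix (q # bs) $$ (i, k) =
   (if i < n then if k < n then jordan_block n a $$ (i, k) else 0
    else if k < n then 0 else jordan_matrix bs $$ (i - n, k - n))" if "i < n + N" "k < n + N" for i k
  using that unfolding q jordan_matrix_Cons N_def[symmetric] by (simp add: N_def)
 show ?case
 proof (cases "n \<ge> 2")
  case True
  then show ?thesis unfolding S by (intro exI[of _ 0] exI[of _ a]) (auto simp: jm)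
 next
  case False
  then have "p \<in> set bs" using Cons.prems q by auto
  from Cons.IH[OF this Cons.prems(2)] obtain k l where kl: "Suc k < N" "!!i. i < N ==>
    jordan_matrix bs $$ (i, k) = (if i = k then l else (0::complex))"
   "!!i. i < N ==> jordan_matrix bs $$ (i, Suc k) = (if i = Suc k then l else if i = k then 1 else 0)"
   unfolding N_def by blast
  show ?thesis unfolding S
  proof (intro exI[of _ "n + k"] exI[of _ l] conjI allI impI)
   fix i assume i: "i < n + N"
   show "jordan_matrix (q # bs) $$ (i, n + k) = (if i = n + k then l else 0)"
    using i kl(1) kl(2)[of "i - n"] by (cases "i < n") (auto simp: jm)
   show "jordan_matrix (q # bs) $$ (i, Suc (n + k)) = (if i = Suc (n + k) then l else if i = n + k then 1 else 0)"
    using i kl(1) kl(3)[of "i - n"] by (cases "i < n") (auto simp: jm Suc_diff_le)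
  qed (use kl in auto)
 qed
qed simp

lemma jordan_matrix_diagonal:
 assumes "!!p. p \<in> set bs ==> fst p = 1" "i < sum_list (map fst bs)" "j < sum_list (map fst bs)" "i ~= j"
 shows "jordan_matrix bs $$ (i, j) = (0::complex)"
 using assms
proof (induction bs arbitrary: i j)
 case (Cons q bs)
 obtain n a where q: "q = (n, a)" by (cases q)
 have n: "n = 1" using Cons.prems(1)[of q] q by simp
 define N where "N = sum_list (map fst bs)"
 have S: "sum_list (map fst (q # bs)) = 1 + N" by (simp add: q n N_def)
 note P = Cons.prems[unfolded S]
 have jm: "jordan_matrix (q # bs) $$ (i, k) =
   (if i < 1 then if k < 1 then jordan_block 1 a $$ (i, k) else 0
    else if k < 1 then 0 else jordan_matrix bs $$ (i - 1, k - 1))" if "i < 1 + N" "k < 1 + N" for i k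
  using that unfolding q n jordan_matrix_Cons N_def[symmetric] by (simp add: N_def)
 show ?case
 proof (cases "i < 1 \<or> j < 1")
  case True
  then show ?thesis using P by (auto simp: jm)
 next
  case False
  then have "jordan_matrix bs $$ (i - 1, j - 1) = 0" using P by (intro Cons.IH) (auto simp: N_def)
  then show ?thesis using P False by (auto simp: jm)
 qed
qed simp

text \<open>A Jordan block of size at least two supplies the chain. Conversely, for a diagonal
  matrix w lies both in the kernel and in the image of D - l, which forces every coordinate of w to
  vanish.\<close>

lemma not_diagonalizable_iff:
 assumes A: "A \<in> carrier_mat n n"
 shows "\<not> diagonalizable A \<longleftrightarrow> (\<exists>l v w. jordan_pair n A l v w)"
proof
 assume nd: "\<not> diagonalizable A"
 obtain as where "char_poly A = (\<Prod>a\<leftarrow>as. [:- a, 1:])" using char_poly_factorized[OF A] by blast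
 then obtain bs where bs: "jordan_nf A bs" using jordan_nf_exists[OF A] by blast
 let ?J = "jordan_matrix bs"
 have sim: "similar_mat A ?J" and n0: "0 \<notin> fst ` set bs" using bs by (auto simp: jordan_nf_def)
 obtain P Q where PQ: "similar_mat_wit A ?J P Q" using sim unfolding similar_mat_def by blast
 note w = similar_mat_wit_vec[OF A PQ]
 have J: "?J \<in> carrier_mat n n" and P: "P \<in> carrier_mat n n" and Q: "Q \<in> carrier_mat n n"
  using w(1-3)[OF zero_carrier_vec] by auto
 have dim: "sum_list (map fst bs) = n" using carrier_matD(1)[OF J] by simp
 have "\<not> diagonal_mat ?J" using nd sim by (auto simp: diagonalizable_def)
 then have "\<not> (\<forall>p\<in>set bs. fst p = 1)"
  using jordan_matrix_diagonal[of bs] unfolding diagonal_mat_def jordan_matrix_dim by blast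
 then obtain p where "p \<in> set bs" "fst p ~= 1" by blast
 moreover from this have "fst p ~= 0" using n0 by force
 ultimately have p: "p \<in> set bs" "fst p \<ge> 2" by auto
 obtain k l where kl: "Suc k < n" "!!i. i < n ==> ?J $$ (i, k) = (if i = k then l else 0)"
  "!!i. i < n ==> ?J $$ (i, Suc k) = (if i = Suc k then l else if i = k then 1 else 0)"
  using jordan_matrix_pair[OF p] unfolding dim by blast
 define v where "v = P *\<^sub>v unit_vec n (Suc k)"
 define u where "u = P *\<^sub>v unit_vec n k"
 have colJ: "?J *\<^sub>v unit_vec n j = Matrix.vec n (\<lambda>i. ?J $$ (i, j))" if "j < n" for j
  using that J by (intro eq_vecI) (auto simp: dim)
 have J1: "?J *\<^sub>v unit_vec n (Suc k) = l \<cdot>\<^sub>v unit_vec n (Suc k) + unit_vec n k"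
  unfolding colJ[OF kl(1)] using kl by (intro eq_vecI) auto
 have J2: "?J *\<^sub>v unit_vec n k = l \<cdot>\<^sub>v unit_vec n k"
  unfolding colJ[OF Suc_lessD[OF kl(1)]] using kl by (intro eq_vecI) auto
 have "jordan_pair n A l v u"
  unfolding jordan_pair_def
 proof (intro conjI)
  show "v \<in> carrier_vec n" "u \<in> carrier_vec n" unfolding v_def u_def using P by auto
  have "Q *\<^sub>v u = unit_vec n k" unfolding u_def by (rule w(5)[OF unit_vec_carrier])
  moreover have "vec_index (unit_vec n k) k = (1::complex)" using kl(1) by simp
  moreover have "Q *\<^sub>v 0\<^sub>v n = 0\<^sub>v n" using Q by (intro eq_vecI) auto
  moreover have "vec_index (0\<^sub>v n) k = (0::complex)" using kl(1) by simp
  ultimately show "u ~= 0\<^sub>v n" by (metis zero_neq_one)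
  show "A *\<^sub>v v = l \<cdot>\<^sub>v v + u"
   unfolding v_def u_def w(6)[OF unit_vec_carrier] J1
   using P by (simp add: mult_add_distrib_mat_vec[of _ n n] mult_mat_vec[of _ n n])
  show "A *\<^sub>v u = l \<cdot>\<^sub>v u"
   unfolding u_def w(6)[OF unit_vec_carrier] J2 using P by (simp add: mult_mat_vec[of _ n n])
 qed
 then show "\<exists>l v w. jordan_pair n A l v w" by blast
next
 assume "\<exists>l v w. jordan_pair n A l v w"
 then obtain l v u where p: "v \<in> carrier_vec n" "u \<in> carrier_vec n" "u ~= 0\<^sub>v n"
   "A *\<^sub>v v = l \<cdot>\<^sub>v v + u" "A *\<^sub>v u = l \<cdot>\<^sub>v u" by (auto simp: jordan_pair_def)
 show "\<not> diagonalizable A"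
 proof
  assume "diagonalizable A"
  then obtain D where D: "diagonal_mat D" "similar_mat A D" by (auto simp: diagonalizable_def)
  obtain P Q where PQ: "similar_mat_wit A D P Q" using D(2) unfolding similar_mat_def by blast
  note w = similar_mat_wit_vec[OF A PQ]
  have Dc: "D \<in> carrier_mat n n" and P: "P \<in> carrier_mat n n" and Q: "Q \<in> carrier_mat n n"
   using w(1-3)[OF zero_carrier_vec] by auto
  define v' where "v' = Q *\<^sub>v v"
  define u' where "u' = Q *\<^sub>v u"
  have c: "v' \<in> carrier_vec n" "u' \<in> carrier_vec n" unfolding v'_def u'_def using Q p by auto
  have Dv: "D *\<^sub>v v' = l \<cdot>\<^sub>v v' + u'"
   unfolding v'_def u'_def w(7)[OF p(1), symmetric] p(4) using Q p(1,2)
   by (simp add: mult_add_distrib_mat_vec[of _ n n] mult_mat_vec[of _ n n])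
  have Du: "D *\<^sub>v u' = l \<cdot>\<^sub>v u'"
   unfolding u'_def w(7)[OF p(2), symmetric] p(5) using Q p(2) by (simp add: mult_mat_vec[of _ n n])
  have Di: "vec_index (D *\<^sub>v x) i = D $$ (i, i) * vec_index x i" if x: "x \<in> carrier_vec n" and i: "i < n" for x i
  proof -
   have "vec_index (D *\<^sub>v x) i = (\<Sum>j<n. D $$ (i, j) * vec_index x j)"
    using Dc x i by (simp add: scalar_prod_def atLeast0LessThan)
   also have "\<dots> = (\<Sum>j<n. if j = i then D $$ (i, i) * vec_index x i else 0)"
    using D(1) Dc i by (intro sum.cong) (auto simp: diagonal_mat_def)
   finally show ?thesis using i by simp
  qed
  have "vec_index u' i = 0" if i: "i < n" for i
  proof (rule ccontr)
   assume nz: "vec_index u' i ~= 0"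
   have "D $$ (i, i) * vec_index u' i = l * vec_index u' i" using Di[OF c(2) i] c i by (auto simp: Du)
   then have "D $$ (i, i) = l" using nz by simp
   moreover have "D $$ (i, i) * vec_index v' i = l * vec_index v' i + vec_index u' i"
    using Di[OF c(1) i] c i by (simp add: Dv)
   ultimately show False using nz by simp
  qed
  then have "u' = 0\<^sub>v n" using c(2) by (intro eq_vecI) auto
  then have "u = P *\<^sub>v 0\<^sub>v n" using w(4)[OF p(2)] by (simp add: u'_def)
  moreover have "P *\<^sub>v 0\<^sub>v n = 0\<^sub>v n" using P by (intro eq_vecI) auto
  ultimately show False using p(3) by simp
 qed
qed

section \<open>Block structure of the induced representation\<close>

locale induced_pair = coset_pair +
 fixes m :: nat and \<rho> \<psi> :: "real^2^2 => complex mat"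
 assumes \<rho>_carrier: "h \<in> H ==> \<rho> h \<in> carrier_mat m m"
  and \<rho>_mult: "g \<in> H ==> h \<in> H ==> \<rho> (g ** h) = \<rho> g * \<rho> h"
  and \<rho>_one: "\<rho> I2 = 1\<^sub>m m"
  and \<psi>_carrier: "g \<in> G ==> \<psi> g \<in> carrier_mat (d * m) (d * m)"
  and \<psi>_mult: "g \<in> G ==> h \<in> G ==> \<psi> (g ** h) = \<psi> g * \<psi> h"
  and \<psi>_one: "\<psi> I2 = 1\<^sub>m (d * m)"
  and induced: "g \<in> G ==> induced_rep H m \<rho> d \<gamma> g = \<psi> g"
begin

text \<open>The column of the only nonzero block in block row a of the matrix of g.\<close>

definition tgt :: "real^2^2 => nat => nat" where "tgt g a = idx (adj2 g ** \<gamma> a)"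

text \<open>The element of H whose image under \<open>\<rho>\<close> stands in that block.\<close>

definition coc :: "real^2^2 => nat => real^2^2" where "coc g a = adj2 (\<gamma> a) ** g ** \<gamma> (tgt g a)"

definition blk :: "nat => complex vec => complex vec" where
 "blk a v = Matrix.vec m (\<lambda>i. vec_index v (a * m + i))"

lemma blk_carrier [simp]: "blk a v \<in> carrier_vec m"
 by (simp add: blk_def)

lemma dim_blk [simp]: "dim_vec (blk a v) = m"
 by (simp add: blk_def)

lemma blk_index [simp]: "i < m ==> vec_index (blk a v) i = vec_index v (a * m + i)"
 by (simp add: blk_def)

lemma index_less: "a < d ==> i < m ==> a * m + i < d * m"
proof -
 assume a: "a < d" and i: "i < m"
 have "a * m + i < Suc a * m" using i by simp
 also have "\<dots> <= d * m" using a by (intro mult_le_mono1) simp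
 finally show ?thesis .
qed

lemma index_split: "r < d * m ==> r div m < d \<and> r mod m < m \<and> r = (r div m) * m + r mod m"
 by (metis div_mult_mod_eq less_mult_imp_div_less mod_less_divisor mult_0_right not_less0 gr0I)

lemma vec_eq_blkI:
 assumes "v \<in> carrier_vec (d * m)" "w \<in> carrier_vec (d * m)" "!!a. a < d ==> blk a v = blk a w"
 shows "v = w"
proof (rule eq_vecI)
 show "dim_vec v = dim_vec w" using assms by simp
 fix r assume "r < dim_vec w"
 then have r: "r div m < d" "r mod m < m" "r = (r div m) * m + r mod m" using index_split[of r] assms(2) by auto
 have "vec_index (blk (r div m) v) (r mod m) = vec_index (blk (r div m) w) (r mod m)"
  using assms(3)[OF r(1)] by simp
 then show "vec_index v r = vec_index w r" using r by simp
qed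

lemma tgt: assumes "g \<in> G" "a < d" shows "tgt g a < d" "coc g a \<in> H"
  "!!b. b < d ==> adj2 (\<gamma> a) ** g ** \<gamma> b \<in> H \<longleftrightarrow> b = tgt g a"
proof -
 have m: "adj2 g ** \<gamma> a \<in> G" using G.mult_mem G.adj_mem \<gamma>_mem assms by blast
 have eq: "adj2 (adj2 (\<gamma> b) ** (adj2 g ** \<gamma> a)) = adj2 (\<gamma> a) ** g ** \<gamma> b" for b
  by (simp add: adj2_mult matrix_mul_assoc)
 have iff: "adj2 (\<gamma> a) ** g ** \<gamma> b \<in> H \<longleftrightarrow> adj2 (\<gamma> b) ** (adj2 g ** \<gamma> a) \<in> H" for b
  using H.adj_mem[of "adj2 (\<gamma> b) ** (adj2 g ** \<gamma> a)"] H.adj_mem[of "adj2 (\<gamma> a) ** g ** \<gamma> b"]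
  unfolding eq by (metis adj2_adj2 eq)
 show t: "tgt g a < d" and c: "coc g a \<in> H"
  using idx[OF m] unfolding tgt_def coc_def iff by auto
 show "adj2 (\<gamma> a) ** g ** \<gamma> b \<in> H \<longleftrightarrow> b = tgt g a" if "b < d" for b
  using c t that idx_unique[OF m that] unfolding coc_def tgt_def iff by auto
qed

lemma sum_blocks: "(\<Sum>s<n * m. f s) = (\<Sum>b<n. \<Sum>j<m. f (b * m + j) :: complex)"
proof (induction n)
 case (Suc n)
 have "(\<Sum>s<Suc n * m. f s) = (\<Sum>s<n * m + m. f s)" by (simp add: add.commute)
 then show ?case unfolding sum_lessThan_add using Suc by simp
qed simp

lemma \<psi>_index:
 assumes "g \<in> G" "a < d" "i < m" "b < d" "j < m"
 shows "\<psi> g $$ (a * m + i, b * m + j) = (if b = tgt g a then \<rho> (coc g a) $$ (i, j) else 0)"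
proof -
 have "\<psi> g $$ (a * m + i, b * m + j) = (if adj2 (\<gamma> a) ** g ** \<gamma> b \<in> H then \<rho> (adj2 (\<gamma> a) ** g ** \<gamma> b) $$ (i, j) else 0)"
  unfolding induced[OF assms(1), symmetric] induced_rep_def
  using assms index_less[of a i] index_less[of b j] G.det1[OF \<gamma>_mem[OF assms(2)]] by (simp add: Let_def)
 then show ?thesis unfolding tgt(3)[OF assms(1,2,4)] coc_def by simp
qed

lemma blk_action:
 assumes g: "g \<in> G" and a: "a < d" and v: "v \<in> carrier_vec (d * m)"
 shows "blk a (\<psi> g *\<^sub>v v) = \<rho> (coc g a) *\<^sub>v blk (tgt g a) v"
proof (rule eq_vecI)
 note t = tgt[OF g a]
 have rc: "\<rho> (coc g a) \<in> carrier_mat m m" by (rule \<rho>_carrier[OF t(2)])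
 show "dim_vec (blk a (\<psi> g *\<^sub>v v)) = dim_vec (\<rho> (coc g a) *\<^sub>v blk (tgt g a) v)"
  using rc by (simp add: blk_def)
 fix i assume "i < dim_vec (\<rho> (coc g a) *\<^sub>v blk (tgt g a) v)"
 then have i: "i < m" using rc by simp
 have "vec_index (\<psi> g *\<^sub>v v) (a * m + i) = (\<Sum>s<d * m. \<psi> g $$ (a * m + i, s) * vec_index v s)"
  using \<psi>_carrier[OF g] v index_less[OF a i] by (simp add: scalar_prod_def atLeast0LessThan)
 also have "\<dots> = (\<Sum>b<d. \<Sum>j<m. \<psi> g $$ (a * m + i, b * m + j) * vec_index v (b * m + j))" by (rule sum_blocks)
 also have "\<dots> = (\<Sum>b<d. if b = tgt g a then \<Sum>j<m. \<rho> (coc g a) $$ (i, j) * vec_index v (tgt g a * m + j) else 0)"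
  by (intro sum.cong refl) (auto simp: \<psi>_index[OF g a i] intro!: sum.cong)
 also have "\<dots> = (\<Sum>j<m. \<rho> (coc g a) $$ (i, j) * vec_index v (tgt g a * m + j))"
  using t(1) by simp
 finally show "vec_index (blk a (\<psi> g *\<^sub>v v)) i = vec_index (\<rho> (coc g a) *\<^sub>v blk (tgt g a) v) i"
  using rc i by (simp add: scalar_prod_def atLeast0LessThan)
qed

lemma blk_add: "v \<in> carrier_vec (d * m) ==> w \<in> carrier_vec (d * m) ==> a < d ==> blk a (v + w) = blk a v + blk a w"
 using index_less by (intro eq_vecI) (auto simp: blk_def)

lemma blk_smult: "v \<in> carrier_vec (d * m) ==> a < d ==> blk a (c \<cdot>\<^sub>v v) = c \<cdot>\<^sub>v blk a v"
 using index_less by (intro eq_vecI) (auto simp: blk_def)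

lemma blk_zero: "a < d ==> blk a (0\<^sub>v (d * m)) = 0\<^sub>v m"
 using index_less by (intro eq_vecI) (auto simp: blk_def)

end

section \<open>Embedding of the small representation and transfer of the logarithmic
  condition\<close>

context induced_pair
begin

text \<open>The index of the trivial coset. Its representative lies in H but may differ from
  \<open>I2\<close>, which is the source of the twists by \<open>\<gamma> base\<close>.\<close>

definition base :: nat where "base = idx I2"

lemma base: "base < d" "adj2 (\<gamma> base) \<in> H" "\<gamma> base \<in> H"
proof -
 show "base < d" "adj2 (\<gamma> base) \<in> H" using idx[OF G.one_mem] by (simp_all add: base_def)
 then show "\<gamma> base \<in> H" using H.adj_mem[of "adj2 (\<gamma> base)"] by simp
qed

lemma base_unique: "a < d ==> adj2 (\<gamma> a) \<in> H ==> a = base"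
 using idx_unique[OF G.one_mem, of a] by (simp add: base_def)

lemma tgt_base: "h \<in> H ==> tgt h base = base" "h \<in> H ==> coc h base = adj2 (\<gamma> base) ** h ** \<gamma> base"
proof -
 assume h: "h \<in> H"
 have "adj2 (\<gamma> base) ** h ** \<gamma> base \<in> H" by (intro H.mult_mem base h)
 moreover have "h \<in> G" using h H_sub by blast
 ultimately show "tgt h base = base" using tgt(3)[OF _ base(1) base(1)] by simp
 then show "coc h base = adj2 (\<gamma> base) ** h ** \<gamma> base" by (simp add: coc_def)
qed

lemma tgt_eq_base: "h \<in> H ==> a < d ==> tgt h a = base ==> a = base"
proof (rule base_unique)
 assume h: "h \<in> H" and a: "a < d" and t: "tgt h a = base"
 have "coc h a ** (adj2 (\<gamma> base) ** adj2 h) \<in> H"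
  using tgt(2)[of h a] h a H_sub by (intro H.mult_mem H.adj_mem base) auto
 also have "coc h a ** (adj2 (\<gamma> base) ** adj2 h) = adj2 (\<gamma> a)"
  using h H.det1[OF base(3)] by (simp add: coc_def t matrix_mul_assoc[symmetric] adj2_cancel adj2_inverse)
 finally show "adj2 (\<gamma> a) \<in> H" .
qed

text \<open>Places w in the block of the trivial coset. The twist makes the embedding commute with
  the action of H.\<close>

definition emb :: "complex vec => complex vec" where
 "emb w = Matrix.vec (d * m) (\<lambda>r. if r div m = base then vec_index (\<rho> (adj2 (\<gamma> base)) *\<^sub>v w) (r mod m) else 0)"

lemma emb_carrier [simp]: "emb w \<in> carrier_vec (d * m)"
 by (simp add: emb_def)

lemma blk_emb:
 assumes "a < d" "w \<in> carrier_vec m"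
 shows "blk a (emb w) = (if a = base then \<rho> (adj2 (\<gamma> base)) *\<^sub>v w else 0\<^sub>v m)"
 using assms index_less[OF assms(1)] \<rho>_carrier[OF base(2)] by (intro eq_vecI) (auto simp: emb_def)

lemma \<rho>_cancel:
 assumes h: "h \<in> H" and w: "w \<in> carrier_vec m"
 shows "\<rho> h *\<^sub>v (\<rho> (adj2 h) *\<^sub>v w) = w"
proof -
 have "\<rho> h *\<^sub>v (\<rho> (adj2 h) *\<^sub>v w) = (\<rho> h * \<rho> (adj2 h)) *\<^sub>v w"
  by (rule assoc_mult_mat_vec[OF \<rho>_carrier[OF h] \<rho>_carrier[OF H.adj_mem[OF h]] w, symmetric])
 also have "\<rho> h * \<rho> (adj2 h) = 1\<^sub>m m"
  using \<rho>_mult[OF h H.adj_mem[OF h]] h by (simp add: adj2_inverse \<rho>_one)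
 finally show ?thesis using w by simp
qed

lemma emb_nonzero:
 assumes "w \<in> carrier_vec m" "w ~= 0\<^sub>v m"
 shows "emb w ~= 0\<^sub>v (d * m)"
proof
 assume "emb w = 0\<^sub>v (d * m)"
 then have "\<rho> (adj2 (\<gamma> base)) *\<^sub>v w = 0\<^sub>v m"
  using blk_emb[OF base(1) assms(1)] blk_zero[OF base(1)] by simp
 then have "w = \<rho> (\<gamma> base) *\<^sub>v 0\<^sub>v m" using \<rho>_cancel[OF base(3) assms(1)] by simp
 also have "\<dots> = 0\<^sub>v m" using \<rho>_carrier[OF base(3)] by (intro eq_vecI) auto
 finally show False using assms(2) by simp
qed

lemma \<psi>_emb:
 assumes h: "h \<in> H" and w: "w \<in> carrier_vec m"
 shows "\<psi> h *\<^sub>v emb w = emb (\<rho> h *\<^sub>v w)"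
proof (rule vec_eq_blkI)
 have hG: "h \<in> G" using h H_sub by blast
 have hw: "\<rho> h *\<^sub>v w \<in> carrier_vec m" by (rule mult_mat_vec_carrier[OF \<rho>_carrier[OF h] w])
 show "\<psi> h *\<^sub>v emb w \<in> carrier_vec (d * m)" by (rule mult_mat_vec_carrier[OF \<psi>_carrier[OF hG] emb_carrier])
 fix a assume a: "a < d"
 have act: "blk a (\<psi> h *\<^sub>v emb w) = \<rho> (coc h a) *\<^sub>v blk (tgt h a) (emb w)" by (rule blk_action[OF hG a emb_carrier])
 have cc: "\<rho> (coc h a) \<in> carrier_mat m m" by (rule \<rho>_carrier[OF tgt(2)[OF hG a]])
 show "blk a (\<psi> h *\<^sub>v emb w) = blk a (emb (\<rho> h *\<^sub>v w))"
 proof (cases "a = base")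
  case True
  have cH: "coc h base \<in> H" using tgt(2)[OF hG base(1)] .
  have "\<rho> (coc h base) *\<^sub>v (\<rho> (adj2 (\<gamma> base)) *\<^sub>v w) = \<rho> (coc h base ** adj2 (\<gamma> base)) *\<^sub>v w"
   unfolding \<rho>_mult[OF cH base(2)]
   by (rule assoc_mult_mat_vec[OF \<rho>_carrier[OF cH] \<rho>_carrier[OF base(2)] w, symmetric])
  also have "coc h base ** adj2 (\<gamma> base) = adj2 (\<gamma> base) ** h"
   using H.det1[OF base(3)] by (simp add: tgt_base(2)[OF h] matrix_mul_assoc[symmetric] adj2_inverse)
  also have "\<rho> (adj2 (\<gamma> base) ** h) *\<^sub>v w = \<rho> (adj2 (\<gamma> base)) *\<^sub>v (\<rho> h *\<^sub>v w)"
   unfolding \<rho>_mult[OF base(2) h]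
   by (rule assoc_mult_mat_vec[OF \<rho>_carrier[OF base(2)] \<rho>_carrier[OF h] w])
  finally show ?thesis unfolding act using True blk_emb[OF base(1)] w hw tgt_base(1)[OF h] by simp
 next
  case False
  have "tgt h a ~= base" using tgt_eq_base[OF h a] False by blast
  then have "blk a (\<psi> h *\<^sub>v emb w) = \<rho> (coc h a) *\<^sub>v 0\<^sub>v m"
   unfolding act using blk_emb[OF tgt(1)[OF hG a] w] by simp
  also have "\<dots> = 0\<^sub>v m" using cc by (intro eq_vecI) auto
  finally show ?thesis using blk_emb[OF a hw] False by simp
 qed
qed simp

lemma emb_add: "v \<in> carrier_vec m ==> w \<in> carrier_vec m ==> emb (v + w) = emb v + emb w"
proof -
 assume v: "v \<in> carrier_vec m" and w: "w \<in> carrier_vec m"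
 show ?thesis
 proof (rule vec_eq_blkI)
  fix a assume a: "a < d"
  show "blk a (emb (v + w)) = blk a (emb v + emb w)"
   using v w blk_add[OF emb_carrier emb_carrier a, of v w] blk_emb[OF a] \<rho>_carrier[OF base(2)]
   by (simp add: mult_add_distrib_mat_vec[of _ m m])
 qed auto
qed

lemma emb_smult: "v \<in> carrier_vec m ==> emb (c \<cdot>\<^sub>v v) = c \<cdot>\<^sub>v emb v"
proof -
 assume v: "v \<in> carrier_vec m"
 show ?thesis
 proof (rule vec_eq_blkI)
  fix a assume a: "a < d"
  show "blk a (emb (c \<cdot>\<^sub>v v)) = blk a (c \<cdot>\<^sub>v emb v)"
   using v blk_smult[OF emb_carrier a, of c v] blk_emb[OF a] \<rho>_carrier[OF base(2)]
   by (simp add: mult_mat_vec[of _ m m]) (intro impI eq_vecI, auto)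
 qed auto
qed

text \<open>A power of the conjugate of g by \<open>\<gamma> a\<close> lies in H, so that power of g
  maps coset a to itself and acts on block a through \<open>\<rho>\<close>.\<close>

lemma fixed_block:
 assumes g: "g \<in> G" and a: "a < d"
 obtains N where "N > 0" "adj2 (\<gamma> a) ** matpow g N ** \<gamma> a \<in> H"
  "!!v. v \<in> carrier_vec (d * m) ==> blk a (\<psi> (matpow g N) *\<^sub>v v) = \<rho> (adj2 (\<gamma> a) ** matpow g N ** \<gamma> a) *\<^sub>v blk a v"
proof -
 have da: "det (\<gamma> a) = 1" using \<gamma>_mem[OF a] by simp
 have "adj2 (\<gamma> a) ** g ** \<gamma> a \<in> G" by (intro G.mult_mem G.adj_mem \<gamma>_mem a g)
 from power_mem[OF this] obtain N where "N > 0 \<and> N dvd fact d \<and> matpow (adj2 (\<gamma> a) ** g ** \<gamma> a) N \<in> H" ..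
 then have N: "N > 0" "matpow (adj2 (\<gamma> a) ** g ** \<gamma> a) N \<in> H" by (rule conjunct1, elim conjE)
 have N2: "adj2 (\<gamma> a) ** matpow g N ** \<gamma> a \<in> H" using N(2) unfolding matpow_conj[OF da] .
 have p: "matpow g N \<in> G" by (rule G.matpow_mem[OF g])
 have t: "tgt (matpow g N) a = a" using tgt(3)[OF p a a] N2 by simp
 show thesis
 proof (rule that[OF N(1) N2])
  fix v :: "complex vec" assume v: "v \<in> carrier_vec (d * m)"
  show "blk a (\<psi> (matpow g N) *\<^sub>v v) = \<rho> (adj2 (\<gamma> a) ** matpow g N ** \<gamma> a) *\<^sub>v blk a v"
   using blk_action[OF p a v] unfolding t by (simp add: coc_def t)
 qed
qed

lemma nonzero_block:
 assumes "v \<in> carrier_vec (d * m)" "v ~= 0\<^sub>v (d * m)"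
 shows "\<exists>a<d. blk a v ~= 0\<^sub>v m"
proof (rule ccontr)
 assume "\<not> (\<exists>a<d. blk a v ~= 0\<^sub>v m)"
 then have z: "blk a v = 0\<^sub>v m" if "a < d" for a using that by blast
 have "v = 0\<^sub>v (d * m)" by (rule vec_eq_blkI[OF assms(1) zero_carrier_vec]) (simp add: z blk_zero)
 with assms(2) show False by blast
qed

text \<open>Powers of a Jordan block of size two. At n = 0 the truncated exponent n - 1 does no harm
  because the factor n vanishes.\<close>

lemma \<psi>_matpow_pair:
 assumes g: "g \<in> G" and v: "v \<in> carrier_vec (d * m)" and w: "w \<in> carrier_vec (d * m)"
  and eq: "\<psi> g *\<^sub>v v = l \<cdot>\<^sub>v v + w" "\<psi> g *\<^sub>v w = l \<cdot>\<^sub>v w"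
 shows "\<psi> (matpow g n) *\<^sub>v w = l ^ n \<cdot>\<^sub>v w \<and> \<psi> (matpow g n) *\<^sub>v v = l ^ n \<cdot>\<^sub>v v + (of_nat n * l ^ (n - 1)) \<cdot>\<^sub>v w"
proof (induction n)
 case 0
 then show ?case using v w by (auto simp: \<psi>_one)
next
 case (Suc n)
 have c: "\<psi> g \<in> carrier_mat (d * m) (d * m)" "\<psi> (matpow g n) \<in> carrier_mat (d * m) (d * m)"
  using \<psi>_carrier g G.matpow_mem by auto
 have ps: "\<psi> (matpow g (Suc n)) *\<^sub>v x = \<psi> g *\<^sub>v (\<psi> (matpow g n) *\<^sub>v x)" if "x \<in> carrier_vec (d * m)" for x
  unfolding matpow_Suc \<psi>_mult[OF g G.matpow_mem[OF g]] by (rule assoc_mult_mat_vec[OF c that])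
 have "\<psi> (matpow g (Suc n)) *\<^sub>v w = l ^ n \<cdot>\<^sub>v (l \<cdot>\<^sub>v w)"
  unfolding ps[OF w] using Suc mult_mat_vec[OF c(1) w, of "l ^ n"] eq(2) by simp
 moreover have "\<psi> (matpow g (Suc n)) *\<^sub>v v = l ^ n \<cdot>\<^sub>v (l \<cdot>\<^sub>v v + w) + (of_nat n * l ^ (n - 1)) \<cdot>\<^sub>v (l \<cdot>\<^sub>v w)"
  unfolding ps[OF v] using Suc v w c(1) eq
  by (simp add: mult_add_distrib_mat_vec[of _ "d * m" "d * m"] mult_mat_vec[of _ "d * m" "d * m"])
 moreover have "l ^ n \<cdot>\<^sub>v (l \<cdot>\<^sub>v v + w) + (of_nat n * l ^ (n - 1)) \<cdot>\<^sub>v (l \<cdot>\<^sub>v w) =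
   l ^ Suc n \<cdot>\<^sub>v v + (of_nat (Suc n) * l ^ (Suc n - 1)) \<cdot>\<^sub>v w"
 proof (rule eq_vecI)
  fix i assume "i < dim_vec (l ^ Suc n \<cdot>\<^sub>v v + (of_nat (Suc n) * l ^ (Suc n - 1)) \<cdot>\<^sub>v w)"
  then have i: "i < d * m" using w by simp
  show "vec_index (l ^ n \<cdot>\<^sub>v (l \<cdot>\<^sub>v v + w) + (of_nat n * l ^ (n - 1)) \<cdot>\<^sub>v (l \<cdot>\<^sub>v w)) i =
   vec_index (l ^ Suc n \<cdot>\<^sub>v v + (of_nat (Suc n) * l ^ (Suc n - 1)) \<cdot>\<^sub>v w) i"
   using v w i by (cases n) (simp_all add: algebra_simps)
 qed (use v w in auto)
 moreover have "l ^ n \<cdot>\<^sub>v (l \<cdot>\<^sub>v w) = l ^ Suc n \<cdot>\<^sub>v w" by (simp add: smult_smult_assoc mult.commute)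
 ultimately show ?case by simp
qed

lemma parabolic_block:
 assumes "g \<in> G" "a < d" "parabolic g"
 shows "parabolic (adj2 (\<gamma> a) ** matpow g N ** \<gamma> a)"
 using assms parabolic_conj[of "\<gamma> a"] parabolic_matpow \<gamma>_mem by simp

text \<open>From G to H, eigenvectors are embedded; a Jordan chain of g is restricted to a block
  where its eigenvector is nonzero, after passing to a power that preserves the block. The chain
  survives with factor N l^(N - 1), nonzero since |l| = 1. From H to G, eigenvalues are tested on
  the N-th power, and a chain is simply embedded.\<close>

lemma logarithmic_iff: "logarithmic G \<psi> \<longleftrightarrow> logarithmic H \<rho>"
proof
 assume L: "logarithmic G \<psi>"
 have ev: "cmod l = 1" if g: "g \<in> G" "parabolic g" and v: "v \<in> carrier_vec (d * m)" "v ~= 0\<^sub>v (d * m)" "\<psi> g *\<^sub>v v = l \<cdot>\<^sub>v v" for g l v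
 proof -
  have "eigenvalue (\<psi> g) l" using v \<psi>_carrier[OF g(1)] by (auto simp: eigenvalue_def eigenvector_def)
  then show ?thesis using L g by (auto simp: logarithmic_def)
 qed
 show "logarithmic H \<rho>"
  unfolding logarithmic_def
 proof (intro conjI ballI impI allI)
  fix h l assume h: "h \<in> H" "parabolic h" and l: "eigenvalue (\<rho> h) l"
  then obtain w where w: "w \<in> carrier_vec m" "w ~= 0\<^sub>v m" "\<rho> h *\<^sub>v w = l \<cdot>\<^sub>v w"
   using \<rho>_carrier[OF h(1)] by (auto simp: eigenvalue_def eigenvector_def)
  show "cmod l = 1"
   using h H_sub w by (intro ev[of h "emb w"]) (auto simp: emb_nonzero \<psi>_emb emb_smult)
 next
  obtain g where g: "g \<in> G" "parabolic g" "\<not> diagonalizable (\<psi> g)" using L by (auto simp: logarithmic_def)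
  then obtain l v w where p: "v \<in> carrier_vec (d * m)" "w \<in> carrier_vec (d * m)" "w ~= 0\<^sub>v (d * m)"
   "\<psi> g *\<^sub>v v = l \<cdot>\<^sub>v v + w" "\<psi> g *\<^sub>v w = l \<cdot>\<^sub>v w"
   using not_diagonalizable_iff[OF \<psi>_carrier[OF g(1)]] by (auto simp: jordan_pair_def)
  have l0: "l ~= 0" using ev[OF g(1,2) p(2,3,5)] by auto
  obtain a where a: "a < d" "blk a w ~= 0\<^sub>v m" using nonzero_block[OF p(2,3)] by blast
  obtain N where N: "N > 0" "adj2 (\<gamma> a) ** matpow g N ** \<gamma> a \<in> H"
   "!!v. v \<in> carrier_vec (d * m) ==> blk a (\<psi> (matpow g N) *\<^sub>v v) = \<rho> (adj2 (\<gamma> a) ** matpow g N ** \<gamma> a) *\<^sub>v blk a v"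
   by (rule fixed_block[OF g(1) a(1)]) (rule that)
  define h where "h = adj2 (\<gamma> a) ** matpow g N ** \<gamma> a"
  note hH = N(2)[folded h_def] and act = N(3)[folded h_def]
  define c where "c = of_nat N * l ^ (N - 1)"
  have c0: "c ~= 0" using l0 N(1) by (simp add: c_def)
  note pw = \<psi>_matpow_pair[OF g(1) p(1,2,4,5), of N, folded c_def]
  have cc: "\<rho> h \<in> carrier_mat m m" by (rule \<rho>_carrier[OF hH])
  have bw: "\<rho> h *\<^sub>v blk a w = l ^ N \<cdot>\<^sub>v blk a w"
   using act[OF p(2)] pw blk_smult[OF p(2) a(1)] by simp
  have bv: "\<rho> h *\<^sub>v blk a v = l ^ N \<cdot>\<^sub>v blk a v + c \<cdot>\<^sub>v blk a w"
   using act[OF p(1)] pw p(1,2) a(1) by (simp add: blk_add blk_smult)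
  have "jordan_pair m (\<rho> h) (l ^ N) (blk a v) (c \<cdot>\<^sub>v blk a w)"
   unfolding jordan_pair_def
  proof (intro conjI)
   show "c \<cdot>\<^sub>v blk a w ~= 0\<^sub>v m"
   proof
    assume z: "c \<cdot>\<^sub>v blk a w = 0\<^sub>v m"
    have "blk a w = 0\<^sub>v m"
    proof (rule eq_vecI)
     fix i assume i: "i < dim_vec (0\<^sub>v m :: complex vec)"
     have "vec_index (c \<cdot>\<^sub>v blk a w) i = 0" using z i by simp
     then show "vec_index (blk a w) i = vec_index (0\<^sub>v m) i" using c0 i by simp
    qed simp
    with a(2) show False by simp
   qed
   show "\<rho> h *\<^sub>v (c \<cdot>\<^sub>v blk a w) = l ^ N \<cdot>\<^sub>v (c \<cdot>\<^sub>v blk a w)"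
    unfolding mult_mat_vec[OF cc blk_carrier] bw by (simp add: smult_smult_assoc mult.commute)
  qed (use bv in auto)
  then have "\<not> diagonalizable (\<rho> h)" using not_diagonalizable_iff[OF cc] by blast
  then show "\<exists>h\<in>H. parabolic h \<and> \<not> diagonalizable (\<rho> h)"
   using hH parabolic_block[OF g(1) a(1) g(2)] unfolding h_def by blast
 qed
next
 assume L: "logarithmic H \<rho>"
 show "logarithmic G \<psi>"
  unfolding logarithmic_def
 proof (intro conjI ballI impI allI)
  fix g l assume g: "g \<in> G" "parabolic g" and l: "eigenvalue (\<psi> g) l"
  then obtain w where w: "w \<in> carrier_vec (d * m)" "w ~= 0\<^sub>v (d * m)" "\<psi> g *\<^sub>v w = l \<cdot>\<^sub>v w"
   using \<psi>_carrier[OF g(1)] by (auto simp: eigenvalue_def eigenvector_def)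
  obtain a where a: "a < d" "blk a w ~= 0\<^sub>v m" using nonzero_block[OF w(1,2)] by blast
  obtain N where N: "N > 0" "adj2 (\<gamma> a) ** matpow g N ** \<gamma> a \<in> H"
   "!!v. v \<in> carrier_vec (d * m) ==> blk a (\<psi> (matpow g N) *\<^sub>v v) = \<rho> (adj2 (\<gamma> a) ** matpow g N ** \<gamma> a) *\<^sub>v blk a v"
   by (rule fixed_block[OF g(1) a(1)]) (rule that)
  have "\<psi> (matpow g n) *\<^sub>v w = l ^ n \<cdot>\<^sub>v w" for n
  proof (induction n)
   case (Suc n)
   have "\<psi> (matpow g (Suc n)) *\<^sub>v w = \<psi> g *\<^sub>v (\<psi> (matpow g n) *\<^sub>v w)"
    unfolding matpow_Suc \<psi>_mult[OF g(1) G.matpow_mem[OF g(1)]]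
    by (rule assoc_mult_mat_vec[OF \<psi>_carrier[OF g(1)] \<psi>_carrier[OF G.matpow_mem[OF g(1)]] w(1)])
   also have "\<dots> = l ^ n \<cdot>\<^sub>v (l \<cdot>\<^sub>v w)"
    unfolding Suc mult_mat_vec[OF \<psi>_carrier[OF g(1)] w(1)] w(3) ..
   finally show ?case by (simp add: smult_smult_assoc mult.commute)
  qed (use w(1) in \<open>simp add: \<psi>_one\<close>)
  then have "\<rho> (adj2 (\<gamma> a) ** matpow g N ** \<gamma> a) *\<^sub>v blk a w = l ^ N \<cdot>\<^sub>v blk a w"
   using N(3)[OF w(1)] blk_smult[OF w(1) a(1)] by simp
  then have "eigenvalue (\<rho> (adj2 (\<gamma> a) ** matpow g N ** \<gamma> a)) (l ^ N)"
   using a(2) \<rho>_carrier[OF N(2)] unfolding eigenvalue_def eigenvector_def by (intro exI[of _ "blk a w"]) auto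
  then have "cmod (l ^ N) = 1" using L N(2) parabolic_block[OF g(1) a(1) g(2)] by (auto simp: logarithmic_def)
  then have "cmod l ^ N = 1 ^ N" by (simp add: norm_power)
  then show "cmod l = 1" using N(1) by (rule power_eq_imp_eq_base[OF _ norm_ge_zero zero_le_one])
 next
  obtain h where h: "h \<in> H" "parabolic h" "\<not> diagonalizable (\<rho> h)" using L by (auto simp: logarithmic_def)
  then obtain l v w where p: "v \<in> carrier_vec m" "w \<in> carrier_vec m" "w ~= 0\<^sub>v m"
   "\<rho> h *\<^sub>v v = l \<cdot>\<^sub>v v + w" "\<rho> h *\<^sub>v w = l \<cdot>\<^sub>v w"
   using not_diagonalizable_iff[OF \<rho>_carrier[OF h(1)]] by (auto simp: jordan_pair_def)
  have "jordan_pair (d * m) (\<psi> h) l (emb v) (emb w)"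
   unfolding jordan_pair_def using p h(1) by (auto simp: \<psi>_emb emb_add emb_smult emb_nonzero)
  then have "\<not> diagonalizable (\<psi> h)" using not_diagonalizable_iff[OF \<psi>_carrier[of h]] h(1) H_sub by blast
  then show "\<exists>g\<in>G. parabolic g \<and> \<not> diagonalizable (\<psi> g)" using h H_sub by blast
 qed
qed

text \<open>\<open>- I2\<close> is central, so its induced matrix is block diagonal with all blocks
  equal to its value under \<open>\<rho>\<close>.\<close>

lemma center_iff: "\<psi> I2 = c \<cdot>\<^sub>m \<psi> (- I2) \<longleftrightarrow> \<rho> I2 = c \<cdot>\<^sub>m \<rho> (- I2)"
proof -
 have n: "- I2 \<in> G" "- I2 \<in> H" using G.neg_one_mem H.neg_one_mem by auto
 have tgt_eq: "tgt (- I2) a = a" "coc (- I2) a = - I2" "tgt I2 a = a" "coc I2 a = I2" if a: "a < d" for a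
 proof -
  have da: "det (\<gamma> a) = 1" using \<gamma>_mem[OF a] by simp
  have e: "adj2 (\<gamma> a) ** (- I2) ** \<gamma> a = - I2" "adj2 (\<gamma> a) ** I2 ** \<gamma> a = I2"
   using da by (simp_all add: uminus_mult_mat2 adj2_inverse)
  show t: "tgt (- I2) a = a" "tgt I2 a = a"
   using tgt(3)[OF n(1) a a] tgt(3)[OF G.one_mem a a] unfolding e using n by auto
  show "coc (- I2) a = - I2" "coc I2 a = I2" unfolding coc_def t e by auto
 qed
 have idx: "\<psi> (- I2) $$ (a * m + i, b * m + j) = (if b = a then \<rho> (- I2) $$ (i, j) else 0)"
  "\<psi> I2 $$ (a * m + i, b * m + j) = (if b = a then \<rho> I2 $$ (i, j) else 0)"
  if "a < d" "b < d" "i < m" "j < m" for a b i j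
  using \<psi>_index[OF n(1) that(1,3,2,4)] \<psi>_index[OF G.one_mem that(1,3,2,4)] that tgt_eq by simp_all
 note c = \<psi>_carrier[OF n(1)] \<psi>_carrier[OF G.one_mem] \<rho>_carrier[OF n(2)] \<rho>_carrier[OF H.one_mem]
 show ?thesis
 proof
  assume eq: "\<psi> I2 = c \<cdot>\<^sub>m \<psi> (- I2)"
  show "\<rho> I2 = c \<cdot>\<^sub>m \<rho> (- I2)"
  proof (rule eq_matI)
   fix i j assume "i < dim_row (c \<cdot>\<^sub>m \<rho> (- I2))" "j < dim_col (c \<cdot>\<^sub>m \<rho> (- I2))"
   then have ij: "i < m" "j < m" using c by auto
   have "\<psi> I2 $$ (base * m + i, base * m + j) = c * \<psi> (- I2) $$ (base * m + i, base * m + j)"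
    using index_less[OF base(1)] ij c(1) by (subst eq) simp
   then show "\<rho> I2 $$ (i, j) = (c \<cdot>\<^sub>m \<rho> (- I2)) $$ (i, j)"
    using idx[OF base(1) base(1) ij] ij c by simp
  qed (use c in auto)
 next
  assume eq: "\<rho> I2 = c \<cdot>\<^sub>m \<rho> (- I2)"
  show "\<psi> I2 = c \<cdot>\<^sub>m \<psi> (- I2)"
  proof (rule eq_matI)
   fix r s assume "r < dim_row (c \<cdot>\<^sub>m \<psi> (- I2))" "s < dim_col (c \<cdot>\<^sub>m \<psi> (- I2))"
   then have rs: "r < d * m" "s < d * m" using c by auto
   obtain a i b j where *: "a < d" "i < m" "r = a * m + i" "b < d" "j < m" "s = b * m + j"
    using index_split[OF rs(1)] index_split[OF rs(2)] by blast
   have "\<rho> I2 $$ (i, j) = c * \<rho> (- I2) $$ (i, j)" using * c by (subst eq) simp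
   then show "\<psi> I2 $$ (r, s) = (c \<cdot>\<^sub>m \<psi> (- I2)) $$ (r, s)"
    using idx[OF *(1,4,2,5)] c(1) rs *(3,6) by simp
  qed (use c in auto)
 qed
qed

end

section \<open>Transfer of forms\<close>

text \<open>A space of functions spanned by n of them is determined by finitely many points:
  whenever the points chosen so far miss a relation, one more point is added. The induction needs at
  most one for each function.\<close>

lemma finite_detection:
 fixes g :: "nat => 'b => complex"
 shows "\<exists>T. finite T \<and> T \<subseteq> S \<and> (\<forall>c. (\<forall>x\<in>T. (\<Sum>i<n. c i * g i x) = 0) --> (\<forall>x\<in>S. (\<Sum>i<n. c i * g i x) = 0))"
proof -
 define L where "L n c x = (\<Sum>i<n. c i * g i x)" for n c x
 have L_Suc: "L (Suc n) c x = L n c x + c n * g n x" for n c x by (simp add: L_def)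
 have L_diff: "L n (\<lambda>i. e i - b * c i) x = L n e x - b * L n c x" for n e b c x
  unfolding L_def sum_distrib_left sum_subtractf[symmetric] by (intro sum.cong) (auto simp: algebra_simps)
 have "\<exists>T. finite T \<and> T \<subseteq> S \<and> (\<forall>c. (\<forall>x\<in>T. L n c x = 0) --> (\<forall>x\<in>S. L n c x = 0))" for n
 proof (induction n)
  case 0
  show ?case by (intro exI[of _ "{}"]) (simp add: L_def)
 next
  case (Suc n)
  then obtain T where T: "finite T" "T \<subseteq> S" "!!c. (\<forall>x\<in>T. L n c x = 0) ==> \<forall>x\<in>S. L n c x = 0" by blast
  have last: "\<forall>x\<in>S. L (Suc n) c x = 0" if "c n = 0" "\<forall>x\<in>T. L (Suc n) c x = 0" for c
   using T(3)[of c] that unfolding L_Suc by simp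
  show ?case
  proof (cases "\<forall>c. (\<forall>x\<in>T. L (Suc n) c x = 0) --> (\<forall>x\<in>S. L (Suc n) c x = 0)")
   case True
   then show ?thesis using T(1,2) by blast
  next
   case False
   then obtain c x where c: "!!y. y \<in> T ==> L (Suc n) c y = 0" and x: "x \<in> S" "L (Suc n) c x ~= 0" by blast
   then have cn: "c n ~= 0" using last by blast
   have "\<forall>y\<in>S. L (Suc n) e y = 0" if e: "\<forall>y\<in>insert x T. L (Suc n) e y = 0" for e
   \<comment> \<open>Subtracting a multiple of the undetected combination c removes the last
     coefficient of e, so the induction hypothesis applies; the new point x then shows that the
     multiple is 0.\<close>
   proof -
    define b where "b = e n / c n"
    have "e n - b * c n = 0" using cn by (simp add: b_def)
    moreover have "\<forall>y\<in>T. L (Suc n) (\<lambda>i. e i - b * c i) y = 0" unfolding L_diff using e c by simp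
    ultimately have "\<forall>y\<in>S. L (Suc n) (\<lambda>i. e i - b * c i) y = 0" by (rule last)
    then have "b * L (Suc n) c x = 0" using x(1) e unfolding L_diff by simp
    then have "e n = 0" using x(2) cn by (simp add: b_def)
    then show ?thesis using last e by blast
   qed
   then show ?thesis using T(1,2) x(1) by (intro exI[of _ "insert x T"]) blast
  qed
 qed
 from this[of n] show ?thesis unfolding L_def .
qed

lemma holomorphic_eq_zero:
 assumes "F holomorphic_on \<H>" "open U" "U ~= {}" "U \<subseteq> \<H>" "!!z. z \<in> U ==> F z = 0" "Im z > 0"
 shows "F z = 0"
 by (rule analytic_continuation_open[OF assms(2) open_H assms(3) connected_H assms(4), of F "\<lambda>_. 0"])
  (use assms in auto)

text \<open>The set where finitely many of the functions are nonzero is open and nonempty, and a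
  further function vanishing on it would vanish identically.\<close>

lemma common_nonzero:
 assumes "finite I" "!!i. i \<in> I ==> F i holomorphic_on \<H>" "!!i. i \<in> I ==> \<exists>z. Im z > 0 \<and> F i z ~= 0"
 shows "\<exists>z. Im z > 0 \<and> (\<forall>i\<in>I. F i z ~= (0::complex))"
 using assms
proof (induction I)
 case empty
 show ?case by (intro exI[of _ \<i>]) simp
next
 case (insert i I)
 obtain z where z: "Im z > 0" "\<forall>i\<in>I. F i z ~= 0" using insert.IH insert.prems by blast
 define P where "P w = (\<Prod>i\<in>I. F i w)" for w
 have P: "P holomorphic_on \<H>" unfolding P_def using insert.prems(1) by (intro holomorphic_intros) auto
 define U where "U = P -` (- {0}) \<inter> \<H>"
 have oU: "open U" unfolding U_def
  using continuous_on_open_vimage[OF open_H, of P] holomorphic_on_imp_continuous_on[OF P] by blast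
 have nU: "U ~= {}" using z insert.hyps(1) by (auto simp: U_def P_def)
 show ?case
 proof (rule ccontr)
  assume neg: "\<not> ?thesis"
  have "F i w = 0" if w: "w \<in> U" for w
  proof (rule ccontr)
   assume "F i w ~= 0"
   moreover have "Im w > 0" "\<forall>j\<in>I. F j w ~= 0" using w insert.hyps(1) by (auto simp: U_def P_def)
   ultimately show False using neg by auto
  qed
  then have "F i w = 0" if "Im w > 0" for w
   using that holomorphic_eq_zero[OF insert.prems(1)[of i] oU nU] by (auto simp: U_def)
  then show False using insert.prems(2)[of i] by auto
 qed
qed

text \<open>Separates the conjugates of \<open>f\<close>: a polynomial in \<open>f\<close> can be made to vanish on all blocks but one
 at points which still detect linear independence.\<close>

lemma separating_polynomial:
 fixes F :: "nat => complex => complex" and g :: "nat => nat => complex => complex"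
 assumes F: "!!a. a < d ==> F a holomorphic_on \<H>" and nc: "!!a. a < d ==> \<not> F a constant_on \<H>"
  and ne: "!!a b. a < d ==> b < d ==> a ~= b ==> \<exists>z. Im z > 0 \<and> F a z ~= F b z"
  and g: "!!a i. a < d ==> i < m ==> g a i holomorphic_on \<H>"
  and ind: "!!a c. a < d ==> (\<forall>z. Im z > 0 --> (\<Sum>i<m. c i * g a i z) = 0) ==> \<forall>i<m. c i = 0"
 obtains V T where "finite V"
  "!!a t. a < d ==> t \<in> T a ==> Im t > 0 \<and> (\<forall>v\<in>V. F a t ~= v)"
  "!!a b t. a < d ==> b < d ==> a ~= b ==> t \<in> T a ==> F b t \<in> V"
  "!!a c. a < d ==> (\<forall>t\<in>T a. (\<Sum>i<m. c i * g a i t) = 0) ==> \<forall>i<m. c i = 0"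
proof -
 \<comment> \<open>Left entries ask for nonzero derivatives, which give local injectivity; right
   entries ask that different functions take different values.\<close>
 define I where "I = Inl ` {..<d} \<union> Inr ` {(a, b). a < d \<and> b < d \<and> a ~= b}"
 define \<Phi> where "\<Phi> x = (case x of Inl a => deriv (F a) | Inr (a, b) => (\<lambda>z. F a z - F b z))" for x
 have "\<exists>z. Im z > 0 \<and> (\<forall>x\<in>I. \<Phi> x z ~= 0)"
 proof (rule common_nonzero)
  have "finite {(a, b). a < d \<and> b < d \<and> a ~= b}"
   by (rule finite_subset[of _ "{..<d} \<times> {..<d}"]) auto
  then show "finite I" by (simp add: I_def)
  show "\<Phi> x holomorphic_on \<H>" if "x \<in> I" for x
   using that F by (auto simp: I_def \<Phi>_def intro!: holomorphic_intros open_H)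
  show "\<exists>z. Im z > 0 \<and> \<Phi> x z ~= 0" if x: "x \<in> I" for x
  proof (cases x)
   case (Inl a)
   then have a: "a < d" using x by (auto simp: I_def)
   show ?thesis
   proof (rule ccontr)
    assume "\<not> ?thesis"
    then have "deriv (F a) z = 0" if "Im z > 0" for z using that Inl by (auto simp: \<Phi>_def)
    then have "(F a has_field_derivative 0) (at z)" if "z \<in> \<H>" for z
     using holomorphic_derivI[OF F[OF a] open_H that] that by simp
    then obtain c where "!!z. z \<in> \<H> ==> F a z = c"
     using DERIV_zero_connected_constant[OF connected_H open_H finite.emptyI holomorphic_on_imp_continuous_on[OF F[OF a]]]
     by auto
    then show False using nc[OF a] by (auto simp: constant_on_def)
   qed
  next
   case (Inr p)
   then show ?thesis using x ne by (cases p) (auto simp: I_def \<Phi>_def)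
  qed
 qed
 then obtain \<tau> where \<tau>: "Im \<tau> > 0" "!!x. x \<in> I ==> \<Phi> x \<tau> ~= 0" by blast
 have der: "deriv (F a) \<tau> ~= 0" if "a < d" for a using \<tau>(2)[of "Inl a"] that by (simp add: I_def \<Phi>_def)
 have dist: "F a \<tau> ~= F b \<tau>" if "a < d" "b < d" "a ~= b" for a b
  using \<tau>(2)[of "Inr (a, b)"] that by (simp add: I_def \<Phi>_def image_iff)
 \<comment> \<open>The element 1 only keeps the set nonempty when there are no two different
   indices.\<close>
 define E where "E = insert 1 ((\<lambda>(a, b). dist (F a \<tau>) (F b \<tau>)) ` {(a, b). a < d \<and> b < d \<and> a ~= b})"
 have "finite {(a, b). a < d \<and> b < d \<and> a ~= b}"
  by (rule finite_subset[of _ "{..<d} \<times> {..<d}"]) auto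
 then have E: "finite E" "E ~= {}" by (simp_all add: E_def)
 define \<epsilon> where "\<epsilon> = Min E / 2"
 have "Min E \<in> E" by (rule Min_in[OF E])
 then have "Min E > 0" using dist by (auto simp: E_def)
 then have \<epsilon>: "\<epsilon> > 0" by (simp add: \<epsilon>_def)
 have sep: "2 * \<epsilon> <= dist (F a \<tau>) (F b \<tau>)" if "a < d" "b < d" "a ~= b" for a b
  unfolding \<epsilon>_def using that Min_le[OF E(1), of "dist (F a \<tau>) (F b \<tau>)"] by (force simp: E_def)
 have "\<forall>a\<in>{..<d}. \<exists>r>0. ball \<tau> r \<subseteq> \<H> \<and> inj_on (F a) (ball \<tau> r) \<and> (\<forall>t\<in>ball \<tau> r. dist (F a t) (F a \<tau>) < \<epsilon>)"
 proof
  fix a assume "a \<in> {..<d}"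
  then have a: "a < d" by simp
  obtain r1 where r1: "r1 > 0" "ball \<tau> r1 \<subseteq> \<H>" "inj_on (F a) (ball \<tau> r1)"
   by (rule has_complex_derivative_locally_injective[OF F[OF a] _ open_H der[OF a]]) (use \<tau>(1) in auto)
  have "isCont (F a) \<tau>"
   using holomorphic_on_imp_continuous_on[OF F[OF a]] \<tau>(1) by (simp add: continuous_on_eq_continuous_at[OF open_H])
  then obtain r2 where r2: "r2 > 0" "!!t. dist t \<tau> < r2 ==> dist (F a t) (F a \<tau>) < \<epsilon>"
   using \<epsilon> unfolding continuous_at_eps_delta by blast
  show "\<exists>r>0. ball \<tau> r \<subseteq> \<H> \<and> inj_on (F a) (ball \<tau> r) \<and> (\<forall>t\<in>ball \<tau> r. dist (F a t) (F a \<tau>) < \<epsilon>)"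
  proof (intro exI[of _ "min r1 r2"] conjI ballI)
   have sub: "ball \<tau> (min r1 r2) \<subseteq> ball \<tau> r1" by (rule subset_ball) simp
   show "ball \<tau> (min r1 r2) \<subseteq> \<H>" using sub r1(2) by blast
   show "inj_on (F a) (ball \<tau> (min r1 r2))" using sub r1(3) inj_on_subset by blast
  qed (use r1 r2 in \<open>auto simp: dist_commute\<close>)
 qed
 from bchoice[OF this] obtain R where
  "\<forall>a\<in>{..<d}. R a > 0 \<and> ball \<tau> (R a) \<subseteq> \<H> \<and> inj_on (F a) (ball \<tau> (R a)) \<and> (\<forall>t\<in>ball \<tau> (R a). dist (F a t) (F a \<tau>) < \<epsilon>)" ..
 then have R: "!!a. a < d ==> R a > 0" "!!a. a < d ==> ball \<tau> (R a) \<subseteq> \<H>"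
   "!!a. a < d ==> inj_on (F a) (ball \<tau> (R a))"
   "!!a t. a < d ==> t \<in> ball \<tau> (R a) ==> dist (F a t) (F a \<tau>) < \<epsilon>" by blast+
 define r where "r = Min (insert 1 (R ` {..<d}))"
 have r0: "r > 0" unfolding r_def using R(1) by (subst Min_gr_iff) auto
 have "r <= R a" if "a < d" for a unfolding r_def using that by (intro Min_le) auto
 then have rs: "ball \<tau> r \<subseteq> ball \<tau> (R a)" if "a < d" for a using that by (intro subset_ball)
 \<comment> \<open>Disjoint vertical slices of width r/d to the right of \<tau>, one for each block,
   so that points chosen for different blocks never coincide.\<close>
 define U where "U a = {z \<in> ball \<tau> r. real a < real d / r * (Re z - Re \<tau>) \<and> real d / r * (Re z - Re \<tau>) < real a + 1}" for a
 have U: "open (U a)" "U a ~= {}" "U a \<subseteq> \<H>" if a: "a < d" for a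
 proof -
  have d0: "real d > 0" using a by simp
  have "U a = ball \<tau> r \<inter> {z. real a < real d / r * (Re z - Re \<tau>)} \<inter> {z. real d / r * (Re z - Re \<tau>) < real a + 1}"
   by (auto simp: U_def)
  then show "open (U a)"
   by (simp only:) (intro open_Int open_ball open_Collect_less continuous_intros)
  define z where "z = \<tau> + of_real ((real a + 1 / 2) * r / real d)"
  have "real d / r * (Re z - Re \<tau>) = real a + 1 / 2" using r0 d0 by (simp add: z_def)
  moreover have "dist \<tau> z < r"
  proof -
   have "dist \<tau> z = (real a + 1 / 2) / real d * r"
    using r0 d0 by (simp add: z_def dist_norm norm_mult norm_divide flip: of_real_mult of_real_divide)
   also have "\<dots> < 1 * r"
   proof (rule mult_strict_right_mono[OF _ r0])
    have "real a + 1 <= real d" using a by linarith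
    then show "(real a + 1 / 2) / real d < 1" using d0 by (simp add: divide_less_eq)
   qed
   finally show ?thesis by simp
  qed
  ultimately have "z \<in> U a" by (simp add: U_def)
  then show "U a ~= {}" by blast
  show "U a \<subseteq> \<H>" using rs[OF a] R(2)[OF a] by (auto simp: U_def)
 qed
 have Udisj: "a = b" if "z \<in> U a" "z \<in> U b" for a b z
 proof -
  have "real a < real b + 1" "real b < real a + 1" using that unfolding U_def by auto
  then show ?thesis by linarith
 qed
 have "\<forall>a\<in>{..<d}. \<exists>T. finite T \<and> T \<subseteq> U a \<and> (\<forall>c. (\<forall>x\<in>T. (\<Sum>i<m. c i * g a i x) = 0) --> (\<forall>i<m. c i = 0))"
 proof
  fix a assume "a \<in> {..<d}"
  then have a: "a < d" by simp
  show "\<exists>T. finite T \<and> T \<subseteq> U a \<and> (\<forall>c. (\<forall>x\<in>T. (\<Sum>i<m. c i * g a i x) = 0) --> (\<forall>i<m. c i = 0))"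
  proof -
   obtain T where T: "finite T" "T \<subseteq> U a"
    "!!c. (\<forall>x\<in>T. (\<Sum>i<m. c i * g a i x) = 0) ==> \<forall>x\<in>U a. (\<Sum>i<m. c i * g a i x) = 0"
    using finite_detection[where S = "U a" and n = m and g = "g a"] by blast
   have "\<forall>i<m. c i = 0" if c: "\<forall>x\<in>T. (\<Sum>i<m. c i * g a i x) = 0" for c
   proof (rule ind[OF a])
    have "(\<lambda>z. \<Sum>i<m. c i * g a i z) holomorphic_on \<H>" using g[OF a] by (intro holomorphic_intros) auto
    then show "\<forall>z. Im z > 0 --> (\<Sum>i<m. c i * g a i z) = 0"
     using holomorphic_eq_zero[OF _ U[OF a]] T(3)[OF c] by blast
   qed
   then show ?thesis using T(1,2) by blast
  qed
 qed
 from bchoice[OF this] obtain T where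
  "\<forall>a\<in>{..<d}. finite (T a) \<and> T a \<subseteq> U a \<and> (\<forall>c. (\<forall>x\<in>T a. (\<Sum>i<m. c i * g a i x) = 0) --> (\<forall>i<m. c i = 0))" ..
 then have T: "!!a. a < d ==> finite (T a)" "!!a. a < d ==> T a \<subseteq> U a"
  "!!a c. a < d ==> (\<forall>x\<in>T a. (\<Sum>i<m. c i * g a i x) = 0) ==> \<forall>i<m. c i = 0" by blast+
 define V where "V = (\<Union>a\<in>{..<d}. \<Union>b\<in>{..<d} - {a}. F b ` T a)"
 show thesis
 proof (rule that[of V T])
  show "finite V" unfolding V_def using T(1) by auto
  show "F b t \<in> V" if "a < d" "b < d" "a ~= b" "t \<in> T a" for a b t
   using that unfolding V_def by blast
  show "\<forall>i<m. c i = 0" if "a < d" "\<forall>t\<in>T a. (\<Sum>i<m. c i * g a i t) = 0" for a c by (rule T(3)[OF that])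
  show "Im t > 0 \<and> (\<forall>v\<in>V. F a t ~= v)" if a: "a < d" and t: "t \<in> T a" for a t
  proof (intro conjI ballI notI)
   have tU: "t \<in> U a" using T(2)[OF a] t by blast
   then show "Im t > 0" using U(3)[OF a] by auto
   fix v assume v: "v \<in> V" "F a t = v"
   then obtain a' b t' where v': "a' < d" "b < d" "b ~= a'" "t' \<in> T a'" "F a t = F b t'" unfolding V_def by blast
   have t'U: "t' \<in> U a'" using T(2)[OF v'(1)] v'(4) by blast
   have tb: "t \<in> ball \<tau> r" "t' \<in> ball \<tau> r" using tU t'U by (auto simp: U_def)
   \<comment> \<open>Near \<tau> the values of different functions are kept apart. Equal values thus
     come from the same function, injectivity makes the points equal, and they would lie in two
     disjoint slices.\<close>
   have "a = b"
   proof (rule ccontr)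
    assume ab: "a ~= b"
    have "dist (F a t) (F a \<tau>) < \<epsilon>" "dist (F b t') (F b \<tau>) < \<epsilon>"
     using R(4) a v'(2) tb rs by blast+
    then have "dist (F a \<tau>) (F b \<tau>) < 2 * \<epsilon>"
     using dist_triangle2[of "F a \<tau>" "F b \<tau>" "F a t"] v'(5) by (simp add: dist_commute)
    then show False using sep[OF a v'(2) ab] by linarith
   qed
   then have "t = t'" using inj_onD[OF R(3)[OF a]] v'(5) tb rs[OF a] by blast
   then show False using Udisj[OF tU] t'U \<open>a = b\<close> v'(3) by blast
  qed
 qed
qed

section \<open>Restriction and lifting of forms\<close>

lemma slash_eq: "slash k g X z = (jfac g z powi (- k)) \<cdot>\<^sub>v X (mobius g z)"
 by (simp add: slash_def jfac_def)

lemma (in discrete_SL2) exists_cusp: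
 assumes \<delta>: "\<delta> \<in> \<Gamma>" "parabolic \<delta>" "\<delta> ~= I2" "\<delta> ~= - I2"
 shows "\<exists>c. is_cusp \<Gamma> c"
proof -
 have ns: "\<delta> ~= x *\<^sub>R I2" for x using scalar_mem[of x] \<delta> by auto
 have "(trace \<delta>)^2 = 4" using \<delta>(2) by (auto simp: parabolic_def)
 then obtain g e s where g: "det g = 1" "adj2 g ** \<delta> ** g = mat2 e s 0 e" "s ~= 0" "e^2 = 1"
  using parabolic_normal_form[OF det1[OF \<delta>(1)] ns] by blast
 obtain \<gamma> p where p: "p > 0" "\<gamma> \<in> \<Gamma>" "\<gamma> ** g = g ** mat2 1 p 0 1" using period_at[OF \<delta>(1) g] by blast
 have "g ** mat2 1 p 0 1 ** adj2 g = \<gamma>" using g(1) by (simp add: p(3)[symmetric] adj2_cancel)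
 then have "cuspidal \<Gamma> g" using p g(1) by (auto simp: cuspidal_def)
 then show ?thesis using cuspidal_cusp[OF det1] by metis
qed

lemma diagonalizable_diagonal: "A \<in> carrier_mat n n ==> diagonal_mat A ==> diagonalizable A"
 unfolding diagonalizable_def using similar_mat_refl by blast

context induced_pair
begin

abbreviation vvaf_G :: "int => (complex => complex vec) => bool" where
 "vvaf_G k X \<equiv> weakly_holomorphic_log_vvaf k G (d * m) \<psi> X"

abbreviation vvaf_H :: "int => (complex => complex vec) => bool" where
 "vvaf_H k X \<equiv> weakly_holomorphic_log_vvaf k H m \<rho> X"

lemma carriers: "\<forall>g\<in>G. \<psi> g \<in> carrier_mat (d * m) (d * m)" "\<forall>h\<in>H. \<rho> h \<in> carrier_mat m m"
 using \<psi>_carrier \<rho>_carrier by auto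

lemmas vvaf_G_iff = weakly_holomorphic_log_vvaf_iff[OF G.discrete_SL2_axioms carriers(1)]
lemmas vvaf_H_iff = weakly_holomorphic_log_vvaf_iff[OF H.discrete_SL2_axioms carriers(2)]

lemma restrict_form:
 assumes X: "vvaf_G k X" and ind: "independent_components (d * m) X"
 shows "\<exists>Y. vvaf_H k Y \<and> independent_components m Y"
proof -
 note x = X[unfolded vvaf_G_iff]
 define A where "A = \<rho> (\<gamma> base)"
 \<comment> \<open>The block belongs to the representative \<open>\<gamma> base\<close>; applying
   its matrix undoes the conjugation that this representative causes.\<close>
 define Y where "Y z = A *\<^sub>v blk base (X z)" for z
 have A: "A \<in> carrier_mat m m" unfolding A_def by (rule \<rho>_carrier[OF base(3)])
 have Xc: "X z \<in> carrier_vec (d * m)" if "Im z > 0" for z using x that by simp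
 have Yi: "vec_index (Y z) i = (\<Sum>j<m. A $$ (i, j) * vec_index (X z) (base * m + j))" if "i < m" for i z
  using A that by (simp add: Y_def scalar_prod_def atLeast0LessThan)
 have bm: "base * m + j < d * m" if "j < m" for j by (rule index_less[OF base(1) that])
 have "vvaf_H k Y"
  unfolding vvaf_H_iff
 proof (intro conjI ballI allI impI)
  show "logarithmic H \<rho>" using x logarithmic_iff by blast
  show "\<rho> I2 = exp (\<i> * of_real pi * of_int k) \<cdot>\<^sub>m \<rho> (- I2)" using x center_iff by blast
  show "Y z \<in> carrier_vec m" for z unfolding Y_def by (rule mult_mat_vec_carrier[OF A blk_carrier])
  show "(\<lambda>z. vec_index (Y z) i) holomorphic_on \<H>" if "i < m" for i
   using x bm by (simp add: Yi[OF that]) (intro holomorphic_intros, auto)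
  show "moderate_at_cusps H (\<lambda>z. vec_index (Y z) i)" if "i < m" for i
   unfolding moderate_at_cusps_H_iff using x bm
   by (simp add: Yi[OF that]) (intro moderate_at_cusps_sum moderate_at_cusps_mult moderate_at_cusps_const, auto)
  fix h z assume h: "h \<in> H" and z: "z \<in> \<H>"
  have hG: "h \<in> G" using h H_sub by blast
  have hz: "Im (mobius h z) > 0" using h z by simp
  have cH: "coc h base \<in> H" by (rule tgt(2)[OF hG base(1)])
  have "slash k h Y z = A *\<^sub>v blk base (slash k h X z)"
   unfolding slash_eq Y_def blk_smult[OF Xc[OF hz] base(1)] by (rule mult_mat_vec[OF A blk_carrier, symmetric])
  also have "slash k h X z = \<psi> h *\<^sub>v X z" using x hG z by blast
  also have "blk base (\<psi> h *\<^sub>v X z) = \<rho> (coc h base) *\<^sub>v blk base (X z)"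
   using blk_action[OF hG base(1) Xc] z tgt_base(1)[OF h] by simp
  also have "A *\<^sub>v (\<rho> (coc h base) *\<^sub>v blk base (X z)) = (A * \<rho> (coc h base)) *\<^sub>v blk base (X z)"
   by (rule assoc_mult_mat_vec[OF A \<rho>_carrier[OF cH] blk_carrier, symmetric])
  also have "A * \<rho> (coc h base) = \<rho> (\<gamma> base ** coc h base)"
   unfolding A_def by (rule \<rho>_mult[OF base(3) cH, symmetric])
  also have "\<gamma> base ** coc h base = h ** \<gamma> base"
   using H.det1[OF base(3)] by (simp add: tgt_base(2)[OF h] matrix_mul_assoc[symmetric] adj2_cancel)
  also have "\<rho> (h ** \<gamma> base) = \<rho> h * A" unfolding A_def by (rule \<rho>_mult[OF h base(3)])
  also have "(\<rho> h * A) *\<^sub>v blk base (X z) = \<rho> h *\<^sub>v Y z"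
   unfolding Y_def by (rule assoc_mult_mat_vec[OF \<rho>_carrier[OF h] A blk_carrier])
  finally show "slash k h Y z = \<rho> h *\<^sub>v Y z" .
 qed
 moreover have "independent_components m Y"
  unfolding independent_components_def
 proof (intro allI impI)
  fix c :: "nat => complex" and l
  assume c: "\<forall>z\<in>\<H>. (\<Sum>i<m. c i * vec_index (Y z) i) = 0" and l: "l < m"
  define e where "e j = (\<Sum>i<m. c i * A $$ (i, j))" for j
  define E where "E r = (if r div m = base then e (r mod m) else 0)" for r
  have "(\<Sum>r<d * m. E r * vec_index (X z) r) = 0" if z: "z \<in> \<H>" for z
  proof -
   have "(\<Sum>r<d * m. E r * vec_index (X z) r) = (\<Sum>a<d. \<Sum>j<m. E (a * m + j) * vec_index (X z) (a * m + j))"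
    by (rule sum_blocks)
   also have "\<dots> = (\<Sum>a<d. if a = base then \<Sum>j<m. e j * vec_index (X z) (base * m + j) else 0)"
    by (intro sum.cong refl) (auto simp: E_def intro!: sum.cong)
   also have "\<dots> = (\<Sum>j<m. \<Sum>i<m. c i * A $$ (i, j) * vec_index (X z) (base * m + j))"
    using base(1) by (simp add: e_def sum_distrib_right)
   also have "\<dots> = (\<Sum>i<m. \<Sum>j<m. c i * A $$ (i, j) * vec_index (X z) (base * m + j))" by (rule sum.swap)
   also have "\<dots> = (\<Sum>i<m. c i * vec_index (Y z) i)" by (simp add: Yi sum_distrib_left mult.assoc)
   finally show ?thesis using c z by simp
  qed
  then have "\<forall>r<d * m. E r = 0" using ind unfolding independent_components_def by blast
  then have e0: "e j = 0" if "j < m" for j using bm[OF that] that by (force simp: E_def)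
  \<comment> \<open>The coefficients e are those of c multiplied by the matrix A; its right inverse
    B recovers c.\<close>
  define B where "B = \<rho> (adj2 (\<gamma> base))"
  have B: "B \<in> carrier_mat m m" unfolding B_def by (rule \<rho>_carrier[OF base(2)])
  have AB: "A * B = 1\<^sub>m m"
   using \<rho>_mult[OF base(3,2)] H.det1[OF base(3)] by (simp add: A_def B_def adj2_inverse \<rho>_one)
  have "c l = (\<Sum>i<m. c i * (1\<^sub>m m) $$ (i, l))"
  proof -
   have "(\<Sum>i<m. c i * (1\<^sub>m m) $$ (i, l)) = (\<Sum>i<m. if i = l then c l else 0)" using l by (intro sum.cong) auto
   then show ?thesis using l by simp
  qed
  also have "\<dots> = (\<Sum>i<m. c i * (\<Sum>j<m. A $$ (i, j) * B $$ (j, l)))"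
   unfolding AB[symmetric] using A B l by (intro sum.cong) (auto simp: scalar_prod_def atLeast0LessThan)
  also have "\<dots> = (\<Sum>i<m. \<Sum>j<m. c i * A $$ (i, j) * B $$ (j, l))" by (simp add: sum_distrib_left mult.assoc)
  also have "\<dots> = (\<Sum>j<m. \<Sum>i<m. c i * A $$ (i, j) * B $$ (j, l))" by (rule sum.swap)
  also have "\<dots> = (\<Sum>j<m. e j * B $$ (j, l))" by (simp add: e_def sum_distrib_right)
  also have "\<dots> = 0" using e0 by simp
  finally show "c l = 0" .
 qed
 ultimately show ?thesis by blast
qed

definition lift :: "int => (complex => complex vec) => complex => complex vec" where
 "lift k Y z = Matrix.vec (d * m) (\<lambda>r. vec_index (slash k (adj2 (\<gamma> (r div m))) Y z) (r mod m))"

lemma lift_index: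
 assumes "a < d" "i < m"
 shows "vec_index (lift k Y z) (a * m + i) = vec_index (slash k (adj2 (\<gamma> a)) Y z) i"
 using index_less[OF assms] assms by (simp add: lift_def)

lemma blk_lift:
 assumes "a < d" "Im z > 0" and Y: "!!z. Im z > 0 ==> Y z \<in> carrier_vec m"
 shows "blk a (lift k Y z) = slash k (adj2 (\<gamma> a)) Y z"
proof (rule eq_vecI)
 have "Y (mobius (adj2 (\<gamma> a)) z) \<in> carrier_vec m" using assms \<gamma>_mem[OF assms(1)] by (intro Y) simp
 then have d: "dim_vec (slash k (adj2 (\<gamma> a)) Y z) = m" by (simp add: slash_eq)
 then show "dim_vec (blk a (lift k Y z)) = dim_vec (slash k (adj2 (\<gamma> a)) Y z)" by simp
 fix i assume "i < dim_vec (slash k (adj2 (\<gamma> a)) Y z)"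
 then show "vec_index (blk a (lift k Y z)) i = vec_index (slash k (adj2 (\<gamma> a)) Y z) i"
  using d lift_index[OF assms(1)] by simp
qed

lemma slash_mult:
 assumes "det g = 1" "det h = 1" "Im z > 0"
 shows "slash k (g ** h) X z = (jfac h z powi (- k)) \<cdot>\<^sub>v slash k g X (mobius h z)"
 using assms by (simp add: slash_eq jfac_mult mobius_mult power_int_mult_distrib smult_smult_assoc mult.commute)

text \<open>The inverse of \<open>\<gamma> a\<close> times g is h times the inverse of
  \<open>\<gamma> b\<close> with h in H. So g permutes the blocks with a factor
  \<open>\<rho> h\<close>, exactly as the induced matrix does.\<close>

lemma lift_slash:
 assumes Y: "!!z. Im z > 0 ==> Y z \<in> carrier_vec m"
  and H: "!!h z. h \<in> H ==> Im z > 0 ==> slash k h Y z = \<rho> h *\<^sub>v Y z"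
  and g: "g \<in> G" and z: "Im z > 0"
 shows "slash k g (lift k Y) z = \<psi> g *\<^sub>v lift k Y z"
proof (rule vec_eq_blkI)
 have lc: "lift k Y z \<in> carrier_vec (d * m)" for z by (simp add: lift_def)
 show "slash k g (lift k Y) z \<in> carrier_vec (d * m)" unfolding slash_eq using lc by simp
 show "\<psi> g *\<^sub>v lift k Y z \<in> carrier_vec (d * m)" by (rule mult_mat_vec_carrier[OF \<psi>_carrier[OF g] lc])
 have bl: "blk a (lift k Y z) = slash k (adj2 (\<gamma> a)) Y z" if "a < d" "Im z > 0" for a z
  by (rule blk_lift[OF that Y])
 fix a assume a: "a < d"
 define b where "b = tgt g a"
 define h where "h = coc g a"
 have b: "b < d" and h: "h \<in> H" using tgt[OF g a] by (simp_all add: b_def h_def)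
 have da: "det (\<gamma> a) = 1" and db: "det (\<gamma> b) = 1" using \<gamma>_mem a b by simp_all
 have gh: "adj2 (\<gamma> a) ** g = h ** adj2 (\<gamma> b)"
  using db by (simp add: h_def coc_def b_def matrix_mul_assoc[symmetric] adj2_inverse)
 have gz: "Im (mobius g z) > 0" using g z by simp
 have bz: "Im (mobius (adj2 (\<gamma> b)) z) > 0" using db z by simp
 have "blk a (slash k g (lift k Y) z) = (jfac g z powi (- k)) \<cdot>\<^sub>v slash k (adj2 (\<gamma> a)) Y (mobius g z)"
  unfolding slash_eq[of k g] blk_smult[OF lc a] bl[OF a gz] ..
 also have "\<dots> = slash k (adj2 (\<gamma> a) ** g) Y z" using da g z by (simp add: slash_mult)
 also have "\<dots> = (jfac (adj2 (\<gamma> b)) z powi (- k)) \<cdot>\<^sub>v slash k h Y (mobius (adj2 (\<gamma> b)) z)"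
  unfolding gh using h db z by (simp add: slash_mult)
 also have "\<dots> = (jfac (adj2 (\<gamma> b)) z powi (- k)) \<cdot>\<^sub>v (\<rho> h *\<^sub>v Y (mobius (adj2 (\<gamma> b)) z))"
  using H[OF h bz] by simp
 also have "\<dots> = \<rho> h *\<^sub>v slash k (adj2 (\<gamma> b)) Y z"
  unfolding slash_eq by (rule mult_mat_vec[OF \<rho>_carrier[OF h] Y[OF bz], symmetric])
 also have "\<dots> = \<rho> h *\<^sub>v blk b (lift k Y z)" unfolding bl[OF b z] ..
 also have "\<dots> = blk a (\<psi> g *\<^sub>v lift k Y z)" unfolding blk_action[OF g a lc] b_def h_def ..
 finally show "blk a (slash k g (lift k Y) z) = blk a (\<psi> g *\<^sub>v lift k Y z)" .
qed

lemma induce_form: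
 assumes fk: "fuchsian_first_kind (psl_image G)" and X: "vvaf_H k X" and ind: "independent_components m X"
 shows "\<exists>Y. vvaf_G k Y \<and> independent_components (d * m) Y"
proof -
 note x = X[unfolded vvaf_H_iff]
 have Xc: "X z \<in> carrier_vec m" if "Im z > 0" for z using x that by simp
 have Xh: "(\<lambda>z. vec_index (X z) i) holomorphic_on \<H>" if "i < m" for i using x that by blast
 have Xs: "slash k h X z = \<rho> h *\<^sub>v X z" if "h \<in> H" "Im z > 0" for h z using x that by simp
 obtain c where cusp: "is_cusp H c"
 proof -
  \<comment> \<open>The compatibility with the weight makes the value at \<open>- I2\<close> scalar,
    hence diagonalizable. So the non-diagonalizable parabolic element is nontrivial and has a
    cusp.\<close>
  obtain h where h: "h \<in> H" "parabolic h" "\<not> diagonalizable (\<rho> h)" using x by (auto simp: logarithmic_def)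
  define \<epsilon> where "\<epsilon> = exp (\<i> * of_real pi * of_int k)"
  have one: "1\<^sub>m m = \<epsilon> \<cdot>\<^sub>m \<rho> (- I2)" using x \<rho>_one by (simp add: \<epsilon>_def)
  have c: "\<rho> (- I2) \<in> carrier_mat m m" by (rule \<rho>_carrier[OF H.neg_one_mem])
  have "diagonal_mat (\<rho> (- I2))"
   unfolding diagonal_mat_def
  proof (intro allI impI)
   fix i j assume ij: "i < dim_row (\<rho> (- I2))" "j < dim_col (\<rho> (- I2))" "i ~= j"
   then have "\<epsilon> * \<rho> (- I2) $$ (i, j) = 1\<^sub>m m $$ (i, j)" unfolding one by simp
   then show "\<rho> (- I2) $$ (i, j) = 0" using ij c by (simp add: \<epsilon>_def)
  qed
  then have "diagonalizable (\<rho> (- I2))" by (rule diagonalizable_diagonal[OF c])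
  moreover have "diagonalizable (\<rho> I2)"
   unfolding \<rho>_one by (rule diagonalizable_diagonal[of _ m]) (auto simp: diagonal_mat_def)
  ultimately have "h ~= I2" "h ~= - I2" using h(3) by auto
  then show thesis using H.exists_cusp[OF h(1,2)] that by blast
 qed
 obtain f where f: "f holomorphic_on \<H>" "!!h z. h \<in> H ==> Im z > 0 ==> f (mobius h z) = f z"
  "moderate_at_cusps G f" "\<not> f constant_on \<H>"
  "!!g. g \<in> G ==> (!!z. Im z > 0 ==> f (mobius g z) = f z) ==> g \<in> H"
 proof (rule exists_invariant_function[OF fk cusp])
  fix f assume *: "f holomorphic_on \<H>" "!!h z. h \<in> H ==> Im z > 0 ==> f (mobius h z) = f z"
   "moderate_at_cusps G f" "\<not> f constant_on \<H>"
   "!!g. g \<in> G ==> (!!z. Im z > 0 ==> f (mobius g z) = f z) ==> g \<in> H"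
  show thesis by (rule that[OF *])
 qed
 define \<delta> where "\<delta> a = adj2 (\<gamma> a)" for a
 have \<delta>: "\<delta> a \<in> G" "det (\<delta> a) = 1" "det (\<gamma> a) = 1" if "a < d" for a
  using \<gamma>_mem[OF that] G.adj_mem by (simp_all add: \<delta>_def)
 have \<delta>inv: "mobius (\<delta> a) (mobius (\<gamma> a) z) = z" if "a < d" "Im z > 0" for a z
  using \<delta>(3)[OF that(1)] that(2) by (simp add: \<delta>_def mobius_adj2)
 obtain V T where VT: "finite V"
  "!!a t. a < d ==> t \<in> T a ==> Im t > 0 \<and> (\<forall>v\<in>V. f (mobius (\<delta> a) t) ~= v)"
  "!!a b t. a < d ==> b < d ==> a ~= b ==> t \<in> T a ==> f (mobius (\<delta> b) t) \<in> V"
  "!!a c. a < d ==> (\<forall>t\<in>T a. (\<Sum>i<m. c i * vec_index (X (mobius (\<delta> a) t)) i) = 0) ==> \<forall>i<m. c i = 0"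
 proof (rule separating_polynomial[of d "\<lambda>a z. f (mobius (\<delta> a) z)" m "\<lambda>a i z. vec_index (X (mobius (\<delta> a) z)) i"])
  fix a assume a: "a < d"
  show "(\<lambda>z. f (mobius (\<delta> a) z)) holomorphic_on \<H>" by (rule holomorphic_compose_mobius[OF \<delta>(2)[OF a] f(1)])
  show "\<not> (\<lambda>z. f (mobius (\<delta> a) z)) constant_on \<H>"
  proof
   assume "(\<lambda>z. f (mobius (\<delta> a) z)) constant_on \<H>"
   then obtain e where e: "!!z. Im z > 0 ==> f (mobius (\<delta> a) z) = e" by (auto simp: constant_on_def)
   have "f z = e" if "Im z > 0" for z using e[of "mobius (\<gamma> a) z"] that \<delta>(3)[OF a] \<delta>inv[OF a that] by simp
   then show False using f(4) by (auto simp: constant_on_def)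
  qed
  show "(\<lambda>z. vec_index (X (mobius (\<delta> a) z)) i) holomorphic_on \<H>" if "i < m" for i
   by (rule holomorphic_compose_mobius[OF \<delta>(2)[OF a] Xh[OF that]])
  show "\<forall>i<m. c i = 0" if c: "\<forall>z. 0 < Im z --> (\<Sum>i<m. c i * vec_index (X (mobius (\<delta> a) z)) i) = 0" for c
  proof -
   have "(\<Sum>i<m. c i * vec_index (X z) i) = 0" if z: "Im z > 0" for z
   proof -
    have "Im (mobius (\<gamma> a) z) > 0" using \<delta>(3)[OF a] z by simp
    with c have "(\<Sum>i<m. c i * vec_index (X (mobius (\<delta> a) (mobius (\<gamma> a) z))) i) = 0" by blast
    then show ?thesis unfolding \<delta>inv[OF a z] .
   qed
   then have "\<forall>z\<in>\<H>. (\<Sum>i<m. c i * vec_index (X z) i) = 0" by simp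
   with ind show ?thesis unfolding independent_components_def by blast
  qed
 next
  fix a b assume ab: "a < d" "b < d" "a ~= b"
  show "\<exists>z. 0 < Im z \<and> f (mobius (\<delta> a) z) ~= f (mobius (\<delta> b) z)"
  proof (rule ccontr)
   assume "\<not> ?thesis"
   then have eq: "f (mobius (\<delta> a) z) = f (mobius (\<delta> b) z)" if "Im z > 0" for z using that by blast
   \<comment> \<open>If two conjugates of f coincided, this element would fix f, hence lie in H, and
     the two cosets would be equal.\<close>
   have "\<delta> a ** \<gamma> b \<in> H"
   proof (rule f(5))
    show "\<delta> a ** \<gamma> b \<in> G" by (intro G.mult_mem \<delta> \<gamma>_mem ab)
    fix z :: complex assume z: "Im z > 0"
    have "f (mobius (\<delta> a ** \<gamma> b) z) = f (mobius (\<delta> a) (mobius (\<gamma> b) z))"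
     using \<delta>(2)[OF ab(1)] \<delta>(3)[OF ab(2)] z by (simp add: mobius_mult)
    also have "\<dots> = f (mobius (\<delta> b) (mobius (\<gamma> b) z))" using \<delta>(3)[OF ab(2)] z by (intro eq) simp
    finally show "f (mobius (\<delta> a ** \<gamma> b) z) = f z" using \<delta>inv[OF ab(2) z] by simp
   qed
   then show False using coset_unique[OF ab(1,2)] ab(3) by (simp add: \<delta>_def)
  qed
 next
  fix V T assume *: "finite V"
   "!!a t. a < d ==> t \<in> T a ==> Im t > 0 \<and> (\<forall>v\<in>V. f (mobius (\<delta> a) t) ~= v)"
   "!!a b t. a < d ==> b < d ==> a ~= b ==> t \<in> T a ==> f (mobius (\<delta> b) t) \<in> V"
   "!!a c. a < d ==> (\<forall>t\<in>T a. (\<Sum>i<m. c i * vec_index (X (mobius (\<delta> a) t)) i) = 0) ==> \<forall>i<m. c i = 0"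
  show thesis by (rule that[OF *])
 qed
 \<comment> \<open>Vanishes exactly where f takes a value in V, which are the values of the wrong
   conjugates at the detecting points.\<close>
 define P where "P z = (\<Prod>v\<in>V. f z - v)" for z
 have P0: "P z = 0 \<longleftrightarrow> f z \<in> V" for z using VT(1) by (auto simp: P_def)
 have Ph: "P holomorphic_on \<H>" unfolding P_def by (intro holomorphic_intros f(1))
 have Pm: "moderate_at_cusps G P" unfolding P_def
  by (intro moderate_at_cusps_prod moderate_at_cusps_diff moderate_at_cusps_const f(3))
 have Pinv: "P (mobius h z) = P z" if "h \<in> H" "Im z > 0" for h z by (simp add: P_def f(2)[OF that])
 define Y where "Y z = P z \<cdot>\<^sub>v X z" for z
 have Yc: "Y z \<in> carrier_vec m" if "Im z > 0" for z using Xc[OF that] by (simp add: Y_def)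
 have Ys: "slash k h Y z = \<rho> h *\<^sub>v Y z" if "h \<in> H" "Im z > 0" for h z
 proof -
  have "slash k h Y z = P z \<cdot>\<^sub>v slash k h X z"
   using Pinv[OF that] by (simp add: slash_eq Y_def smult_smult_assoc mult.commute)
  also have "\<dots> = \<rho> h *\<^sub>v Y z"
   unfolding Xs[OF that] Y_def by (rule mult_mat_vec[OF \<rho>_carrier[OF that(1)] Xc[OF that(2)], symmetric])
  finally show ?thesis .
 qed
 have li: "vec_index (lift k Y z) (a * m + i) = jfac (\<delta> a) z powi (- k) * P (mobius (\<delta> a) z) * vec_index (X (mobius (\<delta> a) z)) i"
  if "a < d" "i < m" "Im z > 0" for a i z
  using lift_index[OF that(1,2), of k Y z] Xc[of "mobius (\<delta> a) z"] \<delta>(2)[OF that(1)] that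
  by (simp add: slash_eq Y_def \<delta>_def)
 have "vvaf_G k (lift k Y)"
  unfolding vvaf_G_iff
 proof (intro conjI ballI allI impI)
  show "logarithmic G \<psi>" using x logarithmic_iff by blast
  show "\<psi> I2 = exp (\<i> * of_real pi * of_int k) \<cdot>\<^sub>m \<psi> (- I2)" using x center_iff by blast
  show "lift k Y z \<in> carrier_vec (d * m)" for z by (simp add: lift_def)
  show "slash k g (lift k Y) z = \<psi> g *\<^sub>v lift k Y z" if "g \<in> G" "z \<in> \<H>" for g z
   using that by (intro lift_slash Yc Ys) auto
  fix r assume "r < d * m"
  then obtain a i where r: "a < d" "i < m" "r = a * m + i" using index_split[of r] by blast
  let ?F = "\<lambda>z. jfac (\<delta> a) z powi (- k) * P (mobius (\<delta> a) z) * vec_index (X (mobius (\<delta> a) z)) i"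
  have "?F holomorphic_on \<H>"
   using jfac_nz \<delta>(2)[OF r(1)]
   by (intro holomorphic_intros holomorphic_compose_mobius[OF _ Ph] holomorphic_compose_mobius[OF _ Xh[OF r(2)]]) auto
  then show "(\<lambda>z. vec_index (lift k Y z) r) holomorphic_on \<H>"
   by (rule holomorphic_transform) (simp add: r li)
  have "moderate_at_cusps G (\<lambda>z. vec_index (X z) i)" using x r(2) moderate_at_cusps_H_iff by blast
  then have "moderate_at_cusps G ?F"
   using \<delta>[OF r(1)] Pm by (intro moderate_at_cusps_mult moderate_at_cusps_jfac G.moderate_at_cusps_mobius)
  then show "moderate_at_cusps G (\<lambda>z. vec_index (lift k Y z) r)"
   by (rule moderate_at_cusps_cong) (simp add: r li)
 qed
 moreover have "independent_components (d * m) (lift k Y)"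
  unfolding independent_components_def
 proof (intro allI impI)
  fix c :: "nat => complex" and r
  assume c: "\<forall>z\<in>\<H>. (\<Sum>r<d * m. c r * vec_index (lift k Y z) r) = 0" and "r < d * m"
  then obtain a i where r: "a < d" "i < m" "r = a * m + i" using index_split[of r] by blast
  \<comment> \<open>At a detecting point of block a all other blocks vanish, so a relation among all
    components becomes one among the components of X alone.\<close>
  have "\<forall>i<m. c (a * m + i) = 0"
  proof (rule VT(4)[OF r(1)], rule ballI)
   fix t assume t: "t \<in> T a"
   have tI: "Im t > 0" and tV: "f (mobius (\<delta> a) t) \<notin> V" using VT(2)[OF r(1) t] by auto
   have "0 = (\<Sum>r<d * m. c r * vec_index (lift k Y t) r)" using c tI by simp
   also have "\<dots> = (\<Sum>b<d. \<Sum>j<m. c (b * m + j) * vec_index (lift k Y t) (b * m + j))" by (rule sum_blocks)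
   also have "\<dots> = (\<Sum>b<d. if b = a then \<Sum>j<m. c (a * m + j) * vec_index (lift k Y t) (a * m + j) else 0)"
   proof (intro sum.cong refl)
    fix b assume b: "b \<in> {..<d}"
    show "(\<Sum>j<m. c (b * m + j) * vec_index (lift k Y t) (b * m + j)) =
     (if b = a then \<Sum>j<m. c (a * m + j) * vec_index (lift k Y t) (a * m + j) else 0)"
    proof (cases "b = a")
     case False
     then have "P (mobius (\<delta> b) t) = 0" using VT(3)[OF r(1) _ _ t, of b] b by (simp add: P0)
     then show ?thesis using False b tI by (auto simp: li intro!: sum.neutral)
    qed simp
   qed
   also have "\<dots> = (\<Sum>j<m. c (a * m + j) * vec_index (lift k Y t) (a * m + j))" using r(1) by simp
   also have "\<dots> = jfac (\<delta> a) t powi (- k) * P (mobius (\<delta> a) t) * (\<Sum>j<m. c (a * m + j) * vec_index (X (mobius (\<delta> a) t)) j)"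
    unfolding sum_distrib_left using r(1) tI by (intro sum.cong) (auto simp: li)
   finally have "jfac (\<delta> a) t powi (- k) * P (mobius (\<delta> a) t) * (\<Sum>j<m. c (a * m + j) * vec_index (X (mobius (\<delta> a) t)) j) = 0" ..
   moreover have "jfac (\<delta> a) t ~= 0" using jfac_nz[of "\<delta> a" t] \<delta>(2)[OF r(1)] tI by simp
   moreover have "P (mobius (\<delta> a) t) ~= 0" using tV by (simp add: P0)
   ultimately show "(\<Sum>j<m. c (a * m + j) * vec_index (X (mobius (\<delta> a) t)) j) = 0" by simp
  qed
  then show "c r = 0" using r by simp
 qed
 ultimately show ?thesis by blast
qed

end

theorem proposition5p3:
  fixes G H :: "(real^2^2) set"
    and m d :: nat
    and \<rho> \<psi> :: "real^2^2 \<Rightarrow> complex mat"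
    and \<gamma> :: "nat \<Rightarrow> real^2^2"
    and k :: int
  assumes "subgroup G SL2R"
    and "subgroup H SL2R"
    and "H \<subseteq> G"
    and "finite (lcosets\<^bsub>SL2R\<lparr>carrier := G\<rparr>\<^esub> H)"
    and "- I2 \<in> H"
    and "fuchsian_first_kind (psl_image H)"
    and "fuchsian_first_kind (psl_image G)"
    and "matrix_rep H m \<rho>"
    and "left_coset_reps G H d \<gamma>"
    and "matrix_rep G (d * m) \<psi>"
    and "\<forall>g\<in>G. induced_rep H m \<rho> d \<gamma> g = \<psi> g"
  shows "(\<exists>X. weakly_holomorphic_log_vvaf k G (d * m) \<psi> X \<and> independent_components (d * m) X)
     \<longleftrightarrow> (\<exists>X. weakly_holomorphic_log_vvaf k H m \<rho> X \<and> independent_components m X)"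
proof -
 have "discrete_SL2 G" "discrete_SL2 H"
  using assms by (auto intro: fuchsian_imp_discrete)
 then interpret coset_pair G H d \<gamma>
  using assms(3,9) by (rule coset_pairI)
 interpret induced_pair G H d \<gamma> m \<rho> \<psi>
  by unfold_locales
   (use matrix_rep_props[OF assms(2,8)] matrix_rep_props[OF assms(1,10)] assms(11) in auto)
 show ?thesis
  using restrict_form induce_form[OF assms(7)] by blast
qed

end
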